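(* Let $k$ be a field, and let $X=\mathbf{P}^2_k$ with homogeneous coordinates $(x:y:z)$. Let $C\subset X$ be an irreducible reduced curve of degree $m\geq 2$, and let $p\in C$ be a $k$-point smooth on $C$ such that the tangent line $D$ to $C$ at $p$ satisfies $D\cdot C=mp$. Choose the coordinates so that $D$ is given by $z=0$ and $p=(1:0:0)$. Let $f(x/z,y/z)=0$ be the degree-$m$ equation of the affine curve $C\setminus p$ on the affine surface $X\setminus D$. Take the local parameters $t=y/x$, $u=(z/x)^m f(x/z,y/z)$ at $p$ and identify $K_{p,C}=k((t))((u))$. Let $W\subset k((t))((u))$ be the subspace attached by the two-dimensional Krichever map to the sheaf $\mathcal{O}_X$ (with trivialization $1$). Then the support of $W$ is the closed $k$-subspace of $k((t))((u))$ generated by all monomials $t^iu^j$ with $i,j\in\mathbb{Z}$ and $i\le -m^2j$, except for the monomials $$t^{-\alpha_1-m^2l}u^l,\ \ldots,\ t^{-\alpha_g-m^2l}u^l\qquad(l\in\mathbb{Z}),$$ where the natural numbers $\alpha_1,\dots,\alpha_g$ are the Weierstrass gaps of the curve $C$ at $p$.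
   Context: Krichever map for the structure sheaf. Let $X$ be a projective irreducible normal surface over $k$, $C\subset X$ an irreducible reduced curve that is an ample Cartier divisor, and $p$ a $k$-point that is smooth on both $X$ and $C$. Let $t,u$ be local parameters at $p$ such that $u=0$ is a local equation of $C$ near $p$. For a closed point $q\in C$ let $\hat{\mathcal{O}}_q$ be the completed local ring of $X$ at $q$ and $f_q$ a local equation of $C$ at $q$. Put $B_q=\hat{\mathcal{O}}_q[f_q^{-1}]$ (independent of the choice of $f_q$). Let $K_{q,C}$ be the ring obtained from $\hat{\mathcal{O}}_q$ by localizing at the complement of the union of the minimal primes over $(f_q)$, completing $f_q$-adically, and then inverting $f_q$. For $q=p$ this is a two-dimensional local field, identified with $k((t))((u))$ by $t,u$. Let $K_C$ be the completion of the function field $k(X)$ with respect to the discrete valuation given by $C$. It embeds canonically in every $K_{q,C}$. The Krichever map attaches to this data (with the sheaf $\mathcal{O}_X$ and trivialization $1$) the $k$-subspace $$W=\{g\in K_C:\ \text{the image of } g \text{ in } K_{q,C}\text{ lies in }B_q\text{ for all closed points } q\in C,\ q\ne p\},$$ viewed inside $K_{p,C}=k((t))((u))$ via $K_C\subset K_{p,C}$. Support. For a nonzero $g=\sum_{j\ge n}g_ju^j\in k((t))((u))$ with $g_j\in k((t))$, $g_n\ne0$, the lowest monomial of $g$ is $t^{i}u^n$, where $i$ is the $t$-adic valuation of $g_n$. The support of a $k$-subspace $W$ is the closed $k$-subspace of $k((t))((u))$ generated by the lowest monomials of all nonzero elements of $W$. The Weierstrass gaps of $C$ at $p$ are the natural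 numbers which are not the pole order at $p$ of any element of $k[C\setminus p]$. Their number $g$ is the (arithmetic) genus of $C$. *)

theory Defs
  imports
    "HOL-Algebra.Algebra"
    "HOL-Algebra.Algebraic_Closure_Type"
    "HOL-Computational_Algebra.Computational_Algebra"
    "HOL-Analysis.Abstract_Topology"
    "HOL-Library.Extended_Nat"
begin

unbundle fps_syntax

section \<open>Localization, adic completion, length\<close>

type_synonym 'b loc = "('b \<times> 'b) set"
type_synonym 'b compl = "nat \<Rightarrow> 'b set"

definition frac :: "('b, 'c) ring_scheme \<Rightarrow> 'b set \<Rightarrow> 'b \<Rightarrow> 'b \<Rightarrow> 'b loc" where
  "frac R S a s = {(b, t). b \<in> carrier R \<and> t \<in> S \<and>
     (\<exists>w\<in>S. w \<otimes>\<^bsub>R\<^esub> (a \<otimes>\<^bsub>R\<^esub> t \<ominus>\<^bsub>R\<^esub> b \<otimes>\<^bsub>R\<^esub> s) = \<zero>\<^bsub>R\<^esub>)}"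

text \<open>For a multiplicative set \<open>S\<close> of a commutative ring all members of the unions below coincide.\<close>

definition localization :: "('b, 'c) ring_scheme \<Rightarrow> 'b set \<Rightarrow> 'b loc ring" where
  "localization R S = \<lparr>
     carrier = {frac R S a s | a s. a \<in> carrier R \<and> s \<in> S},
     monoid.mult = (\<lambda>A B. \<Union>(a, s)\<in>A. \<Union>(b, t)\<in>B. frac R S (a \<otimes>\<^bsub>R\<^esub> b) (s \<otimes>\<^bsub>R\<^esub> t)),
     one = frac R S \<one>\<^bsub>R\<^esub> \<one>\<^bsub>R\<^esub>,
     ring.zero = frac R S \<zero>\<^bsub>R\<^esub> \<one>\<^bsub>R\<^esub>,
     add = (\<lambda>A B. \<Union>(a, s)\<in>A. \<Union>(b, t)\<in>B.
              frac R S (a \<otimes>\<^bsub>R\<^esub> t \<oplus>\<^bsub>R\<^esub> b \<otimes>\<^bsub>R\<^esub> s) (s \<otimes>\<^bsub>R\<^esub> t))\<rparr>"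

definition to_loc :: "('b, 'c) ring_scheme \<Rightarrow> 'b set \<Rightarrow> 'b \<Rightarrow> 'b loc" where
  "to_loc R S a = frac R S a \<one>\<^bsub>R\<^esub>"

definition powers :: "('b, 'c) ring_scheme \<Rightarrow> 'b \<Rightarrow> 'b set" where
  "powers R a = range (\<lambda>n::nat. a [^]\<^bsub>R\<^esub> n)"

primrec ideal_pow :: "('b, 'c) ring_scheme \<Rightarrow> 'b set \<Rightarrow> nat \<Rightarrow> 'b set" where
  "ideal_pow R I 0 = carrier R"
| "ideal_pow R I (Suc n) = ideal_prod R (ideal_pow R I n) I"

text \<open>The inverse limit of the rings \<open>R / I\<^sup>n\<close>; a coset of \<open>I\<^sup>n\<^sup>+\<^sup>1\<close> maps to the coset of \<open>I\<^sup>n\<close>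
  that contains it.\<close>

definition adic_completion :: "('b, 'c) ring_scheme \<Rightarrow> 'b set \<Rightarrow> 'b compl ring" where
  "adic_completion R I = \<lparr>
     carrier = {\<alpha>. \<forall>n. \<alpha> n \<in> carrier (R Quot ideal_pow R I n) \<and> \<alpha> (Suc n) \<subseteq> \<alpha> n},
     monoid.mult = (\<lambda>\<alpha> \<beta> n. \<alpha> n \<otimes>\<^bsub>R Quot ideal_pow R I n\<^esub> \<beta> n),
     one = (\<lambda>n. \<one>\<^bsub>R Quot ideal_pow R I n\<^esub>),
     ring.zero = (\<lambda>n. \<zero>\<^bsub>R Quot ideal_pow R I n\<^esub>),
     add = (\<lambda>\<alpha> \<beta> n. \<alpha> n \<oplus>\<^bsub>R Quot ideal_pow R I n\<^esub> \<beta> n)\<rparr>"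

definition to_completion :: "('b, 'c) ring_scheme \<Rightarrow> 'b set \<Rightarrow> 'b \<Rightarrow> 'b compl" where
  "to_completion R I a = (\<lambda>n. ideal_pow R I n +>\<^bsub>R\<^esub> a)"

definition minimal_prime_over :: "('b, 'c) ring_scheme \<Rightarrow> 'b set \<Rightarrow> 'b set \<Rightarrow> bool" where
  "minimal_prime_over R I P \<longleftrightarrow> primeideal P R \<and> I \<subseteq> P \<and>
     (\<forall>P'. primeideal P' R \<and> I \<subseteq> P' \<and> P' \<subseteq> P \<longrightarrow> P' = P)"

text \<open>The length of the \<open>R\<close>-module \<open>R / I\<close>.\<close>

definition colength :: "('b, 'c) ring_scheme \<Rightarrow> 'b set \<Rightarrow> enat" where
  "colength R I = Sup {enat n | n. \<exists>J. J 0 = I \<and> J n = carrier R \<and>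
     (\<forall>i\<le>n. ideal (J i) R) \<and> (\<forall>i<n. J i \<subset> J (Suc i))}"


section \<open>The projective plane\<close>

text \<open>In \<open>k[x,y,z]\<close>, realised as \<open>k[x][y][z]\<close>, \<open>x\<close> is the innermost variable.
  Rational functions on the plane are the quotients of forms of equal degree.\<close>

type_synonym 'k form = "'k poly poly poly"
type_synonym 'k ratfun = "'k poly poly poly fract"

definition form_const :: "'k \<Rightarrow> 'k::field form" where "form_const c = [:[:[:c:]:]:]"
definition form_x :: "'k::field form" where "form_x = [:[:[:0, 1:]:]:]"
definition form_y :: "'k::field form" where "form_y = [:[:0, 1:]:]"
definition form_z :: "'k::field form" where "form_z = [:0, 1:]"

definition homogeneous :: "nat \<Rightarrow> 'k::field form \<Rightarrow> bool" where
  "homogeneous d G \<longleftrightarrow>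
     (\<forall>i j l. coeff (coeff (coeff G l) j) i \<noteq> 0 \<longrightarrow> i + j + l = d)"

definition form_eval :: "'k::field form \<Rightarrow> 'k \<Rightarrow> 'k \<Rightarrow> 'k \<Rightarrow> 'k" where
  "form_eval G a b c = poly (poly (poly G [:[:c:]:]) [:b:]) a"

definition tangent_form :: "'k::field form \<Rightarrow> 'k \<Rightarrow> 'k \<Rightarrow> 'k \<Rightarrow> 'k form" where
  "tangent_form G a b c =
     form_const (form_eval (map_poly (map_poly pderiv) G) a b c) * form_x +
     form_const (form_eval (map_poly pderiv G) a b c) * form_y +
     form_const (form_eval (pderiv G) a b c) * form_z"

text \<open>The scheme points of \<open>Proj k[x,y,z]\<close>.\<close>

definition proj_point :: "'k::field form set \<Rightarrow> bool" where
  "proj_point q \<longleftrightarrow> primeideal q ring_of_type_algebra \<and>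
     q = genideal ring_of_type_algebra {G \<in> q. \<exists>d. homogeneous d G} \<and>
     \<not> {form_x, form_y, form_z} \<subseteq> q"

definition closed_point :: "'k::field form set \<Rightarrow> bool" where
  "closed_point q \<longleftrightarrow> proj_point q \<and> (\<forall>q'. proj_point q' \<and> q \<subseteq> q' \<longrightarrow> q' = q)"

definition point_100 :: "'k::field form set" where
  "point_100 = genideal ring_of_type_algebra {form_y, form_z}"

text \<open>The homogeneous ideal of the curve \<open>F = 0\<close>, which for prime \<open>F\<close> is also its generic point.\<close>

definition curve_ideal :: "'k::field form \<Rightarrow> 'k form set" where
  "curve_ideal F = {G. F dvd G}"

definition stalk_ideal :: "'k::field form set \<Rightarrow> 'k form set \<Rightarrow> 'k ratfun set" where
  "stalk_ideal q J = {Fract G H | G H. G \<in> J \<and> H \<notin> q \<and>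
     (\<exists>d. homogeneous d G \<and> homogeneous d H)}"

definition stalk :: "'k::field form set \<Rightarrow> 'k ratfun set" where
  "stalk q = stalk_ideal q UNIV"

definition stalk_ring :: "'k::field form set \<Rightarrow> 'k ratfun ring" where
  "stalk_ring q = ring_of_type_algebra\<lparr>carrier := stalk q\<rparr>"

definition function_field :: "'k::field ratfun set" where
  "function_field = stalk {0}"

definition ratfun_const :: "'k \<Rightarrow> 'k::field ratfun" where
  "ratfun_const c = Fract (form_const c) 1"

definition local_equation :: "'k::field form \<Rightarrow> 'k form set \<Rightarrow> 'k ratfun \<Rightarrow> bool" where
  "local_equation F q f \<longleftrightarrow>
     f \<in> stalk q \<and> cgenideal (stalk_ring q) f = stalk_ideal q (curve_ideal F)"

text \<open>The coefficient of \<open>q\<close> in the intersection cycle of the curves \<open>E = 0\<close> and \<open>F = 0\<close>.\<close>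

definition intersection_mult :: "'k::field form \<Rightarrow> 'k form \<Rightarrow> 'k form set \<Rightarrow> enat" where
  "intersection_mult E F q = colength (stalk_ring q)
     (stalk_ideal q (curve_ideal E) <+>\<^bsub>stalk_ring q\<^esub> stalk_ideal q (curve_ideal F))"

definition dehomogenize :: "'k::field form \<Rightarrow> 'k poly poly" where
  "dehomogenize F = poly F 1"

definition affine_eval :: "'k::field poly poly \<Rightarrow> 'k ratfun \<Rightarrow> 'k ratfun \<Rightarrow> 'k ratfun" where
  "affine_eval f a b = poly (map_poly (\<lambda>g. poly (map_poly ratfun_const g) a) f) b"

definition param_t :: "'k::field ratfun" where
  "param_t = Fract form_y form_x"

definition param_u :: "nat \<Rightarrow> 'k::field form \<Rightarrow> 'k ratfun" where
  "param_u m F = Fract form_z form_x ^ m *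
     affine_eval (dehomogenize F) (Fract form_x form_z) (Fract form_y form_z)"


section \<open>The rings \<open>B\<^sub>q\<close> and \<open>K\<^sub>q\<^sub>,\<^sub>C\<close>\<close>

text \<open>In this section \<open>f\<close> is a local equation of the curve at \<open>q\<close>.\<close>

definition completed_stalk :: "'k::field form set \<Rightarrow> 'k ratfun compl ring" where
  "completed_stalk q = adic_completion (stalk_ring q) (stalk_ideal q q)"

definition to_hat :: "'k::field form set \<Rightarrow> 'k ratfun \<Rightarrow> 'k ratfun compl" where
  "to_hat q = to_completion (stalk_ring q) (stalk_ideal q q)"

definition B_ring :: "'k::field form set \<Rightarrow> 'k ratfun \<Rightarrow> 'k ratfun compl loc ring" where
  "B_ring q f = localization (completed_stalk q) (powers (completed_stalk q) (to_hat q f))"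

definition off_curve :: "'k::field form set \<Rightarrow> 'k ratfun \<Rightarrow> 'k ratfun compl set" where
  "off_curve q f = carrier (completed_stalk q) -
     \<Union>{P. minimal_prime_over (completed_stalk q)
           (cgenideal (completed_stalk q) (to_hat q f)) P}"

definition curve_loc :: "'k::field form set \<Rightarrow> 'k ratfun \<Rightarrow> 'k ratfun compl loc ring" where
  "curve_loc q f = localization (completed_stalk q) (off_curve q f)"

definition curve_loc_ideal :: "'k::field form set \<Rightarrow> 'k ratfun \<Rightarrow> 'k ratfun compl loc set" where
  "curve_loc_ideal q f = cgenideal (curve_loc q f)
     (to_loc (completed_stalk q) (off_curve q f) (to_hat q f))"

definition OK_ring :: "'k::field form set \<Rightarrow> 'k ratfun \<Rightarrow> 'k ratfun compl loc compl ring" where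
  "OK_ring q f = adic_completion (curve_loc q f) (curve_loc_ideal q f)"

definition hat_to_OK ::
  "'k::field form set \<Rightarrow> 'k ratfun \<Rightarrow> 'k ratfun compl \<Rightarrow> 'k ratfun compl loc compl" where
  "hat_to_OK q f \<alpha> = to_completion (curve_loc q f) (curve_loc_ideal q f)
     (to_loc (completed_stalk q) (off_curve q f) \<alpha>)"

definition OK_powers :: "'k::field form set \<Rightarrow> 'k ratfun \<Rightarrow> 'k ratfun compl loc compl set" where
  "OK_powers q f = powers (OK_ring q f) (hat_to_OK q f (to_hat q f))"

type_synonym 'k localfield = "'k ratfun compl loc compl loc"

definition K_ring :: "'k::field form set \<Rightarrow> 'k ratfun \<Rightarrow> 'k localfield ring" where
  "K_ring q f = localization (OK_ring q f) (OK_powers q f)"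

definition OK_to_K ::
  "'k::field form set \<Rightarrow> 'k ratfun \<Rightarrow> 'k ratfun compl loc compl \<Rightarrow> 'k localfield" where
  "OK_to_K q f = to_loc (OK_ring q f) (OK_powers q f)"

definition hat_to_K ::
  "'k::field form set \<Rightarrow> 'k ratfun \<Rightarrow> 'k ratfun compl \<Rightarrow> 'k localfield" where
  "hat_to_K q f \<alpha> = OK_to_K q f (hat_to_OK q f \<alpha>)"

definition stalk_to_K :: "'k::field form set \<Rightarrow> 'k ratfun \<Rightarrow> 'k ratfun \<Rightarrow> 'k localfield" where
  "stalk_to_K q f a = hat_to_K q f (to_hat q a)"

definition B_to_K ::
  "'k::field form set \<Rightarrow> 'k ratfun \<Rightarrow> 'k ratfun compl loc \<Rightarrow> 'k localfield" where
  "B_to_K q f A = (\<Union>(\<alpha>, \<sigma>)\<in>A.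
     frac (OK_ring q f) (OK_powers q f) (hat_to_OK q f \<alpha>) (hat_to_OK q f \<sigma>))"

text \<open>Non-zero elements of the local ring at \<open>q\<close> become units in \<open>K\<^sub>q\<^sub>,\<^sub>C\<close>, so the map from the
  local ring extends uniquely to its field of fractions.\<close>

definition funfield_to_K :: "'k::field form set \<Rightarrow> 'k ratfun \<Rightarrow> 'k ratfun \<Rightarrow> 'k localfield" where
  "funfield_to_K q f r = (THE \<kappa>. \<kappa> \<in> carrier (K_ring q f) \<and>
     (\<forall>a\<in>stalk q. \<forall>b\<in>stalk q. b \<noteq> 0 \<and> r = a / b \<longrightarrow>
        stalk_to_K q f b \<otimes>\<^bsub>K_ring q f\<^esub> \<kappa> = stalk_to_K q f a))"

definition K_converges ::
  "'k::field form set \<Rightarrow> 'k ratfun \<Rightarrow> (nat \<Rightarrow> 'k localfield) \<Rightarrow> 'k localfield \<Rightarrow> bool" where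
  "K_converges q f s \<kappa> \<longleftrightarrow> (\<forall>N::nat. \<exists>n0. \<forall>n\<ge>n0. \<exists>\<xi>\<in>carrier (OK_ring q f).
     s n \<ominus>\<^bsub>K_ring q f\<^esub> \<kappa> =
       OK_to_K q f ((hat_to_OK q f (to_hat q f) [^]\<^bsub>OK_ring q f\<^esub> N) \<otimes>\<^bsub>OK_ring q f\<^esub> \<xi>))"


section \<open>The completion \<open>K\<^sub>C\<close> of the function field\<close>

definition curve_ord :: "'k::field form \<Rightarrow> 'k ratfun \<Rightarrow> int" where
  "curve_ord F r = (THE n. \<exists>i j G H d. \<not> F dvd G \<and> \<not> F dvd H \<and>
     homogeneous d (F ^ i * G) \<and> homogeneous d (F ^ j * H) \<and>
     r = Fract (F ^ i * G) (F ^ j * H) \<and> n = int i - int j)"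

definition curve_ord_ge :: "'k::field form \<Rightarrow> int \<Rightarrow> 'k ratfun \<Rightarrow> bool" where
  "curve_ord_ge F N r \<longleftrightarrow> r = 0 \<or> N \<le> curve_ord F r"

definition curve_cauchy :: "'k::field form \<Rightarrow> (nat \<Rightarrow> 'k ratfun) set" where
  "curve_cauchy F = {s. range s \<subseteq> function_field \<and>
     (\<forall>N. \<exists>n0. \<forall>i\<ge>n0. \<forall>j\<ge>n0. curve_ord_ge F N (s i - s j))}"

definition K_C :: "'k::field form \<Rightarrow> (nat \<Rightarrow> 'k ratfun) set set" where
  "K_C F = curve_cauchy F // {(s, s'). s \<in> curve_cauchy F \<and> s' \<in> curve_cauchy F \<and>
     (\<forall>N. \<exists>n0. \<forall>i\<ge>n0. curve_ord_ge F N (s i - s' i))}"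

definition K_C_to_K ::
  "'k::field form set \<Rightarrow> 'k ratfun \<Rightarrow> (nat \<Rightarrow> 'k ratfun) set \<Rightarrow> 'k localfield" where
  "K_C_to_K q f g = (THE \<kappa>. \<kappa> \<in> carrier (K_ring q f) \<and>
     (\<forall>s\<in>g. K_converges q f (\<lambda>n. funfield_to_K q f (s n)) \<kappa>))"


section \<open>The Krichever subspace\<close>

text \<open>The field \<open>k((t))((u))\<close> is \<open>'k fls fls\<close>: the coefficient of \<open>t\<^sup>i u\<^sup>j\<close> in \<open>h\<close> is \<open>h $$ j $$ i\<close>.
  A local parameter system \<open>t\<close>, \<open>u\<close> with \<open>u\<close> a local equation of the curve determines the
  following \<open>\<theta>\<close> uniquely.\<close>

definition identifies_by_parameters ::
  "'k::field form set \<Rightarrow> 'k ratfun \<Rightarrow> 'k ratfun \<Rightarrow> ('k localfield \<Rightarrow> 'k fls fls) \<Rightarrow> bool" where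
  "identifies_by_parameters p t u \<theta> \<longleftrightarrow>
     \<theta> \<in> ring_iso (K_ring p u) ring_of_type_algebra \<and>
     (\<forall>c. \<theta> (stalk_to_K p u (ratfun_const c)) = fls_const (fls_const c)) \<and>
     \<theta> (stalk_to_K p u t) = fls_const fls_X \<and>
     \<theta> (stalk_to_K p u u) = fls_X \<and>
     \<theta> ` hat_to_K p u ` carrier (completed_stalk p) =
       {h. \<forall>i j. h $$ j $$ i \<noteq> 0 \<longrightarrow> 0 \<le> i \<and> 0 \<le> j} \<and>
     \<theta> ` OK_to_K p u ` carrier (OK_ring p u) = {h. \<forall>j. h $$ j \<noteq> 0 \<longrightarrow> 0 \<le> j}"

definition krichever_K_C ::
  "'k::field form \<Rightarrow> 'k form set \<Rightarrow> (nat \<Rightarrow> 'k ratfun) set set" where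
  "krichever_K_C F p = {g \<in> K_C F. \<forall>q f. closed_point q \<and> F \<in> q \<and> q \<noteq> p \<and>
     local_equation F q f \<longrightarrow> K_C_to_K q f g \<in> B_to_K q f ` carrier (B_ring q f)}"

definition krichever_subspace ::
  "'k::field form \<Rightarrow> 'k form set \<Rightarrow> 'k ratfun \<Rightarrow> ('k localfield \<Rightarrow> 'k fls fls) \<Rightarrow> 'k fls fls set"
  where
  "krichever_subspace F p u \<theta> = (\<lambda>g. \<theta> (K_C_to_K p u g)) ` krichever_K_C F p"


section \<open>Supports\<close>

definition monomial :: "int \<Rightarrow> int \<Rightarrow> 'k::field fls fls" where
  "monomial i j = fls_const (fls_X_intpow i) * fls_X_intpow j"

definition lowest_monomial :: "'k::field fls fls \<Rightarrow> 'k fls fls" where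
  "lowest_monomial g = monomial (fls_subdegree (g $$ fls_subdegree g)) (fls_subdegree g)"

definition k_subspace :: "'k::field fls fls set \<Rightarrow> bool" where
  "k_subspace = module.subspace (\<lambda>c h. fls_const (fls_const c) * h)"

text \<open>The two-dimensional local field topology: basic neighbourhoods of \<open>0\<close> prescribe, below some
  power of \<open>u\<close>, a \<open>t\<close>-adic neighbourhood for each coefficient.\<close>

definition basic_nhd :: "(int \<Rightarrow> int) \<Rightarrow> int \<Rightarrow> 'k::field fls fls \<Rightarrow> 'k fls fls set" where
  "basic_nhd e N g = {h. \<forall>j<N. \<forall>i<e j. h $$ j $$ i = g $$ j $$ i}"

definition local_field_topology :: "'k::field fls fls topology" where
  "local_field_topology = topology (\<lambda>U. \<forall>g\<in>U. \<exists>e N. basic_nhd e N g \<subseteq> U)"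

lemma istopology_local_field:
  "istopology (\<lambda>U. \<forall>g\<in>U. \<exists>e N. basic_nhd e N (g :: 'k::field fls fls) \<subseteq> U)"
  unfolding istopology_def
proof (intro conjI allI impI ballI)
  fix S T :: "'k fls fls set" and g
  assume S: "\<forall>g\<in>S. \<exists>e N. basic_nhd e N g \<subseteq> S" and T: "\<forall>g\<in>T. \<exists>e N. basic_nhd e N g \<subseteq> T"
    and g: "g \<in> S \<inter> T"
  obtain e N e' N' where "basic_nhd e N g \<subseteq> S" "basic_nhd e' N' g \<subseteq> T"
    using S T g by blast
  moreover have "basic_nhd (\<lambda>j. max (e j) (e' j)) (max N N') g \<subseteq>
      basic_nhd e N g \<inter> basic_nhd e' N' g"
    by (auto simp: basic_nhd_def)
  ultimately show "\<exists>e N. basic_nhd e N g \<subseteq> S \<inter> T"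
    by blast
next
  fix \<K> :: "'k fls fls set set" and g
  assume "\<forall>U\<in>\<K>. \<forall>g\<in>U. \<exists>e N. basic_nhd e N g \<subseteq> U" and "g \<in> \<Union>\<K>"
  then show "\<exists>e N. basic_nhd e N g \<subseteq> \<Union>\<K>"
    by (meson UnionE Union_upper order_trans)
qed

definition closed_span :: "'k::field fls fls set \<Rightarrow> 'k fls fls set" where
  "closed_span A = (\<lambda>V. k_subspace V \<and> closedin local_field_topology V) hull A"

definition support :: "'k::field fls fls set \<Rightarrow> 'k fls fls set" where
  "support W = closed_span (lowest_monomial ` (W - {0}))"


section \<open>Weierstrass gaps\<close>

definition curve_field :: "'k::field form \<Rightarrow> 'k ratfun set ring" where
  "curve_field F = stalk_ring (curve_ideal F) Quot stalk_ideal (curve_ideal F) (curve_ideal F)"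

definition restrict_to_curve :: "'k::field form \<Rightarrow> 'k ratfun \<Rightarrow> 'k ratfun set" where
  "restrict_to_curve F a =
     stalk_ideal (curve_ideal F) (curve_ideal F) +>\<^bsub>stalk_ring (curve_ideal F)\<^esub> a"

definition curve_stalk :: "'k::field form \<Rightarrow> 'k form set \<Rightarrow> 'k ratfun set set" where
  "curve_stalk F q = restrict_to_curve F ` stalk q"

definition curve_stalk_max :: "'k::field form \<Rightarrow> 'k form set \<Rightarrow> 'k ratfun set set" where
  "curve_stalk_max F q = restrict_to_curve F ` stalk_ideal q q"

definition functions_off :: "'k::field form \<Rightarrow> 'k form set \<Rightarrow> 'k ratfun set set" where
  "functions_off F p = {a \<in> carrier (curve_field F).
     \<forall>q. closed_point q \<and> F \<in> q \<and> q \<noteq> p \<longrightarrow> a \<in> curve_stalk F q}"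

text \<open>Here \<open>p\<close> is a smooth point of the curve, so that its local ring on the curve is a discrete
  valuation ring; \<open>\<tau>\<close> is a uniformizer.\<close>

definition has_pole_order :: "'k::field form \<Rightarrow> 'k form set \<Rightarrow> 'k ratfun set \<Rightarrow> nat \<Rightarrow> bool" where
  "has_pole_order F p a n \<longleftrightarrow> (\<exists>\<tau>\<in>curve_stalk F p.
     curve_stalk_max F p = (\<lambda>b. \<tau> \<otimes>\<^bsub>curve_field F\<^esub> b) ` curve_stalk F p \<and>
     a \<otimes>\<^bsub>curve_field F\<^esub> (\<tau> [^]\<^bsub>curve_field F\<^esub> n) \<in> curve_stalk F p - curve_stalk_max F p)"

definition weierstrass_gaps :: "'k::field form \<Rightarrow> 'k form set \<Rightarrow> nat set" where
  "weierstrass_gaps F p = {n. \<not> (\<exists>a\<in>functions_off F p. has_pole_order F p a n)}"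

end

theory Submission
  imports Defs
begin

text \<open>Contact of order \<open>m\<close> at \<open>p\<close> forces \<open>F = c y\<^sup>m + z L\<close> with \<open>L(p) \<noteq> 0\<close>, so \<open>f\<close> is monic in \<open>Y = y/z\<close> up to a
  constant. At a closed point \<open>q \<noteq> p\<close> of the curve, an element of \<open>K\<^sub>C\<close> whose image lies in \<open>B\<^sub>q\<close> has its leading
  coefficient along the curve regular at \<open>q\<close>. For this one shows that \<open>f\<close> is a nonzerodivisor of the completed local
  ring and that elements lying in no minimal prime over \<open>f\<close> are nonzerodivisors modulo \<open>f\<close>; modulo \<open>f\<close>, the completion
  is a finite module over \<open>k[[d]]\<close> for a function \<open>d\<close> transversal to the curve, which replaces flatness and excellence.
  The local denominators generate the unit ideal of \<open>k[X,Y]/f\<close>, so the elements of \<open>W\<close> of order \<open>N\<close> along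
  the curve have as leading coefficients at \<open>f\<^sup>N\<close> exactly the nonzero functions in \<open>k[C \<setminus> p]\<close>.

  At \<open>p\<close> put \<open>S = z/x\<close>. Then \<open>u = c t\<^sup>m + S w\<close> with a unit \<open>w\<close>, so \<open>S\<close> restricts to a series of order \<open>m\<close> in \<open>t\<close>,
  and \<open>f = u S\<^sup>-\<^sup>m\<close> has leading coefficient of order \<open>-(m\<^sup>2)\<close> in \<open>t\<close>. The monomials \<open>X\<^sup>iY\<^sup>j\<close>
  with \<open>j < m\<close> have the pairwise distinct pole orders \<open>m i + (m - 1) j\<close> at \<open>p\<close>, so every nonzero function in
  \<open>k[C \<setminus> p]\<close> has an expansion of order \<open>-n\<close> with a nongap \<open>n\<close>, and \<open>f\<^sup>N\<close> times it has the lowest monomial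
  \<open>t\<close> to the power \<open>- n - m\<^sup>2 N\<close>, times \<open>u\<^sup>N\<close>.\<close>

section \<open>Localization\<close>

text \<open>The maps from \<open>K_C\<close> to the rings \<open>K_ring q f\<close> are definite
  descriptions, so nothing can be computed before existence and uniqueness are known. The locale
  \<open>good_point\<close> isolates two facts that suffice: elements of the local ring outside the
  ideal of the curve become units, and the \<open>f\<close>-adic filtration is separated. Away from
  the flex they come from commutative algebra, at the flex from the given isomorphism
  \<open>\<theta>\<close>. The obstacle is that the completed local ring can have zero divisors
  modulo \<open>f\<close> where the curve is singular. All control comes from one number:
  \<open>M\<close> bounds the dimension over k of the local ring modulo \<open>d\<close> and
  \<open>f\<close>. Hence the \<open>M\<close>-th power of the maximal ideal lies in the ideal of
  \<open>d\<close> and \<open>f\<close>, and an explicit Artin-Rees bound with factor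
  \<open>M + 1\<close> follows. Limits are never described completely: a support sees only lowest
  monomials, so a rational function from a representing Cauchy sequence replaces the limit once it
  agrees with it beyond the leading power of \<open>u\<close>.\<close>

context cring
begin

lemma diff_tel:
  "a \<in> carrier R \<Longrightarrow> b \<in> carrier R \<Longrightarrow> c \<in> carrier R \<Longrightarrow> (a \<ominus> b) \<oplus> (b \<ominus> c) = a \<ominus> c"
  by (simp add: minus_eq a_assoc) (simp add: a_assoc[symmetric] l_neg)

lemma mult_diff:
  assumes "a \<in> carrier R" "c \<in> carrier R" "b \<in> carrier R" "d \<in> carrier R"
  shows "a \<otimes> b \<ominus> c \<otimes> d = (a \<ominus> c) \<otimes> b \<oplus> (b \<ominus> d) \<otimes> c"
proof -
  have "(a \<ominus> c) \<otimes> b = a \<otimes> b \<ominus> c \<otimes> b" "(b \<ominus> d) \<otimes> c = c \<otimes> b \<ominus> c \<otimes> d"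
    using assms by (simp_all add: minus_eq l_distr r_distr l_minus r_minus m_comm)
  then show ?thesis using diff_tel[of "a \<otimes> b" "c \<otimes> b" "c \<otimes> d"] assms by simp
qed

end

locale mult_system = cring R for R (structure) and S +
  assumes S_sub: "S \<subseteq> carrier R" and S_one: "\<one> \<in> S"
    and S_mult: "s \<in> S \<Longrightarrow> t \<in> S \<Longrightarrow> s \<otimes> t \<in> S"
begin

abbreviation "fr \<equiv> frac R S"
abbreviation "L \<equiv> localization R S"

lemma S_carr [simp, intro]: "s \<in> S \<Longrightarrow> s \<in> carrier R"
  using S_sub by blast

lemma mult_diff_eq_0:
  "w \<in> carrier R \<Longrightarrow> x \<in> carrier R \<Longrightarrow> y \<in> carrier R \<Longrightarrow>
     w \<otimes> (x \<ominus> y) = \<zero> \<longleftrightarrow> w \<otimes> x = w \<otimes> y"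
  by (simp add: minus_eq r_distr r_minus) (metis minus_equality minus_minus m_closed r_neg a_inv_closed)

lemma mem_frac:
  assumes "a \<in> carrier R" "s \<in> S"
  shows "(b, t) \<in> fr a s \<longleftrightarrow> b \<in> carrier R \<and> t \<in> S \<and> (\<exists>w\<in>S. w \<otimes> (a \<otimes> t) = w \<otimes> (b \<otimes> s))"
  using assms by (auto simp: frac_def mult_diff_eq_0)

lemma frac_self: "a \<in> carrier R \<Longrightarrow> s \<in> S \<Longrightarrow> (a, s) \<in> fr a s"
  using S_one by (auto simp: mem_frac)

text \<open>The multiplier has to contain the middle denominator \<open>t\<close> besides
  \<open>w\<close> and \<open>w'\<close>: \<open>S\<close> may contain zero divisors, so nothing can
  be cancelled.\<close>

lemma frac_trans:
  assumes c: "a \<in> carrier R" "b \<in> carrier R" "c \<in> carrier R" "s \<in> S" "t \<in> S" "v \<in> S"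
    and w: "w \<in> S" "w' \<in> S" and eq: "w \<otimes> (a \<otimes> t) = w \<otimes> (b \<otimes> s)" "w' \<otimes> (b \<otimes> v) = w' \<otimes> (c \<otimes> t)"
  shows "\<exists>w\<in>S. w \<otimes> (a \<otimes> v) = w \<otimes> (c \<otimes> s)"
proof
  show "w \<otimes> w' \<otimes> t \<in> S" using c w S_mult by simp
  have "w \<otimes> w' \<otimes> t \<otimes> (a \<otimes> v) = (w' \<otimes> v) \<otimes> (w \<otimes> (a \<otimes> t))"
    using c w by (simp add: m_ac)
  also have "\<dots> = (w \<otimes> s) \<otimes> (w' \<otimes> (b \<otimes> v))" unfolding eq(1) using c w by (simp add: m_ac)
  also have "\<dots> = w \<otimes> w' \<otimes> t \<otimes> (c \<otimes> s)" unfolding eq(2) using c w by (simp add: m_ac)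
  finally show "w \<otimes> w' \<otimes> t \<otimes> (a \<otimes> v) = w \<otimes> w' \<otimes> t \<otimes> (c \<otimes> s)" .
qed

lemma frac_subset:
  assumes a: "a \<in> carrier R" "b \<in> carrier R" "s \<in> S" "t \<in> S"
    and r: "w \<in> S" "w \<otimes> (b \<otimes> s) = w \<otimes> (a \<otimes> t)"
  shows "fr a s \<subseteq> fr b t"
proof (rule subrelI)
  fix c v assume "(c, v) \<in> fr a s"
  then obtain w' where "c \<in> carrier R" "v \<in> S" "w' \<in> S" "w' \<otimes> (a \<otimes> v) = w' \<otimes> (c \<otimes> s)"
    using a by (auto simp: mem_frac)
  with r a show "(c, v) \<in> fr b t"
    using frac_trans[of b a c t s v w w'] by (simp add: mem_frac)
qed

lemma frac_eq_iff:
  assumes "a \<in> carrier R" "b \<in> carrier R" "s \<in> S" "t \<in> S"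
  shows "fr a s = fr b t \<longleftrightarrow> (\<exists>w\<in>S. w \<otimes> (a \<otimes> t) = w \<otimes> (b \<otimes> s))"
proof
  assume "fr a s = fr b t"
  then have "(b, t) \<in> fr a s" using frac_self assms by simp
  then show "\<exists>w\<in>S. w \<otimes> (a \<otimes> t) = w \<otimes> (b \<otimes> s)"
    using assms by (simp add: mem_frac)
next
  assume "\<exists>w\<in>S. w \<otimes> (a \<otimes> t) = w \<otimes> (b \<otimes> s)"
  then obtain w where "w \<in> S" "w \<otimes> (a \<otimes> t) = w \<otimes> (b \<otimes> s)" by blast
  then show "fr a s = fr b t"
    using frac_subset[of a b s t w] frac_subset[of b a t s w] assms by simp
qed

lemma frac_eqI:
  assumes "a \<in> carrier R" "b \<in> carrier R" "s \<in> S" "t \<in> S" "a \<otimes> t = b \<otimes> s"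
  shows "fr a s = fr b t"
  using assms S_one by (subst frac_eq_iff) auto

lemma carrier_L: "carrier L = {fr a s | a s. a \<in> carrier R \<and> s \<in> S}"
  by (simp add: localization_def)

lemma frac_in_L [simp, intro]: "a \<in> carrier R \<Longrightarrow> s \<in> S \<Longrightarrow> fr a s \<in> carrier L"
  by (auto simp: carrier_L)

lemma L_E: "A \<in> carrier L \<Longrightarrow> (\<And>a s. a \<in> carrier R \<Longrightarrow> s \<in> S \<Longrightarrow> A = fr a s \<Longrightarrow> P) \<Longrightarrow> P"
  by (auto simp: carrier_L)

text \<open>Sum and product in a localization are unions over all pairs of representatives; once the
  members are known to coincide, the union collapses to any one of them.\<close>

lemma UN2_const:
  assumes "(a, s) \<in> A" "(b, t) \<in> B"
    and "\<And>a s b t. (a, s) \<in> A \<Longrightarrow> (b, t) \<in> B \<Longrightarrow> f a s b t = C"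
  shows "(\<Union>(a, s)\<in>A. \<Union>(b, t)\<in>B. f a s b t) = C"
  using assms by fast

lemma L_mult [simp]:
  assumes c: "a \<in> carrier R" "b \<in> carrier R" "s \<in> S" "t \<in> S"
  shows "fr a s \<otimes>\<^bsub>L\<^esub> fr b t = fr (a \<otimes> b) (s \<otimes> t)"
proof -
  have *: "fr (a' \<otimes> b') (s' \<otimes> t') = fr (a \<otimes> b) (s \<otimes> t)" if 1: "(a', s') \<in> fr a s" "(b', t') \<in> fr b t"
    for a' b' s' t'
  proof -
    obtain w v where w: "w \<in> S" and wq: "w \<otimes> (a \<otimes> s') = w \<otimes> (a' \<otimes> s)" and v: "v \<in> S"
      and vq: "v \<otimes> (b \<otimes> t') = v \<otimes> (b' \<otimes> t)"
      and c': "a' \<in> carrier R" "b' \<in> carrier R" "s' \<in> S" "t' \<in> S"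
      using 1 c by (auto simp: mem_frac)
    have "w \<otimes> v \<otimes> (a' \<otimes> b' \<otimes> (s \<otimes> t)) = (w \<otimes> (a' \<otimes> s)) \<otimes> (v \<otimes> (b' \<otimes> t))"
      using w v c c' by (simp add: m_ac)
    also have "\<dots> = w \<otimes> v \<otimes> (a \<otimes> b \<otimes> (s' \<otimes> t'))"
      unfolding wq[symmetric] vq[symmetric] using w v c c' by (simp add: m_ac)
    finally have "w \<otimes> v \<otimes> (a' \<otimes> b' \<otimes> (s \<otimes> t)) = w \<otimes> v \<otimes> (a \<otimes> b \<otimes> (s' \<otimes> t'))" .
    moreover have "w \<otimes> v \<in> S" using w v S_mult by blast
    ultimately show ?thesis using c c' S_mult by (subst frac_eq_iff) auto
  qed
  show ?thesis unfolding localization_def monoid.simps ring_record_simps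
    by (rule UN2_const[OF frac_self[OF c(1,3)] frac_self[OF c(2,4)]]) (rule *)
qed

lemma L_add [simp]:
  assumes c: "a \<in> carrier R" "b \<in> carrier R" "s \<in> S" "t \<in> S"
  shows "fr a s \<oplus>\<^bsub>L\<^esub> fr b t = fr (a \<otimes> t \<oplus> b \<otimes> s) (s \<otimes> t)"
proof -
  have *: "fr (a' \<otimes> t' \<oplus> b' \<otimes> s') (s' \<otimes> t') = fr (a \<otimes> t \<oplus> b \<otimes> s) (s \<otimes> t)" if 1: "(a', s') \<in> fr a s" "(b', t') \<in> fr b t"
    for a' b' s' t'
  proof -
    obtain w v where w: "w \<in> S" and wq: "w \<otimes> (a \<otimes> s') = w \<otimes> (a' \<otimes> s)" and v: "v \<in> S"
      and vq: "v \<otimes> (b \<otimes> t') = v \<otimes> (b' \<otimes> t)"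
      and c': "a' \<in> carrier R" "b' \<in> carrier R" "s' \<in> S" "t' \<in> S"
      using 1 c by (auto simp: mem_frac)
    have "w \<otimes> v \<otimes> ((a' \<otimes> t' \<oplus> b' \<otimes> s') \<otimes> (s \<otimes> t)) =
        (w \<otimes> (a' \<otimes> s)) \<otimes> (v \<otimes> (t \<otimes> t')) \<oplus> (v \<otimes> (b' \<otimes> t)) \<otimes> (w \<otimes> (s \<otimes> s'))"
      using w v c c' by (simp add: m_ac l_distr r_distr)
    also have "\<dots> = w \<otimes> v \<otimes> ((a \<otimes> t \<oplus> b \<otimes> s) \<otimes> (s' \<otimes> t'))"
      unfolding wq[symmetric] vq[symmetric] using w v c c' by (simp add: m_ac l_distr r_distr)
    finally have "w \<otimes> v \<otimes> ((a' \<otimes> t' \<oplus> b' \<otimes> s') \<otimes> (s \<otimes> t)) = w \<otimes> v \<otimes> ((a \<otimes> t \<oplus> b \<otimes> s) \<otimes> (s' \<otimes> t'))" .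
    moreover have "w \<otimes> v \<in> S" using w v S_mult by blast
    ultimately show ?thesis using c c' S_mult by (subst frac_eq_iff) auto
  qed
  show ?thesis unfolding localization_def monoid.simps ring_record_simps
    by (rule UN2_const[OF frac_self[OF c(1,3)] frac_self[OF c(2,4)]]) (rule *)
qed

lemma L_one: "\<one>\<^bsub>L\<^esub> = fr \<one> \<one>" by (simp add: localization_def)
lemma L_zero: "\<zero>\<^bsub>L\<^esub> = fr \<zero> \<one>" by (simp add: localization_def)

lemma L_cring: "cring L"
proof (rule cringI)
  show "abelian_group L"
  proof (rule abelian_groupI)
    fix A B C assume A: "A \<in> carrier L" and B: "B \<in> carrier L" and C: "C \<in> carrier L"
    from A obtain a s where a: "a \<in> carrier R" "s \<in> S" "A = fr a s" by (rule L_E)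
    from B obtain b t where b: "b \<in> carrier R" "t \<in> S" "B = fr b t" by (rule L_E)
    from C obtain c v where c: "c \<in> carrier R" "v \<in> S" "C = fr c v" by (rule L_E)
    show "A \<oplus>\<^bsub>L\<^esub> B \<in> carrier L" using a b S_mult by simp
    show "A \<oplus>\<^bsub>L\<^esub> B \<oplus>\<^bsub>L\<^esub> C = A \<oplus>\<^bsub>L\<^esub> (B \<oplus>\<^bsub>L\<^esub> C)"
      using a b c S_mult by (simp add: l_distr r_distr a_ac m_ac)
    show "A \<oplus>\<^bsub>L\<^esub> B = B \<oplus>\<^bsub>L\<^esub> A"
      using a b by (simp add: a_ac m_ac)
    show "\<zero>\<^bsub>L\<^esub> \<oplus>\<^bsub>L\<^esub> A = A"
      using a S_one by (simp add: L_zero)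
    show "\<exists>B\<in>carrier L. B \<oplus>\<^bsub>L\<^esub> A = \<zero>\<^bsub>L\<^esub>"
      using a S_one S_mult frac_eqI[of \<zero> \<zero> "s \<otimes> s" \<one>]
      by (intro bexI[of _ "fr (\<ominus> a) s"]) (simp_all add: L_zero l_minus l_neg)
  next
    show "\<zero>\<^bsub>L\<^esub> \<in> carrier L" using S_one by (simp add: L_zero)
  qed
  show "comm_monoid L"
  proof (rule comm_monoidI)
    fix A B C assume A: "A \<in> carrier L" and B: "B \<in> carrier L" and C: "C \<in> carrier L"
    from A obtain a s where a: "a \<in> carrier R" "s \<in> S" "A = fr a s" by (rule L_E)
    from B obtain b t where b: "b \<in> carrier R" "t \<in> S" "B = fr b t" by (rule L_E)
    from C obtain c v where c: "c \<in> carrier R" "v \<in> S" "C = fr c v" by (rule L_E)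
    show "A \<otimes>\<^bsub>L\<^esub> B \<in> carrier L" using a b S_mult by simp
    show "A \<otimes>\<^bsub>L\<^esub> B \<otimes>\<^bsub>L\<^esub> C = A \<otimes>\<^bsub>L\<^esub> (B \<otimes>\<^bsub>L\<^esub> C)"
      using a b c S_mult by (simp add: m_ac)
    show "A \<otimes>\<^bsub>L\<^esub> B = B \<otimes>\<^bsub>L\<^esub> A" using a b by (simp add: m_ac)
    show "\<one>\<^bsub>L\<^esub> \<otimes>\<^bsub>L\<^esub> A = A" using a S_one by (simp add: L_one)
  next
    show "\<one>\<^bsub>L\<^esub> \<in> carrier L" using S_one by (simp add: L_one)
  qed
  fix A B C assume A: "A \<in> carrier L" and B: "B \<in> carrier L" and C: "C \<in> carrier L"
  from A obtain a s where a: "a \<in> carrier R" "s \<in> S" "A = fr a s" by (rule L_E)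
  from B obtain b t where b: "b \<in> carrier R" "t \<in> S" "B = fr b t" by (rule L_E)
  from C obtain c v where c: "c \<in> carrier R" "v \<in> S" "C = fr c v" by (rule L_E)
  \<comment> \<open>The two sides arise with denominators \<open>s t v\<close> and
    \<open>s v t v\<close>. They agree only as fractions, so the extra factor \<open>v\<close> is
    removed by \<open>frac_eqI\<close>.\<close>
  show "(A \<oplus>\<^bsub>L\<^esub> B) \<otimes>\<^bsub>L\<^esub> C = A \<otimes>\<^bsub>L\<^esub> C \<oplus>\<^bsub>L\<^esub> B \<otimes>\<^bsub>L\<^esub> C"
    using a b c S_mult
      frac_eqI[of "(a \<otimes> t \<oplus> b \<otimes> s) \<otimes> c" "a \<otimes> c \<otimes> (t \<otimes> v) \<oplus> b \<otimes> c \<otimes> (s \<otimes> v)"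
        "s \<otimes> t \<otimes> v" "s \<otimes> v \<otimes> (t \<otimes> v)"]
    by (simp add: l_distr r_distr a_ac m_ac)
qed

sublocale L: cring L by (rule L_cring)

abbreviation "tol \<equiv> to_loc R S"

lemma tol_carr [simp, intro]: "a \<in> carrier R \<Longrightarrow> tol a \<in> carrier L"
  using S_one by (auto simp: to_loc_def)

lemma tol_hom: "tol \<in> ring_hom R L"
  using S_one by (intro ring_hom_memI) (auto simp: to_loc_def L_one intro!: frac_eqI)

lemma tol_mult [simp]: "a \<in> carrier R \<Longrightarrow> b \<in> carrier R \<Longrightarrow> tol (a \<otimes> b) = tol a \<otimes>\<^bsub>L\<^esub> tol b"
  using ring_hom_mult[OF tol_hom] by blast
lemma tol_add [simp]: "a \<in> carrier R \<Longrightarrow> b \<in> carrier R \<Longrightarrow> tol (a \<oplus> b) = tol a \<oplus>\<^bsub>L\<^esub> tol b"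
  using ring_hom_add[OF tol_hom] by blast
lemma tol_one [simp]: "tol \<one> = \<one>\<^bsub>L\<^esub>"
  using ring_hom_one[OF tol_hom] by blast
lemma tol_zero [simp]: "tol \<zero> = \<zero>\<^bsub>L\<^esub>"
  by (simp add: to_loc_def L_zero)

lemma tol_unit: "s \<in> S \<Longrightarrow> tol s \<otimes>\<^bsub>L\<^esub> fr \<one> s = \<one>\<^bsub>L\<^esub>"
  using S_one by (simp add: to_loc_def L_one frac_eqI)

lemma frac_eq: "a \<in> carrier R \<Longrightarrow> s \<in> S \<Longrightarrow> fr a s = tol a \<otimes>\<^bsub>L\<^esub> fr \<one> s"
  using S_one by (simp add: to_loc_def)

lemma tol_eq_iff: "a \<in> carrier R \<Longrightarrow> b \<in> carrier R \<Longrightarrow> tol a = tol b \<longleftrightarrow> (\<exists>w\<in>S. w \<otimes> a = w \<otimes> b)"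
  using S_one by (simp add: to_loc_def frac_eq_iff)

end

lemma (in cring) powers_mult_system: "a \<in> carrier R \<Longrightarrow> mult_system R (powers R a)"
  by unfold_locales (auto simp: powers_def nat_pow_mult intro: range_eqI[of _ _ 0])

section \<open>Adic completion\<close>

locale adic = cring R + ideal I R for R (structure) and I
begin

abbreviation "Pw \<equiv> ideal_pow R I"
abbreviation "C \<equiv> adic_completion R I"

lemma Pw_ideal: "ideal (Pw n) R"
  by (induction n) (auto intro: oneideal ideal_prod_is_ideal ideal_axioms)

lemma Pw_Suc: "Pw (Suc n) \<subseteq> Pw n"
  using ideal_prod_inter[OF Pw_ideal ideal_axioms, of n] by auto

lemma Pw_mono: "n \<le> m \<Longrightarrow> Pw m \<subseteq> Pw n"
  by (rule lift_Suc_antimono_le[of Pw]) (use Pw_Suc in auto)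

lemma Pw_carr: "x \<in> Pw n \<Longrightarrow> x \<in> carrier R"
  using ideal.Icarr[OF Pw_ideal] .

lemma Pw_zero: "\<zero> \<in> Pw n"
  using additive_subgroup.zero_closed[OF ideal.axioms(1)[OF Pw_ideal]] .
lemma Pw_add: "x \<in> Pw n \<Longrightarrow> y \<in> Pw n \<Longrightarrow> x \<oplus> y \<in> Pw n"
  using additive_subgroup.a_closed[OF ideal.axioms(1)[OF Pw_ideal]] .
lemma Pw_neg: "x \<in> Pw n \<Longrightarrow> \<ominus> x \<in> Pw n"
  using additive_subgroup.a_inv_closed[OF ideal.axioms(1)[OF Pw_ideal]] .
lemma Pw_minus: "x \<in> Pw n \<Longrightarrow> y \<in> Pw n \<Longrightarrow> x \<ominus> y \<in> Pw n"
  by (simp add: minus_eq Pw_add Pw_neg)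
lemma Pw_mult: "x \<in> Pw n \<Longrightarrow> y \<in> carrier R \<Longrightarrow> x \<otimes> y \<in> Pw n"
  using ideal.I_r_closed[OF Pw_ideal] .

lemma coset_eq_iff: "a \<in> carrier R \<Longrightarrow> b \<in> carrier R \<Longrightarrow> Pw n +> a = Pw n +> b \<longleftrightarrow> a \<ominus> b \<in> Pw n"
  using quotient_eq_iff_same_a_r_cos[OF Pw_ideal] by blast

lemma coset_self: "a \<in> carrier R \<Longrightarrow> a \<in> Pw n +> a"
  using abelian_subgroup.a_rcos_self[OF ideal.axioms(1)[OF Pw_ideal, THEN abelian_subgroupI3[OF _ is_abelian_group]]] .

lemma mem_coset: "a \<in> carrier R \<Longrightarrow> b \<in> Pw n +> a \<longleftrightarrow> b \<in> carrier R \<and> b \<ominus> a \<in> Pw n"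
proof -
  assume a: "a \<in> carrier R"
  have "b \<in> Pw n +> a \<longleftrightarrow> (\<exists>h\<in>Pw n. b = h \<oplus> a)" by (auto simp: a_r_coset_def')
  also have "\<dots> \<longleftrightarrow> b \<in> carrier R \<and> b \<ominus> a \<in> Pw n"
  proof safe
    fix h assume h: "h \<in> Pw n"
    show "h \<oplus> a \<in> carrier R" using h a Pw_carr by blast
    have "h \<oplus> a \<ominus> a = h" using a Pw_carr[OF h] by (simp add: minus_eq a_assoc r_neg)
    then show "h \<oplus> a \<ominus> a \<in> Pw n" using h by simp
  next
    assume "b \<in> carrier R" "b \<ominus> a \<in> Pw n"
    then show "\<exists>h\<in>Pw n. b = h \<oplus> a"
      using a by (intro bexI[of _ "b \<ominus> a"]) (auto simp: minus_eq a_assoc l_neg)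
  qed
  finally show ?thesis .
qed

lemma coset_subset_iff:
  assumes "a \<in> carrier R" "b \<in> carrier R" "n \<le> m"
  shows "Pw m +> a \<subseteq> Pw n +> b \<longleftrightarrow> a \<ominus> b \<in> Pw n"
proof
  assume "Pw m +> a \<subseteq> Pw n +> b"
  then show "a \<ominus> b \<in> Pw n" using coset_self[of a m] assms mem_coset by blast
next
  assume d: "a \<ominus> b \<in> Pw n"
  show "Pw m +> a \<subseteq> Pw n +> b"
  proof
    fix x assume x: "x \<in> Pw m +> a"
    then have xc: "x \<in> carrier R" and "x \<ominus> a \<in> Pw n" using mem_coset assms Pw_mono by blast+
    then have "(x \<ominus> a) \<oplus> (a \<ominus> b) \<in> Pw n" using d Pw_add by blast
    then show "x \<in> Pw n +> b" using assms xc mem_coset diff_tel by simp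
  qed
qed

text \<open>A point of the inverse limit is handled through a sequence of ring elements:
  \<open>cls\<close> forms the cosets, \<open>coh\<close> is compatibility of neighbours. Arithmetic
  in the completion becomes termwise arithmetic modulo powers of the ideal. Entry 0 carries no
  information, as \<open>Pw 0\<close> is the whole ring.\<close>

definition cls :: "(nat \<Rightarrow> 'a) \<Rightarrow> 'a compl" where "cls x = (\<lambda>n. Pw n +> x n)"
definition coh :: "(nat \<Rightarrow> 'a) \<Rightarrow> bool" where
  "coh x \<longleftrightarrow> (\<forall>n. x n \<in> carrier R \<and> x (Suc n) \<ominus> x n \<in> Pw n)"

lemma cohD: "coh x \<Longrightarrow> x n \<in> carrier R" "coh x \<Longrightarrow> x (Suc n) \<ominus> x n \<in> Pw n"
  by (auto simp: coh_def)

lemma carr_quot: "carrier (R Quot Pw n) = {Pw n +> a | a. a \<in> carrier R}"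
  by (auto simp: FactRing_def A_RCOSETS_def RCOSETS_def a_r_coset_def)

lemma carrier_C: "carrier C = {cls x | x. coh x}"
proof safe
  fix \<alpha> assume a: "\<alpha> \<in> carrier C"
  then have "\<forall>n. \<exists>x. x \<in> carrier R \<and> \<alpha> n = Pw n +> x" "\<forall>n. \<alpha> (Suc n) \<subseteq> \<alpha> n"
    by (simp_all add: adic_completion_def carr_quot) blast
  then obtain x where x: "\<And>n. x n \<in> carrier R" "\<And>n. \<alpha> n = Pw n +> x n" "\<And>n. \<alpha> (Suc n) \<subseteq> \<alpha> n"
    by metis
  have "x (Suc n) \<ominus> x n \<in> Pw n" for n
    using coset_subset_iff[of "x (Suc n)" "x n" n "Suc n"] x by (metis lessI less_imp_le)
  then have "coh x" "\<alpha> = cls x" using x by (auto simp: coh_def cls_def)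
  then show "\<exists>x. \<alpha> = cls x \<and> coh x" by blast
next
  fix x assume c: "coh x"
  then have "Pw (Suc n) +> x (Suc n) \<subseteq> Pw n +> x n" for n
    using coset_subset_iff[of "x (Suc n)" "x n" n "Suc n"] by (auto simp: coh_def)
  then show "cls x \<in> carrier C"
    using c by (auto simp: adic_completion_def carr_quot cls_def coh_def)
qed

lemma C_E: "\<alpha> \<in> carrier C \<Longrightarrow> (\<And>x. coh x \<Longrightarrow> \<alpha> = cls x \<Longrightarrow> P) \<Longrightarrow> P"
  by (auto simp: carrier_C)
lemma cls_carr [simp, intro]: "coh x \<Longrightarrow> cls x \<in> carrier C"
  by (auto simp: carrier_C)

lemma cls_eq_iff: "coh x \<Longrightarrow> coh y \<Longrightarrow> cls x = cls y \<longleftrightarrow> (\<forall>n. x n \<ominus> y n \<in> Pw n)"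
  by (simp add: cls_def fun_eq_iff coset_eq_iff cohD)

lemma coh_add:
  assumes "coh x" "coh y" shows "coh (\<lambda>n. x n \<oplus> y n)"
proof -
  have "x (Suc n) \<oplus> y (Suc n) \<ominus> (x n \<oplus> y n) = (x (Suc n) \<ominus> x n) \<oplus> (y (Suc n) \<ominus> y n)" for n
    using assms[THEN cohD(1)] by (simp add: minus_eq minus_add a_ac)
  then show ?thesis using assms by (auto simp: coh_def intro!: Pw_add)
qed

lemma coh_mult:
  assumes "coh x" "coh y" shows "coh (\<lambda>n. x n \<otimes> y n)"
proof -
  have "x (Suc n) \<otimes> y (Suc n) \<ominus> (x n \<otimes> y n) =
     (x (Suc n) \<ominus> x n) \<otimes> y (Suc n) \<oplus> (y (Suc n) \<ominus> y n) \<otimes> x n" for n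
  proof -
    have c: "x (Suc n) \<in> carrier R" "x n \<in> carrier R" "y (Suc n) \<in> carrier R" "y n \<in> carrier R"
      using assms[THEN cohD(1)] by auto
    then show ?thesis by (rule mult_diff)
  qed
  then show ?thesis using assms by (auto simp: coh_def intro!: Pw_add Pw_mult)
qed

lemma coh_const: "a \<in> carrier R \<Longrightarrow> coh (\<lambda>n. a)"
  by (simp add: coh_def minus_eq r_neg Pw_zero)

lemma C_add [simp]: "coh x \<Longrightarrow> coh y \<Longrightarrow> cls x \<oplus>\<^bsub>C\<^esub> cls y = cls (\<lambda>n. x n \<oplus> y n)"
  using ideal.axioms(1)[OF Pw_ideal, THEN abelian_subgroupI3[OF _ is_abelian_group]]
  by (auto simp: adic_completion_def FactRing_def cls_def cohD fun_eq_iff abelian_subgroup.a_rcos_sum)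
lemma C_mult [simp]: "coh x \<Longrightarrow> coh y \<Longrightarrow> cls x \<otimes>\<^bsub>C\<^esub> cls y = cls (\<lambda>n. x n \<otimes> y n)"
  by (simp add: adic_completion_def FactRing_def cls_def cohD fun_eq_iff ideal.rcoset_mult_add[OF Pw_ideal])
lemma C_one: "\<one>\<^bsub>C\<^esub> = cls (\<lambda>n. \<one>)"
  by (simp add: adic_completion_def FactRing_def cls_def)
lemma C_zero: "\<zero>\<^bsub>C\<^esub> = cls (\<lambda>n. \<zero>)"
  using ideal.Icarr[OF Pw_ideal] by (auto simp: adic_completion_def FactRing_def cls_def fun_eq_iff a_coset_add_zero subsetI)

lemma C_cring: "cring C"
proof (rule cringI)
  have z: "coh (\<lambda>n. \<zero>)" and o: "coh (\<lambda>n. \<one>)" by (simp_all add: coh_const)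
  show "abelian_group C"
  proof (rule abelian_groupI)
    fix \<alpha> \<beta> \<gamma> assume "\<alpha> \<in> carrier C" "\<beta> \<in> carrier C" "\<gamma> \<in> carrier C"
    then obtain x y w where x: "coh x" "\<alpha> = cls x" and y: "coh y" "\<beta> = cls y" and w: "coh w" "\<gamma> = cls w"
      by (metis C_E)
    note c = cohD(1)[OF x(1)] cohD(1)[OF y(1)] cohD(1)[OF w(1)]
    show "\<alpha> \<oplus>\<^bsub>C\<^esub> \<beta> \<in> carrier C" using x y by (simp add: coh_add)
    show "\<alpha> \<oplus>\<^bsub>C\<^esub> \<beta> \<oplus>\<^bsub>C\<^esub> \<gamma> = \<alpha> \<oplus>\<^bsub>C\<^esub> (\<beta> \<oplus>\<^bsub>C\<^esub> \<gamma>)" using x y w c by (simp add: coh_add a_assoc)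
    show "\<alpha> \<oplus>\<^bsub>C\<^esub> \<beta> = \<beta> \<oplus>\<^bsub>C\<^esub> \<alpha>" using x y c by (simp add: a_comm)
    show "\<zero>\<^bsub>C\<^esub> \<oplus>\<^bsub>C\<^esub> \<alpha> = \<alpha>" using x c z by (simp add: C_zero)
    have "coh (\<lambda>n. \<ominus> \<one> \<otimes> x n)" by (rule coh_mult) (auto intro: coh_const x)
    moreover have "\<ominus> \<one> \<otimes> x n \<oplus> x n = \<zero>" for n using c by (simp add: l_minus l_neg)
    ultimately show "\<exists>\<beta>\<in>carrier C. \<beta> \<oplus>\<^bsub>C\<^esub> \<alpha> = \<zero>\<^bsub>C\<^esub>"
      using x by (intro bexI[of _ "cls (\<lambda>n. \<ominus> \<one> \<otimes> x n)"]) (auto simp: C_zero)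
  qed (simp add: C_zero z)
  show "comm_monoid C"
  proof (rule comm_monoidI)
    fix \<alpha> \<beta> \<gamma> assume "\<alpha> \<in> carrier C" "\<beta> \<in> carrier C" "\<gamma> \<in> carrier C"
    then obtain x y w where x: "coh x" "\<alpha> = cls x" and y: "coh y" "\<beta> = cls y" and w: "coh w" "\<gamma> = cls w"
      by (metis C_E)
    note c = cohD(1)[OF x(1)] cohD(1)[OF y(1)] cohD(1)[OF w(1)]
    show "\<alpha> \<otimes>\<^bsub>C\<^esub> \<beta> \<in> carrier C" using x y by (simp add: coh_mult)
    show "\<alpha> \<otimes>\<^bsub>C\<^esub> \<beta> \<otimes>\<^bsub>C\<^esub> \<gamma> = \<alpha> \<otimes>\<^bsub>C\<^esub> (\<beta> \<otimes>\<^bsub>C\<^esub> \<gamma>)" using x y w c by (simp add: coh_mult m_assoc)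
    show "\<alpha> \<otimes>\<^bsub>C\<^esub> \<beta> = \<beta> \<otimes>\<^bsub>C\<^esub> \<alpha>" using x y c by (simp add: m_comm)
    show "\<one>\<^bsub>C\<^esub> \<otimes>\<^bsub>C\<^esub> \<alpha> = \<alpha>" using x c o by (simp add: C_one)
  qed (simp add: C_one o)
  fix \<alpha> \<beta> \<gamma> assume "\<alpha> \<in> carrier C" "\<beta> \<in> carrier C" "\<gamma> \<in> carrier C"
  then obtain x y w where x: "coh x" "\<alpha> = cls x" and y: "coh y" "\<beta> = cls y" and w: "coh w" "\<gamma> = cls w"
    by (metis C_E)
  note c = cohD(1)[OF x(1)] cohD(1)[OF y(1)] cohD(1)[OF w(1)]
  show "(\<alpha> \<oplus>\<^bsub>C\<^esub> \<beta>) \<otimes>\<^bsub>C\<^esub> \<gamma> = \<alpha> \<otimes>\<^bsub>C\<^esub> \<gamma> \<oplus>\<^bsub>C\<^esub> \<beta> \<otimes>\<^bsub>C\<^esub> \<gamma>"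
    using x y w c by (simp add: coh_add coh_mult l_distr)
qed

sublocale C: cring C by (rule C_cring)

abbreviation "toc \<equiv> to_completion R I"

lemma toc_eq: "toc a = cls (\<lambda>n. a)" by (simp add: to_completion_def cls_def)
lemma toc_carr [simp, intro]: "a \<in> carrier R \<Longrightarrow> toc a \<in> carrier C" by (simp add: toc_eq coh_const)
lemma toc_mult [simp]: "a \<in> carrier R \<Longrightarrow> b \<in> carrier R \<Longrightarrow> toc (a \<otimes> b) = toc a \<otimes>\<^bsub>C\<^esub> toc b"
  by (simp add: toc_eq coh_const)
lemma toc_add [simp]: "a \<in> carrier R \<Longrightarrow> b \<in> carrier R \<Longrightarrow> toc (a \<oplus> b) = toc a \<oplus>\<^bsub>C\<^esub> toc b"
  by (simp add: toc_eq coh_const)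
lemma toc_one [simp]: "toc \<one> = \<one>\<^bsub>C\<^esub>" by (simp add: toc_eq C_one)
lemma toc_zero [simp]: "toc \<zero> = \<zero>\<^bsub>C\<^esub>" by (simp add: toc_eq C_zero)
lemma cls_zero_iff: "coh x \<Longrightarrow> cls x = \<zero>\<^bsub>C\<^esub> \<longleftrightarrow> (\<forall>n. x n \<in> Pw n)"
  by (simp add: C_zero cls_eq_iff coh_const cohD minus_eq)

lemma C_minus: "coh x \<Longrightarrow> coh y \<Longrightarrow> cls x \<ominus>\<^bsub>C\<^esub> cls y = cls (\<lambda>n. x n \<ominus> y n) \<and> coh (\<lambda>n. x n \<ominus> y n)"
proof -
  assume x: "coh x" and y: "coh y"
  have c: "coh (\<lambda>n. \<ominus> \<one> \<otimes> y n)" by (rule coh_mult) (auto intro: coh_const y)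
  then have n: "coh (\<lambda>n. \<ominus> y n)" using y by (simp add: l_minus cohD)
  have "cls (\<lambda>n. \<ominus> y n) \<oplus>\<^bsub>C\<^esub> cls y = \<zero>\<^bsub>C\<^esub>" using n y by (simp add: C_zero l_neg cohD)
  then have "\<ominus>\<^bsub>C\<^esub> cls y = cls (\<lambda>n. \<ominus> y n)" using C.minus_equality n y by blast
  then show ?thesis using x n coh_add[OF x n] by (simp add: minus_eq[abs_def] C.minus_eq)
qed

lemma coh_le:
  assumes "coh x" "n \<le> k" shows "x k \<ominus> x n \<in> Pw n"
  using \<open>n \<le> k\<close>
proof (induction k rule: dec_induct)
  case base
  then show ?case using cohD[OF assms(1)] by (simp add: minus_eq r_neg Pw_zero)
next
  case (step k)
  have "x (Suc k) \<ominus> x n = (x (Suc k) \<ominus> x k) \<oplus> (x k \<ominus> x n)"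
    using cohD(1)[OF assms(1)] by (simp add: diff_tel)
  then show ?case using step cohD(2)[OF assms(1), of k] Pw_mono[of n k] by (auto intro!: Pw_add)
qed

end

section \<open>Prime ideals\<close>

context cring
begin

text \<open>An ideal maximal among those that contain \<open>I\<close> and miss \<open>M\<close> is
  prime; Zorn's lemma provides one.\<close>

lemma prime_avoiding:
  assumes I: "ideal I R" and M: "M \<subseteq> carrier R" "\<one> \<in> M" "\<And>a b. a \<in> M \<Longrightarrow> b \<in> M \<Longrightarrow> a \<otimes> b \<in> M"
    and d: "I \<inter> M = {}"
  shows "\<exists>P. primeideal P R \<and> I \<subseteq> P \<and> P \<inter> M = {}"
proof -
  define A where "A = {J. ideal J R \<and> I \<subseteq> J \<and> J \<inter> M = {}}"
  have "\<exists>P\<in>A. \<forall>J\<in>A. P \<subseteq> J \<longrightarrow> J = P"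
  proof (rule subset_Zorn_nonempty)
    show "A \<noteq> {}" using I d by (auto simp: A_def)
    fix C assume C: "C \<noteq> {}" "subset.chain A C"
    have CA: "C \<subseteq> A" using C(2) by (simp add: pred_on.chain_def)
    have "subset.chain {I. ideal I R} C"
      using C(2) CA unfolding pred_on.chain_def A_def by blast
    then have "ideal (\<Union>C) R" using chain_Union_is_ideal[of C] C by simp
    moreover have "I \<subseteq> \<Union>C" using C(1) CA unfolding A_def by blast
    moreover have "\<Union>C \<inter> M = {}" using CA unfolding A_def by blast
    ultimately show "\<Union>C \<in> A" by (simp add: A_def)
  qed
  then obtain P where "P \<in> A" and mx: "\<forall>J\<in>A. P \<subseteq> J \<longrightarrow> J = P" by (elim bexE)
  then have P: "ideal P R" "I \<subseteq> P" "P \<inter> M = {}" by (simp_all add: A_def)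
  have max: "J = P" if "ideal J R" "I \<subseteq> J" "J \<inter> M = {}" "P \<subseteq> J" for J
    using mx that by (simp add: A_def)
  interpret P: ideal P R by fact
  \<comment> \<open>By maximality \<open>P\<close> cannot be enlarged by \<open>a\<close> without
    meeting \<open>M\<close>. If \<open>a\<close> and \<open>b\<close> are outside \<open>P\<close>
    with product in \<open>P\<close>, the two elements of \<open>M\<close> found here multiply into
    \<open>P\<close>.\<close>
  have ex: "\<exists>p\<in>P. \<exists>x\<in>carrier R. p \<oplus> x \<otimes> a \<in> M" if a: "a \<in> carrier R" "a \<notin> P" for a
  proof (rule ccontr)
    assume no: "\<not> ?thesis"
    have J: "ideal (P <+> PIdl a) R" by (intro add_ideals P cgenideal_ideal a)
    have el: "z \<in> P <+> PIdl a \<longleftrightarrow> (\<exists>p\<in>P. \<exists>x\<in>carrier R. z = p \<oplus> x \<otimes> a)" for z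
      by (auto simp: set_add_def' cgenideal_def)
    have sub: "P \<subseteq> P <+> PIdl a"
    proof
      fix p assume "p \<in> P"
      then show "p \<in> P <+> PIdl a" unfolding el using a by (intro bexI[of _ p] bexI[of _ \<zero>]) auto
    qed
    have "(P <+> PIdl a) \<inter> M = {}" using no by (auto simp: el)
    then have "P <+> PIdl a = P" using sub order_trans[OF P(2) sub] by (intro max J)
    moreover have "a \<in> P <+> PIdl a" unfolding el using a by (intro bexI[of _ \<zero>] bexI[of _ \<one>]) auto
    ultimately show False using a by blast
  qed
  have "primeideal P R"
  proof (rule primeidealI)
    show "carrier R \<noteq> P" using P M by auto
    fix a b assume ab: "a \<in> carrier R" "b \<in> carrier R" "a \<otimes> b \<in> P"
    show "a \<in> P \<or> b \<in> P"
    proof (rule ccontr)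
      assume "\<not> (a \<in> P \<or> b \<in> P)"
      then obtain p x q y where p: "p \<in> P" "x \<in> carrier R" "p \<oplus> x \<otimes> a \<in> M"
        and q: "q \<in> P" "y \<in> carrier R" "q \<oplus> y \<otimes> b \<in> M" using ex ab by metis
      have c: "p \<in> carrier R" "q \<in> carrier R" using p q by auto
      have "(p \<oplus> x \<otimes> a) \<otimes> (q \<oplus> y \<otimes> b) = p \<otimes> (q \<oplus> y \<otimes> b) \<oplus> (x \<otimes> a \<otimes> q \<oplus> (x \<otimes> y) \<otimes> (a \<otimes> b))"
        using c p q ab by (simp add: l_distr r_distr m_ac a_ac)
      also have "\<dots> \<in> P" using p q ab c
        by (intro P.a_closed[OF P.I_r_closed[OF p(1)] P.a_closed[OF P.I_l_closed[OF q(1)] P.I_l_closed[OF ab(3)]]]) simp_all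
      finally show False using M(3)[OF p(3) q(3)] P by blast
    qed
  qed (fact P is_cring)+
  then show ?thesis using P by blast
qed

text \<open>After localizing at a minimal prime \<open>P\<close> over \<open>I\<close>, its elements
  are nilpotent modulo \<open>I\<close>. Otherwise the products of an element off \<open>P\<close>
  with a power of \<open>r\<close> avoid \<open>I\<close>, and a prime avoiding them would lie in
  \<open>P\<close> but miss \<open>r\<close>.\<close>

lemma minimal_prime_elem:
  assumes P: "minimal_prime_over R I P" and I: "ideal I R" and r: "r \<in> P"
  shows "\<exists>w\<in>carrier R - P. \<exists>n::nat. w \<otimes> r [^] n \<in> I"
proof (rule ccontr)
  assume no: "\<not> ?thesis"
  interpret P: primeideal P R using P by (simp add: minimal_prime_over_def)
  have rc: "r \<in> carrier R" using P.Icarr[OF r] .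
  define M where "M = {a. \<exists>w\<in>carrier R - P. \<exists>n::nat. a = w \<otimes> r [^] n}"
  have MI: "w \<otimes> r [^] n \<in> M" if "w \<in> carrier R - P" for w and n :: nat
    using that unfolding M_def by blast
  have one: "\<one> \<in> carrier R - P" using P.I_notcarr P.one_imp_carrier by auto
  have "\<exists>P'. primeideal P' R \<and> I \<subseteq> P' \<and> P' \<inter> M = {}"
  proof (rule prime_avoiding[OF I])
    show "M \<subseteq> carrier R" using rc by (auto simp: M_def)
    show "\<one> \<in> M" using MI[OF one, of 0] by simp
    show "I \<inter> M = {}" using no by (auto simp: M_def)
    fix a b assume "a \<in> M" "b \<in> M"
    then obtain w v and n k :: nat where *: "a = w \<otimes> r [^] n" "b = v \<otimes> r [^] k" "w \<in> carrier R - P" "v \<in> carrier R - P"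
      unfolding M_def by auto
    have "a \<otimes> b = (w \<otimes> v) \<otimes> r [^] (n + k)"
      using * rc by (simp add: nat_pow_mult[symmetric] m_ac)
    moreover have "w \<otimes> v \<in> carrier R - P" using *(3,4) P.I_prime[of w v] by auto
    ultimately show "a \<otimes> b \<in> M" using MI by simp
  qed
  then obtain P' where P': "primeideal P' R" "I \<subseteq> P'" "P' \<inter> M = {}" by blast
  interpret P': primeideal P' R by fact
  have "P' \<subseteq> P"
  proof
    fix x assume x: "x \<in> P'"
    show "x \<in> P"
    proof (rule ccontr)
      assume "x \<notin> P"
      moreover have xc: "x \<in> carrier R" using P'.Icarr[OF x] .
      ultimately have "x \<otimes> r [^] (0::nat) \<in> M" using MI by blast
      then have "x \<in> M" using xc by simp
      then show False using x P'(3) by blast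
    qed
  qed
  moreover have "\<forall>Q. primeideal Q R \<and> I \<subseteq> Q \<and> Q \<subseteq> P \<longrightarrow> Q = P"
    using P by (simp add: minimal_prime_over_def)
  ultimately have "P' = P" using P'(1,2) by simp
  then have "r \<in> P'" using r by simp
  moreover have "\<one> \<otimes> r [^] (1::nat) \<in> M" using one by (rule MI)
  then have "r \<in> M" using rc by simp
  ultimately show False using P'(3) by (meson disjoint_iff)
qed

text \<open>The prime obtained from \<open>prime_avoiding\<close> for the powers of \<open>d\<close> is minimal because every
  element is, up to a power of \<open>d\<close>, strongly \<open>\<pi>\<close>-regular modulo \<open>f\<close>: this replaces Krull's
  principal ideal theorem.\<close>

lemma non_zero_divisor_off_minimal_primes:
  assumes f: "f \<in> carrier R" and d: "d \<in> carrier R"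
    and nzd: "\<And>x. x \<in> carrier R \<Longrightarrow> d \<otimes> x \<in> PIdl f \<Longrightarrow> x \<in> PIdl f"
    and reg: "\<And>r. r \<in> carrier R \<Longrightarrow> \<exists>(n::nat) (j::nat). \<exists>y\<in>carrier R. r [^] n \<otimes> (d [^] j \<ominus> r \<otimes> y) \<in> PIdl f"
    and s: "s \<in> carrier R" "s \<notin> \<Union>{P. minimal_prime_over R (PIdl f) P}"
    and x: "x \<in> carrier R" "s \<otimes> x \<in> PIdl f"
  shows "x \<in> PIdl f"
proof (rule ccontr)
  assume nx: "x \<notin> PIdl f"
  interpret F: ideal "PIdl f" R by (rule cgenideal_ideal[OF f])
  \<comment> \<open>The annihilator of \<open>x\<close> modulo \<open>f\<close>. It contains
    \<open>s\<close> and \<open>f\<close>, and no power of \<open>d\<close>, because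
    \<open>d\<close> is a nonzerodivisor modulo \<open>f\<close>. A prime over \<open>J\<close>
    missing the powers of \<open>d\<close> turns out to be minimal over \<open>f\<close>, although
    it contains \<open>s\<close>.\<close>
  define J where "J = {a \<in> carrier R. a \<otimes> x \<in> PIdl f}"
  have J: "ideal J R"
  proof (rule idealI[OF ring_axioms])
    show "subgroup J (add_monoid R)"
    proof (rule add.subgroupI)
      show "J \<subseteq> carrier R" by (auto simp: J_def)
      have "\<zero> \<in> J" using x(1) by (simp add: J_def F.zero_closed)
      then show "J \<noteq> {}" by blast
      fix a b assume ab: "a \<in> J" "b \<in> J"
      then show "\<ominus> a \<in> J" using x(1) by (simp add: J_def l_minus)
      show "a \<oplus> b \<in> J" using ab x(1) by (simp add: J_def l_distr)
    qed
    fix a y assume a: "a \<in> J" "y \<in> carrier R"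
    then show "y \<otimes> a \<in> J" using F.I_l_closed[of "a \<otimes> x" y] x(1) by (simp add: J_def m_assoc)
    then show "a \<otimes> y \<in> J" using a by (simp add: J_def m_comm)
  qed
  define M where "M = range (\<lambda>n::nat. d [^] n)"
  have dn: "y \<in> PIdl f" if "y \<in> carrier R" "d [^] n \<otimes> y \<in> PIdl f" for n :: nat and y
    using that
  proof (induction n arbitrary: y)
    case 0
    then show ?case by simp
  next
    case (Suc n)
    have "d [^] n \<otimes> (d \<otimes> y) \<in> PIdl f" using Suc.prems d by (simp add: m_assoc)
    then have "d \<otimes> y \<in> PIdl f" by (rule Suc.IH[rotated]) (simp add: d Suc.prems(1))
    then show ?case by (rule nzd[OF Suc.prems(1)])
  qed
  have "\<exists>P. primeideal P R \<and> J \<subseteq> P \<and> P \<inter> M = {}"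
  proof (rule prime_avoiding[OF J])
    show "M \<subseteq> carrier R" using d by (auto simp: M_def)
    show "\<one> \<in> M" using rangeI[of "\<lambda>n::nat. d [^] n" 0] by (simp add: M_def)
    fix a b assume "a \<in> M" "b \<in> M"
    then show "a \<otimes> b \<in> M" using d by (auto simp: M_def nat_pow_mult)
  next
    show "J \<inter> M = {}"
    proof (rule ccontr)
      assume "J \<inter> M \<noteq> {}"
      then obtain n :: nat where "d [^] n \<in> J" by (auto simp: M_def)
      then have "d [^] n \<otimes> x \<in> PIdl f" by (simp add: J_def)
      then show False using dn[OF x(1)] nx by blast
    qed
  qed
  then obtain P where P: "primeideal P R" "J \<subseteq> P" "P \<inter> M = {}" by blast
  interpret P: primeideal P R by fact
  have fJ: "PIdl f \<subseteq> J"
  proof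
    fix a assume "a \<in> PIdl f"
    then show "a \<in> J" using F.I_r_closed[of a x] F.Icarr[of a] x(1) by (simp add: J_def)
  qed
  have "minimal_prime_over R (PIdl f) P"
    unfolding minimal_prime_over_def
  proof (intro conjI allI impI)
    show "PIdl f \<subseteq> P" using fJ P(2) by (rule order_trans)
    fix P' assume P': "primeideal P' R \<and> PIdl f \<subseteq> P' \<and> P' \<subseteq> P"
    interpret P': primeideal P' R using P' by (elim conjE)
    have "r \<in> P'" if r: "r \<in> P" for r
    proof -
      have rc: "r \<in> carrier R" using P.Icarr[OF r] .
      obtain n j :: nat and y where y: "y \<in> carrier R" "r [^] n \<otimes> (d [^] j \<ominus> r \<otimes> y) \<in> PIdl f" using reg[OF rc] by blast
      \<comment> \<open>As \<open>r\<close> lies in \<open>P\<close>, this factor in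
        \<open>P\<close> would put a power of \<open>d\<close> there. So in the smaller prime
        \<open>P'\<close> it must be the power of \<open>r\<close> that is a member.\<close>
      have "d [^] j \<ominus> r \<otimes> y \<notin> P"
      proof
        assume "d [^] j \<ominus> r \<otimes> y \<in> P"
        then have "(d [^] j \<ominus> r \<otimes> y) \<oplus> r \<otimes> y \<in> P" using r y by (intro P.a_closed P.I_r_closed) auto
        moreover have "(d [^] j \<ominus> r \<otimes> y) \<oplus> r \<otimes> y = d [^] j" using d rc y by (simp add: minus_eq a_assoc l_neg)
        ultimately have "d [^] j \<in> P \<inter> M" by (simp add: M_def)
        then show False using P(3) by blast
      qed
      then have "d [^] j \<ominus> r \<otimes> y \<notin> P'" using P' by blast
      moreover have "r [^] n \<otimes> (d [^] j \<ominus> r \<otimes> y) \<in> P'" using y(2) P' by blast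
      ultimately have "r [^] n \<in> P'" using P'.I_prime[of "r [^] n" "d [^] j \<ominus> r \<otimes> y"] rc d y(1) by simp
      then show "r \<in> P'"
      proof (induction n)
        case 0
        then show ?case using P'.I_notcarr P'.one_imp_carrier by simp
      next
        case (Suc n)
        have "r [^] n \<otimes> r \<in> P'" using Suc.prems by simp
        then have "r [^] n \<in> P' \<or> r \<in> P'" by (rule P'.I_prime[rotated 2]) (simp_all add: rc)
        then show ?case using Suc.IH by (elim disjE)
      qed
    qed
    then have "P \<subseteq> P'" by blast
    then show "P' = P" using P' by (simp add: subset_antisym)
  qed (fact P)
  moreover have "s \<in> J" using s(1) x by (simp add: J_def)
  ultimately show False using s(2) P(2) by blast
qed

end

section \<open>Linear dependence\<close>

text \<open>Fraction-free Gaussian elimination, so that one statement serves over the field, over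
  power series and over polynomials in one variable. It is the source of every linear dependence
  below.\<close>

lemma homogeneous_system_nontrivial:
  fixes A :: "nat \<Rightarrow> nat \<Rightarrow> 'a::idom"
  shows "\<exists>x. (\<exists>j\<le>M. x j \<noteq> 0) \<and> (\<forall>i<M. (\<Sum>j\<le>M. A i j * x j) = 0)"
proof (induction M arbitrary: A)
  case 0
  show ?case by (intro exI[of _ "\<lambda>_. 1"]) simp
next
  case (Suc M)
  show ?case
  proof (cases "\<forall>i<Suc M. A i (Suc M) = 0")
    case True
    then show ?thesis
      by (intro exI[of _ "\<lambda>j. if j = Suc M then 1 else 0"]) auto
  next
    case False
    then obtain p where p: "p < Suc M" and c: "A p (Suc M) \<noteq> 0" by blast
    \<comment> \<open>The last unknown is eliminated with row \<open>p\<close> as pivot;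
      \<open>r\<close> enumerates the remaining rows. Scaling the smaller solution by
      \<open>c\<close> lets the last unknown be found without division.\<close>
    define c where "c = A p (Suc M)"
    define r where "r i = (if i < p then i else Suc i)" for i
    define B where "B i j = c * A (r i) j - A (r i) (Suc M) * A p j" for i j
    obtain x where x: "\<exists>j\<le>M. x j \<noteq> 0" "\<And>i. i < M \<Longrightarrow> (\<Sum>j\<le>M. B i j * x j) = 0"
      using Suc[of B] by blast
    define y where "y j = (if j = Suc M then - (\<Sum>j\<le>M. A p j * x j) else c * x j)" for j
    have S: "(\<Sum>j\<le>Suc M. A i j * y j) = c * (\<Sum>j\<le>M. A i j * x j) - A i (Suc M) * (\<Sum>j\<le>M. A p j * x j)" for i
    proof -
      have "(\<Sum>j\<le>M. A i j * y j) = (\<Sum>j\<le>M. c * (A i j * x j))"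
        by (rule sum.cong) (auto simp: y_def)
      then show ?thesis by (simp add: y_def sum_distrib_left)
    qed
    have "(\<Sum>j\<le>Suc M. A i j * y j) = 0" if i: "i < Suc M" for i
    proof (cases "i = p")
      case True
      then show ?thesis unfolding S by (simp add: c_def)
    next
      case False
      then obtain i' where i': "i' < M" "i = r i'"
        using i p by (cases "i < p") (auto simp: r_def intro: that[of i] that[of "i - 1"])
      have "(\<Sum>j\<le>M. B i' j * x j) = c * (\<Sum>j\<le>M. A i j * x j) - A i (Suc M) * (\<Sum>j\<le>M. A p j * x j)"
        unfolding B_def i' by (simp add: left_diff_distrib sum_subtractf sum_distrib_left mult.assoc)
      then show ?thesis unfolding S using x(2)[OF i'(1)] by simp
    qed
    moreover have "\<exists>j\<le>Suc M. y j \<noteq> 0"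
    proof -
      obtain j where "j \<le> M" "x j \<noteq> 0" using x(1) by blast
      then show ?thesis using c by (intro exI[of _ j]) (auto simp: y_def c_def)
    qed
    ultimately show ?thesis by blast
  qed
qed

text \<open>The constants act through a homomorphism into a larger field, so that vector spaces over
  k can be plain sets of rational functions.\<close>

locale const_hom =
  fixes h :: "'k::field \<Rightarrow> 'a::field"
  assumes h_add: "h (a + b) = h a + h b" and h_mult: "h (a * b) = h a * h b" and h_one: "h 1 = 1"
begin

lemma h_zero: "h 0 = 0" using h_add[of 0 0] by (metis add_0 add_cancel_right_right)
lemma h_sum: "h (\<Sum>i\<in>A. g i) = (\<Sum>i\<in>A. h (g i))"
  by (induction A rule: infinite_finite_induct) (auto simp: h_zero h_add)
lemma h_inverse: "a \<noteq> 0 \<Longrightarrow> h (inverse a) * h a = 1" using h_mult[of "inverse a" a] h_one by simp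
lemma h_uminus: "h (- a) = - h a" using h_add[of a "- a"] h_zero by (simp add: eq_neg_iff_add_eq_0 add.commute)
definition ksub :: "'a set \<Rightarrow> bool" where
  "ksub V \<longleftrightarrow> 0 \<in> V \<and> (\<forall>x\<in>V. \<forall>y\<in>V. x + y \<in> V) \<and> (\<forall>c. \<forall>x\<in>V. h c * x \<in> V)"

lemma ksub_sum: "ksub V \<Longrightarrow> (\<And>i. i \<in> A \<Longrightarrow> g i \<in> V) \<Longrightarrow> (\<Sum>i\<in>A. g i) \<in> V"
  by (induction A rule: infinite_finite_induct) (auto simp: ksub_def)

lemma ksub_uminus: "ksub V \<Longrightarrow> x \<in> V \<Longrightarrow> - x \<in> V"
  using h_uminus[of 1] h_one unfolding ksub_def by (metis mult_minus1)

text \<open>\<open>V 0\<close> modulo \<open>I\<close> has dimension at most \<open>M\<close>. If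
  the chain dropped \<open>M + 1\<close> times, one vector from each drop would give
  \<open>M + 1\<close> vectors, dependent modulo \<open>I\<close>.\<close>

lemma finite_span_chain_stationary:
  assumes V: "\<And>i. ksub (V i)" "\<And>i. V (Suc i) \<subseteq> V i" and I: "ksub I" "\<And>i. I \<subseteq> V i"
    and B: "\<And>v. v \<in> V 0 \<Longrightarrow> \<exists>c. v - (\<Sum>b<M. h (c b) * B b) \<in> I"
  shows "\<exists>i\<le>M. V i = V (Suc i)"
proof (rule ccontr)
  assume "\<not> ?thesis"
  then have "\<forall>i. \<exists>v. i \<le> M \<longrightarrow> v \<in> V i - V (Suc i)" using V(2) by blast
  then obtain v where v: "\<And>i. i \<le> M \<Longrightarrow> v i \<in> V i - V (Suc i)" by metis
  have mono: "i \<le> j \<Longrightarrow> V j \<subseteq> V i" for i j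
    by (rule lift_Suc_antimono_le[of V]) (use V(2) in auto)
  have "\<forall>i. \<exists>c. i \<le> M \<longrightarrow> v i - (\<Sum>b<M. h (c b) * B b) \<in> I"
    using B mono[of 0] v by blast
  then obtain c where c: "\<And>i. i \<le> M \<Longrightarrow> v i - (\<Sum>b<M. h (c i b) * B b) \<in> I" by metis
  obtain x where x: "\<exists>j\<le>M. x j \<noteq> 0" "\<And>b. b < M \<Longrightarrow> (\<Sum>j\<le>M. c j b * x j) = 0"
    using homogeneous_system_nontrivial[of M "\<lambda>b j. c j b"] by blast
  have "(\<Sum>j\<le>M. h (x j) * (\<Sum>b<M. h (c j b) * B b)) = (\<Sum>b<M. \<Sum>j\<le>M. h (x j) * (h (c j b) * B b))"
    by (simp add: sum_distrib_left) (rule sum.swap)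
  also have "\<dots> = (\<Sum>b<M. h (\<Sum>j\<le>M. c j b * x j) * B b)"
    by (simp add: h_sum h_mult sum_distrib_right sum_distrib_left mult_ac)
  also have "\<dots> = 0" using x(2) by (simp add: h_zero)
  finally have z: "(\<Sum>j\<le>M. h (x j) * (\<Sum>b<M. h (c j b) * B b)) = 0" .
  have "(\<Sum>j\<le>M. h (x j) * (v j - (\<Sum>b<M. h (c j b) * B b))) \<in> I"
    by (rule ksub_sum[OF I(1)]) (use c I(1) in \<open>auto simp: ksub_def\<close>)
  then have sI: "(\<Sum>j\<le>M. h (x j) * v j) \<in> I"
    using z by (simp add: right_diff_distrib sum_subtractf)
  \<comment> \<open>The first index with nonzero coefficient: all later vectors and \<open>I\<close>
    lie in \<open>V (Suc i)\<close>, hence so does \<open>v i\<close>, against its choice.\<close>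
  define i where "i = (LEAST j. x j \<noteq> 0)"
  obtain j0 where j0: "j0 \<le> M" "x j0 \<noteq> 0" using x(1) by blast
  have i: "x i \<noteq> 0" "i \<le> M" unfolding i_def
    using LeastI[of "\<lambda>j. x j \<noteq> 0", OF j0(2)] Least_le[of "\<lambda>j. x j \<noteq> 0", OF j0(2)] j0(1) by auto
  have lt: "x j = 0" if "j < i" for j using that not_less_Least unfolding i_def by blast
  have "(\<Sum>j\<le>M. h (x j) * v j) = h (x i) * v i + (\<Sum>j\<in>{..M} - {i}. h (x j) * v j)"
    using i by (simp add: sum.remove)
  moreover have "(\<Sum>j\<in>{..M} - {i}. h (x j) * v j) \<in> V (Suc i)"
  proof (rule ksub_sum[OF V(1)])
    fix j assume j: "j \<in> {..M} - {i}"
    show "h (x j) * v j \<in> V (Suc i)"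
    proof (cases "j < i")
      case True
      then show ?thesis using lt V(1)[of "Suc i"] by (simp add: h_zero ksub_def)
    next
      case False
      then have "v j \<in> V (Suc i)" using v[of j] j mono[of "Suc i" j] by auto
      then show ?thesis using V(1)[of "Suc i"] by (auto simp: ksub_def)
    qed
  qed
  ultimately have "(\<Sum>j\<le>M. h (x j) * v j) + - (\<Sum>j\<in>{..M} - {i}. h (x j) * v j) = h (x i) * v i"
    and "- (\<Sum>j\<in>{..M} - {i}. h (x j) * v j) \<in> V (Suc i)" using ksub_uminus[OF V(1)] by auto
  then have "h (x i) * v i \<in> V (Suc i)"
    using sI I(2)[of "Suc i"] V(1)[of "Suc i"] unfolding ksub_def by (metis subsetD)
  then have "h (inverse (x i)) * (h (x i) * v i) \<in> V (Suc i)" using V(1)[of "Suc i"] by (auto simp: ksub_def)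
  then have "v i \<in> V (Suc i)" using h_inverse[OF i(1)] by (simp flip: mult.assoc)
  then show False using v i by blast
qed

end

section \<open>Local subrings of a field\<close>

lemma type_algebra_simps [simp]:
  "carrier ring_of_type_algebra = UNIV" "x \<otimes>\<^bsub>ring_of_type_algebra\<^esub> y = x * y"
  "\<one>\<^bsub>ring_of_type_algebra\<^esub> = 1" "\<zero>\<^bsub>ring_of_type_algebra\<^esub> = 0"
  "x \<oplus>\<^bsub>ring_of_type_algebra\<^esub> y = x + y"
  by (simp_all add: ring_of_type_algebra_def)

text \<open>A local ring realised inside a field, so that computations use the arithmetic of the
  field type; \<open>Rg\<close> mediates to the carrier-based notions of ideal and
  completion.\<close>

locale local_subring = const_hom h for h :: "'k::field \<Rightarrow> 'a::field" +
  fixes \<O> m :: "'a set"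
  assumes O_one: "1 \<in> \<O>" and O_add: "x \<in> \<O> \<Longrightarrow> y \<in> \<O> \<Longrightarrow> x + y \<in> \<O>"
    and O_mult: "x \<in> \<O> \<Longrightarrow> y \<in> \<O> \<Longrightarrow> x * y \<in> \<O>" and O_h: "h c \<in> \<O>"
    and m_sub: "m \<subseteq> \<O>" and m_zero: "0 \<in> m" and m_add: "x \<in> m \<Longrightarrow> y \<in> m \<Longrightarrow> x + y \<in> m"
    and m_mult: "x \<in> m \<Longrightarrow> y \<in> \<O> \<Longrightarrow> x * y \<in> m"
    and m_one: "1 \<notin> m" and O_unit: "x \<in> \<O> \<Longrightarrow> x \<notin> m \<Longrightarrow> inverse x \<in> \<O>"
begin

abbreviation "Rg \<equiv> ring_of_type_algebra\<lparr>carrier := \<O>\<rparr>"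

lemma O_zero: "0 \<in> \<O>" using O_h[of 0] h_zero by simp
lemma O_uminus: "x \<in> \<O> \<Longrightarrow> - x \<in> \<O>" using O_mult[OF O_h[of "-1"], of x] h_uminus[of 1] h_one by simp
lemma O_diff: "x \<in> \<O> \<Longrightarrow> y \<in> \<O> \<Longrightarrow> x - y \<in> \<O>" using O_add[OF _ O_uminus] by force
lemma O_power: "x \<in> \<O> \<Longrightarrow> x ^ n \<in> \<O>" by (induction n) (auto simp: O_one O_mult)
lemma O_sum: "(\<And>i. i \<in> A \<Longrightarrow> g i \<in> \<O>) \<Longrightarrow> (\<Sum>i\<in>A. g i) \<in> \<O>"
  by (induction A rule: infinite_finite_induct) (auto simp: O_zero O_add)
lemma O_prod: "(\<And>i. i \<in> A \<Longrightarrow> g i \<in> \<O>) \<Longrightarrow> (\<Prod>i\<in>A. g i) \<in> \<O>"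
  by (induction A rule: infinite_finite_induct) (auto simp: O_one O_mult)

lemma Rg_cring: "cring Rg"
proof (rule cringI)
  show "abelian_group Rg"
  proof (rule abelian_groupI)
    fix x assume "x \<in> carrier Rg"
    then show "\<exists>y\<in>carrier Rg. y \<oplus>\<^bsub>Rg\<^esub> x = \<zero>\<^bsub>Rg\<^esub>"
      using O_uminus by (intro bexI[of _ "- x"]) auto
  qed (auto simp: O_add O_zero)
  show "comm_monoid Rg" by (rule comm_monoidI) (auto simp: O_mult O_one)
qed (auto simp: distrib_right)

lemma Rg_uminus: "x \<in> \<O> \<Longrightarrow> \<ominus>\<^bsub>Rg\<^esub> x = - x"
  using abelian_group.minus_equality[OF ring.is_abelian_group[OF cring.axioms(1)[OF Rg_cring]], of "- x" x]
  by (simp add: O_uminus)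
lemma Rg_minus [simp]: "x \<in> \<O> \<Longrightarrow> y \<in> \<O> \<Longrightarrow> x \<ominus>\<^bsub>Rg\<^esub> y = x - y"
  by (simp add: a_minus_def Rg_uminus)
lemma Rg_pow [simp]: "x [^]\<^bsub>Rg\<^esub> (n::nat) = x ^ n"
  by (induction n) (auto simp: monoid.nat_pow_Suc[OF cring.axioms(2)[OF Rg_cring, THEN comm_monoid.axioms(1)]] nat_pow_def mult_ac)

lemma m_ideal: "ideal m Rg"
proof (rule idealI)
  show "ring Rg" using Rg_cring by (rule cring.axioms)
  interpret R: cring Rg by (rule Rg_cring)
  show "subgroup m (add_monoid Rg)"
  proof (rule R.add.subgroupI)
    show "m \<subseteq> carrier Rg" "m \<noteq> {}" using m_sub m_zero by auto
    fix x y assume x: "x \<in> m" "y \<in> m"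
    then show "x \<oplus>\<^bsub>Rg\<^esub> y \<in> m" using m_add by simp
    have "x * - 1 \<in> m" using x O_uminus[OF O_one] by (rule_tac m_mult)
    then show "\<ominus>\<^bsub>Rg\<^esub> x \<in> m" using x m_sub by (subst Rg_uminus) auto
  qed
  fix a x assume "a \<in> m" "x \<in> carrier Rg"
  then show "x \<otimes>\<^bsub>Rg\<^esub> a \<in> m" "a \<otimes>\<^bsub>Rg\<^esub> x \<in> m" using m_mult by (auto simp: mult.commute)
qed

sublocale adic Rg m
  by (intro adic.intro Rg_cring m_ideal)

lemma Pw_O: "x \<in> Pw n \<Longrightarrow> x \<in> \<O>" using Pw_carr[of x n] by simp
lemma Pw_diff': "x \<in> Pw n \<Longrightarrow> y \<in> Pw n \<Longrightarrow> x - y \<in> Pw n"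
  using Pw_minus[of x n y] Pw_O by simp
lemma Pw_add': "x \<in> Pw n \<Longrightarrow> y \<in> Pw n \<Longrightarrow> x + y \<in> Pw n"
  using Pw_add[of x n y] by simp
lemma Pw_mult': "x \<in> Pw n \<Longrightarrow> y \<in> \<O> \<Longrightarrow> x * y \<in> Pw n"
  using Pw_mult[of x n y] by simp
lemma Pw_0: "0 \<in> Pw n" using Pw_zero[of n] by simp
lemma Pw_Suc_mult: "x \<in> Pw n \<Longrightarrow> y \<in> m \<Longrightarrow> x * y \<in> Pw (Suc n)"
  using ideal_prod.prod[of x "Pw n" y m Rg] by simp
lemma power_Pw: "x \<in> m \<Longrightarrow> x ^ n \<in> Pw n"
proof (induction n)
  case (Suc n)
  then show ?case using Pw_Suc_mult[of "x ^ n" n x] by (simp only: power_Suc2)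
qed (simp add: O_one)

lemma coh_iff: "coh x \<longleftrightarrow> (\<forall>n. x n \<in> \<O> \<and> x (Suc n) - x n \<in> Pw n)"
proof (cases "\<forall>n. x n \<in> \<O>")
  case True
  then have "x (Suc n) \<ominus>\<^bsub>Rg\<^esub> x n = x (Suc n) - x n" for n by simp
  with True show ?thesis by (simp add: coh_def)
next
  case False
  then show ?thesis by (auto simp: coh_def)
qed
lemma coh_O: "coh x \<Longrightarrow> x n \<in> \<O>" by (simp add: coh_iff)
lemma coh_le': "coh x \<Longrightarrow> n \<le> k \<Longrightarrow> x k - x n \<in> Pw n"
  using coh_le[of x n k] by (simp add: coh_O)

text \<open>Congruence modulo a power of the maximal ideal. Membership in the ring is included so
  that chains of congruences compose without side conditions.\<close>

definition cg :: "nat \<Rightarrow> 'a \<Rightarrow> 'a \<Rightarrow> bool" where "cg n x y \<longleftrightarrow> x \<in> \<O> \<and> y \<in> \<O> \<and> x - y \<in> Pw n"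

lemma cg_refl: "x \<in> \<O> \<Longrightarrow> cg n x x" by (simp add: cg_def Pw_0)
lemma cg_sym: "cg n x y \<Longrightarrow> cg n y x" using Pw_diff'[OF Pw_0, of "x - y" n] by (simp add: cg_def)
lemma cg_trans [trans]: "cg n x y \<Longrightarrow> cg n y z \<Longrightarrow> cg n x z" using Pw_add'[of "x - y" n "y - z"] by (simp add: cg_def)
lemma cg_add: "cg n x y \<Longrightarrow> cg n x' y' \<Longrightarrow> cg n (x + x') (y + y')"
  using Pw_add'[of "x - y" n "x' - y'"] by (simp add: cg_def O_add algebra_simps)
lemma cg_diff: "cg n x y \<Longrightarrow> cg n x' y' \<Longrightarrow> cg n (x - x') (y - y')"
  using Pw_diff'[of "x - y" n "x' - y'"] by (simp add: cg_def O_diff algebra_simps)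
lemma cg_mult: "cg n x y \<Longrightarrow> cg n x' y' \<Longrightarrow> cg n (x * x') (y * y')"
proof -
  assume a: "cg n x y" "cg n x' y'"
  then have "(x - y) * x' \<in> Pw n" "(x' - y') * y \<in> Pw n" by (simp_all add: cg_def Pw_mult')
  then have "(x - y) * x' + (x' - y') * y \<in> Pw n" by (rule Pw_add')
  moreover have "(x - y) * x' + (x' - y') * y = x * x' - y * y'" by (simp add: algebra_simps)
  ultimately show ?thesis using a by (simp add: cg_def O_mult)
qed
lemma cg_power: "cg n x y \<Longrightarrow> cg n (x ^ k) (y ^ k)"
  by (induction k) (auto intro: cg_refl cg_mult simp: O_one)
lemma cg_sum: "(\<And>i. i \<in> A \<Longrightarrow> cg n (g i) (g' i)) \<Longrightarrow> cg n (\<Sum>i\<in>A. g i) (\<Sum>i\<in>A. g' i)"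
  by (induction A rule: infinite_finite_induct) (auto intro: cg_refl cg_add simp: O_zero)
lemma coh_cg: "coh x \<longleftrightarrow> (\<forall>n. cg n (x (Suc n)) (x n))"
  unfolding coh_iff cg_def by (metis)
lemma coh_add': "coh x \<Longrightarrow> coh y \<Longrightarrow> coh (\<lambda>n. x n + y n)" using cg_add by (simp add: coh_cg)
lemma coh_diff': "coh x \<Longrightarrow> coh y \<Longrightarrow> coh (\<lambda>n. x n - y n)" using cg_diff by (simp add: coh_cg)
lemma coh_mult': "coh x \<Longrightarrow> coh y \<Longrightarrow> coh (\<lambda>n. x n * y n)" using cg_mult by (simp add: coh_cg)
lemma coh_const': "a \<in> \<O> \<Longrightarrow> coh (\<lambda>n. a)" using cg_refl by (simp add: coh_cg)
lemma coh_power': "coh x \<Longrightarrow> coh (\<lambda>n. x n ^ k)" using cg_power by (simp add: coh_cg)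
lemma coh_sum': "(\<And>i. i \<in> A \<Longrightarrow> coh (x i)) \<Longrightarrow> coh (\<lambda>n. \<Sum>i\<in>A. x i n)" using cg_sum[of A] by (simp add: coh_cg)

lemma one_minus_unit:
  assumes "x \<in> m" shows "1 - x \<in> \<O>" "inverse (1 - x) \<in> \<O>" "1 - x \<noteq> 0"
proof -
  have x: "x \<in> \<O>" using assms m_sub by blast
  show o: "1 - x \<in> \<O>" using x O_one O_diff by blast
  have nm: "1 - x \<notin> m" using m_add[OF _ assms, of "1 - x"] m_one by auto
  show "inverse (1 - x) \<in> \<O>" by (rule O_unit[OF o nm])
  show "1 - x \<noteq> 0" using nm m_zero by auto
qed

end

section \<open>A prime element and a transversal parameter\<close>

text \<open>As \<open>f\<close> is prime and does not divide \<open>d\<close>, the two behave like a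
  regular sequence; \<open>B\<close> spans the ring modulo \<open>d\<close> and \<open>f\<close>
  over the constants. The bound \<open>M\<close> on that dimension is behind every index shift
  below.\<close>

locale transversal = local_subring h \<O> m for h :: "'k::field \<Rightarrow> 'a::field" and \<O> m +
  fixes f d :: 'a and M :: nat and B :: "nat \<Rightarrow> 'a"
  assumes f_m: "f \<in> m" and d_m: "d \<in> m" and f_nz: "f \<noteq> 0"
    and f_prime: "x \<in> \<O> \<Longrightarrow> y \<in> \<O> \<Longrightarrow> z \<in> \<O> \<Longrightarrow> x * y = f * z \<Longrightarrow> (\<exists>w\<in>\<O>. x = f * w) \<or> (\<exists>w\<in>\<O>. y = f * w)"
    and d_f: "w \<in> \<O> \<Longrightarrow> d \<noteq> f * w"
    and B_O: "B b \<in> \<O>"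
    and span: "x \<in> \<O> \<Longrightarrow> \<exists>c. \<exists>u\<in>\<O>. \<exists>v\<in>\<O>. x = (\<Sum>b<M. h (c b) * B b) + d * u + f * v"
begin

definition If where "If = {d * a + f * b | a b. a \<in> \<O> \<and> b \<in> \<O>}"

lemma f_O: "f \<in> \<O>" and d_O: "d \<in> \<O>" using f_m d_m m_sub by auto

lemma If_I: "a \<in> \<O> \<Longrightarrow> b \<in> \<O> \<Longrightarrow> d * a + f * b \<in> If" by (auto simp: If_def)
lemma If_add: "x \<in> If \<Longrightarrow> y \<in> If \<Longrightarrow> x + y \<in> If"
proof -
  assume "x \<in> If" "y \<in> If"
  then obtain a b a' b' where "x = d * a + f * b" "y = d * a' + f * b'" "a \<in> \<O>" "b \<in> \<O>" "a' \<in> \<O>" "b' \<in> \<O>"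
    unfolding If_def by blast
  then show "x + y \<in> If" using If_I[of "a + a'" "b + b'"] by (simp add: O_add algebra_simps)
qed
lemma If_mult: "x \<in> If \<Longrightarrow> y \<in> \<O> \<Longrightarrow> x * y \<in> If"
proof -
  assume "x \<in> If" and y: "y \<in> \<O>"
  then obtain a b where "x = d * a + f * b" "a \<in> \<O>" "b \<in> \<O>"
    unfolding If_def by blast
  then show "x * y \<in> If" using If_I[of "a * y" "b * y"] y by (simp add: O_mult algebra_simps)
qed
lemma If_zero: "0 \<in> If" using If_I[OF O_zero O_zero] by simp
lemma If_O: "x \<in> If \<Longrightarrow> x \<in> \<O>" by (auto simp: If_def O_add O_mult d_O f_O)

text \<open>The ideals generated by \<open>If\<close> and the product of the first \<open>i\<close>
  factors stop descending at some \<open>i \<le> M\<close>. There the product \<open>p\<close>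
  satisfies \<open>p * (1 - g i * x) \<in> If\<close>, and \<open>1 - g i * x\<close> is a unit, as
  in Nakayama's lemma.\<close>

lemma prod_in_If:
  assumes g: "\<And>j. g j \<in> m"
  shows "(\<Prod>j<M. g j) \<in> If"
proof -
  define V where "V i = {(\<Prod>j<i. g j) * x + y | x y. x \<in> \<O> \<and> y \<in> If}" for i
  have gO: "g j \<in> \<O>" for j using g m_sub by blast
  have VI: "(\<Prod>j<i. g j) * x + y \<in> V i" if "x \<in> \<O>" "y \<in> If" for i x y using that by (auto simp: V_def)
  have "\<exists>i\<le>M. V i = V (Suc i)"
  proof (rule finite_span_chain_stationary[where I = If])
    fix i
    show "ksub (V i)" unfolding ksub_def
    proof (intro conjI ballI allI)
      show "0 \<in> V i" using VI[OF O_zero If_zero] by simp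
      fix v c assume "v \<in> V i"
      then obtain x y where v: "v = (\<Prod>j<i. g j) * x + y" "x \<in> \<O>" "y \<in> If" by (auto simp: V_def)
      show "h c * v \<in> V i" using VI[of "h c * x" "y * h c" i] v O_h O_mult If_mult by (simp add: algebra_simps)
      fix w assume "w \<in> V i"
      then obtain x' y' where w: "w = (\<Prod>j<i. g j) * x' + y'" "x' \<in> \<O>" "y' \<in> If" by (auto simp: V_def)
      show "v + w \<in> V i" using VI[of "x + x'" "y + y'" i] v w O_add If_add by (simp add: algebra_simps)
    qed
    show "V (Suc i) \<subseteq> V i"
    proof
      fix v assume "v \<in> V (Suc i)"
      then obtain x y where v: "v = (\<Prod>j<Suc i. g j) * x + y" "x \<in> \<O>" "y \<in> If" by (auto simp: V_def)
      then show "v \<in> V i" using VI[of "g i * x" y i] O_mult gO by (simp add: algebra_simps)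
    qed
    show "If \<subseteq> V i" using VI[OF O_zero, of _ i] by auto
  next
    show "ksub If" unfolding ksub_def
      using If_zero If_add If_mult O_h by (metis mult.commute)
    fix v assume "v \<in> V 0"
    then have "v \<in> \<O>" by (auto simp: V_def If_O O_add)
    then obtain c u w where "u \<in> \<O>" "w \<in> \<O>" "v = (\<Sum>b<M. h (c b) * B b) + d * u + f * w" using span by blast
    then show "\<exists>c. v - (\<Sum>b<M. h (c b) * B b) \<in> If" using If_I by (intro exI[of _ c]) (simp add: add.assoc)
  qed
  then obtain i where i: "i \<le> M" "V i = V (Suc i)" by blast
  have "(\<Prod>j<i. g j) \<in> V (Suc i)" using VI[OF O_one If_zero, of i] i by simp
  then obtain x y where x: "(\<Prod>j<i. g j) = (\<Prod>j<Suc i. g j) * x + y" "x \<in> \<O>" "y \<in> If" by (auto simp: V_def)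
  define u where "u = 1 - g i * x"
  have gx: "g i * x \<in> m" using g x m_mult by blast
  have u: "inverse u \<in> \<O>" "u \<noteq> 0" unfolding u_def using one_minus_unit[OF gx] by auto
  define p where "p = (\<Prod>j<i. g j)"
  have "p = p * (g i * x) + y" unfolding p_def using x(1) unfolding prod.lessThan_Suc mult.assoc .
  then have "p * u = y" unfolding u_def right_diff_distrib by (metis add_diff_cancel_left' mult.right_neutral)
  then have "p = y * inverse u" using u(2) by (metis mult.assoc mult.right_neutral right_inverse)
  then have "(\<Prod>j<i. g j) = y * inverse u" by (simp only: p_def)
  then have "(\<Prod>j<i. g j) \<in> If" using If_mult[OF x(3) u(1)] by simp
  moreover have "{..<M} = {..<i} \<union> {i..<M}" using i by auto
  then have "(\<Prod>j<M. g j) = (\<Prod>j<i. g j) * (\<Prod>j\<in>{i..<M}. g j)"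
    by (simp add: prod.union_disjoint ivl_disj_int)
  moreover have "(\<Prod>j\<in>{i..<M}. g j) \<in> \<O>" by (rule O_prod) (rule gO)
  ultimately show ?thesis using If_mult by (simp only:)
qed

text \<open>Powers of the ideal are built one factor at a time. The induction \<open>key\<close>
  therefore carries along the factors already split off, until all \<open>M\<close> of them are
  gathered for \<open>prod_in_If\<close>.\<close>

lemma Pw_M: "Pw M \<subseteq> If"
proof -
  have key: "x * (\<Prod>j<k. g j) \<in> If" if "x \<in> Pw n" "\<And>j. g j \<in> m" "n + k = M" for x and n k :: nat and g :: "nat \<Rightarrow> 'a"
    using that
  proof (induction n arbitrary: x k g)
    case 0
    then show ?case using If_mult[OF prod_in_If[of g], of x] by (simp add: mult.commute)
  next
    case (Suc n)
    have "x \<in> ideal_prod Rg (Pw n) m" using Suc.prems by simp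
    then show ?case
    proof induction
      case (prod i j)
      have "i * (\<Prod>l<Suc k. (case l of 0 \<Rightarrow> j | Suc l \<Rightarrow> g l)) \<in> If"
        by (rule Suc.IH) (use prod Suc.prems in \<open>auto split: nat.split\<close>)
      moreover have "(\<Prod>l<Suc k. (case l of 0 \<Rightarrow> j | Suc l \<Rightarrow> g l)) = j * (\<Prod>l<k. g l)"
        by (subst prod.lessThan_Suc_shift) simp
      ultimately show ?case by (simp add: mult.assoc)
    next
      case (sum s1 s2)
      then show ?case using If_add by (simp add: distrib_right)
    qed
  qed
  have "x \<in> If" if x: "x \<in> Pw M" for x
    using key[OF x, of "\<lambda>_. 0" 0] m_zero by simp
  then show ?thesis by blast
qed

text \<open>Multiplying the inclusion \<open>Pw_M\<close> by \<open>j\<close> further factors keeps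
  these factors in the coefficients. This quantitative form makes limits of such decompositions
  converge.\<close>

lemma Pw_split:
  assumes "x \<in> Pw (M + j)"
  shows "\<exists>a\<in>Pw j. \<exists>b\<in>Pw j. x = d * a + f * b"
  using assms
proof (induction j arbitrary: x)
  case 0
  then have "x \<in> If" using Pw_M by auto
  then show ?case by (auto simp: If_def)
next
  case (Suc j)
  have "x \<in> ideal_prod Rg (Pw (M + j)) m" using Suc.prems by simp
  then show ?case
  proof induction
    case (prod y z)
    obtain a b where "a \<in> Pw j" "b \<in> Pw j" "y = d * a + f * b" using Suc.IH[OF prod(1)] by blast
    then show ?case using Pw_Suc_mult[OF _ prod(2)]
      by (intro bexI[of _ "a * z"] bexI[of _ "b * z"]) (auto simp: algebra_simps simp del: ideal_pow.simps)
  next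
    case (sum s1 s2)
    then obtain a b a' b' where ab: "a \<in> Pw (Suc j)" "b \<in> Pw (Suc j)" "s1 = d * a + f * b"
      "a' \<in> Pw (Suc j)" "b' \<in> Pw (Suc j)" "s2 = d * a' + f * b'" by blast
    then have "a + a' \<in> Pw (Suc j)" "b + b' \<in> Pw (Suc j)" using Pw_add' by (auto simp del: ideal_pow.simps)
    then show ?case using ab
      by (intro bexI[of _ "a + a'"] bexI[of _ "b + b'"]) (auto simp: algebra_simps simp del: ideal_pow.simps)
  qed
qed

text \<open>Exactness of the Koszul complex of \<open>d\<close> and \<open>f\<close> in the middle:
  the prime \<open>f\<close> divides \<open>d * a\<close> but not \<open>d\<close>.\<close>

lemma cross_cancel:
  assumes "a \<in> \<O>" "b \<in> \<O>" "d * a = f * b"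
  shows "\<exists>c\<in>\<O>. a = f * c \<and> b = d * c"
proof -
  obtain c where c: "c \<in> \<O>" "a = f * c" using f_prime[OF d_O assms(1,2,3)] d_f by blast
  have "f * b = d * (f * c)" using assms(3)[unfolded c(2)] by (rule sym)
  also have "\<dots> = f * (d * c)" by (rule mult.left_commute)
  finally have "f * b = f * (d * c)" .
  then have "b = d * c" by (rule mult_left_cancel[OF f_nz, THEN iffD1])
  then show ?thesis using c by blast
qed

text \<open>An explicit Artin-Rees bound. A round costs \<open>M\<close> powers for
  \<open>Pw_split\<close>, and one more that places the \<open>f\<close>-part \<open>b\<close> in
  the required power; in exchange the cofactor gains the factor \<open>d \<in> m\<close>.\<close>

lemma f_mult_Pw:
  assumes "x \<in> \<O>" "f * x \<in> Pw (k * Suc M)"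
  shows "x \<in> Pw k"
  using assms
proof (induction k arbitrary: x)
  case (Suc k)
  have "Suc k * Suc M = M + Suc (k * Suc M)" by simp
  then have "f * x \<in> Pw (M + Suc (k * Suc M))" using Suc.prems(2) by metis
  then obtain a b where ab: "a \<in> Pw (Suc (k * Suc M))" "b \<in> Pw (Suc (k * Suc M))" "f * x = d * a + f * b"
    using Pw_split by blast
  have abO: "a \<in> \<O>" "b \<in> \<O>" using ab Pw_O by blast+
  have "d * a = f * (x - b)" using ab(3) by (simp add: algebra_simps)
  then obtain c where c: "c \<in> \<O>" "a = f * c" "x - b = d * c"
    using cross_cancel[of a "x - b"] abO Suc.prems O_diff by blast
  have "f * c \<in> Pw (k * Suc M)" using ab(1) c(2) Pw_Suc by blast
  then have "c * d \<in> Pw (Suc k)" using Suc.IH[OF c(1)] Pw_Suc_mult d_m by blast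
  moreover have "b \<in> Pw (Suc k)" using ab(2) Pw_mono[of "Suc k" "Suc (k * Suc M)"] by auto
  ultimately have "b + c * d \<in> Pw (Suc k)" using Pw_add' by blast
  moreover have "x = b + c * d" using c(3) by (simp add: algebra_simps)
  ultimately show ?case by simp
qed simp

text \<open>\<open>f\<close> stays a nonzerodivisor in the completion: \<open>f_mult_Pw\<close>
  controls the entry at index \<open>n * Suc M\<close>, and coherence carries the result back to
  \<open>n\<close>.\<close>

lemma coh_f_cancel:
  assumes x: "coh x" and fx: "\<And>n. f * x n \<in> Pw n"
  shows "x n \<in> Pw n"
proof -
  have "x (n * Suc M) \<in> Pw n" using f_mult_Pw[OF coh_O[OF x] fx] .
  moreover have "x (n * Suc M) - x n \<in> Pw n" by (rule coh_le'[OF x]) simp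
  ultimately show ?thesis using Pw_diff'[of "x (n * Suc M)" n "x (n * Suc M) - x n"] by simp
qed

text \<open>\<open>d\<close> stays a nonzerodivisor modulo \<open>f\<close> in the completion. Each
  entry is corrected by \<open>Pw_split\<close> and then divided by \<open>f\<close> through
  \<open>cross_cancel\<close>.\<close>

lemma coh_d_cancel:
  assumes x: "coh x" and y: "coh y" and dx: "\<And>n. d * x n - f * y n \<in> Pw n"
  shows "\<exists>c. coh c \<and> (\<forall>n. x n - f * c n \<in> Pw n)"
proof -
  have "\<exists>c\<in>\<O>. x (M + j) - f * c \<in> Pw j" for j
  proof -
    obtain a b where ab: "a \<in> Pw j" "b \<in> Pw j" "d * x (M + j) - f * y (M + j) = d * a + f * b"
      using Pw_split[OF dx] by blast
    have "d * (x (M + j) - a) = f * (y (M + j) + b)" using ab(3) by (simp add: algebra_simps)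
    then obtain c where "c \<in> \<O>" "x (M + j) - a = f * c"
      using cross_cancel[of "x (M + j) - a" "y (M + j) + b"] Pw_O ab coh_O[OF x] coh_O[OF y] O_diff O_add by blast
    then show ?thesis using ab by (intro bexI[of _ c]) (auto simp: algebra_simps)
  qed
  then obtain c where c: "\<And>j. c j \<in> \<O>" "\<And>j. x (M + j) - f * c j \<in> Pw j" by metis
  have cx: "cg j (f * c j) (x j)" for j
  proof -
    have "cg j (x (M + j)) (f * c j)" using c coh_O[OF x] f_O O_mult by (auto simp: cg_def)
    moreover have "cg j (x (M + j)) (x j)" using coh_le'[OF x, of j "M + j"] coh_O[OF x] by (auto simp: cg_def)
    ultimately show ?thesis using cg_sym cg_trans by blast
  qed
  \<comment> \<open>The quotients \<open>c j\<close> are chosen independently, and only their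
    multiples by \<open>f\<close> are known to be close to each other. Along the indices
    \<open>k * Suc M\<close> the bound \<open>f_mult_Pw\<close> cancels \<open>f\<close>, which
    gives coherence.\<close>
  define e where "e k = c (k * Suc M)" for k
  have "coh e" unfolding coh_iff
  proof (intro allI conjI)
    fix k
    show "e k \<in> \<O>" by (simp add: e_def c)
    let ?a = "k * Suc M" and ?b = "Suc k * Suc M"
    have ab: "?a \<le> ?b" by simp
    have "cg ?a (f * c ?b) (x ?b)" using cx[of ?b] Pw_mono[OF ab] by (auto simp: cg_def)
    also have "cg ?a (x ?b) (x ?a)" using coh_le'[OF x ab] coh_O[OF x] by (auto simp: cg_def)
    also have "cg ?a (x ?a) (f * c ?a)" using cx cg_sym by blast
    finally have "f * (e (Suc k) - e k) \<in> Pw ?a" by (simp add: cg_def e_def algebra_simps)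
    then show "e (Suc k) - e k \<in> Pw k" using f_mult_Pw[OF O_diff] c by (simp add: e_def)
  qed
  moreover have "x n - f * e n \<in> Pw n" for n
  proof -
    let ?a = "n * Suc M"
    have an: "n \<le> ?a" by simp
    have "cg n (f * c ?a) (x ?a)" using cx[of ?a] Pw_mono[OF an] by (auto simp: cg_def)
    also have "cg n (x ?a) (x n)" using coh_le'[OF x an] coh_O[OF x] by (auto simp: cg_def)
    finally show ?thesis using cg_sym by (auto simp: cg_def e_def)
  qed
  ultimately show ?thesis by blast
qed

text \<open>From index \<open>M\<close> on, differences of neighbouring entries split into a
  \<open>d\<close>-part and an \<open>f\<close>-part tending to zero. The partial sums of the parts
  are the two coherent sequences.\<close>

lemma coh_zero_at_M:
  assumes x: "coh x" and z: "x M \<in> Pw M"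
  shows "\<exists>a b. coh a \<and> coh b \<and> (\<forall>n. cg n (x n) (d * a n + f * b n))"
proof -
  obtain p' q' where p': "p' \<in> \<O>" "q' \<in> \<O>" "x M = d * p' + f * q'"
    using Pw_M z by (auto simp: If_def)
  have "\<exists>p\<in>Pw j. \<exists>q\<in>Pw j. x (M + Suc j) - x (M + j) = d * p + f * q" for j
    using Pw_split[of "x (M + Suc j) - x (M + j)" j] coh_le'[OF x, of "M + j" "M + Suc j"] by simp
  then obtain p q where pq: "\<And>j. p j \<in> Pw j" "\<And>j. q j \<in> Pw j"
    "\<And>j. x (M + Suc j) - x (M + j) = d * p j + f * q j" by metis
  define a where "a n = p' + (\<Sum>j<n. p j)" for n
  define b where "b n = q' + (\<Sum>j<n. q j)" for n
  have aO: "a n \<in> \<O>" "b n \<in> \<O>" for n unfolding a_def b_def using p' Pw_O[OF pq(1)] Pw_O[OF pq(2)] by (auto intro!: O_add O_sum)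
  have "coh a" "coh b" unfolding coh_iff using aO pq by (auto simp: a_def b_def)
  moreover have e: "x (M + n) = d * a n + f * b n" for n
  proof (induction n)
    case 0
    then show ?case using p' by (simp add: a_def b_def)
  next
    case (Suc n)
    then show ?case using pq(3)[of n] by (simp add: a_def b_def algebra_simps)
  qed
  have "cg n (x n) (d * a n + f * b n)" for n
    unfolding e[symmetric] using cg_sym coh_le'[OF x, of n "M + n"] coh_O[OF x] by (simp add: cg_def)
  ultimately show ?thesis by blast
qed

text \<open>Subtracting the entry \<open>x M\<close> as a constant reduces to
  \<open>coh_zero_at_M\<close>. This is the division step that \<open>coh_span\<close>
  iterates.\<close>

lemma coh_span_step:
  assumes x: "coh x"
  shows "\<exists>c a b. coh a \<and> coh b \<and> (\<forall>n. cg n (x n) ((\<Sum>l<M. h (c l) * B l) + d * a n + f * b n))"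
proof -
  obtain c u v where c: "u \<in> \<O>" "v \<in> \<O>" "x M = (\<Sum>l<M. h (c l) * B l) + d * u + f * v"
    using span[OF coh_O[OF x]] by blast
  have "coh (\<lambda>n. x n - x M)" using x coh_O by (intro coh_diff' coh_const') auto
  then obtain a b where ab: "coh a" "coh b" "\<And>n. cg n (x n - x M) (d * a n + f * b n)"
    using coh_zero_at_M[of "\<lambda>n. x n - x M"] Pw_0 by auto
  have "cg n (x n) ((\<Sum>l<M. h (c l) * B l) + d * (a n + u) + f * (b n + v))" for n
    using cg_add[OF ab(3)[of n] cg_refl[OF coh_O[OF x, of M]]] c(3) by (simp add: algebra_simps)
  moreover have "coh (\<lambda>n. a n + u)" "coh (\<lambda>n. b n + v)" using ab c by (auto intro: coh_add' coh_const')
  ultimately show ?thesis by blast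
qed

text \<open>\<open>\<Phi>\<close> represents the ring homomorphism \<open>k[[D]] \<rightarrow> \<hat>\<O>\<close>, \<open>D \<mapsto> d\<close>; the completion modulo \<open>f\<close> is
  generated by \<open>B 0, \<dots>, B (M - 1)\<close> over its image.\<close>

definition \<Phi> :: "'k fps \<Rightarrow> nat \<Rightarrow> 'a" where "\<Phi> a n = (\<Sum>l<n. h (fps_nth a l) * d ^ l)"

lemma \<Phi>_O: "\<Phi> a n \<in> \<O>" by (simp add: \<Phi>_def O_sum O_mult O_h O_power d_O)
lemma \<Phi>_coh: "coh (\<Phi> a)"
proof -
  have "h c * d ^ n \<in> Pw n" for c n using Pw_mult'[OF power_Pw[OF d_m] O_h] by (simp only: mult.commute)
  then have "\<Phi> a (Suc n) - \<Phi> a n \<in> Pw n" for n by (simp add: \<Phi>_def)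
  then show ?thesis using \<Phi>_O by (simp add: coh_iff)
qed
lemma \<Phi>_add: "\<Phi> (a + b) n = \<Phi> a n + \<Phi> b n" by (simp add: \<Phi>_def h_add distrib_right sum.distrib)
lemma \<Phi>_zero: "\<Phi> 0 n = 0" by (simp add: \<Phi>_def h_zero)
lemma \<Phi>_sum: "\<Phi> (\<Sum>i\<in>A. g i) n = (\<Sum>i\<in>A. \<Phi> (g i) n)"
  by (induction A rule: infinite_finite_induct) (auto simp: \<Phi>_zero \<Phi>_add)

text \<open>Truncation makes the map multiplicative only modulo a power of the ideal: the product of
  truncations has extra terms in which \<open>d\<close> has exponent at least
  \<open>n\<close>.\<close>

lemma \<Phi>_mult: "cg n (\<Phi> (a * b) n) (\<Phi> a n * \<Phi> b n)"
proof -
  have "\<Phi> a n * \<Phi> b n = (\<Sum>(i, j)\<in>{..<n} \<times> {..<n}. h (fps_nth a i) * h (fps_nth b j) * d ^ (i + j))"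
    by (simp add: \<Phi>_def sum_product sum.cartesian_product power_add mult_ac)
  also have "{..<n} \<times> {..<n} = {(i, j). i + j < n} \<union> {(i, j). i < n \<and> j < n \<and> n \<le> i + j}" by auto
  also have "(\<Sum>(i, j)\<in>\<dots>. h (fps_nth a i) * h (fps_nth b j) * d ^ (i + j)) =
     (\<Sum>(i, j)\<in>{(i, j). i + j < n}. h (fps_nth a i) * h (fps_nth b j) * d ^ (i + j)) +
     (\<Sum>(i, j)\<in>{(i, j). i < n \<and> j < n \<and> n \<le> i + j}. h (fps_nth a i) * h (fps_nth b j) * d ^ (i + j))" (is "_ = ?A + ?R")
    by (rule sum.union_disjoint)
      (auto intro: finite_subset[of _ "{..<n} \<times> {..<n}"])
  finally have 1: "\<Phi> a n * \<Phi> b n = ?A + ?R" by simp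
  have "\<Phi> (a * b) n = (\<Sum>l<n. \<Sum>i\<le>l. h (fps_nth a i) * h (fps_nth b (l - i)) * d ^ l)"
    by (simp add: \<Phi>_def fps_mult_nth atLeast0AtMost h_sum h_mult sum_distrib_right)
  also have "\<dots> = (\<Sum>l<n. \<Sum>i\<le>l. h (fps_nth a i) * h (fps_nth b (l - i)) * d ^ (i + (l - i)))"
    by (intro sum.cong refl) simp
  also have "\<dots> = ?A" by (rule sum.triangle_reindex[symmetric])
  finally have 2: "\<Phi> (a * b) n = ?A" .
  have "?R \<in> Pw n"
  proof -
    have "h (fps_nth a i) * h (fps_nth b j) * d ^ (i + j) \<in> Pw n" if "n \<le> i + j" for i j
      using subsetD[OF Pw_mono[OF that] Pw_mult'[OF power_Pw[OF d_m] O_mult[OF O_h O_h]]]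
      by (subst mult.commute)
    then have "cg n ?R (\<Sum>(i, j)\<in>{(i, j). i < n \<and> j < n \<and> n \<le> i + j}. 0)"
      by (intro cg_sum) (simp add: cg_def O_zero split_beta O_mult O_h O_power d_O)
    then show ?thesis by (simp add: cg_def)
  qed
  then have "0 - ?R \<in> Pw n" by (rule Pw_diff'[OF Pw_0])
  moreover have "\<Phi> (a * b) n - \<Phi> a n * \<Phi> b n = 0 - ?R" unfolding 1 2 by simp
  ultimately show ?thesis unfolding cg_def using \<Phi>_O O_mult[OF \<Phi>_O \<Phi>_O] by (simp only: simp_thms)
qed

lemma \<Phi>_X_power: "cg n (\<Phi> (fps_X ^ j) n) (d ^ j)"
proof (cases "j < n")
  case True
  have "\<Phi> (fps_X ^ j) n = (\<Sum>l<n. if l = j then d ^ l else 0)"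
    unfolding \<Phi>_def by (rule sum.cong) (auto simp: fps_X_power_nth h_one h_zero)
  then have "\<Phi> (fps_X ^ j) n = d ^ j" using True by (simp add: sum.delta)
  then show ?thesis by (simp add: cg_refl O_power d_O)
next
  case False
  then have "\<Phi> (fps_X ^ j) n = 0" by (auto simp: \<Phi>_def fps_X_power_nth h_zero)
  moreover have "d ^ j \<in> Pw n" using power_Pw[OF d_m, of j] Pw_mono[of n j] False by auto
  ultimately show ?thesis using Pw_diff'[OF Pw_0] by (simp add: cg_def O_zero O_power d_O)
qed

text \<open>Iterating \<open>coh_span_step\<close> on the coefficient of \<open>d\<close> yields one
  constant per generator and per power of \<open>d\<close>, hence power series; the
  \<open>f\<close>-parts accumulate in \<open>Y\<close>.\<close>

lemma coh_span:
  assumes x: "coh x"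
  shows "\<exists>A Y. coh Y \<and> (\<forall>n. cg n (x n) ((\<Sum>l<M. \<Phi> (A l) n * B l) + f * Y n))"
proof -
  have "\<forall>x. \<exists>t. coh x \<longrightarrow> coh (fst (snd t)) \<and> coh (snd (snd t)) \<and>
      (\<forall>n. cg n (x n) ((\<Sum>l<M. h (fst t l) * B l) + d * fst (snd t) n + f * snd (snd t) n))"
  proof
    fix x
    show "\<exists>t. coh x \<longrightarrow> coh (fst (snd t)) \<and> coh (snd (snd t)) \<and>
      (\<forall>n. cg n (x n) ((\<Sum>l<M. h (fst t l) * B l) + d * fst (snd t) n + f * snd (snd t) n))"
    proof (cases "coh x")
      case True
      from coh_span_step[OF this] obtain c a b where
        "coh a" "coh b" "\<forall>n. cg n (x n) ((\<Sum>l<M. h (c l) * B l) + d * a n + f * b n)"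
        by (elim exE conjE)
      then show ?thesis by (intro exI[of _ "(c, a, b)"]) simp
    qed simp
  qed
  from choice[OF this] obtain T where T: "\<forall>x. coh x \<longrightarrow> coh (fst (snd (T x))) \<and> coh (snd (snd (T x))) \<and>
      (\<forall>n. cg n (x n) ((\<Sum>l<M. h (fst (T x) l) * B l) + d * fst (snd (T x)) n + f * snd (snd (T x)) n))"
    by (elim exE)
  define c a b where "c x = fst (T x)" and "a x = fst (snd (T x))" and "b x = snd (snd (T x))" for x
  have abc: "\<And>x. coh x \<Longrightarrow> coh (a x)" "\<And>x. coh x \<Longrightarrow> coh (b x)"
    "\<And>x n. coh x \<Longrightarrow> cg n (x n) ((\<Sum>l<M. h (c x l) * B l) + d * a x n + f * b x n)"
    using T by (simp_all add: c_def a_def b_def)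
  \<comment> \<open>\<open>Xs k\<close> is the remainder after \<open>k\<close> division steps, the
    cofactor of \<open>d ^ k\<close> that is still to be expanded.\<close>
  define Xs where "Xs i = rec_nat x (\<lambda>_. a) i" for i
  have Xs: "coh (Xs i)" for i by (induction i) (auto simp: Xs_def x abc)
  define Y where "Y n = (\<Sum>i<n. d ^ i * b (Xs i) n)" for n
  have bO: "b (Xs i) n \<in> \<O>" for i n using abc(2)[OF Xs] coh_O by blast
  have YO: "Y n \<in> \<O>" for n by (simp add: Y_def O_sum O_mult O_power d_O bO)
  have "coh Y" unfolding coh_cg
  proof
    fix n
    have "cg n (\<Sum>i<n. d ^ i * b (Xs i) (Suc n)) (Y n)" unfolding Y_def
      by (intro cg_sum cg_mult cg_refl O_power d_O) (use abc(2)[OF Xs] in \<open>simp add: coh_cg\<close>)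
    moreover have "cg n (d ^ n * b (Xs n) (Suc n)) 0"
      using Pw_mult'[OF power_Pw[OF d_m] bO, of n n "Suc n"] O_mult[OF O_power[OF d_O] bO]
      by (simp add: cg_def O_zero)
    ultimately show "cg n (Y (Suc n)) (Y n)"
      using cg_add[of n "\<Sum>i<n. d ^ i * b (Xs i) (Suc n)" "Y n" "d ^ n * b (Xs n) (Suc n)" 0] by (simp add: Y_def)
  qed
  define A where "A l = Abs_fps (\<lambda>i. c (Xs i) l)" for l
  have it: "cg n (x n) ((\<Sum>i<k. d ^ i * ((\<Sum>l<M. h (c (Xs i) l) * B l) + f * b (Xs i) n)) + d ^ k * Xs k n)" for k n
  proof (induction k)
    case 0
    then show ?case using cg_refl coh_O[OF x] by (simp add: Xs_def)
  next
    case (Suc k)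
    let ?s = "\<Sum>i<k. d ^ i * ((\<Sum>l<M. h (c (Xs i) l) * B l) + f * b (Xs i) n)"
    have s: "?s \<in> \<O>" using bO B_O d_O f_O O_h by (intro O_sum O_mult O_power O_add) auto
    have "cg n (?s + d ^ k * Xs k n) (?s + d ^ k * ((\<Sum>l<M. h (c (Xs k) l) * B l) + d * Xs (Suc k) n + f * b (Xs k) n))"
      using abc(3)[OF Xs, of n k] by (intro cg_add cg_mult cg_refl s O_power d_O) (simp add: Xs_def)
    with Suc have "cg n (x n) (?s + d ^ k * ((\<Sum>l<M. h (c (Xs k) l) * B l) + d * Xs (Suc k) n + f * b (Xs k) n))"
      by (rule cg_trans)
    then show ?case by (simp add: algebra_simps)
  qed
  have "cg n (x n) ((\<Sum>l<M. \<Phi> (A l) n * B l) + f * Y n)" for n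
  proof -
    let ?s = "\<Sum>i<n. d ^ i * ((\<Sum>l<M. h (c (Xs i) l) * B l) + f * b (Xs i) n)"
    have s: "?s \<in> \<O>" using bO B_O d_O f_O O_h by (intro O_sum O_mult O_power O_add) auto
    have "d ^ n * Xs n n \<in> Pw n" using Pw_mult'[OF power_Pw[OF d_m] coh_O[OF Xs]] .
    then have "cg n (?s + d ^ n * Xs n n) ?s" using s by (simp add: cg_def O_add Pw_O)
    with it[of n n] have "cg n (x n) ?s" by (rule cg_trans)
    also have "?s = (\<Sum>i<n. \<Sum>l<M. h (c (Xs i) l) * d ^ i * B l) + f * Y n"
      unfolding Y_def by (simp add: distrib_left sum.distrib sum_distrib_left mult_ac)
    also have "(\<Sum>i<n. \<Sum>l<M. h (c (Xs i) l) * d ^ i * B l) = (\<Sum>l<M. \<Phi> (A l) n * B l)"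
      by (subst sum.swap) (simp add: \<Phi>_def A_def sum_distrib_right)
    finally show ?thesis .
  qed
  then show ?thesis using \<open>coh Y\<close> by blast
qed

text \<open>The powers of \<open>r\<close> up to \<open>r ^ M\<close> are \<open>M + 1\<close>
  elements of a module with \<open>M\<close> generators over k[[D]], so they satisfy a nontrivial
  relation modulo \<open>f\<close>. Its first nonzero coefficient is a unit times a power of
  \<open>D\<close>; the lowest power of \<open>r\<close> is factored out.\<close>

lemma coh_pi_regular:
  assumes r: "coh r"
  shows "\<exists>i j y z. coh y \<and> coh z \<and> (\<forall>n. cg n (r n ^ i * (d ^ j - r n * y n)) (f * z n))"
proof -
  have "\<forall>i. \<exists>t. coh (snd t) \<and> (\<forall>n. cg n (r n ^ i) ((\<Sum>l<M. \<Phi> (fst t l) n * B l) + f * snd t n))"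
  proof
    fix i
    from coh_span[OF coh_power'[OF r, of i]] obtain A Y where
      "coh Y" "\<forall>n. cg n (r n ^ i) ((\<Sum>l<M. \<Phi> (A l) n * B l) + f * Y n)" by (elim exE conjE)
    then show "\<exists>t. coh (snd t) \<and> (\<forall>n. cg n (r n ^ i) ((\<Sum>l<M. \<Phi> (fst t l) n * B l) + f * snd t n))"
      by (intro exI[of _ "(A, Y)"]) simp
  qed
  from choice[OF this] obtain T where T: "\<forall>i. coh (snd (T i)) \<and>
      (\<forall>n. cg n (r n ^ i) ((\<Sum>l<M. \<Phi> (fst (T i) l) n * B l) + f * snd (T i) n))"
    by (elim exE)
  define A Y where "A i = fst (T i)" and "Y i = snd (T i)" for i
  have A: "\<And>i. coh (Y i)" "\<And>i n. cg n (r n ^ i) ((\<Sum>l<M. \<Phi> (A i l) n * B l) + f * Y i n)"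
    using T by (simp_all add: A_def Y_def)
  obtain \<xi> where \<xi>: "\<exists>j\<le>M. \<xi> j \<noteq> 0" "\<And>l. l < M \<Longrightarrow> (\<Sum>j\<le>M. A j l * \<xi> j) = 0"
    using homogeneous_system_nontrivial[of M "\<lambda>l j. A j l"] by blast
  define i where "i = (LEAST j. \<xi> j \<noteq> 0)"
  obtain j0 where j0: "j0 \<le> M" "\<xi> j0 \<noteq> 0" using \<xi>(1) by blast
  have i: "\<xi> i \<noteq> 0" "i \<le> M" unfolding i_def
    using LeastI[of "\<lambda>j. \<xi> j \<noteq> 0", OF j0(2)] Least_le[of "\<lambda>j. \<xi> j \<noteq> 0", OF j0(2)] j0(1) by auto
  have lt: "\<xi> j = 0" if "j < i" for j using that not_less_Least unfolding i_def by blast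
  define j where "j = subdegree (\<xi> i)"
  \<comment> \<open>The unit part of the first nonzero coefficient; dividing the relation by it
    makes that coefficient exactly \<open>fps_X ^ j\<close>.\<close>
  define \<beta> where "\<beta> = fps_shift j (\<xi> i)"
  have dec: "\<xi> i = \<beta> * fps_X ^ j" unfolding \<beta>_def j_def by (rule subdegree_decompose)
  have "fps_nth \<beta> 0 \<noteq> 0" using i nth_subdegree_nonzero by (auto simp: \<beta>_def j_def)
  then have inv: "inverse \<beta> * \<beta> = 1" by (rule inverse_mult_eq_1)
  define \<eta> where "\<eta> l = inverse \<beta> * \<xi> l" for l
  have \<eta>i: "\<eta> i = fps_X ^ j" unfolding \<eta>_def dec using inv by (simp flip: mult.assoc)
  have \<eta>0: "\<eta> l = 0" if "l < i" for l using lt[OF that] by (simp add: \<eta>_def)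
  have \<eta>A: "(\<Sum>k\<le>M. A k l * \<eta> k) = 0" if "l < M" for l
  proof -
    have "(\<Sum>k\<le>M. A k l * \<eta> k) = inverse \<beta> * (\<Sum>k\<le>M. A k l * \<xi> k)"
      by (simp add: \<eta>_def sum_distrib_left mult_ac)
    then show ?thesis using \<xi>(2)[OF that] by simp
  qed
  define z where "z n = (\<Sum>k\<le>M. \<Phi> (\<eta> k) n * Y k n)" for n
  have cz: "coh z" unfolding z_def by (intro coh_sum' coh_mult' \<Phi>_coh A)
  have rel: "cg n (\<Sum>k\<le>M. \<Phi> (\<eta> k) n * r n ^ k) (f * z n)" for n
  proof -
    have "cg n (\<Sum>k\<le>M. \<Phi> (\<eta> k) n * r n ^ k) (\<Sum>k\<le>M. \<Phi> (\<eta> k) n * ((\<Sum>l<M. \<Phi> (A k l) n * B l) + f * Y k n))"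
      by (intro cg_sum cg_mult cg_refl \<Phi>_O A)
    also have "\<dots> = (\<Sum>l<M. (\<Sum>k\<le>M. \<Phi> (A k l) n * \<Phi> (\<eta> k) n) * B l) + f * z n"
    proof -
      have "(\<Sum>k\<le>M. \<Phi> (\<eta> k) n * (\<Sum>l<M. \<Phi> (A k l) n * B l)) = (\<Sum>l<M. (\<Sum>k\<le>M. \<Phi> (A k l) n * \<Phi> (\<eta> k) n) * B l)"
        unfolding sum_distrib_left sum_distrib_right by (subst sum.swap) (simp add: mult_ac)
      then show ?thesis by (simp add: z_def distrib_left sum.distrib sum_distrib_left mult_ac)
    qed
    also have "cg n \<dots> ((\<Sum>l<M. (\<Sum>k\<le>M. \<Phi> (A k l * \<eta> k) n) * B l) + f * z n)"
      using coh_O[OF cz] f_O by (intro cg_add cg_sum cg_mult cg_refl B_O cg_sym[OF \<Phi>_mult] O_mult) auto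
    also have "\<dots> = f * z n" by (simp add: \<eta>A \<Phi>_zero flip: \<Phi>_sum)
    finally show ?thesis .
  qed
  \<comment> \<open>The terms of the relation above \<open>r ^ i\<close>, divided by
    \<open>r ^ Suc i\<close> and negated.\<close>
  define y where "y n = - (\<Sum>k\<in>{Suc i..M}. \<Phi> (\<eta> k) n * r n ^ (k - Suc i))" for n
  have "coh (\<lambda>n. 0 - (\<Sum>k\<in>{Suc i..M}. \<Phi> (\<eta> k) n * r n ^ (k - Suc i)))"
    by (intro coh_diff' coh_sum' coh_mult' \<Phi>_coh coh_power' r coh_const' O_zero)
  then have cy: "coh y" by (simp add: y_def[abs_def])
  have "cg n (r n ^ i * (d ^ j - r n * y n)) (f * z n)" for n
  proof -
    have "(\<Sum>k\<le>M. \<Phi> (\<eta> k) n * r n ^ k) = (\<Sum>k\<in>{i..M}. \<Phi> (\<eta> k) n * r n ^ k)"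
      by (rule sum.mono_neutral_right) (auto simp: \<eta>0 \<Phi>_zero)
    also have "\<dots> = \<Phi> (\<eta> i) n * r n ^ i + (\<Sum>k\<in>{Suc i..M}. \<Phi> (\<eta> k) n * r n ^ k)"
      using i by (simp add: sum.atLeast_Suc_atMost)
    also have "(\<Sum>k\<in>{Suc i..M}. \<Phi> (\<eta> k) n * r n ^ k) = (\<Sum>k\<in>{Suc i..M}. r n ^ i * (r n * (\<Phi> (\<eta> k) n * r n ^ (k - Suc i))))"
    proof (rule sum.cong)
      fix k assume "k \<in> {Suc i..M}"
      then have "r n ^ k = r n ^ i * r n * r n ^ (k - Suc i)"
        using power_add[of "r n" "Suc i" "k - Suc i"] by (simp add: mult_ac)
      then show "\<Phi> (\<eta> k) n * r n ^ k = r n ^ i * (r n * (\<Phi> (\<eta> k) n * r n ^ (k - Suc i)))" by (simp add: mult_ac)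
    qed simp
    also have "\<Phi> (\<eta> i) n * r n ^ i + (\<Sum>k\<in>{Suc i..M}. r n ^ i * (r n * (\<Phi> (\<eta> k) n * r n ^ (k - Suc i)))) =
       r n ^ i * (\<Phi> (fps_X ^ j) n - r n * y n)"
      by (simp add: y_def \<eta>i sum_distrib_left algebra_simps)
    finally have e: "(\<Sum>k\<le>M. \<Phi> (\<eta> k) n * r n ^ k) = r n ^ i * (\<Phi> (fps_X ^ j) n - r n * y n)" .
    have "cg n (r n ^ i * (d ^ j - r n * y n)) (r n ^ i * (\<Phi> (fps_X ^ j) n - r n * y n))"
      using coh_O[OF r] coh_O[OF cy] by (intro cg_mult cg_refl cg_diff cg_sym[OF \<Phi>_X_power] O_power O_mult) auto
    also have "cg n \<dots> (f * z n)" using rel[of n] unfolding e .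
    finally show ?thesis .
  qed
  then show ?thesis using cy cz by blast
qed

end

section \<open>Evaluation of polynomials along ring homomorphisms\<close>

definition rhom :: "('a::comm_ring_1 \<Rightarrow> 'b::comm_ring_1) \<Rightarrow> bool" where
  "rhom \<phi> \<longleftrightarrow> (\<forall>a b. \<phi> (a + b) = \<phi> a + \<phi> b) \<and> (\<forall>a b. \<phi> (a * b) = \<phi> a * \<phi> b) \<and> \<phi> 1 = 1"

lemma rhomD:
  assumes "rhom \<phi>"
  shows "\<phi> (a + b) = \<phi> a + \<phi> b" "\<phi> (a * b) = \<phi> a * \<phi> b" "\<phi> 1 = 1" "\<phi> 0 = 0"
    "\<phi> (- a) = - \<phi> a" "\<phi> (a - b) = \<phi> a - \<phi> b" "\<phi> (a ^ n) = \<phi> a ^ n" "\<phi> (sum g A) = (\<Sum>i\<in>A. \<phi> (g i))"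
proof -
  have a: "\<And>a b. \<phi> (a + b) = \<phi> a + \<phi> b" and m: "\<And>a b. \<phi> (a * b) = \<phi> a * \<phi> b" and o: "\<phi> 1 = 1"
    using assms by (auto simp: rhom_def)
  have z: "\<phi> 0 = 0" using a[of 0 0] by (metis add_0 add_cancel_right_right)
  have n: "\<phi> (- a) = - \<phi> a" for a
    using a[of a "- a"] z by (simp add: eq_neg_iff_add_eq_0 add.commute)
  show "\<phi> (a + b) = \<phi> a + \<phi> b" "\<phi> (a * b) = \<phi> a * \<phi> b" "\<phi> 1 = 1" "\<phi> 0 = 0" "\<phi> (- a) = - \<phi> a"
    by (fact a m o z n)+
  show "\<phi> (a - b) = \<phi> a - \<phi> b" using a[of a "- b"] n by simp
  show "\<phi> (a ^ n) = \<phi> a ^ n" by (induction n) (auto simp: o m)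
  show "\<phi> (sum g A) = (\<Sum>i\<in>A. \<phi> (g i))" by (induction A rule: infinite_finite_induct) (auto simp: z a)
qed

lemma rhom_comp: "rhom \<phi> \<Longrightarrow> rhom \<psi> \<Longrightarrow> rhom (\<lambda>x. \<psi> (\<phi> x))"
  by (simp add: rhom_def)

lemma rhom_poly_map:
  assumes "rhom \<phi>" shows "rhom (\<lambda>p. poly (map_poly \<phi> p) x)"
proof -
  note r = rhomD[OF assms]
  have "map_poly \<phi> (p + q) = map_poly \<phi> p + map_poly \<phi> q" for p q
    by (rule poly_eqI) (simp add: coeff_map_poly r)
  moreover have "map_poly \<phi> (p * q) = map_poly \<phi> p * map_poly \<phi> q" for p q
    by (rule poly_eqI) (simp add: coeff_map_poly r coeff_mult)
  ultimately show ?thesis by (simp add: rhom_def r)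
qed

lemma rhom_poly: "rhom (\<lambda>p. poly p x)" by (simp add: rhom_def)

lemma poly_map_const: "rhom \<phi> \<Longrightarrow> poly (map_poly \<phi> [:a:]) x = \<phi> a"
  by (cases "a = 0") (simp_all add: map_poly_pCons rhomD(4))
lemma poly_map_var: "rhom \<phi> \<Longrightarrow> poly (map_poly \<phi> [:0, 1:]) x = x"
  by (simp add: map_poly_pCons rhomD)

lemma rhom_poly_eq:
  assumes "rhom \<phi>" "rhom \<psi>" "\<And>a. \<phi> [:a:] = \<psi> [:a:]" "\<phi> [:0, 1:] = \<psi> [:0, 1:]"
  shows "\<phi> = \<psi>"
proof
  fix p
  show "\<phi> p = \<psi> p"
  proof (induction p)
    case (pCons a p)
    have "pCons a p = [:a:] + [:0, 1:] * p" by simp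
    then show ?case using pCons assms by (simp only: rhomD[OF assms(1)] rhomD[OF assms(2)])
  qed (simp add: assms rhomD)
qed

lemma rhom_const_poly: "rhom (\<lambda>a. [:a:])" by (simp add: rhom_def one_pCons)

text \<open>Constants and the three variables generate all forms; identities between evaluation maps
  are checked on these generators.\<close>

lemma rhom_form_eq:
  fixes \<phi> \<psi> :: "'k::field form \<Rightarrow> 'b::comm_ring_1"
  assumes "rhom \<phi>" "rhom \<psi>" "\<And>c. \<phi> (form_const c) = \<psi> (form_const c)"
    "\<phi> form_x = \<psi> form_x" "\<phi> form_y = \<psi> form_y" "\<phi> form_z = \<psi> form_z"
  shows "\<phi> = \<psi>"
proof (rule rhom_poly_eq[OF assms(1,2)])
  have "(\<lambda>a. \<phi> [:a:]) = (\<lambda>a. \<psi> [:a:])"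
  proof (rule rhom_poly_eq)
    have "(\<lambda>a. \<phi> [:[:a:]:]) = (\<lambda>a. \<psi> [:[:a:]:])"
      by (rule rhom_poly_eq) (use assms in \<open>auto intro: rhom_comp[OF rhom_const_poly] rhom_comp rhom_const_poly simp: form_const_def form_x_def\<close>)
    then show "\<phi> [:[:a:]:] = \<psi> [:[:a:]:]" for a by (rule fun_cong)
  qed (use assms in \<open>auto intro: rhom_comp rhom_const_poly simp: form_y_def\<close>)
  then show "\<phi> [:a:] = \<psi> [:a:]" for a by (rule fun_cong)
qed (use assms in \<open>simp add: form_z_def\<close>)

definition ev2 :: "('k::field \<Rightarrow> 'b::field) \<Rightarrow> 'b \<Rightarrow> 'b \<Rightarrow> 'k poly poly \<Rightarrow> 'b" where
  "ev2 h a b g = poly (map_poly (\<lambda>g. poly (map_poly h g) a) g) b"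
definition ev3 :: "('k::field \<Rightarrow> 'b::field) \<Rightarrow> 'b \<Rightarrow> 'b \<Rightarrow> 'b \<Rightarrow> 'k form \<Rightarrow> 'b" where
  "ev3 h a b c G = poly (map_poly (ev2 h a b) G) c"

lemma rhom_ev2: "rhom h \<Longrightarrow> rhom (ev2 h a b)"
  unfolding ev2_def[abs_def] by (intro rhom_poly_map)
lemma rhom_ev3: "rhom h \<Longrightarrow> rhom (ev3 h a b c)"
  unfolding ev3_def[abs_def] by (intro rhom_poly_map rhom_ev2)

lemma ev2_gens:
  assumes "rhom h"
  shows "ev2 h a b [:[:c:]:] = h c" "ev2 h a b [:[:0, 1:]:] = a" "ev2 h a b [:0, 1:] = b" "ev2 h a b [:p:] = poly (map_poly h p) a"
  using assms by (simp_all add: ev2_def poly_map_const poly_map_var rhom_poly_map)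

lemma ev3_gens:
  assumes "rhom h"
  shows "ev3 h a b c (form_const e) = h e" "ev3 h a b c form_x = a" "ev3 h a b c form_y = b" "ev3 h a b c form_z = c"
  using assms by (simp_all add: ev3_def poly_map_const poly_map_var rhom_ev2 ev2_gens form_const_def form_x_def form_y_def form_z_def)

lemma rhom_dehomogenize: "rhom dehomogenize"
  unfolding dehomogenize_def[abs_def] by (rule rhom_poly)

lemma dehomogenize_gens:
  "dehomogenize (form_const c) = [:[:c:]:]" "dehomogenize form_x = [:[:0, 1:]:]" "dehomogenize form_y = [:0, 1:]"
  "dehomogenize form_z = 1"
  by (simp_all add: dehomogenize_def form_const_def form_x_def form_y_def form_z_def)

lemma ev3_dehomogenize: "rhom h \<Longrightarrow> ev3 h a b 1 G = ev2 h a b (dehomogenize G)"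
proof -
  assume h: "rhom h"
  have "ev3 h a b 1 = (\<lambda>G. ev2 h a b (dehomogenize G))"
    by (rule rhom_form_eq) (use h in \<open>auto simp: ev3_gens dehomogenize_gens ev2_gens rhomD[OF rhom_ev2] poly_map_const poly_map_var
        intro: rhom_ev3 rhom_comp[OF rhom_dehomogenize] rhom_ev2\<close>)
  then show ?thesis by (rule fun_cong)
qed

section \<open>Homogeneous forms\<close>

definition gc :: "'k::field form \<Rightarrow> nat \<Rightarrow> nat \<Rightarrow> nat \<Rightarrow> 'k" where
  "gc G i j l = coeff (coeff (coeff G l) j) i"

lemma form_eqI: "(\<And>i j l. gc G i j l = gc H i j l) \<Longrightarrow> G = H"
  unfolding gc_def by (intro poly_eqI) auto

lemma homogeneous_gc: "homogeneous d G \<longleftrightarrow> (\<forall>i j l. gc G i j l \<noteq> 0 \<longrightarrow> i + j + l = d)"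
  by (simp add: homogeneous_def gc_def)

lemma gc_add: "gc (G + H) i j l = gc G i j l + gc H i j l" by (simp add: gc_def)
lemma gc_uminus: "gc (- G) i j l = - gc G i j l" by (simp add: gc_def)
lemma gc_zero: "gc 0 i j l = 0" by (simp add: gc_def)
lemma gc_sum: "gc (\<Sum>a\<in>A. g a) i j l = (\<Sum>a\<in>A. gc (g a) i j l)"
  by (induction A rule: infinite_finite_induct) (auto simp: gc_add gc_zero)
lemma gc_mult: "gc (G * H) i j l =
  (\<Sum>l'\<le>l. \<Sum>j'\<le>j. \<Sum>i'\<le>i. gc G i' j' l' * gc H (i - i') (j - j') (l - l'))"
  by (simp add: gc_def coeff_mult coeff_sum)

lemma homogeneous_zero [simp]: "homogeneous d 0" by (simp add: homogeneous_def)
lemma homogeneous_add: "homogeneous d G \<Longrightarrow> homogeneous d H \<Longrightarrow> homogeneous d (G + H)"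
  unfolding homogeneous_gc gc_add by (metis add_0)
lemma homogeneous_uminus: "homogeneous d G \<Longrightarrow> homogeneous d (- G)"
  unfolding homogeneous_gc gc_uminus by simp
lemma homogeneous_mult:
  assumes "homogeneous d G" "homogeneous e H" shows "homogeneous (d + e) (G * H)"
  unfolding homogeneous_gc
proof (intro allI impI)
  fix i j l assume "gc (G * H) i j l \<noteq> 0"
  then obtain l' j' i' where "l' \<le> l" "j' \<le> j" "i' \<le> i" "gc G i' j' l' * gc H (i - i') (j - j') (l - l') \<noteq> 0"
    unfolding gc_mult by (meson atMost_iff sum.not_neutral_contains_not_neutral)
  moreover from this have "gc G i' j' l' \<noteq> 0" "gc H (i - i') (j - j') (l - l') \<noteq> 0" by auto
  then have "i' + j' + l' = d" "(i - i') + (j - j') + (l - l') = e"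
    using assms unfolding homogeneous_gc by blast+
  ultimately have "i' + j' + l' = d" "(i - i') + (j - j') + (l - l') = e" "l' \<le> l" "j' \<le> j" "i' \<le> i" by auto
  then show "i + j + l = d + e" by linarith
qed
lemma homogeneous_const [simp]: "homogeneous 0 (form_const c)"
  by (auto simp: homogeneous_def form_const_def coeff_pCons split: nat.splits if_splits)
lemma homogeneous_one [simp]: "homogeneous 0 1"
  using homogeneous_const[of 1] by (simp add: form_const_def one_pCons)
lemma homogeneous_vars [simp]: "homogeneous (Suc 0) form_x" "homogeneous (Suc 0) form_y" "homogeneous (Suc 0) form_z"
  by (auto simp: homogeneous_def form_x_def form_y_def form_z_def coeff_pCons split: nat.splits if_splits)
lemma homogeneous_power: "homogeneous d G \<Longrightarrow> homogeneous (d * n) (G ^ n)"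
  by (induction n) (use homogeneous_mult in fastforce)+
lemma homogeneous_power1: "homogeneous (Suc 0) G \<Longrightarrow> homogeneous n (G ^ n)"
  using homogeneous_power[of "Suc 0" G n] by simp
lemma homogeneous_sum: "(\<And>a. a \<in> A \<Longrightarrow> homogeneous d (g a)) \<Longrightarrow> homogeneous d (\<Sum>a\<in>A. g a)"
  by (induction A rule: infinite_finite_induct) (auto intro: homogeneous_add)

definition mono3 :: "'k::field \<Rightarrow> nat \<times> nat \<times> nat \<Rightarrow> 'k form" where
  "mono3 c = (\<lambda>(i, j, l). monom (monom (monom c i) j) l)"
definition degs :: "nat \<Rightarrow> (nat \<times> nat \<times> nat) set" where "degs e = {(i, j, l). i + j + l = e}"
text \<open>The homogeneous component of degree \<open>e\<close>, assembled from coefficients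
  because the nested polynomial type shows no total degree.\<close>

definition hcomp :: "nat \<Rightarrow> 'k::field form \<Rightarrow> 'k form" where
  "hcomp e G = (\<Sum>(i, j, l)\<in>degs e. mono3 (gc G i j l) (i, j, l))"

lemma finite_degs: "finite (degs e)"
  by (rule finite_subset[of _ "{..e} \<times> {..e} \<times> {..e}"]) (auto simp: degs_def)

lemma gc_mono3: "gc (mono3 c t) i j l = (if t = (i, j, l) then c else 0)"
  by (cases t) (auto simp: gc_def mono3_def)

lemma gc_hcomp: "gc (hcomp e G) i j l = (if i + j + l = e then gc G i j l else 0)"
proof -
  have "gc (hcomp e G) i j l = (\<Sum>t\<in>degs e. if t = (i, j, l) then gc G i j l else 0)"
    unfolding hcomp_def gc_sum by (rule sum.cong) (auto simp: gc_mono3 split: if_splits)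
  also have "\<dots> = (if i + j + l = e then gc G i j l else 0)"
    using finite_degs[of e] by (simp add: sum.delta degs_def)
  finally show ?thesis .
qed

lemma hcomp_homogeneous [simp]: "homogeneous e (hcomp e G)"
  unfolding homogeneous_gc gc_hcomp by auto
lemma hcomp_add: "hcomp e (G + H) = hcomp e G + hcomp e H"
  by (rule form_eqI) (simp add: gc_hcomp gc_add)
lemma hcomp_zero: "hcomp e 0 = 0"
  by (rule form_eqI) (simp add: gc_hcomp gc_zero)
lemma hcomp_sum: "hcomp e (\<Sum>a\<in>A. g a) = (\<Sum>a\<in>A. hcomp e (g a))"
  by (induction A rule: infinite_finite_induct) (auto simp: hcomp_add hcomp_zero)
lemma hcomp_of_homogeneous: "homogeneous d G \<Longrightarrow> hcomp e G = (if e = d then G else 0)"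
  unfolding homogeneous_gc by (rule form_eqI) (auto simp: gc_hcomp gc_zero)

lemma hcomp_bound: "\<exists>D. \<forall>e>D. hcomp e G = 0"
proof -
  define D1 where "D1 = degree G"
  define D2 where "D2 = Max ((\<lambda>l. degree (coeff G l)) ` {..D1})"
  define D3 where "D3 = Max ((\<lambda>(l, j). degree (coeff (coeff G l) j)) ` ({..D1} \<times> {..D2}))"
  have bnd: "i \<le> D3 \<and> j \<le> D2 \<and> l \<le> D1" if nz: "gc G i j l \<noteq> 0" for i j l
  proof -
    have l: "l \<le> D1" unfolding D1_def using nz by (intro le_degree) (auto simp: gc_def)
    have "j \<le> degree (coeff G l)" using nz by (intro le_degree) (auto simp: gc_def)
    also have "\<dots> \<le> D2" unfolding D2_def using l by (intro Max_ge) auto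
    finally have j: "j \<le> D2" .
    have "i \<le> degree (coeff (coeff G l) j)" using nz by (intro le_degree) (auto simp: gc_def)
    also have "\<dots> \<le> D3" unfolding D3_def using l j by (intro Max_ge) auto
    finally show ?thesis using l j by simp
  qed
  have "gc (hcomp e G) i j l = 0" if "e > D1 + D2 + D3" for e i j l
    using that bnd[of i j l] unfolding gc_hcomp by (cases "gc G i j l = 0") auto
  then show ?thesis by (intro exI[of _ "D1 + D2 + D3"]) (auto intro: form_eqI simp: gc_zero)
qed

lemma sum_hcomp: "(\<forall>e>D. hcomp e G = 0) \<Longrightarrow> G = (\<Sum>e\<le>D. hcomp e G)"
proof (rule form_eqI)
  fix i j l assume D: "\<forall>e>D. hcomp e G = 0"
  have "gc (\<Sum>e\<le>D. hcomp e G) i j l = (\<Sum>e\<le>D. if e = i + j + l then gc G i j l else 0)"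
    unfolding gc_sum by (rule sum.cong) (auto simp: gc_hcomp)
  also have "\<dots> = (if i + j + l \<le> D then gc G i j l else 0)" by (simp add: sum.delta)
  also have "\<dots> = gc G i j l"
    using D gc_hcomp[of "i + j + l" G i j l] gc_zero by (metis not_le)
  finally show "gc G i j l = gc (\<Sum>e\<le>D. hcomp e G) i j l" by simp
qed

lemma hcomp_mult_homogeneous:
  assumes F: "homogeneous m F"
  shows "hcomp n (F * G) = (if m \<le> n then F * hcomp (n - m) G else 0)"
proof -
  obtain D where D: "\<forall>e>D. hcomp e G = 0" using hcomp_bound by blast
  have "hcomp n (F * G) = hcomp n (F * (\<Sum>e\<le>D. hcomp e G))" using sum_hcomp[OF D] by simp
  also have "\<dots> = (\<Sum>e\<le>D. hcomp n (F * hcomp e G))" by (simp add: sum_distrib_left hcomp_sum)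
  also have "\<dots> = (\<Sum>e\<le>D. if n = m + e then F * hcomp e G else 0)"
    by (intro sum.cong refl hcomp_of_homogeneous homogeneous_mult F) simp
  also have "\<dots> = (\<Sum>e\<le>D. if e = n - m then (if m \<le> n then F * hcomp (n - m) G else 0) else 0)"
    by (intro sum.cong refl) auto
  also have "\<dots> = (if m \<le> n then F * hcomp (n - m) G else 0)"
    using D by (auto simp: sum.delta not_le)
  finally show ?thesis .
qed

text \<open>A homogeneous multiple of \<open>F\<close> equals its own component, which is
  \<open>F\<close> times a single component of \<open>G\<close>; cancelling \<open>F\<close>
  identifies \<open>G\<close> with that component.\<close>

lemma homogeneous_cancel:
  assumes F: "homogeneous m F" "F \<noteq> 0" and FG: "homogeneous n (F * G)" and G: "G \<noteq> 0"
  shows "m \<le> n" "homogeneous (n - m) G"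
proof -
  have e: "F * G = (if m \<le> n then F * hcomp (n - m) G else 0)"
    using hcomp_of_homogeneous[OF FG, of n] hcomp_mult_homogeneous[OF F(1), of n G] by simp
  show mn: "m \<le> n" using e F G by (auto split: if_splits)
  then have "F * G = F * hcomp (n - m) G" using e by simp
  then have "G = hcomp (n - m) G" using F by (simp only: mult_cancel_left) auto
  then show "homogeneous (n - m) G" using hcomp_homogeneous by metis
qed

lemma ev3_mono3: "rhom h \<Longrightarrow> ev3 h a b c (mono3 e (i, j, l)) = h e * a ^ i * b ^ j * c ^ l"
proof -
  assume h: "rhom h"
  have "mono3 e (i, j, l) = form_const e * form_x ^ i * form_y ^ j * form_z ^ l"
    unfolding form_const_def form_x_def form_y_def form_z_def mono3_def
    by (simp flip: monom_Suc add: monom_altdef smult_power poly_const_pow power_mult_distrib)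
  then show ?thesis using h by (simp add: rhomD[OF rhom_ev3[OF h]] ev3_gens)
qed

lemma ev3_homogeneous:
  assumes "rhom h" "homogeneous d G"
  shows "ev3 h a b c G = (\<Sum>(i, j, l)\<in>degs d. h (gc G i j l) * a ^ i * b ^ j * c ^ l)"
proof -
  have "G = hcomp d G" using hcomp_of_homogeneous[OF assms(2), of d] by simp
  then have "ev3 h a b c G = ev3 h a b c (hcomp d G)" by (rule arg_cong)
  then show ?thesis using assms(1)
    by (simp add: hcomp_def rhomD(8)[OF rhom_ev3[OF assms(1)]] case_prod_beta)
      (rule sum.cong; auto simp: ev3_mono3)
qed

lemma ev3_scale:
  assumes "rhom h" "homogeneous d G"
  shows "ev3 h (s * a) (s * b) (s * c) G = s ^ d * ev3 h a b c G"
  unfolding ev3_homogeneous[OF assms] sum_distrib_left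
  by (rule sum.cong) (auto simp: degs_def power_mult_distrib power_add)

section \<open>Forms as elements of the fraction field\<close>

definition emb :: "'k::field form \<Rightarrow> 'k ratfun" where "emb G = Fract G 1"

lemma rhom_emb: "rhom emb" by (simp add: rhom_def emb_def One_fract_def)
lemma emb_eq_iff: "emb G = emb H \<longleftrightarrow> G = H" by (simp add: emb_def eq_fract)
lemma emb_0_iff [simp]: "emb G = 0 \<longleftrightarrow> G = 0" using emb_eq_iff[of G 0] by (simp add: rhomD(4)[OF rhom_emb])
lemma Fract_emb: "Fract G H = emb G / emb H" if "H \<noteq> 0" using that by (simp add: emb_def)
lemma ratfun_const_emb: "ratfun_const c = emb (form_const c)" by (simp add: ratfun_const_def emb_def)
lemma rhom_form_const: "rhom form_const"
  unfolding form_const_def[abs_def]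
  by (rule rhom_comp[OF rhom_comp[OF rhom_const_poly rhom_const_poly] rhom_const_poly])
lemma rhom_ratfun_const: "rhom ratfun_const"
  unfolding ratfun_const_emb[abs_def] by (rule rhom_comp[OF rhom_form_const rhom_emb])

text \<open>A form is its own value at the coordinate functions; together with
  \<open>ev3_scale\<close> this expresses dividing out a power of any chosen variable.\<close>

lemma emb_ev3: "emb G = ev3 ratfun_const (emb form_x) (emb form_y) (emb form_z) G"
proof -
  have "emb = ev3 ratfun_const (emb form_x) (emb form_y) (emb form_z)"
    by (rule rhom_form_eq) (auto simp: rhom_emb rhom_ev3 rhom_ratfun_const ev3_gens ratfun_const_emb)
  then show ?thesis by (rule fun_cong)
qed

interpretation rc: const_hom ratfun_const
  using rhomD[OF rhom_ratfun_const] by unfold_locales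

section \<open>Local rings of the projective plane\<close>

lemma stalk_idealI:
  "G \<in> J \<Longrightarrow> H \<notin> q \<Longrightarrow> 0 \<in> q \<Longrightarrow> homogeneous d G \<Longrightarrow> homogeneous d H \<Longrightarrow> emb G / emb H \<in> stalk_ideal q J"
proof -
  assume *: "G \<in> J" "H \<notin> q" "0 \<in> q" "homogeneous d G" "homogeneous d H"
  then have "H \<noteq> 0" by auto
  then have "emb G / emb H = Fract G H" by (simp add: Fract_emb)
  then show ?thesis using * unfolding stalk_ideal_def by blast
qed

lemma stalk_idealE:
  assumes "r \<in> stalk_ideal q J" "0 \<in> q"
  obtains d G H where "r = emb G / emb H" "G \<in> J" "H \<notin> q" "H \<noteq> 0" "homogeneous d G" "homogeneous d H"
proof -
  obtain d G H where *: "r = Fract G H" "G \<in> J" "H \<notin> q" "homogeneous d G" "homogeneous d H"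
    using assms(1) unfolding stalk_ideal_def by blast
  have "H \<noteq> 0" using *(3) assms(2) by auto
  then show thesis using that[of G H d] * Fract_emb[of H G] by simp
qed

locale plane_point =
  fixes q :: "'k::field form set"
  assumes proj: "proj_point q"
begin

lemma q_primeideal: "primeideal q ring_of_type_algebra" using proj by (simp add: proj_point_def)

lemma q_zero: "0 \<in> q" and q_add: "x \<in> q \<Longrightarrow> y \<in> q \<Longrightarrow> x + y \<in> q"
  and q_mult: "x \<in> q \<Longrightarrow> x * y \<in> q" and q_mult': "x \<in> q \<Longrightarrow> y * x \<in> q"
  and q_prime: "x * y \<in> q \<Longrightarrow> x \<in> q \<or> y \<in> q" and q_one: "1 \<notin> q"
proof -
  interpret P: primeideal q "ring_of_type_algebra :: 'k form ring" by (rule q_primeideal)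
  note Q = ideal.axioms(1)[OF P.is_ideal]
  show "0 \<in> q" using additive_subgroup.zero_closed[OF Q] by simp
  show "x \<in> q \<Longrightarrow> y \<in> q \<Longrightarrow> x + y \<in> q" using additive_subgroup.a_closed[OF Q, of x y] by simp
  show "x \<in> q \<Longrightarrow> x * y \<in> q" using P.I_r_closed[of x y] by simp
  show "x \<in> q \<Longrightarrow> y * x \<in> q" using P.I_l_closed[of x y] by simp
  show "x * y \<in> q \<Longrightarrow> x \<in> q \<or> y \<in> q" using P.I_prime[of x y] by simp
  show "1 \<notin> q" using P.one_imp_carrier P.I_notcarr by auto
qed

lemma q_power: "x ^ n \<in> q \<Longrightarrow> x \<in> q"
  by (induction n) (use q_one q_prime in auto)
lemma q_nonzero: "H \<notin> q \<Longrightarrow> H \<noteq> 0" using q_zero by blast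

lemma stalk_sub: "stalk_ideal q J \<subseteq> stalk q" unfolding stalk_def stalk_ideal_def by blast

lemmas stI = stalk_idealI[OF _ _ q_zero]
lemmas stE = stalk_idealE[OF _ q_zero]

lemma stalkI: "H \<notin> q \<Longrightarrow> homogeneous d G \<Longrightarrow> homogeneous d H \<Longrightarrow> emb G / emb H \<in> stalk q"
  unfolding stalk_def by (rule stI) auto
lemma stalkE:
  assumes "r \<in> stalk q"
  obtains d G H where "r = emb G / emb H" "H \<notin> q" "H \<noteq> 0" "homogeneous d G" "homogeneous d H"
  using assms unfolding stalk_def by (rule stE) blast

lemma stalk_ideal_add:
  assumes J: "\<And>x y. x \<in> J \<Longrightarrow> y \<in> J \<Longrightarrow> x + y \<in> J" "\<And>x y. x \<in> J \<Longrightarrow> x * y \<in> J"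
    and x: "x \<in> stalk_ideal q J" and y: "y \<in> stalk_ideal q J"
  shows "x + y \<in> stalk_ideal q J"
proof -
  obtain d G H where x: "x = emb G / emb H" "G \<in> J" "H \<notin> q" "H \<noteq> 0" "homogeneous d G" "homogeneous d H"
    using x by (rule stE)
  obtain e K L where y: "y = emb K / emb L" "K \<in> J" "L \<notin> q" "L \<noteq> 0" "homogeneous e K" "homogeneous e L"
    using y by (rule stE)
  have "x + y = emb (G * L + K * H) / emb (H * L)"
    using x y by (simp add: rhomD[OF rhom_emb] add_frac_eq)
  moreover have "homogeneous (d + e) (G * L + K * H)"
    using homogeneous_mult[OF x(5) y(6)] homogeneous_mult[OF y(5) x(6)] by (simp add: homogeneous_add add.commute)
  moreover have "homogeneous (d + e) (H * L)" using homogeneous_mult[OF x(6) y(6)] .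
  moreover have "H * L \<notin> q" using q_prime x y by blast
  moreover have "G * L + K * H \<in> J" using x y J by blast
  ultimately show ?thesis using stI by metis
qed

lemma stalk_ideal_mult:
  assumes J: "\<And>x y. x \<in> J \<Longrightarrow> x * y \<in> J"
    and x: "x \<in> stalk_ideal q J" and y: "y \<in> stalk q"
  shows "x * y \<in> stalk_ideal q J"
proof -
  obtain d G H where x: "x = emb G / emb H" "G \<in> J" "H \<notin> q" "H \<noteq> 0" "homogeneous d G" "homogeneous d H"
    using x by (rule stE)
  obtain e K L where y: "y = emb K / emb L" "L \<notin> q" "L \<noteq> 0" "homogeneous e K" "homogeneous e L"
    using y by (rule stalkE)
  have "x * y = emb (G * K) / emb (H * L)"
    using x y by (simp add: rhomD[OF rhom_emb])
  moreover have "H * L \<notin> q" using q_prime x y by blast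
  moreover have "G * K \<in> J" using x J by blast
  ultimately show ?thesis using stI homogeneous_mult[OF x(5) y(4)] homogeneous_mult[OF x(6) y(5)] by metis
qed

text \<open>A fraction has many representations; primality of \<open>q\<close> makes membership of
  the numerator independent of the chosen one.\<close>

lemma max_iff:
  assumes "H \<notin> q" "homogeneous d G" "homogeneous d H"
  shows "emb G / emb H \<in> stalk_ideal q q \<longleftrightarrow> G \<in> q"
proof
  assume "emb G / emb H \<in> stalk_ideal q q"
  then obtain d K L where K: "emb G / emb H = emb K / emb L" "K \<in> q" "L \<notin> q" "L \<noteq> 0" by (rule stE)
  have "emb (G * L) = emb (K * H)" using K assms q_nonzero by (simp add: rhomD[OF rhom_emb] frac_eq_eq)
  then have "G * L = K * H" by (simp only: emb_eq_iff)
  then have "G * L \<in> q" using K(2) q_mult by simp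
  then show "G \<in> q" using K(3) q_prime by blast
next
  assume "G \<in> q"
  then show "emb G / emb H \<in> stalk_ideal q q" using assms stI by blast
qed

lemma local_subring_stalk: "local_subring ratfun_const (stalk q) (stalk_ideal q q)"
proof unfold_locales
  show one: "1 \<in> stalk q" using stalkI[OF q_one homogeneous_one homogeneous_one] by (simp add: rhomD[OF rhom_emb])
  show "x + y \<in> stalk q" "x * y \<in> stalk q" if "x \<in> stalk q" "y \<in> stalk q" for x y
    using that stalk_ideal_add[of UNIV x y] stalk_ideal_mult[of UNIV x y] by (auto simp: stalk_def)
  show "ratfun_const c \<in> stalk q" for c
    using stalkI[OF q_one homogeneous_const homogeneous_one] by (simp add: rhomD[OF rhom_emb] ratfun_const_emb)
  show "stalk_ideal q q \<subseteq> stalk q" by (rule stalk_sub)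
  show "0 \<in> stalk_ideal q q" using stI[OF q_zero q_one homogeneous_zero homogeneous_one] by (simp add: rhomD[OF rhom_emb])
  show "x + y \<in> stalk_ideal q q" if "x \<in> stalk_ideal q q" "y \<in> stalk_ideal q q" for x y
    using that q_add q_mult by (intro stalk_ideal_add)
  show "x * y \<in> stalk_ideal q q" if "x \<in> stalk_ideal q q" "y \<in> stalk q" for x y
    using that q_mult by (intro stalk_ideal_mult)
  show "1 \<notin> stalk_ideal q q"
    using max_iff[OF q_one homogeneous_one homogeneous_one] q_one by (simp add: rhomD[OF rhom_emb])
  show "inverse x \<in> stalk q" if x: "x \<in> stalk q" "x \<notin> stalk_ideal q q" for x
  proof -
    obtain d G H where r: "x = emb G / emb H" "H \<notin> q" "H \<noteq> 0" "homogeneous d G" "homogeneous d H"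
      using x(1) by (rule stalkE)
    then have "G \<notin> q" using max_iff x(2) by blast
    then have "emb H / emb G \<in> stalk q" using r stalkI by blast
    then show ?thesis using r by simp
  qed
qed

text \<open>Its powers serve as denominators of every degree at \<open>q\<close>, whether or not
  \<open>q\<close> is a rational point.\<close>

lemma linear_form_off: "\<exists>l. homogeneous (Suc 0) l \<and> l \<notin> q"
  using proj homogeneous_vars unfolding proj_point_def by blast

lemma stalk_unitI: "H \<notin> q \<Longrightarrow> G \<notin> q \<Longrightarrow> homogeneous d G \<Longrightarrow> homogeneous d H \<Longrightarrow> inverse (emb G / emb H) \<in> stalk q"
  using stalkI[of G d H] by simp

end

text \<open>The zero ideal is the generic point of the plane, so the function field is itself a
  stalk and inherits the closure properties from \<open>local_subring_stalk\<close>.\<close>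

lemma plane_point_zero: "plane_point {0}"
proof
  interpret R: cring "ring_of_type_algebra :: 'a form ring" by (rule cring_from_type_algebra)
  have z: "ideal {0 :: 'a form} ring_of_type_algebra" using R.zeroideal by simp
  have "primeideal {0 :: 'a form} ring_of_type_algebra"
  proof (rule primeidealI[OF z R.is_cring])
    have "(1 :: 'a form) \<noteq> 0" by simp
    then show "carrier ring_of_type_algebra \<noteq> {0 :: 'a form}" by (metis UNIV_I singletonD type_algebra_simps(1))
  qed simp
  moreover have "{0 :: 'a form} = genideal ring_of_type_algebra {G \<in> {0}. \<exists>d. homogeneous d G}"
  proof
    show "{0} \<subseteq> genideal ring_of_type_algebra {G \<in> {0 :: 'a form}. \<exists>d. homogeneous d G}"
      using R.genideal_self[of "{G \<in> {0 :: 'a form}. \<exists>d. homogeneous d G}"] homogeneous_zero by auto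
    show "genideal ring_of_type_algebra {G \<in> {0}. \<exists>d. homogeneous d G} \<subseteq> {0 :: 'a form}"
      by (rule R.genideal_minimal[OF z]) auto
  qed
  moreover have "\<not> {form_x, form_y, form_z} \<subseteq> {0 :: 'a form}" by (simp add: form_z_def)
  ultimately show "proj_point {0 :: 'a form}" unfolding proj_point_def by (intro conjI)
qed

lemmas funfield_local_subring = plane_point.local_subring_stalk[OF plane_point_zero, folded function_field_def]

lemma funfield_closed:
  "x \<in> function_field \<Longrightarrow> y \<in> function_field \<Longrightarrow> x + y \<in> function_field"
  "x \<in> function_field \<Longrightarrow> y \<in> function_field \<Longrightarrow> x - y \<in> function_field"
  "x \<in> function_field \<Longrightarrow> y \<in> function_field \<Longrightarrow> x * y \<in> function_field"
  "ratfun_const c \<in> function_field" "x \<in> function_field \<Longrightarrow> x ^ n \<in> function_field"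
  by (rule local_subring.O_add[OF funfield_local_subring]
      local_subring.O_diff[OF funfield_local_subring] local_subring.O_mult[OF funfield_local_subring]
      local_subring.O_h[OF funfield_local_subring] local_subring.O_power[OF funfield_local_subring]; assumption?)+

lemma funfield_inverse: "x \<in> function_field \<Longrightarrow> inverse x \<in> function_field"
proof -
  assume x: "x \<in> function_field"
  show ?thesis
  proof (cases "x \<in> stalk_ideal {0} {0}")
    case True
    then have "x = 0" by (rule plane_point.stE[OF plane_point_zero]) (simp add: rhomD[OF rhom_emb])
    then show ?thesis using x by simp
  next
    case False
    show ?thesis by (rule local_subring.O_unit[OF funfield_local_subring x False])
  qed
qed

lemma funfieldI: "homogeneous d G \<Longrightarrow> homogeneous d H \<Longrightarrow> H \<noteq> 0 \<Longrightarrow> emb G / emb H \<in> function_field"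
  unfolding function_field_def using plane_point.stalkI[OF plane_point_zero] by blast
lemma funfieldE:
  assumes "r \<in> function_field"
  obtains d G H where "r = emb G / emb H" "H \<noteq> 0" "homogeneous d G" "homogeneous d H"
  using assms unfolding function_field_def by (rule plane_point.stalkE[OF plane_point_zero]) blast

section \<open>Order along the curve\<close>

locale plane_curve =
  fixes F :: "'k::field form" and m :: nat
  assumes m_pos: "0 < m" and homF: "homogeneous m F" and primeF: "prime_elem F"
begin

lemma F_nz: "F \<noteq> 0" using primeF by auto
lemma F_dvd_mult: "F dvd G * H \<longleftrightarrow> F dvd G \<or> F dvd H" using primeF prime_elem_dvd_mult_iff by blast

lemma split_power:
  assumes "homogeneous d G" "G \<noteq> 0"
  shows "\<exists>i H. G = F ^ i * H \<and> \<not> F dvd H \<and> m * i \<le> d \<and> homogeneous (d - m * i) H"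
  using assms
proof (induction d arbitrary: G rule: less_induct)
  case (less d)
  show ?case
  proof (cases "F dvd G")
    case True
    then obtain G1 where G1: "G = F * G1" by (elim dvdE)
    then have "G1 \<noteq> 0" using less.prems by auto
    then have h: "m \<le> d" "homogeneous (d - m) G1"
      using homogeneous_cancel[OF homF F_nz, of d G1] less.prems G1 by auto
    then have "d - m < d" using m_pos by simp
    from less.IH[OF this h(2) \<open>G1 \<noteq> 0\<close>] obtain i H where
      iH: "G1 = F ^ i * H" "\<not> F dvd H" "m * i \<le> d - m" "homogeneous (d - m - m * i) H" by blast
    then show ?thesis using G1 h by (intro exI[of _ "Suc i"] exI[of _ H]) (auto simp: algebra_simps)
  next
    case False
    then show ?thesis using less.prems by (intro exI[of _ 0] exI[of _ G]) auto
  qed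
qed

text \<open>Two representations of one function yield an identity of forms, and comparing powers of
  the prime \<open>F\<close> in it shows that the difference of exponents is unique. So the
  description in \<open>curve_ord\<close> denotes something.\<close>

lemma curve_ord_eq:
  assumes G: "\<not> F dvd G" "\<not> F dvd H" and h: "homogeneous d (F ^ i * G)" "homogeneous d (F ^ j * H)"
    and r: "r = emb (F ^ i * G) / emb (F ^ j * H)"
  shows "curve_ord F r = int i - int j"
  unfolding curve_ord_def
proof (rule the_equality)
  have "H \<noteq> 0" using G by auto
  then have nz: "F ^ j * H \<noteq> 0" using F_nz by simp
  show "\<exists>i' j' G H d. \<not> F dvd G \<and> \<not> F dvd H \<and> homogeneous d (F ^ i' * G) \<and> homogeneous d (F ^ j' * H) \<and>
        r = Fract (F ^ i' * G) (F ^ j' * H) \<and> int i - int j = int i' - int j'"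
    using assms Fract_emb[OF nz] by metis
  fix n assume "\<exists>i j G H d. \<not> F dvd G \<and> \<not> F dvd H \<and> homogeneous d (F ^ i * G) \<and> homogeneous d (F ^ j * H) \<and>
        r = Fract (F ^ i * G) (F ^ j * H) \<and> n = int i - int j"
  then obtain i' j' G' H' where *: "\<not> F dvd G'" "\<not> F dvd H'" "r = Fract (F ^ i' * G') (F ^ j' * H')" "n = int i' - int j'"
    by blast
  have nz': "F ^ j' * H' \<noteq> 0" using * F_nz by auto
  have "emb (F ^ i * G) / emb (F ^ j * H) = emb (F ^ i' * G') / emb (F ^ j' * H')"
    using r *(3) Fract_emb[OF nz'] by simp
  moreover have "emb (F ^ j * H) \<noteq> 0" "emb (F ^ j' * H') \<noteq> 0" using nz nz' by (simp_all only: emb_0_iff not_False_eq_True)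
  ultimately have "emb (F ^ i * G) * emb (F ^ j' * H') = emb (F ^ i' * G') * emb (F ^ j * H)"
    by (simp only: frac_eq_eq not_False_eq_True)
  then have "emb ((F ^ i * G) * (F ^ j' * H')) = emb ((F ^ i' * G') * (F ^ j * H))"
    by (simp only: rhomD(2)[OF rhom_emb])
  then have e: "F ^ (i + j') * (G * H') = F ^ (i' + j) * (G' * H)"
    unfolding emb_eq_iff by (simp add: power_add mult_ac)
  have nd: "\<not> F dvd G * H'" "\<not> F dvd G' * H" using F_dvd_mult G * by auto
  have "i + j' = i' + j"
  proof (rule ccontr)
    assume "i + j' \<noteq> i' + j"
    then consider k where "i + j' = i' + j + Suc k" | k where "i' + j = i + j' + Suc k"
      by (metis add.commute add_Suc_right less_iff_Suc_add nat_neq_iff)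
    then show False
    proof cases
      case 1
      then have "F ^ (i' + j) * (F * F ^ k * (G * H')) = F ^ (i' + j) * (G' * H)"
        using e by (simp add: power_add mult_ac)
      then have "F * (F ^ k * (G * H')) = G' * H" using F_nz by (simp add: mult_ac)
      then show False using nd by (metis dvd_triv_left)
    next
      case 2
      then have "F ^ (i + j') * (G * H') = F ^ (i + j') * (F * F ^ k * (G' * H))"
        using e by (simp add: power_add mult_ac)
      then have "G * H' = F * (F ^ k * (G' * H))" using F_nz by (simp add: mult_ac)
      then show False using nd by (metis dvd_triv_left)
    qed
  qed
  then show "n = int i - int j" using *(4) by linarith
qed

end

locale curve_point = plane_curve F m + plane_point q for F :: "'k::field form" and m :: nat and q :: "'k form set" +
  fixes f :: "'k ratfun"
  assumes F_q: "F \<in> q" and local_eq: "local_equation F q f"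
begin

interpretation A: local_subring ratfun_const "stalk q" "stalk_ideal q q" by (rule local_subring_stalk)

definition fO :: "'k ratfun set" where "fO = stalk_ideal q (curve_ideal F)"

lemma f_O: "f \<in> stalk q" using local_eq by (simp add: local_equation_def)

lemma fO_eq: "fO = {f * x | x. x \<in> stalk q}"
  using local_eq unfolding local_equation_def fO_def cgenideal_def stalk_ring_def
  by (auto simp: mult.commute)

lemma quot_in_fO:
  assumes "H \<notin> q" "homogeneous d G" "homogeneous d H"
  shows "emb G / emb H \<in> fO \<longleftrightarrow> F dvd G"
proof
  assume "emb G / emb H \<in> fO"
  then obtain d K L where K: "emb G / emb H = emb K / emb L" "K \<in> curve_ideal F" "L \<notin> q" "L \<noteq> 0"
    unfolding fO_def by (rule stE)
  have "emb (G * L) = emb (K * H)" using K assms q_nonzero by (simp add: rhomD[OF rhom_emb] frac_eq_eq)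
  then have "G * L = K * H" by (simp only: emb_eq_iff)
  then have "F dvd G * L" using K by (simp add: curve_ideal_def)
  moreover have "\<not> F dvd L" using K F_q q_mult by (metis dvdE)
  ultimately show "F dvd G" using F_dvd_mult by blast
next
  assume "F dvd G"
  then show "emb G / emb H \<in> fO" unfolding fO_def using assms by (intro stI) (auto simp: curve_ideal_def)
qed

lemma f_nz: "f \<noteq> 0"
proof
  assume f0: "f = 0"
  obtain l where l: "homogeneous (Suc 0) l" "l \<notin> q" using linear_form_off by blast
  have "emb F / emb (l ^ m) \<in> fO"
    using quot_in_fO[of "l ^ m" m F] homogeneous_power1[OF l(1)] homF l(2) q_power by auto
  then have "emb F / emb (l ^ m) = 0" by (auto simp: fO_eq f0)
  then show False using F_nz q_nonzero[OF l(2)] by simp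
qed

lemma fO_I: "x \<in> stalk q \<Longrightarrow> f * x \<in> fO" by (auto simp: fO_eq)
lemma fO_mult: "x \<in> fO \<Longrightarrow> y \<in> stalk q \<Longrightarrow> x * y \<in> fO"
  unfolding fO_eq using A.O_mult by (auto simp: mult.assoc)

lemma fO_prime:
  assumes "x \<in> stalk q" "y \<in> stalk q" "x * y \<in> fO"
  shows "x \<in> fO \<or> y \<in> fO"
proof -
  obtain d G H where x: "x = emb G / emb H" "H \<notin> q" "H \<noteq> 0" "homogeneous d G" "homogeneous d H"
    using assms(1) by (rule stalkE)
  obtain e K L where y: "y = emb K / emb L" "L \<notin> q" "L \<noteq> 0" "homogeneous e K" "homogeneous e L"
    using assms(2) by (rule stalkE)
  have "x * y = emb (G * K) / emb (H * L)" using x y by (simp add: rhomD[OF rhom_emb])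
  moreover have "H * L \<notin> q" using x y q_prime by blast
  ultimately have "F dvd G * K"
    using assms(3) quot_in_fO[OF _ homogeneous_mult[OF x(4) y(4)] homogeneous_mult[OF x(5) y(5)]] by simp
  then show ?thesis using F_dvd_mult quot_in_fO x y by auto
qed

lemma f_m: "f \<in> stalk_ideal q q"
proof (rule ccontr)
  assume "f \<notin> stalk_ideal q q"
  then have "inverse f \<in> stalk q" using A.O_unit f_O by blast
  then have "1 \<in> fO" using fO_I[of "inverse f"] f_nz by simp
  then have "F dvd 1" using quot_in_fO[OF q_one homogeneous_one homogeneous_one] by (simp add: rhomD[OF rhom_emb])
  then show False using primeF prime_elem_not_unit by blast
qed

lemma unit_not_fO: "x \<in> stalk q \<Longrightarrow> inverse x \<in> stalk q \<Longrightarrow> x \<noteq> 0 \<Longrightarrow> y \<in> stalk q \<Longrightarrow> y \<notin> fO \<Longrightarrow> y * x \<notin> fO"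
  using fO_mult[of "y * x" "inverse x"] by (auto simp: mult.assoc)

text \<open>\<open>F / l ^ m\<close> and \<open>f\<close> generate the same ideal, so each is a
  multiple of the other and the cofactors are mutually inverse. This links an arbitrary local
  equation with the form \<open>F\<close>.\<close>

lemma curve_equation_unit:
  assumes "homogeneous (Suc 0) l" "l \<notin> q"
  obtains w where "w \<in> stalk q" "inverse w \<in> stalk q" "w \<noteq> 0" "emb F / emb (l ^ m) = f * w"
proof -
  have lm: "l ^ m \<notin> q" using assms q_power by blast
  have "emb F / emb (l ^ m) \<in> fO" using quot_in_fO[OF lm homF homogeneous_power1[OF assms(1)]] by simp
  then obtain w where w: "w \<in> stalk q" "emb F / emb (l ^ m) = f * w" by (auto simp: fO_eq)
  have "f \<in> fO" using fO_I[OF A.O_one] by simp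
  then obtain d G H where G: "f = emb G / emb H" "G \<in> curve_ideal F" "H \<notin> q" "H \<noteq> 0" "homogeneous d G" "homogeneous d H"
    unfolding fO_def by (rule stE)
  then obtain G' where G': "G = F * G'" by (auto simp: curve_ideal_def)
  have "G' \<noteq> 0" using G G' f_nz by (auto simp: rhomD[OF rhom_emb])
  then have hG': "m \<le> d" "homogeneous (d - m) G'" using homogeneous_cancel[OF homF F_nz, of d G'] G G' by auto
  define v where "v = emb (l ^ m * G') / emb H"
  have v: "v \<in> stalk q" unfolding v_def
    using homogeneous_mult[OF homogeneous_power1[OF assms(1), of m] hG'(2)] hG'(1) G by (intro stalkI[of H d]) auto
  have "f = emb F / emb (l ^ m) * v"
    using G(1) G' q_nonzero[OF assms(2)] by (simp add: v_def rhomD[OF rhom_emb])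
  then have "f * 1 = f * (w * v)" using w by (simp add: mult.assoc)
  then have wv: "w * v = 1" using f_nz by (metis mult_left_cancel)
  then have "w \<noteq> 0" "inverse w = v" by (auto simp: inverse_unique)
  then show ?thesis using that w v by blast
qed

text \<open>Numerator and denominator are stripped of their powers of \<open>F\<close> and divided
  by powers of a linear form off \<open>q\<close>. Replacing \<open>F / l ^ m\<close> by
  \<open>f\<close> costs units, which are absorbed in \<open>a\<close> and \<open>b\<close>. So the
  order along the curve can be read off in the local ring of any of its points.\<close>

lemma ord_decomposition:
  assumes r: "r \<in> function_field" "r \<noteq> 0"
  obtains N a b where "a \<in> stalk q" "b \<in> stalk q" "a \<notin> fO" "b \<notin> fO" "r = f powi N * a / b" "curve_ord F r = N"
proof -
  obtain d G H where G: "r = emb G / emb H" "H \<noteq> 0" "homogeneous d G" "homogeneous d H"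
    using r(1) by (rule funfieldE)
  have "G \<noteq> 0" using r(2) G by (auto simp: rhomD[OF rhom_emb])
  obtain i G' where G': "G = F ^ i * G'" "\<not> F dvd G'" "m * i \<le> d" "homogeneous (d - m * i) G'"
    using split_power[OF G(3) \<open>G \<noteq> 0\<close>] by blast
  obtain j H' where H': "H = F ^ j * H'" "\<not> F dvd H'" "m * j \<le> d" "homogeneous (d - m * j) H'"
    using split_power[OF G(4) G(2)] by blast
  obtain l where l: "homogeneous (Suc 0) l" "l \<notin> q" using linear_form_off by blast
  obtain w where w: "w \<in> stalk q" "inverse w \<in> stalk q" "w \<noteq> 0" "emb F / emb (l ^ m) = f * w"
    using curve_equation_unit[OF l] .
  have ln: "l ^ n \<notin> q" for n using l q_power by blast
  have l0: "emb l \<noteq> 0" using q_nonzero[OF l(2)] by simp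
  define a0 where "a0 = emb G' / emb (l ^ (d - m * i))"
  define b0 where "b0 = emb H' / emb (l ^ (d - m * j))"
  have ab0: "a0 \<in> stalk q" "b0 \<in> stalk q" "a0 \<notin> fO" "b0 \<notin> fO"
    unfolding a0_def b0_def
    using stalkI[OF ln G'(4) homogeneous_power1[OF l(1)]] stalkI[OF ln H'(4) homogeneous_power1[OF l(1)]]
      quot_in_fO[OF ln G'(4) homogeneous_power1[OF l(1)]] quot_in_fO[OF ln H'(4) homogeneous_power1[OF l(1)]] G'(2) H'(2) by auto
  have num: "emb G = emb l ^ d * ((f * w) ^ i * a0)"
  proof -
    have "emb l ^ d = emb l ^ (m * i) * emb l ^ (d - m * i)" using G'(3) by (simp flip: power_add)
    then show ?thesis using l0 unfolding w(4)[symmetric] a0_def G'(1)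
      by (simp add: rhomD[OF rhom_emb] power_divide power_mult)
  qed
  have den: "emb H = emb l ^ d * ((f * w) ^ j * b0)"
  proof -
    have "emb l ^ d = emb l ^ (m * j) * emb l ^ (d - m * j)" using H'(3) by (simp flip: power_add)
    then show ?thesis using l0 unfolding w(4)[symmetric] b0_def H'(1)
      by (simp add: rhomD[OF rhom_emb] power_divide power_mult)
  qed
  have bnz: "b0 \<noteq> 0" using ab0(4) fO_I[OF A.O_zero] by auto
  have wi: "w ^ k \<in> stalk q" "inverse (w ^ k) \<in> stalk q" "w ^ k \<noteq> 0" for k
    using w A.O_power[OF w(1)] A.O_power[OF w(2)] by (simp_all add: power_inverse)
  define a where "a = a0 * w ^ i"
  define b where "b = b0 * w ^ j"
  have ab: "a \<in> stalk q" "b \<in> stalk q" "a \<notin> fO" "b \<notin> fO" unfolding a_def b_def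
    using A.O_mult[OF ab0(1) wi(1)] A.O_mult[OF ab0(2) wi(1)] unit_not_fO[OF wi ab0(1,3)] unit_not_fO[OF wi ab0(2,4)] by auto
  have "r = (f ^ i * a) / (f ^ j * b)" unfolding G(1) num den a_def b_def
    using l0 by (simp add: power_mult_distrib mult_ac)
  also have "\<dots> = f powi (int i - int j) * a / b"
    using f_nz by (simp add: power_int_diff)
  finally have re: "r = f powi (int i - int j) * a / b" .
  have "curve_ord F r = int i - int j"
    using G G' H' by (intro curve_ord_eq[of G' H' d]) auto
  then show ?thesis using that[OF ab re] by blast
qed

lemma funfield_quot:
  assumes r: "r \<in> function_field"
  obtains a b where "a \<in> stalk q" "b \<in> stalk q" "b \<noteq> 0" "r = a / b"
proof -
  obtain d G H where G: "r = emb G / emb H" "H \<noteq> 0" "homogeneous d G" "homogeneous d H"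
    using r(1) by (rule funfieldE)
  obtain l where l: "homogeneous (Suc 0) l" "l \<notin> q" using linear_form_off by blast
  have ln: "l ^ d \<notin> q" using l q_power by blast
  show ?thesis
  proof (rule that)
    show "emb G / emb (l ^ d) \<in> stalk q" "emb H / emb (l ^ d) \<in> stalk q"
      using stalkI[OF ln _ homogeneous_power1[OF l(1)]] G by auto
    show "emb H / emb (l ^ d) \<noteq> 0" using G(2) q_nonzero[OF ln] by simp
    show "r = emb G / emb (l ^ d) / (emb H / emb (l ^ d))" using G q_nonzero[OF ln] by simp
  qed
qed

lemma stalk_funfield: "a \<in> stalk q \<Longrightarrow> a \<in> function_field"
  by (erule stalkE) (auto intro: funfieldI)

end

section \<open>Completion along a principal ideal\<close>

lemma (in cring) add_minus_add:
  assumes "a \<in> carrier R" "b \<in> carrier R" "c \<in> carrier R"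
  shows "(a \<oplus> b) \<ominus> (a \<oplus> c) = b \<ominus> c"
proof -
  have "(a \<oplus> b) \<ominus> (a \<oplus> c) = (b \<oplus> a) \<oplus> (\<ominus> a \<oplus> \<ominus> c)"
    using assms by (simp only: minus_eq minus_add a_comm[of a b])
  also have "\<dots> = b \<oplus> (a \<oplus> (\<ominus> a \<oplus> \<ominus> c))" using assms by (intro a_assoc) simp_all
  also have "a \<oplus> (\<ominus> a \<oplus> \<ominus> c) = \<ominus> c" using assms by (simp add: r_neg2)
  finally show ?thesis by (simp only: minus_eq)
qed

lemma (in cring) ideal_pow_PIdl:
  assumes f: "f \<in> carrier R"
  shows "ideal_pow R (PIdl f) n = PIdl (f [^] n)"
proof (induction n)
  case 0
  have "x \<in> PIdl \<one>" if "x \<in> carrier R" for x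
    using r_one[OF that] that unfolding cgenideal_def by (metis (mono_tags, lifting) mem_Collect_eq)
  then show ?case using cgenideal_ideal[OF one_closed] ideal.Icarr by fastforce
next
  case (Suc n)
  have "z \<in> PIdl (f [^] Suc n)" if "z \<in> ideal_prod R (PIdl (f [^] n)) (PIdl f)" for z
    using that
  proof induction
    case (prod i j)
    then obtain x y where "x \<in> carrier R" "y \<in> carrier R" "i = x \<otimes> f [^] n" "j = y \<otimes> f"
      by (auto simp: cgenideal_def)
    then have "i \<otimes> j = (x \<otimes> y) \<otimes> f [^] Suc n" "x \<otimes> y \<in> carrier R" using f by (simp_all add: m_ac)
    then show ?case unfolding cgenideal_def by blast
  next
    case (sum s1 s2)
    then show ?case
      using additive_subgroup.a_closed[OF ideal.axioms(1)[OF cgenideal_ideal], of "f [^] Suc n"] f by simp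
  qed
  moreover have "z \<in> ideal_prod R (PIdl (f [^] n)) (PIdl f)" if z: "z \<in> PIdl (f [^] Suc n)" for z
  proof -
    obtain x where x: "x \<in> carrier R" "z = x \<otimes> f [^] Suc n" using z by (auto simp: cgenideal_def)
    then have "z = (x \<otimes> f [^] n) \<otimes> f" using f by (simp add: m_assoc)
    moreover have "x \<otimes> f [^] n \<in> PIdl (f [^] n)" using x unfolding cgenideal_def by blast
    ultimately show ?thesis using ideal_prod.prod cgenideal_self[OF f] by metis
  qed
  ultimately show ?case using Suc by auto
qed

locale principal_adic = cring R for R (structure) +
  fixes f assumes f_carr [simp]: "f \<in> carrier R"
begin

sublocale adic R "PIdl f"
  by (intro adic.intro is_cring cgenideal_ideal f_carr)

lemma Pw_iff: "x \<in> Pw n \<longleftrightarrow> (\<exists>y\<in>carrier R. x = f [^] n \<otimes> y)"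
proof -
  have "x \<in> Pw n \<longleftrightarrow> (\<exists>y. x = y \<otimes> f [^] n \<and> y \<in> carrier R)"
    unfolding ideal_pow_PIdl[OF f_carr] unfolding cgenideal_def by (rule mem_Collect_eq)
  also have "\<dots> \<longleftrightarrow> (\<exists>y\<in>carrier R. x = f [^] n \<otimes> y)"
    using m_comm[OF nat_pow_closed[OF f_carr]] by metis
  finally show ?thesis .
qed

lemma Pw_I: "y \<in> carrier R \<Longrightarrow> f [^] n \<otimes> y \<in> Pw n"
  unfolding Pw_iff by blast

lemma toc_pow: "a \<in> carrier R \<Longrightarrow> toc a [^]\<^bsub>C\<^esub> (n::nat) = toc (a [^] n)"
  by (induction n) auto

text \<open>In this generality \<open>f\<close> may be a zero divisor, so the quotient is not found
  by cancelling. It is summed up from the differences of entries beyond index \<open>n\<close>, each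
  of which is visibly a multiple of the \<open>n\<close>-th power of \<open>f\<close>.\<close>

lemma cls_multiple:
  assumes x: "coh x" and z: "x n \<in> Pw n"
  shows "\<exists>\<beta>\<in>carrier C. cls x = toc f [^]\<^bsub>C\<^esub> n \<otimes>\<^bsub>C\<^esub> \<beta>"
proof -
  obtain y0 where y0: "y0 \<in> carrier R" "x n = f [^] n \<otimes> y0" using z Pw_iff by blast
  have "\<exists>w\<in>carrier R. x (n + Suc k) \<ominus> x (n + k) = f [^] (n + k) \<otimes> w" for k
    using cohD(2)[OF x, of "n + k"] Pw_iff by simp
  then obtain w where w: "\<And>k. w k \<in> carrier R" "\<And>k. x (n + Suc k) \<ominus> x (n + k) = f [^] (n + k) \<otimes> w k"
    by metis
  define y where "y = rec_nat y0 (\<lambda>k v. f [^] k \<otimes> w k \<oplus> v)"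
  have yS: "y (Suc k) = f [^] k \<otimes> w k \<oplus> y k" for k by (simp add: y_def)
  have yc: "y k \<in> carrier R" for k by (induction k) (auto simp: y_def y0 w)
  have xc: "x k \<in> carrier R" for k using cohD[OF x] by simp
  have e: "x (n + k) = f [^] n \<otimes> y k" for k
  proof (induction k)
    case 0
    then show ?case using y0 by (simp add: y_def)
  next
    case (Suc k)
    have "x (n + Suc k) = (x (n + Suc k) \<ominus> x (n + k)) \<oplus> x (n + k)"
      using xc by (simp add: minus_eq a_assoc l_neg)
    also have "\<dots> = f [^] (n + k) \<otimes> w k \<oplus> x (n + k)" by (simp only: w(2))
    also have "\<dots> = f [^] (n + k) \<otimes> w k \<oplus> f [^] n \<otimes> y k" by (simp only: Suc)
    also have "\<dots> = f [^] n \<otimes> y (Suc k)"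
      using w yc by (simp add: yS r_distr nat_pow_mult[symmetric] m_assoc)
    finally show ?case .
  qed
  have cy: "coh y" unfolding coh_def
  proof (intro allI conjI yc)
    fix k
    have "y (Suc k) \<ominus> y k = f [^] k \<otimes> w k" using yc w by (simp add: yS minus_eq a_assoc r_neg)
    then show "y (Suc k) \<ominus> y k \<in> Pw k" using w Pw_I by simp
  qed
  have "toc f [^]\<^bsub>C\<^esub> n \<otimes>\<^bsub>C\<^esub> cls y = cls (\<lambda>k. f [^] n \<otimes> y k)"
    using cy by (simp only: toc_pow f_carr) (simp add: toc_eq coh_const)
  also have "\<dots> = cls x"
  proof (subst cls_eq_iff)
    show "coh (\<lambda>k. f [^] n \<otimes> y k)" using coh_mult[OF coh_const cy] by simp
    show "coh x" by fact
    show "\<forall>k. f [^] n \<otimes> y k \<ominus> x k \<in> Pw k"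
      unfolding e[symmetric] using coh_le[OF x] by simp
  qed
  finally show ?thesis using cy by (intro bexI[of _ "cls y"]) auto
qed

text \<open>The limit is a diagonal sequence. That it approximates the given elements requires
  reading divisibility by the \<open>k\<close>-th power of \<open>f\<close> from the
  \<open>k\<close>-th entry alone, which is \<open>cls_multiple\<close>.\<close>

lemma C_complete:
  assumes \<eta>: "\<And>k. \<eta> k \<in> carrier C"
    and d: "\<And>k. \<exists>x\<in>carrier C. \<eta> (Suc k) \<ominus>\<^bsub>C\<^esub> \<eta> k = toc f [^]\<^bsub>C\<^esub> (k::nat) \<otimes>\<^bsub>C\<^esub> x"
  shows "\<exists>\<eta>'\<in>carrier C. \<forall>k. \<exists>y\<in>carrier C. \<eta>' \<ominus>\<^bsub>C\<^esub> \<eta> k = toc f [^]\<^bsub>C\<^esub> k \<otimes>\<^bsub>C\<^esub> y"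
proof -
  have "\<exists>e. coh e \<and> \<eta> k = cls e" for k using \<eta>[of k] by (auto elim: C_E)
  then obtain e where e: "\<And>k. coh (e k)" "\<And>k. \<eta> k = cls (e k)" by metis
  have ec: "e k n \<in> carrier R" for k n using cohD[OF e(1)] by simp
  have step: "e (Suc k) n \<ominus> e k n \<in> Pw n" if "n \<le> k" for k n
  proof -
    obtain x where x: "x \<in> carrier C" "\<eta> (Suc k) \<ominus>\<^bsub>C\<^esub> \<eta> k = toc f [^]\<^bsub>C\<^esub> k \<otimes>\<^bsub>C\<^esub> x" using d by blast
    obtain v where v: "coh v" "x = cls v" using x(1) by (rule C_E)
    have "cls (\<lambda>n. e (Suc k) n \<ominus> e k n) = cls (\<lambda>n. f [^] k \<otimes> v n)"
    proof -
      have "toc f [^]\<^bsub>C\<^esub> k \<otimes>\<^bsub>C\<^esub> x = cls (\<lambda>n. f [^] k \<otimes> v n)"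
        unfolding toc_pow[OF f_carr] v(2) using v(1) by (simp add: toc_eq coh_const)
      then show ?thesis using x(2) e(2) C_minus[OF e(1) e(1)] by simp
    qed
    then have "e (Suc k) n \<ominus> e k n \<ominus> f [^] k \<otimes> v n \<in> Pw n"
      using cls_eq_iff[of "\<lambda>n. e (Suc k) n \<ominus> e k n" "\<lambda>n. f [^] k \<otimes> v n"] C_minus[OF e(1) e(1)]
        coh_mult[OF coh_const v(1)] by simp
    moreover have "f [^] k \<otimes> v n \<in> Pw n" using Pw_I cohD[OF v(1)] Pw_mono[OF that] by blast
    ultimately have "(e (Suc k) n \<ominus> e k n \<ominus> f [^] k \<otimes> v n) \<oplus> f [^] k \<otimes> v n \<in> Pw n" by (rule Pw_add)
    then show ?thesis using ec cohD[OF v(1)] by (simp add: minus_eq a_assoc l_neg)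
  qed
  define g where "g n = e n n" for n
  have "coh g" unfolding coh_def g_def
  proof (intro allI conjI ec)
    fix n
    have "(e (Suc n) (Suc n) \<ominus> e (Suc n) n) \<oplus> (e (Suc n) n \<ominus> e n n) \<in> Pw n"
      using cohD(2)[OF e(1)] step[of n n] by (intro Pw_add) auto
    then show "e (Suc n) (Suc n) \<ominus> e n n \<in> Pw n" using ec by (simp add: diff_tel)
  qed
  moreover have "\<exists>y\<in>carrier C. cls g \<ominus>\<^bsub>C\<^esub> \<eta> k = toc f [^]\<^bsub>C\<^esub> k \<otimes>\<^bsub>C\<^esub> y" for k
  proof -
    have "g k \<ominus> e k k \<in> Pw k" unfolding g_def using ec by (simp add: minus_eq r_neg Pw_zero)
    then show ?thesis using cls_multiple[of "\<lambda>n. g n \<ominus> e k n" k] C_minus[OF \<open>coh g\<close> e(1)] e(2) by simp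
  qed
  ultimately show ?thesis by blast
qed

end

section \<open>The tower of completions and localizations\<close>

text \<open>Only membership of \<open>f\<close> in the local ring is assumed, so that the same
  construction serves at the flex and away from it.\<close>

locale tower = plane_point q for q :: "'k::field form set" +
  fixes f :: "'k ratfun"
  assumes f_stalk: "f \<in> stalk q"
begin

interpretation A: local_subring ratfun_const "stalk q" "stalk_ideal q q" by (rule local_subring_stalk)

lemma completed_eq: "completed_stalk q = A.C"
  by (simp add: completed_stalk_def stalk_ring_def)
lemma to_hat_eq: "to_hat q = A.toc"
  by (simp add: to_hat_def stalk_ring_def)

lemma hat_cring: "cring (completed_stalk q)" unfolding completed_eq by (rule A.C_cring)

interpretation Ch: cring "completed_stalk q" by (rule hat_cring)

lemma hat_carr [simp, intro]: "a \<in> stalk q \<Longrightarrow> to_hat q a \<in> carrier (completed_stalk q)"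
  unfolding completed_eq to_hat_eq by (rule A.toc_carr) simp
lemma hat_add: "a \<in> stalk q \<Longrightarrow> b \<in> stalk q \<Longrightarrow> to_hat q (a + b) = to_hat q a \<oplus>\<^bsub>completed_stalk q\<^esub> to_hat q b"
  unfolding completed_eq to_hat_eq using A.toc_add[of a b] by simp
lemma hat_mult: "a \<in> stalk q \<Longrightarrow> b \<in> stalk q \<Longrightarrow> to_hat q (a * b) = to_hat q a \<otimes>\<^bsub>completed_stalk q\<^esub> to_hat q b"
  unfolding completed_eq to_hat_eq using A.toc_mult[of a b] by simp
lemma hat_one: "to_hat q 1 = \<one>\<^bsub>completed_stalk q\<^esub>"
  unfolding completed_eq to_hat_eq using A.toc_one by simp

lemma off_curve_mult_system: "mult_system (completed_stalk q) (off_curve q f)"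
proof
  let ?P = "minimal_prime_over (completed_stalk q) (cgenideal (completed_stalk q) (to_hat q f))"
  have P: "primeideal P (completed_stalk q)" if "?P P" for P
    using that by (simp add: minimal_prime_over_def)
  show "off_curve q f \<subseteq> carrier (completed_stalk q)" by (auto simp: off_curve_def)
  show "\<one>\<^bsub>completed_stalk q\<^esub> \<in> off_curve q f"
    using primeideal.I_notcarr[OF P] ideal.one_imp_carrier[OF primeideal.axioms(1)[OF P]] by (auto simp: off_curve_def)
  fix s t assume s: "s \<in> off_curve q f" "t \<in> off_curve q f"
  then have c: "s \<in> carrier (completed_stalk q)" "t \<in> carrier (completed_stalk q)" by (auto simp: off_curve_def)
  have "s \<otimes>\<^bsub>completed_stalk q\<^esub> t \<notin> P" if "?P P" for P
    using primeideal.I_prime[OF P[OF that] c] s that by (auto simp: off_curve_def)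
  then show "s \<otimes>\<^bsub>completed_stalk q\<^esub> t \<in> off_curve q f" using c by (auto simp: off_curve_def)
qed

interpretation S: mult_system "completed_stalk q" "off_curve q f" by (rule off_curve_mult_system)

abbreviation "fl \<equiv> to_loc (completed_stalk q) (off_curve q f) (to_hat q f)"

lemma principal_adic_loc: "principal_adic (curve_loc q f) fl"
  unfolding curve_loc_def using S.tol_carr[OF hat_carr[OF f_stalk]]
  by (intro principal_adic.intro principal_adic_axioms.intro S.L_cring)

interpretation OK: principal_adic "curve_loc q f" fl by (rule principal_adic_loc)

lemma OK_eq: "OK_ring q f = OK.C" by (simp add: OK_ring_def curve_loc_ideal_def)
lemma hat_to_OK_eq: "hat_to_OK q f \<alpha> = OK.toc (S.tol \<alpha>)" by (simp add: hat_to_OK_def curve_loc_ideal_def)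
lemma OK_cring: "cring (OK_ring q f)" unfolding OK_eq by (rule OK.C_cring)

interpretation OKr: cring "OK_ring q f" by (rule OK_cring)

lemma tol_loc: "a \<in> carrier (completed_stalk q) \<Longrightarrow> S.tol a \<in> carrier (curve_loc q f)"
  unfolding curve_loc_def by simp

lemma hO_carr [simp, intro]: "\<alpha> \<in> carrier (completed_stalk q) \<Longrightarrow> hat_to_OK q f \<alpha> \<in> carrier (OK_ring q f)"
  unfolding OK_eq hat_to_OK_eq by (intro OK.toc_carr tol_loc)
lemma hO_add: "\<alpha> \<in> carrier (completed_stalk q) \<Longrightarrow> \<beta> \<in> carrier (completed_stalk q) \<Longrightarrow>
  hat_to_OK q f (\<alpha> \<oplus>\<^bsub>completed_stalk q\<^esub> \<beta>) = hat_to_OK q f \<alpha> \<oplus>\<^bsub>OK_ring q f\<^esub> hat_to_OK q f \<beta>"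
  unfolding OK_eq hat_to_OK_eq using S.tol_add[folded curve_loc_def] OK.toc_add tol_loc by simp
lemma hO_mult: "\<alpha> \<in> carrier (completed_stalk q) \<Longrightarrow> \<beta> \<in> carrier (completed_stalk q) \<Longrightarrow>
  hat_to_OK q f (\<alpha> \<otimes>\<^bsub>completed_stalk q\<^esub> \<beta>) = hat_to_OK q f \<alpha> \<otimes>\<^bsub>OK_ring q f\<^esub> hat_to_OK q f \<beta>"
  unfolding OK_eq hat_to_OK_eq using S.tol_mult[folded curve_loc_def] OK.toc_mult tol_loc by simp
lemma hO_one: "hat_to_OK q f \<one>\<^bsub>completed_stalk q\<^esub> = \<one>\<^bsub>OK_ring q f\<^esub>"
  unfolding OK_eq hat_to_OK_eq using S.tol_one[folded curve_loc_def] OK.toc_one by simp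

abbreviation "fh \<equiv> hat_to_OK q f (to_hat q f)"

lemma fh_eq: "fh = OK.toc fl" by (simp add: hat_to_OK_eq)
lemma fh_carr [simp, intro]: "fh \<in> carrier (OK_ring q f)" using f_stalk by blast

lemma OK_powers_mult_system: "mult_system (OK_ring q f) (OK_powers q f)"
  unfolding OK_powers_def by (rule OKr.powers_mult_system) simp

interpretation K: mult_system "OK_ring q f" "OK_powers q f" by (rule OK_powers_mult_system)

lemma K_eq: "K_ring q f = K.L" by (simp add: K_ring_def)
lemma K_cring: "cring (K_ring q f)" unfolding K_eq by (rule K.L_cring)

interpretation KK: cring "K_ring q f" by (rule K_cring)

abbreviation "j \<equiv> OK_to_K q f"
abbreviation "\<iota> \<equiv> stalk_to_K q f"

lemma j_carr [simp, intro]: "\<xi> \<in> carrier (OK_ring q f) \<Longrightarrow> j \<xi> \<in> carrier (K_ring q f)"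
  unfolding OK_to_K_def K_eq by (rule K.tol_carr)
lemma j_add: "\<xi> \<in> carrier (OK_ring q f) \<Longrightarrow> \<zeta> \<in> carrier (OK_ring q f) \<Longrightarrow> j (\<xi> \<oplus>\<^bsub>OK_ring q f\<^esub> \<zeta>) = j \<xi> \<oplus>\<^bsub>K_ring q f\<^esub> j \<zeta>"
  unfolding OK_to_K_def K_eq by (rule K.tol_add)
lemma j_mult: "\<xi> \<in> carrier (OK_ring q f) \<Longrightarrow> \<zeta> \<in> carrier (OK_ring q f) \<Longrightarrow> j (\<xi> \<otimes>\<^bsub>OK_ring q f\<^esub> \<zeta>) = j \<xi> \<otimes>\<^bsub>K_ring q f\<^esub> j \<zeta>"
  unfolding OK_to_K_def K_eq by (rule K.tol_mult)
lemma j_one: "j \<one>\<^bsub>OK_ring q f\<^esub> = \<one>\<^bsub>K_ring q f\<^esub>"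
  unfolding OK_to_K_def K_eq by (rule K.tol_one)
lemma j_zero: "j \<zero>\<^bsub>OK_ring q f\<^esub> = \<zero>\<^bsub>K_ring q f\<^esub>"
  unfolding OK_to_K_def K_eq by (rule K.tol_zero)
lemma j_pow: "\<xi> \<in> carrier (OK_ring q f) \<Longrightarrow> j (\<xi> [^]\<^bsub>OK_ring q f\<^esub> (n::nat)) = j \<xi> [^]\<^bsub>K_ring q f\<^esub> n"
  by (induction n) (auto simp: j_one j_mult)
lemma j_uminus: "\<xi> \<in> carrier (OK_ring q f) \<Longrightarrow> j (\<ominus>\<^bsub>OK_ring q f\<^esub> \<xi>) = \<ominus>\<^bsub>K_ring q f\<^esub> j \<xi>"
  using j_add[of "\<ominus>\<^bsub>OK_ring q f\<^esub> \<xi>" \<xi>] KK.minus_equality[of "j (\<ominus>\<^bsub>OK_ring q f\<^esub> \<xi>)" "j \<xi>"]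
  by (simp add: OKr.l_neg j_zero)
lemma j_minus: "\<xi> \<in> carrier (OK_ring q f) \<Longrightarrow> \<zeta> \<in> carrier (OK_ring q f) \<Longrightarrow> j (\<xi> \<ominus>\<^bsub>OK_ring q f\<^esub> \<zeta>) = j \<xi> \<ominus>\<^bsub>K_ring q f\<^esub> j \<zeta>"
  by (simp add: OKr.minus_eq KK.minus_eq j_add j_uminus)

lemma iota_eq: "\<iota> a = j (hat_to_OK q f (to_hat q a))" by (simp add: stalk_to_K_def hat_to_K_def)
lemma iota_carr [simp, intro]: "a \<in> stalk q \<Longrightarrow> \<iota> a \<in> carrier (K_ring q f)" by (auto simp: iota_eq)
lemma iota_add: "a \<in> stalk q \<Longrightarrow> b \<in> stalk q \<Longrightarrow> \<iota> (a + b) = \<iota> a \<oplus>\<^bsub>K_ring q f\<^esub> \<iota> b"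
  by (simp add: iota_eq hat_add hO_add j_add)
lemma iota_mult: "a \<in> stalk q \<Longrightarrow> b \<in> stalk q \<Longrightarrow> \<iota> (a * b) = \<iota> a \<otimes>\<^bsub>K_ring q f\<^esub> \<iota> b"
  by (simp add: iota_eq hat_mult hO_mult j_mult)
lemma iota_one: "\<iota> 1 = \<one>\<^bsub>K_ring q f\<^esub>"
  by (simp add: iota_eq hat_one hO_one j_one)
lemma iota_pow: "a \<in> stalk q \<Longrightarrow> \<iota> (a ^ n) = \<iota> a [^]\<^bsub>K_ring q f\<^esub> n"
  by (induction n) (auto simp: iota_one iota_mult A.O_power KK.m_comm)
lemma iota_f: "\<iota> f = j fh" by (simp add: iota_eq)

lemma fh_pow_mem: "fh [^]\<^bsub>OK_ring q f\<^esub> (n::nat) \<in> OK_powers q f"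
  by (simp add: OK_powers_def powers_def)

lemma iota_f_pow_frac:
  fixes n :: nat
  assumes "\<xi> \<in> carrier (OK_ring q f)"
  shows "\<iota> f [^]\<^bsub>K_ring q f\<^esub> n \<otimes>\<^bsub>K_ring q f\<^esub> frac (OK_ring q f) (OK_powers q f) \<xi> (fh [^]\<^bsub>OK_ring q f\<^esub> n) = j \<xi>"
proof -
  let ?s = "fh [^]\<^bsub>OK_ring q f\<^esub> n"
  have "frac (OK_ring q f) (OK_powers q f) \<xi> ?s = j \<xi> \<otimes>\<^bsub>K_ring q f\<^esub> frac (OK_ring q f) (OK_powers q f) \<one>\<^bsub>OK_ring q f\<^esub> ?s"
    unfolding OK_to_K_def K_eq by (rule K.frac_eq[OF assms fh_pow_mem])
  moreover have "j ?s \<otimes>\<^bsub>K_ring q f\<^esub> frac (OK_ring q f) (OK_powers q f) \<one>\<^bsub>OK_ring q f\<^esub> ?s = \<one>\<^bsub>K_ring q f\<^esub>"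
    unfolding OK_to_K_def K_eq by (rule K.tol_unit[OF fh_pow_mem])
  moreover have "frac (OK_ring q f) (OK_powers q f) \<one>\<^bsub>OK_ring q f\<^esub> ?s \<in> carrier (K_ring q f)"
    unfolding K_eq by (intro K.frac_in_L fh_pow_mem) simp
  moreover have "\<iota> f [^]\<^bsub>K_ring q f\<^esub> n = j ?s" by (simp add: iota_f j_pow)
  ultimately show ?thesis using assms by (simp add: KK.m_lcomm)
qed

text \<open>The neighbourhoods of zero that define \<open>K_converges\<close>: the image of the
  \<open>N\<close>-th power of \<open>f\<close> times \<open>OK_ring q f\<close>.\<close>

definition Fil :: "nat \<Rightarrow> 'k localfield \<Rightarrow> bool" where
  "Fil N \<kappa> \<longleftrightarrow> (\<exists>\<xi>\<in>carrier (OK_ring q f). \<kappa> = j ((fh [^]\<^bsub>OK_ring q f\<^esub> N) \<otimes>\<^bsub>OK_ring q f\<^esub> \<xi>))"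

lemma Fil_carr: "Fil N \<kappa> \<Longrightarrow> \<kappa> \<in> carrier (K_ring q f)" by (auto simp: Fil_def)
lemma Fil_I: "\<xi> \<in> carrier (OK_ring q f) \<Longrightarrow> Fil N (\<iota> f [^]\<^bsub>K_ring q f\<^esub> N \<otimes>\<^bsub>K_ring q f\<^esub> j \<xi>)"
  unfolding Fil_def by (intro bexI[of _ \<xi>]) (simp_all add: j_mult j_pow iota_f)
lemma Fil_add: "Fil N \<kappa> \<Longrightarrow> Fil N \<kappa>' \<Longrightarrow> Fil N (\<kappa> \<oplus>\<^bsub>K_ring q f\<^esub> \<kappa>')"
  unfolding Fil_def
proof safe
  fix \<xi> \<zeta> assume c: "\<xi> \<in> carrier (OK_ring q f)" "\<zeta> \<in> carrier (OK_ring q f)"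
  then show "\<exists>\<chi>\<in>carrier (OK_ring q f). j (fh [^]\<^bsub>OK_ring q f\<^esub> N \<otimes>\<^bsub>OK_ring q f\<^esub> \<xi>) \<oplus>\<^bsub>K_ring q f\<^esub>
     j (fh [^]\<^bsub>OK_ring q f\<^esub> N \<otimes>\<^bsub>OK_ring q f\<^esub> \<zeta>) = j (fh [^]\<^bsub>OK_ring q f\<^esub> N \<otimes>\<^bsub>OK_ring q f\<^esub> \<chi>)"
    by (intro bexI[of _ "\<xi> \<oplus>\<^bsub>OK_ring q f\<^esub> \<zeta>"]) (simp_all add: OKr.r_distr j_add)
qed
lemma Fil_uminus: "Fil N \<kappa> \<Longrightarrow> Fil N (\<ominus>\<^bsub>K_ring q f\<^esub> \<kappa>)"
  unfolding Fil_def
proof safe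
  fix \<xi> assume c: "\<xi> \<in> carrier (OK_ring q f)"
  then show "\<exists>\<chi>\<in>carrier (OK_ring q f). \<ominus>\<^bsub>K_ring q f\<^esub> j (fh [^]\<^bsub>OK_ring q f\<^esub> N \<otimes>\<^bsub>OK_ring q f\<^esub> \<xi>) = j (fh [^]\<^bsub>OK_ring q f\<^esub> N \<otimes>\<^bsub>OK_ring q f\<^esub> \<chi>)"
    by (intro bexI[of _ "\<ominus>\<^bsub>OK_ring q f\<^esub> \<xi>"]) (simp_all add: OKr.r_minus j_uminus)
qed
lemma Fil_minus: "Fil N \<kappa> \<Longrightarrow> Fil N \<kappa>' \<Longrightarrow> Fil N (\<kappa> \<ominus>\<^bsub>K_ring q f\<^esub> \<kappa>')"
  by (simp add: KK.minus_eq Fil_add Fil_uminus)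
lemma Fil_zero: "Fil N \<zero>\<^bsub>K_ring q f\<^esub>"
  unfolding Fil_def by (intro bexI[of _ "\<zero>\<^bsub>OK_ring q f\<^esub>"]) (simp_all add: j_zero)

lemma K_converges_Fil: "K_converges q f s \<kappa> \<longleftrightarrow> (\<forall>N. \<exists>n0. \<forall>n\<ge>n0. Fil N (s n \<ominus>\<^bsub>K_ring q f\<^esub> \<kappa>))"
  by (simp add: K_converges_def Fil_def)

text \<open>Along a subsequence the increments lie in growing powers of \<open>f\<close> times
  \<open>OK_ring q f\<close>, and that ring is complete by \<open>C_complete\<close>. The first term
  may have a denominator, so it is kept apart and added at the end.\<close>

lemma K_complete:
  assumes s: "\<And>n. s n \<in> carrier (K_ring q f)"
    and cauchy: "\<And>N. \<exists>n0. \<forall>i\<ge>n0. \<forall>j\<ge>n0. Fil N (s i \<ominus>\<^bsub>K_ring q f\<^esub> s j)"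
  shows "\<exists>\<kappa>\<in>carrier (K_ring q f). K_converges q f s \<kappa>"
proof -
  obtain n0 where n0: "\<And>N i j. i \<ge> n0 N \<Longrightarrow> j \<ge> n0 N \<Longrightarrow> Fil N (s i \<ominus>\<^bsub>K_ring q f\<^esub> s j)"
    using cauchy by metis
  \<comment> \<open>The thresholds for the single accuracies need not increase; their running
    maximum does.\<close>
  define nn where "nn k = Max (n0 ` {..k})" for k
  have nn: "n0 l \<le> nn k" if "l \<le> k" for l k unfolding nn_def using that by (intro Max_ge) auto
  have "\<exists>x\<in>carrier (OK_ring q f). s (nn (Suc k)) \<ominus>\<^bsub>K_ring q f\<^esub> s (nn k) = j ((fh [^]\<^bsub>OK_ring q f\<^esub> k) \<otimes>\<^bsub>OK_ring q f\<^esub> x)" for k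
    using n0[of k "nn (Suc k)" "nn k"] nn[of k "Suc k"] nn[of k k] by (simp add: Fil_def)
  then obtain x where x: "\<And>k. x k \<in> carrier (OK_ring q f)"
    "\<And>k. s (nn (Suc k)) \<ominus>\<^bsub>K_ring q f\<^esub> s (nn k) = j ((fh [^]\<^bsub>OK_ring q f\<^esub> k) \<otimes>\<^bsub>OK_ring q f\<^esub> x k)" by metis
  define \<eta> where "\<eta> = rec_nat \<zero>\<^bsub>OK_ring q f\<^esub> (\<lambda>k v. ((fh [^]\<^bsub>OK_ring q f\<^esub> k) \<otimes>\<^bsub>OK_ring q f\<^esub> x k) \<oplus>\<^bsub>OK_ring q f\<^esub> v)"
  have \<eta>S: "\<eta> (Suc k) = ((fh [^]\<^bsub>OK_ring q f\<^esub> k) \<otimes>\<^bsub>OK_ring q f\<^esub> x k) \<oplus>\<^bsub>OK_ring q f\<^esub> \<eta> k" and \<eta>0: "\<eta> 0 = \<zero>\<^bsub>OK_ring q f\<^esub>" for k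
    by (simp_all add: \<eta>_def)
  have \<eta>c: "\<eta> k \<in> carrier (OK_ring q f)" for k by (induction k) (auto simp: \<eta>S \<eta>0 x)
  have "\<eta> (Suc k) \<ominus>\<^bsub>OK_ring q f\<^esub> \<eta> k = (fh [^]\<^bsub>OK_ring q f\<^esub> k) \<otimes>\<^bsub>OK_ring q f\<^esub> x k" for k
    using \<eta>c x by (simp add: \<eta>S OKr.minus_eq OKr.a_assoc OKr.r_neg)
  then have "\<exists>\<eta>'\<in>carrier (OK_ring q f). \<forall>k. \<exists>y\<in>carrier (OK_ring q f). \<eta>' \<ominus>\<^bsub>OK_ring q f\<^esub> \<eta> k = fh [^]\<^bsub>OK_ring q f\<^esub> k \<otimes>\<^bsub>OK_ring q f\<^esub> y"
    using OK.C_complete[of \<eta>] \<eta>c x(1) unfolding OK_eq fh_eq by metis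
  then obtain \<eta>' where \<eta>': "\<eta>' \<in> carrier (OK_ring q f)"
    "\<And>k. \<exists>y\<in>carrier (OK_ring q f). \<eta>' \<ominus>\<^bsub>OK_ring q f\<^esub> \<eta> k = fh [^]\<^bsub>OK_ring q f\<^esub> k \<otimes>\<^bsub>OK_ring q f\<^esub> y" by blast
  have se: "s (nn k) = s (nn 0) \<oplus>\<^bsub>K_ring q f\<^esub> j (\<eta> k)" for k
  proof (induction k)
    case 0
    then show ?case using s by (simp add: \<eta>0 j_zero)
  next
    case (Suc k)
    have "s (nn (Suc k)) = (s (nn (Suc k)) \<ominus>\<^bsub>K_ring q f\<^esub> s (nn k)) \<oplus>\<^bsub>K_ring q f\<^esub> s (nn k)"
      using s by (simp add: KK.minus_eq KK.a_assoc KK.l_neg)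
    also have "\<dots> = j ((fh [^]\<^bsub>OK_ring q f\<^esub> k) \<otimes>\<^bsub>OK_ring q f\<^esub> x k) \<oplus>\<^bsub>K_ring q f\<^esub> s (nn k)"
      by (simp only: x(2))
    also have "\<dots> = j ((fh [^]\<^bsub>OK_ring q f\<^esub> k) \<otimes>\<^bsub>OK_ring q f\<^esub> x k) \<oplus>\<^bsub>K_ring q f\<^esub> (s (nn 0) \<oplus>\<^bsub>K_ring q f\<^esub> j (\<eta> k))"
      by (simp only: Suc)
    also have "\<dots> = s (nn 0) \<oplus>\<^bsub>K_ring q f\<^esub> j (\<eta> (Suc k))"
      using s x \<eta>c by (simp add: \<eta>S j_add KK.a_lcomm)
    finally show ?case .
  qed
  define \<kappa> where "\<kappa> = s (nn 0) \<oplus>\<^bsub>K_ring q f\<^esub> j \<eta>'"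
  have \<kappa>c: "\<kappa> \<in> carrier (K_ring q f)" using s \<eta>' by (simp add: \<kappa>_def)
  have lim: "Fil N (\<kappa> \<ominus>\<^bsub>K_ring q f\<^esub> s (nn N))" for N
  proof -
    obtain y where y: "y \<in> carrier (OK_ring q f)" "\<eta>' \<ominus>\<^bsub>OK_ring q f\<^esub> \<eta> N = fh [^]\<^bsub>OK_ring q f\<^esub> N \<otimes>\<^bsub>OK_ring q f\<^esub> y"
      using \<eta>'(2) by blast
    have "\<kappa> \<ominus>\<^bsub>K_ring q f\<^esub> s (nn N) = j \<eta>' \<ominus>\<^bsub>K_ring q f\<^esub> j (\<eta> N)"
    proof -
      have c: "s (nn 0) \<in> carrier (K_ring q f)" "j \<eta>' \<in> carrier (K_ring q f)" "j (\<eta> N) \<in> carrier (K_ring q f)"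
        using s \<eta>' \<eta>c by auto
      show ?thesis unfolding \<kappa>_def se[of N] by (rule KK.add_minus_add[OF c])
    qed
    then show ?thesis using y \<eta>' \<eta>c unfolding Fil_def by (metis j_minus)
  qed
  have "Fil N (s i \<ominus>\<^bsub>K_ring q f\<^esub> \<kappa>)" if "i \<ge> nn N" for i N
  proof -
    have "n0 N \<le> i" using nn[of N N] that by simp
    then have "Fil N (s i \<ominus>\<^bsub>K_ring q f\<^esub> s (nn N))" using n0 nn[of N N] by blast
    then have "Fil N ((s i \<ominus>\<^bsub>K_ring q f\<^esub> s (nn N)) \<ominus>\<^bsub>K_ring q f\<^esub> (\<kappa> \<ominus>\<^bsub>K_ring q f\<^esub> s (nn N)))"
      using lim Fil_minus by blast
    moreover have "(s i \<ominus>\<^bsub>K_ring q f\<^esub> s (nn N)) \<ominus>\<^bsub>K_ring q f\<^esub> (\<kappa> \<ominus>\<^bsub>K_ring q f\<^esub> s (nn N)) = s i \<ominus>\<^bsub>K_ring q f\<^esub> \<kappa>"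
    proof -
      have "\<ominus>\<^bsub>K_ring q f\<^esub> (\<kappa> \<ominus>\<^bsub>K_ring q f\<^esub> s (nn N)) = s (nn N) \<ominus>\<^bsub>K_ring q f\<^esub> \<kappa>"
        using s[of "nn N"] \<kappa>c by (simp add: KK.minus_eq KK.minus_add KK.a_comm)
      then have "(s i \<ominus>\<^bsub>K_ring q f\<^esub> s (nn N)) \<ominus>\<^bsub>K_ring q f\<^esub> (\<kappa> \<ominus>\<^bsub>K_ring q f\<^esub> s (nn N)) =
          (s i \<ominus>\<^bsub>K_ring q f\<^esub> s (nn N)) \<oplus>\<^bsub>K_ring q f\<^esub> (s (nn N) \<ominus>\<^bsub>K_ring q f\<^esub> \<kappa>)"
        by (simp only: KK.minus_eq[of "s i \<ominus>\<^bsub>K_ring q f\<^esub> s (nn N)"])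
      also have "\<dots> = s i \<ominus>\<^bsub>K_ring q f\<^esub> \<kappa>" by (rule KK.diff_tel[OF s s \<kappa>c])
      finally show ?thesis .
    qed
    ultimately show ?thesis by simp
  qed
  then show ?thesis unfolding K_converges_Fil using \<kappa>c by blast
qed

end

section \<open>The function field inside the local fields\<close>

lemma (in cring) unit_cancel:
  assumes "u \<in> carrier R" "g \<in> carrier R" "u \<otimes> g = \<one>" "x \<in> carrier R" "y \<in> carrier R" "u \<otimes> x = u \<otimes> y"
  shows "x = y"
proof -
  have "x = (u \<otimes> g) \<otimes> x" using assms by simp
  also have "\<dots> = g \<otimes> (u \<otimes> x)" using assms(1,2,4) by (simp add: m_ac)
  also have "\<dots> = g \<otimes> (u \<otimes> y)" by (simp only: assms(6))
  also have "\<dots> = (u \<otimes> g) \<otimes> y" using assms(1,2,5) by (simp add: m_ac)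
  also have "\<dots> = y" using assms by simp
  finally show ?thesis .
qed

context tower
begin

interpretation A: local_subring ratfun_const "stalk q" "stalk_ideal q q" by (rule local_subring_stalk)
interpretation KK: cring "K_ring q f" by (rule K_cring)
interpretation OKr: cring "OK_ring q f" by (rule OK_cring)
interpretation Ch: cring "completed_stalk q" by (rule hat_cring)
interpretation K: mult_system "OK_ring q f" "OK_powers q f" by (rule OK_powers_mult_system)

lemma iota_zero: "\<iota> 0 = \<zero>\<^bsub>K_ring q f\<^esub>"
proof -
  have c: "\<iota> 0 \<in> carrier (K_ring q f)" using A.O_zero by blast
  have "\<zero>\<^bsub>K_ring q f\<^esub> = (\<iota> 0 \<oplus>\<^bsub>K_ring q f\<^esub> \<iota> 0) \<ominus>\<^bsub>K_ring q f\<^esub> \<iota> 0"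
    using iota_add[OF A.O_zero A.O_zero] c by (simp add: KK.minus_eq KK.r_neg)
  also have "\<dots> = \<iota> 0" using c by (simp add: KK.minus_eq KK.a_assoc KK.r_neg)
  finally show ?thesis by (rule sym)
qed

lemma iota_f_pow_unit: "\<exists>g\<in>carrier (K_ring q f). \<iota> f [^]\<^bsub>K_ring q f\<^esub> (n::nat) \<otimes>\<^bsub>K_ring q f\<^esub> g = \<one>\<^bsub>K_ring q f\<^esub>"
proof
  show "frac (OK_ring q f) (OK_powers q f) \<one>\<^bsub>OK_ring q f\<^esub> (fh [^]\<^bsub>OK_ring q f\<^esub> n) \<in> carrier (K_ring q f)"
    unfolding K_eq by (intro K.frac_in_L fh_pow_mem) simp
  show "\<iota> f [^]\<^bsub>K_ring q f\<^esub> n \<otimes>\<^bsub>K_ring q f\<^esub> frac (OK_ring q f) (OK_powers q f) \<one>\<^bsub>OK_ring q f\<^esub> (fh [^]\<^bsub>OK_ring q f\<^esub> n) = \<one>\<^bsub>K_ring q f\<^esub>"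
    using iota_f_pow_frac[OF OKr.one_closed, of n] by (simp add: j_one)
qed

lemma B_to_K_frac:
  assumes \<alpha>: "\<alpha> \<in> carrier (completed_stalk q)"
  shows "B_to_K q f (frac (completed_stalk q) (powers (completed_stalk q) (to_hat q f)) \<alpha> (to_hat q f [^]\<^bsub>completed_stalk q\<^esub> (n::nat)))
    = frac (OK_ring q f) (OK_powers q f) (hat_to_OK q f \<alpha>) (fh [^]\<^bsub>OK_ring q f\<^esub> n)"
proof -
  let ?P = "powers (completed_stalk q) (to_hat q f)"
  have fc: "to_hat q f \<in> carrier (completed_stalk q)" using f_stalk by blast
  interpret P: mult_system "completed_stalk q" ?P by (rule Ch.powers_mult_system[OF fc])
  have pw: "hat_to_OK q f (to_hat q f [^]\<^bsub>completed_stalk q\<^esub> k) = fh [^]\<^bsub>OK_ring q f\<^esub> k" for k :: nat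
    using fc by (induction k) (auto simp: hO_one hO_mult)
  have mem: "to_hat q f [^]\<^bsub>completed_stalk q\<^esub> k \<in> ?P" for k :: nat by (simp add: powers_def)
  let ?A = "frac (completed_stalk q) ?P \<alpha> (to_hat q f [^]\<^bsub>completed_stalk q\<^esub> n)"
  have eq: "frac (OK_ring q f) (OK_powers q f) (hat_to_OK q f \<beta>) (hat_to_OK q f \<sigma>) =
      frac (OK_ring q f) (OK_powers q f) (hat_to_OK q f \<alpha>) (fh [^]\<^bsub>OK_ring q f\<^esub> n)" if m: "(\<beta>, \<sigma>) \<in> ?A" for \<beta> \<sigma>
  proof -
    obtain w where w: "\<beta> \<in> carrier (completed_stalk q)" "\<sigma> \<in> ?P" "w \<in> ?P"
      "w \<otimes>\<^bsub>completed_stalk q\<^esub> (\<alpha> \<otimes>\<^bsub>completed_stalk q\<^esub> \<sigma>) = w \<otimes>\<^bsub>completed_stalk q\<^esub> (\<beta> \<otimes>\<^bsub>completed_stalk q\<^esub> (to_hat q f [^]\<^bsub>completed_stalk q\<^esub> n))"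
      using m P.mem_frac[OF \<alpha> mem] by blast
    obtain k l :: nat where kl: "\<sigma> = to_hat q f [^]\<^bsub>completed_stalk q\<^esub> k" "w = to_hat q f [^]\<^bsub>completed_stalk q\<^esub> l"
      using w(2,3) by (auto simp: powers_def)
    have "hat_to_OK q f (w \<otimes>\<^bsub>completed_stalk q\<^esub> (\<alpha> \<otimes>\<^bsub>completed_stalk q\<^esub> \<sigma>)) =
        hat_to_OK q f (w \<otimes>\<^bsub>completed_stalk q\<^esub> (\<beta> \<otimes>\<^bsub>completed_stalk q\<^esub> (to_hat q f [^]\<^bsub>completed_stalk q\<^esub> n)))"
      using w(4) by simp
    then have "fh [^]\<^bsub>OK_ring q f\<^esub> l \<otimes>\<^bsub>OK_ring q f\<^esub> (hat_to_OK q f \<beta> \<otimes>\<^bsub>OK_ring q f\<^esub> fh [^]\<^bsub>OK_ring q f\<^esub> n) =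
       fh [^]\<^bsub>OK_ring q f\<^esub> l \<otimes>\<^bsub>OK_ring q f\<^esub> (hat_to_OK q f \<alpha> \<otimes>\<^bsub>OK_ring q f\<^esub> fh [^]\<^bsub>OK_ring q f\<^esub> k)"
      using \<alpha> w(1) fc unfolding kl by (simp add: hO_mult pw)
    then show ?thesis unfolding kl pw
      using \<alpha> w(1) fh_pow_mem by (subst K.frac_eq_iff) auto
  qed
  have "(\<alpha>, to_hat q f [^]\<^bsub>completed_stalk q\<^esub> n) \<in> ?A" by (rule P.frac_self[OF \<alpha> mem])
  then show ?thesis unfolding B_to_K_def using eq by fast
qed

text \<open>Powers of \<open>f\<close> are invertible in \<open>K_ring q f\<close>, so a fraction
  can be tested by clearing its denominator. Later arguments use only this form, in which
  \<open>B_ring\<close> no longer occurs on the right.\<close>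

lemma B_image_iff:
  "\<kappa> \<in> B_to_K q f ` carrier (B_ring q f) \<longleftrightarrow> \<kappa> \<in> carrier (K_ring q f) \<and>
     (\<exists>n::nat. \<exists>\<alpha>\<in>carrier (completed_stalk q). \<iota> f [^]\<^bsub>K_ring q f\<^esub> n \<otimes>\<^bsub>K_ring q f\<^esub> \<kappa> = j (hat_to_OK q f \<alpha>))"
    (is "?L \<longleftrightarrow> ?R")
proof -
  have fc: "to_hat q f \<in> carrier (completed_stalk q)" using f_stalk by blast
  interpret P: mult_system "completed_stalk q" "powers (completed_stalk q) (to_hat q f)"
    by (rule Ch.powers_mult_system[OF fc])
  have fr: "frac (OK_ring q f) (OK_powers q f) (hat_to_OK q f \<alpha>) (fh [^]\<^bsub>OK_ring q f\<^esub> (n::nat)) \<in> carrier (K_ring q f)"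
    if "\<alpha> \<in> carrier (completed_stalk q)" for \<alpha> n
    unfolding K_eq using that by (intro K.frac_in_L fh_pow_mem) auto
  show ?thesis
  proof
    assume ?L
    then obtain A where A: "A \<in> carrier (B_ring q f)" "\<kappa> = B_to_K q f A" by blast
    have "A \<in> carrier P.L" using A(1) by (simp add: B_ring_def)
    then obtain \<alpha> \<sigma> where as: "\<alpha> \<in> carrier (completed_stalk q)" "\<sigma> \<in> powers (completed_stalk q) (to_hat q f)"
      "A = P.fr \<alpha> \<sigma>" by (rule P.L_E)
    obtain n :: nat where "\<sigma> = to_hat q f [^]\<^bsub>completed_stalk q\<^esub> n" using as(2) by (auto simp: powers_def)
    with as have \<alpha>: "\<alpha> \<in> carrier (completed_stalk q)"
      "A = P.fr \<alpha> (to_hat q f [^]\<^bsub>completed_stalk q\<^esub> n)" by simp_all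
    have k: "\<kappa> = frac (OK_ring q f) (OK_powers q f) (hat_to_OK q f \<alpha>) (fh [^]\<^bsub>OK_ring q f\<^esub> n)"
      unfolding A(2) \<alpha>(2) by (rule B_to_K_frac[OF \<alpha>(1)])
    show ?R
    proof (intro conjI exI[of _ n] bexI[of _ \<alpha>] \<alpha>(1))
      show "\<kappa> \<in> carrier (K_ring q f)" unfolding k by (rule fr[OF \<alpha>(1)])
      show "\<iota> f [^]\<^bsub>K_ring q f\<^esub> n \<otimes>\<^bsub>K_ring q f\<^esub> \<kappa> = j (hat_to_OK q f \<alpha>)"
        unfolding k by (rule iota_f_pow_frac[OF hO_carr[OF \<alpha>(1)]])
    qed
  next
    assume ?R
    then obtain n :: nat and \<alpha> where \<alpha>: "\<kappa> \<in> carrier (K_ring q f)" "\<alpha> \<in> carrier (completed_stalk q)"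
      "\<iota> f [^]\<^bsub>K_ring q f\<^esub> n \<otimes>\<^bsub>K_ring q f\<^esub> \<kappa> = j (hat_to_OK q f \<alpha>)" by blast
    obtain g where g: "g \<in> carrier (K_ring q f)" "\<iota> f [^]\<^bsub>K_ring q f\<^esub> n \<otimes>\<^bsub>K_ring q f\<^esub> g = \<one>\<^bsub>K_ring q f\<^esub>"
      using iota_f_pow_unit by blast
    have "\<kappa> = frac (OK_ring q f) (OK_powers q f) (hat_to_OK q f \<alpha>) (fh [^]\<^bsub>OK_ring q f\<^esub> n)"
      using \<alpha> iota_f_pow_frac[OF hO_carr[OF \<alpha>(2)], of n] f_stalk
      by (intro KK.unit_cancel[OF _ g _ fr]) auto
    then have "\<kappa> = B_to_K q f (frac (completed_stalk q) (powers (completed_stalk q) (to_hat q f)) \<alpha> (to_hat q f [^]\<^bsub>completed_stalk q\<^esub> n))"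
      using B_to_K_frac[OF \<alpha>(2)] by simp
    moreover have "frac (completed_stalk q) (powers (completed_stalk q) (to_hat q f)) \<alpha> (to_hat q f [^]\<^bsub>completed_stalk q\<^esub> n) \<in> carrier (B_ring q f)"
      unfolding B_ring_def using \<alpha> by (intro P.frac_in_L) (auto simp: powers_def)
    ultimately show ?L by blast
  qed
qed

end

lemma curve_ord_ge_zero: "curve_ord_ge F N 0" by (simp add: curve_ord_ge_def)

text \<open>What gives \<open>funfield_to_K\<close> and \<open>K_C_to_K\<close> a meaning: the first
  assumption makes nonzero elements of the local ring invertible in the local field, the second
  makes limits unique.\<close>

locale good_point = curve_point F m q f + tower q f
  for F :: "'k::field form" and m :: nat and q :: "'k form set" and f :: "'k ratfun" +
  assumes off_fO_unit: "b \<in> stalk q \<Longrightarrow> b \<notin> fO \<Longrightarrow> \<exists>\<xi>\<in>carrier (OK_ring q f). \<iota> b \<otimes>\<^bsub>K_ring q f\<^esub> j \<xi> = \<one>\<^bsub>K_ring q f\<^esub>"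
    and Fil_separated: "(\<And>N. Fil N \<kappa>) \<Longrightarrow> \<kappa> = \<zero>\<^bsub>K_ring q f\<^esub>"
begin

interpretation A: local_subring ratfun_const "stalk q" "stalk_ideal q q" by (rule local_subring_stalk)
interpretation KK: cring "K_ring q f" by (rule K_cring)
interpretation OKr: cring "OK_ring q f" by (rule OK_cring)

abbreviation "K' \<equiv> K_ring q f"
abbreviation "\<phi> \<equiv> funfield_to_K q f"

text \<open>\<open>ord_decomposition\<close> leaves a power of \<open>f\<close>, invertible by
  construction, and elements outside the ideal of the curve, invertible by assumption. Its exponent
  comes without a sign, hence the two cases.\<close>

lemma iota_unit:
  assumes b: "b \<in> stalk q" "b \<noteq> 0"
  shows "\<exists>g\<in>carrier K'. \<iota> b \<otimes>\<^bsub>K'\<^esub> g = \<one>\<^bsub>K'\<^esub>"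
proof -
  obtain N a c where ac: "a \<in> stalk q" "c \<in> stalk q" "a \<notin> fO" "c \<notin> fO" "b = f powi N * a / c"
    using ord_decomposition[OF stalk_funfield[OF b(1)] b(2)] by metis
  have c0: "c \<noteq> 0" using ac fO_I[OF A.O_zero] by auto
  obtain \<xi> where \<xi>: "\<xi> \<in> carrier (OK_ring q f)" "\<iota> a \<otimes>\<^bsub>K'\<^esub> j \<xi> = \<one>\<^bsub>K'\<^esub>" using off_fO_unit[OF ac(1,3)] by blast
  define n where "n = nat \<bar>N\<bar>"
  obtain g where g: "g \<in> carrier K'" "\<iota> f [^]\<^bsub>K'\<^esub> n \<otimes>\<^bsub>K'\<^esub> g = \<one>\<^bsub>K'\<^esub>" using iota_f_pow_unit by blast
  note cl = f_stalk ac(1,2) b(1) \<xi>(1) g(1) A.O_power A.O_mult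
  show ?thesis
  proof (cases "N \<ge> 0")
    case True
    then have "c * b = f ^ n * a" using ac(5) c0 by (simp add: n_def power_int_def)
    then have "\<iota> c \<otimes>\<^bsub>K'\<^esub> \<iota> b = \<iota> f [^]\<^bsub>K'\<^esub> n \<otimes>\<^bsub>K'\<^esub> \<iota> a"
      using cl by (metis iota_mult iota_pow)
    then have "\<iota> b \<otimes>\<^bsub>K'\<^esub> (\<iota> c \<otimes>\<^bsub>K'\<^esub> (g \<otimes>\<^bsub>K'\<^esub> j \<xi>)) = (\<iota> f [^]\<^bsub>K'\<^esub> n \<otimes>\<^bsub>K'\<^esub> \<iota> a) \<otimes>\<^bsub>K'\<^esub> (g \<otimes>\<^bsub>K'\<^esub> j \<xi>)"
      using cl by (metis KK.m_assoc KK.m_comm KK.m_closed iota_carr j_carr)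
    also have "\<dots> = (\<iota> f [^]\<^bsub>K'\<^esub> n \<otimes>\<^bsub>K'\<^esub> g) \<otimes>\<^bsub>K'\<^esub> (\<iota> a \<otimes>\<^bsub>K'\<^esub> j \<xi>)"
      using cl by (simp add: KK.m_ac)
    also have "\<dots> = \<one>\<^bsub>K'\<^esub>" using g \<xi> by simp
    finally show ?thesis using cl by (intro bexI[of _ "\<iota> c \<otimes>\<^bsub>K'\<^esub> (g \<otimes>\<^bsub>K'\<^esub> j \<xi>)"]) auto
  next
    case False
    then have "(c * f ^ n) * b = a" using ac(5) c0 f_nz by (simp add: n_def power_int_def field_simps)
    then have "\<iota> (c * f ^ n) \<otimes>\<^bsub>K'\<^esub> \<iota> b = \<iota> a" using cl by (metis iota_mult)
    then have "\<iota> b \<otimes>\<^bsub>K'\<^esub> (\<iota> (c * f ^ n) \<otimes>\<^bsub>K'\<^esub> j \<xi>) = \<one>\<^bsub>K'\<^esub>"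
      using cl \<xi>(2) by (metis KK.m_assoc KK.m_comm iota_carr j_carr)
    then show ?thesis using cl by (intro bexI[of _ "\<iota> (c * f ^ n) \<otimes>\<^bsub>K'\<^esub> j \<xi>"]) auto
  qed
qed

lemma iota_cancel:
  assumes "b \<in> stalk q" "b \<noteq> 0" "x \<in> carrier K'" "y \<in> carrier K'" "\<iota> b \<otimes>\<^bsub>K'\<^esub> x = \<iota> b \<otimes>\<^bsub>K'\<^esub> y"
  shows "x = y"
  using iota_unit[OF assms(1,2)] KK.unit_cancel[of "\<iota> b"] assms by blast

text \<open>One pair \<open>a\<close>, \<open>b\<close> suffices: any other pair gives a
  proportional equation, and images of nonzero elements cancel. So the description in
  \<open>funfield_to_K\<close> has exactly one solution.\<close>

lemma phi_eqI:
  assumes a: "a \<in> stalk q" "b \<in> stalk q" "b \<noteq> 0" and \<kappa>: "\<kappa> \<in> carrier K'" "\<iota> b \<otimes>\<^bsub>K'\<^esub> \<kappa> = \<iota> a" and r: "r = a / b"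
  shows "\<phi> r = \<kappa>"
  unfolding funfield_to_K_def
proof (rule the_equality)
  show "\<kappa> \<in> carrier K' \<and> (\<forall>a\<in>stalk q. \<forall>b\<in>stalk q. b \<noteq> 0 \<and> r = a / b \<longrightarrow> \<iota> b \<otimes>\<^bsub>K'\<^esub> \<kappa> = \<iota> a)"
  proof (intro conjI ballI impI \<kappa>(1))
    fix a' b' assume a': "a' \<in> stalk q" "b' \<in> stalk q" "b' \<noteq> 0 \<and> r = a' / b'"
    then have e: "b' * a = b * a'" using r a by (simp add: field_simps)
    have "\<iota> b \<otimes>\<^bsub>K'\<^esub> (\<iota> b' \<otimes>\<^bsub>K'\<^esub> \<kappa>) = \<iota> b' \<otimes>\<^bsub>K'\<^esub> (\<iota> b \<otimes>\<^bsub>K'\<^esub> \<kappa>)"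
      by (rule KK.m_lcomm) (use a a' \<kappa>(1) in auto)
    also have "\<dots> = \<iota> b' \<otimes>\<^bsub>K'\<^esub> \<iota> a" by (simp only: \<kappa>(2))
    also have "\<dots> = \<iota> b \<otimes>\<^bsub>K'\<^esub> \<iota> a'" by (simp only: iota_mult[OF a'(2) a(1), symmetric] iota_mult[OF a(2) a'(1), symmetric] e)
    finally show "\<iota> b' \<otimes>\<^bsub>K'\<^esub> \<kappa> = \<iota> a'"
      by (rule iota_cancel[of b, rotated -1]) (use a a' \<kappa>(1) in auto)
  qed
next
  fix \<kappa>' assume "\<kappa>' \<in> carrier K' \<and> (\<forall>a\<in>stalk q. \<forall>b\<in>stalk q. b \<noteq> 0 \<and> r = a / b \<longrightarrow> \<iota> b \<otimes>\<^bsub>K'\<^esub> \<kappa>' = \<iota> a)"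
  then have "\<kappa>' \<in> carrier K'" "\<iota> b \<otimes>\<^bsub>K'\<^esub> \<kappa>' = \<iota> a" using a r by auto
  then show "\<kappa>' = \<kappa>" using a \<kappa> iota_cancel by metis
qed

lemma phi_quot:
  assumes a: "a \<in> stalk q" "b \<in> stalk q" "b \<noteq> 0"
  shows "\<phi> (a / b) \<in> carrier K' \<and> \<iota> b \<otimes>\<^bsub>K'\<^esub> \<phi> (a / b) = \<iota> a"
proof -
  obtain g where g: "g \<in> carrier K'" "\<iota> b \<otimes>\<^bsub>K'\<^esub> g = \<one>\<^bsub>K'\<^esub>" using iota_unit[OF a(2,3)] by blast
  have "\<iota> b \<otimes>\<^bsub>K'\<^esub> (g \<otimes>\<^bsub>K'\<^esub> \<iota> a) = \<iota> a" using g a by (simp flip: KK.m_assoc)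
  moreover from this have "\<phi> (a / b) = g \<otimes>\<^bsub>K'\<^esub> \<iota> a" using a g by (intro phi_eqI[of a b]) auto
  ultimately show ?thesis using a g by simp
qed

lemma phi_carr [simp, intro]: "r \<in> function_field \<Longrightarrow> \<phi> r \<in> carrier K'"
  using funfield_quot[of r] phi_quot by metis

lemma phi_stalk: "a \<in> stalk q \<Longrightarrow> \<phi> a = \<iota> a"
  using phi_eqI[of a 1 "\<iota> a" a] A.O_one by (simp add: iota_one)

lemma phi_mult: "r \<in> function_field \<Longrightarrow> s \<in> function_field \<Longrightarrow> \<phi> (r * s) = \<phi> r \<otimes>\<^bsub>K'\<^esub> \<phi> s"
proof -
  assume r: "r \<in> function_field" and s: "s \<in> function_field"
  obtain a b where a: "a \<in> stalk q" "b \<in> stalk q" "b \<noteq> 0" "r = a / b" using r by (rule funfield_quot)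
  obtain c d where c: "c \<in> stalk q" "d \<in> stalk q" "d \<noteq> 0" "s = c / d" using s by (rule funfield_quot)
  note P = phi_quot[OF a(1-3), folded a(4)] phi_quot[OF c(1-3), folded c(4)]
  show ?thesis
  proof (rule phi_eqI[of "a * c" "b * d"])
    have "\<iota> (b * d) \<otimes>\<^bsub>K'\<^esub> (\<phi> r \<otimes>\<^bsub>K'\<^esub> \<phi> s) = (\<iota> b \<otimes>\<^bsub>K'\<^esub> \<phi> r) \<otimes>\<^bsub>K'\<^esub> (\<iota> d \<otimes>\<^bsub>K'\<^esub> \<phi> s)"
      unfolding iota_mult[OF a(2) c(2)] using a c r s by (simp add: KK.m_ac)
    also have "\<dots> = \<iota> (a * c)" using P a c by (simp add: iota_mult)
    finally show "\<iota> (b * d) \<otimes>\<^bsub>K'\<^esub> (\<phi> r \<otimes>\<^bsub>K'\<^esub> \<phi> s) = \<iota> (a * c)" .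
  qed (use a c r s A.O_mult in auto)
qed

lemma phi_add: "r \<in> function_field \<Longrightarrow> s \<in> function_field \<Longrightarrow> \<phi> (r + s) = \<phi> r \<oplus>\<^bsub>K'\<^esub> \<phi> s"
proof -
  assume r: "r \<in> function_field" and s: "s \<in> function_field"
  obtain a b where a: "a \<in> stalk q" "b \<in> stalk q" "b \<noteq> 0" "r = a / b" using r by (rule funfield_quot)
  obtain c d where c: "c \<in> stalk q" "d \<in> stalk q" "d \<noteq> 0" "s = c / d" using s by (rule funfield_quot)
  note P = phi_quot[OF a(1-3), folded a(4)] phi_quot[OF c(1-3), folded c(4)]
  show ?thesis
  proof (rule phi_eqI[of "a * d + b * c" "b * d"])
    have "\<iota> (b * d) \<otimes>\<^bsub>K'\<^esub> (\<phi> r \<oplus>\<^bsub>K'\<^esub> \<phi> s) = (\<iota> b \<otimes>\<^bsub>K'\<^esub> \<phi> r) \<otimes>\<^bsub>K'\<^esub> \<iota> d \<oplus>\<^bsub>K'\<^esub> \<iota> b \<otimes>\<^bsub>K'\<^esub> (\<iota> d \<otimes>\<^bsub>K'\<^esub> \<phi> s)"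
      unfolding iota_mult[OF a(2) c(2)] using a c r s by (simp add: KK.r_distr KK.m_ac)
    also have "\<dots> = \<iota> (a * d + b * c)" using P a c A.O_mult by (simp add: iota_mult iota_add)
    finally show "\<iota> (b * d) \<otimes>\<^bsub>K'\<^esub> (\<phi> r \<oplus>\<^bsub>K'\<^esub> \<phi> s) = \<iota> (a * d + b * c)" .
    show "r + s = (a * d + b * c) / (b * d)" using a c by (simp add: field_simps)
  qed (use a c r s A.O_mult A.O_add in auto)
qed

lemma phi_diff: "r \<in> function_field \<Longrightarrow> s \<in> function_field \<Longrightarrow> \<phi> (r - s) = \<phi> r \<ominus>\<^bsub>K'\<^esub> \<phi> s"
proof -
  assume r: "r \<in> function_field" and s: "s \<in> function_field"
  have rs: "r - s \<in> function_field" using r s funfield_closed by blast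
  have "\<phi> r = \<phi> (r - s) \<oplus>\<^bsub>K'\<^esub> \<phi> s" using phi_add[OF rs s] by simp
  then show ?thesis using phi_carr[OF rs] phi_carr[OF s] by (simp add: KK.minus_eq KK.a_assoc KK.r_neg)
qed

text \<open>Continuity of the embedding: order at least \<open>N\<close> along the curve supplies
  the factor \<open>f ^ N\<close>, and the denominator of the rest is a unit of
  \<open>OK_ring q f\<close>.\<close>

lemma phi_Fil:
  assumes r: "r \<in> function_field" and N: "curve_ord_ge F (int N) r"
  shows "Fil N (\<phi> r)"
proof (cases "r = 0")
  case True
  then show ?thesis using phi_stalk[OF A.O_zero] by (simp add: iota_zero Fil_zero)
next
  case False
  obtain M a b where ab: "a \<in> stalk q" "b \<in> stalk q" "a \<notin> fO" "b \<notin> fO" "r = f powi M * a / b" "curve_ord F r = M"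
    using ord_decomposition[OF r False] .
  have MN: "int N \<le> M" using N False ab(6) by (simp add: curve_ord_ge_def)
  define k where "k = nat M - N"
  have "f powi M = f ^ N * f ^ k" using MN by (simp add: k_def power_int_def flip: power_add)
  then have re: "r = (f ^ N * (f ^ k * a)) / b" using ab(5) by (simp add: mult.assoc)
  have b0: "b \<noteq> 0" using ab fO_I[OF A.O_zero] by auto
  obtain \<xi> where \<xi>: "\<xi> \<in> carrier (OK_ring q f)" "\<iota> b \<otimes>\<^bsub>K'\<^esub> j \<xi> = \<one>\<^bsub>K'\<^esub>" using off_fO_unit[OF ab(2,4)] by blast
  have fka: "f ^ k * a \<in> stalk q" "f ^ N \<in> stalk q" using A.O_mult A.O_power f_stalk ab by auto
  have num: "f ^ N * (f ^ k * a) \<in> stalk q" using A.O_mult fka by blast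
  have e: "\<phi> r = \<iota> (f ^ N * (f ^ k * a)) \<otimes>\<^bsub>K'\<^esub> j \<xi>"
  proof (rule phi_eqI[OF num ab(2) b0 _ _ re])
    show "\<iota> (f ^ N * (f ^ k * a)) \<otimes>\<^bsub>K'\<^esub> j \<xi> \<in> carrier K'" using num \<xi> by simp
    show "\<iota> b \<otimes>\<^bsub>K'\<^esub> (\<iota> (f ^ N * (f ^ k * a)) \<otimes>\<^bsub>K'\<^esub> j \<xi>) = \<iota> (f ^ N * (f ^ k * a))"
    proof -
      have "\<iota> b \<otimes>\<^bsub>K'\<^esub> (\<iota> (f ^ N * (f ^ k * a)) \<otimes>\<^bsub>K'\<^esub> j \<xi>) = \<iota> (f ^ N * (f ^ k * a)) \<otimes>\<^bsub>K'\<^esub> (\<iota> b \<otimes>\<^bsub>K'\<^esub> j \<xi>)"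
        by (rule KK.m_lcomm) (use num \<xi>(1) ab(2) in auto)
      then show ?thesis using \<xi>(2) num by simp
    qed
  qed
  have "\<phi> r = \<iota> f [^]\<^bsub>K'\<^esub> N \<otimes>\<^bsub>K'\<^esub> j (hat_to_OK q f (to_hat q (f ^ k * a)) \<otimes>\<^bsub>OK_ring q f\<^esub> \<xi>)"
    unfolding e iota_mult[OF fka(2,1)] iota_pow[OF f_stalk]
    using fka \<xi>(1) f_stalk by (simp add: j_mult hat_carr hO_carr KK.m_assoc flip: iota_eq)
  then show ?thesis using Fil_I[of "hat_to_OK q f (to_hat q (f ^ k * a)) \<otimes>\<^bsub>OK_ring q f\<^esub> \<xi>"] fka \<xi>(1) by auto
qed

section \<open>Limits in the local field and the map from \<open>K_C\<close>\<close>

lemma limit_unique: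
  assumes s: "\<And>n. s n \<in> carrier K'" and \<kappa>: "\<kappa> \<in> carrier K'" "\<kappa>' \<in> carrier K'"
    and c: "K_converges q f s \<kappa>" "K_converges q f s \<kappa>'"
  shows "\<kappa> = \<kappa>'"
proof -
  have "Fil N (\<kappa> \<ominus>\<^bsub>K'\<^esub> \<kappa>')" for N
  proof -
    obtain n0 n1 where "\<forall>n\<ge>n0. Fil N (s n \<ominus>\<^bsub>K'\<^esub> \<kappa>)" "\<forall>n\<ge>n1. Fil N (s n \<ominus>\<^bsub>K'\<^esub> \<kappa>')"
      using c unfolding K_converges_Fil by blast
    then have F: "Fil N (s (max n0 n1) \<ominus>\<^bsub>K'\<^esub> \<kappa>)" "Fil N (s (max n0 n1) \<ominus>\<^bsub>K'\<^esub> \<kappa>')" by auto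
    have "Fil N (\<ominus>\<^bsub>K'\<^esub> (s (max n0 n1) \<ominus>\<^bsub>K'\<^esub> \<kappa>) \<oplus>\<^bsub>K'\<^esub> (s (max n0 n1) \<ominus>\<^bsub>K'\<^esub> \<kappa>'))"
      by (intro Fil_add Fil_uminus F)
    moreover have "\<ominus>\<^bsub>K'\<^esub> (s (max n0 n1) \<ominus>\<^bsub>K'\<^esub> \<kappa>) = \<kappa> \<ominus>\<^bsub>K'\<^esub> s (max n0 n1)"
      using s[of "max n0 n1"] \<kappa> by (simp add: KK.minus_eq KK.minus_add KK.a_comm)
    moreover have "(\<kappa> \<ominus>\<^bsub>K'\<^esub> s (max n0 n1)) \<oplus>\<^bsub>K'\<^esub> (s (max n0 n1) \<ominus>\<^bsub>K'\<^esub> \<kappa>') = \<kappa> \<ominus>\<^bsub>K'\<^esub> \<kappa>'"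
      by (rule KK.diff_tel[OF \<kappa>(1) s \<kappa>(2)])
    ultimately show ?thesis by simp
  qed
  then have "\<kappa> \<ominus>\<^bsub>K'\<^esub> \<kappa>' = \<zero>\<^bsub>K'\<^esub>" by (rule Fil_separated)
  then show ?thesis using KK.r_right_minus_eq \<kappa> by blast
qed

lemma converges_cong:
  assumes "\<And>n. s n \<in> carrier K'" "\<And>n. s' n \<in> carrier K'" "\<kappa> \<in> carrier K'"
    and "K_converges q f s \<kappa>" "\<And>N. \<exists>n0. \<forall>n\<ge>n0. Fil N (s n \<ominus>\<^bsub>K'\<^esub> s' n)"
  shows "K_converges q f s' \<kappa>"
  unfolding K_converges_Fil
proof
  fix N
  obtain n0 n1 where n: "\<forall>n\<ge>n0. Fil N (s n \<ominus>\<^bsub>K'\<^esub> \<kappa>)" "\<forall>n\<ge>n1. Fil N (s n \<ominus>\<^bsub>K'\<^esub> s' n)"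
    using assms(4,5) unfolding K_converges_Fil by blast
  have "Fil N (s' n \<ominus>\<^bsub>K'\<^esub> \<kappa>)" if "n \<ge> max n0 n1" for n
  proof -
    have "Fil N (\<ominus>\<^bsub>K'\<^esub> (s n \<ominus>\<^bsub>K'\<^esub> s' n) \<oplus>\<^bsub>K'\<^esub> (s n \<ominus>\<^bsub>K'\<^esub> \<kappa>))"
      using n that by (intro Fil_add Fil_uminus) auto
    moreover have "\<ominus>\<^bsub>K'\<^esub> (s n \<ominus>\<^bsub>K'\<^esub> s' n) = s' n \<ominus>\<^bsub>K'\<^esub> s n"
      using assms(1,2)[of n] by (simp add: KK.minus_eq KK.minus_add KK.a_comm)
    moreover have "(s' n \<ominus>\<^bsub>K'\<^esub> s n) \<oplus>\<^bsub>K'\<^esub> (s n \<ominus>\<^bsub>K'\<^esub> \<kappa>) = s' n \<ominus>\<^bsub>K'\<^esub> \<kappa>"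
      by (rule KK.diff_tel[OF assms(2,1,3)])
    ultimately show ?thesis by simp
  qed
  then show "\<exists>n0. \<forall>n\<ge>n0. Fil N (s' n \<ominus>\<^bsub>K'\<^esub> \<kappa>)" by blast
qed

text \<open>A name for the relation inside \<open>K_C\<close>. It depends on \<open>F\<close> alone,
  so a class formed at one point can be used at all others.\<close>

definition equi :: "(nat \<Rightarrow> 'k ratfun) rel" where
  "equi = {(s, s'). s \<in> curve_cauchy F \<and> s' \<in> curve_cauchy F \<and>
     (\<forall>N. \<exists>n0. \<forall>i\<ge>n0. curve_ord_ge F N (s i - s' i))}"

lemma K_C_eq: "K_C F = curve_cauchy F // equi" by (simp add: K_C_def equi_def)

lemma cauchy_funfield: "s \<in> curve_cauchy F \<Longrightarrow> s n \<in> function_field"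
  unfolding curve_cauchy_def by blast

lemma cauchy_limit:
  assumes s: "s \<in> curve_cauchy F"
  shows "\<exists>\<kappa>\<in>carrier K'. K_converges q f (\<lambda>n. \<phi> (s n)) \<kappa>"
proof (rule K_complete)
  note sf = cauchy_funfield[OF s]
  show "\<phi> (s n) \<in> carrier K'" for n using sf by blast
  fix N
  obtain n0 where "\<forall>i\<ge>n0. \<forall>j\<ge>n0. curve_ord_ge F (int N) (s i - s j)"
    using s unfolding curve_cauchy_def by blast
  then show "\<exists>n0. \<forall>i\<ge>n0. \<forall>j\<ge>n0. Fil N (\<phi> (s i) \<ominus>\<^bsub>K'\<^esub> \<phi> (s j))"
    using phi_Fil[OF funfield_closed(2)[OF sf sf]] phi_diff[OF sf sf] by (intro exI[of _ n0]) auto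
qed

lemma equi_limit:
  assumes e: "(s, s') \<in> equi" and \<kappa>: "\<kappa> \<in> carrier K'" "K_converges q f (\<lambda>n. \<phi> (s n)) \<kappa>"
  shows "K_converges q f (\<lambda>n. \<phi> (s' n)) \<kappa>"
proof (rule converges_cong[OF _ _ \<kappa>])
  have c: "s \<in> curve_cauchy F" "s' \<in> curve_cauchy F" using e by (auto simp: equi_def)
  note sf = cauchy_funfield[OF c(1)] cauchy_funfield[OF c(2)]
  show "\<phi> (s n) \<in> carrier K'" "\<phi> (s' n) \<in> carrier K'" for n using sf by auto
  fix N
  obtain n0 where "\<forall>i\<ge>n0. curve_ord_ge F (int N) (s i - s' i)" using e unfolding equi_def by blast
  then show "\<exists>n0. \<forall>n\<ge>n0. Fil N (\<phi> (s n) \<ominus>\<^bsub>K'\<^esub> \<phi> (s' n))"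
    using phi_Fil[OF funfield_closed(2)[OF sf]] phi_diff[OF sf] by (intro exI[of _ n0]) auto
qed

text \<open>Equivalent Cauchy sequences have the same limit and limits are unique, so the
  description in \<open>K_C_to_K\<close> can be evaluated on one representative.\<close>

lemma K_C_to_K_class:
  assumes s: "s \<in> curve_cauchy F" and \<kappa>: "\<kappa> \<in> carrier K'" "K_converges q f (\<lambda>n. \<phi> (s n)) \<kappa>"
  shows "K_C_to_K q f (equi `` {s}) = \<kappa>"
  unfolding K_C_to_K_def
proof (rule the_equality)
  show "\<kappa> \<in> carrier K' \<and> (\<forall>s\<in>equi `` {s}. K_converges q f (\<lambda>n. \<phi> (s n)) \<kappa>)"
    using \<kappa> equi_limit by blast
  fix \<kappa>' assume k: "\<kappa>' \<in> carrier K' \<and> (\<forall>s\<in>equi `` {s}. K_converges q f (\<lambda>n. \<phi> (s n)) \<kappa>')"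
  have "(s, s) \<in> equi" using s by (auto simp: equi_def curve_ord_ge_zero)
  then have "K_converges q f (\<lambda>n. \<phi> (s n)) \<kappa>'" using k by blast
  then show "\<kappa>' = \<kappa>" using limit_unique[of "\<lambda>n. \<phi> (s n)" \<kappa>' \<kappa>] k \<kappa> cauchy_funfield[OF s] by blast
qed

lemma const_cauchy: "r \<in> function_field \<Longrightarrow> (\<lambda>n. r) \<in> curve_cauchy F"
  by (auto simp: curve_cauchy_def curve_ord_ge_zero)

lemma K_C_to_K_const:
  assumes r: "r \<in> function_field"
  shows "K_C_to_K q f (equi `` {\<lambda>n. r}) = \<phi> r"
proof (rule K_C_to_K_class[OF const_cauchy[OF r] phi_carr[OF r]])
  show "K_converges q f (\<lambda>n. \<phi> r) (\<phi> r)"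
    unfolding K_converges_Fil using phi_carr[OF r] by (simp add: KK.minus_eq KK.r_neg Fil_zero)
qed

lemma K_C_to_K_approx:
  assumes s: "s \<in> curve_cauchy F"
  shows "K_C_to_K q f (equi `` {s}) \<in> carrier K' \<and>
    (\<forall>N. \<exists>n0. \<forall>n\<ge>n0. Fil N (\<phi> (s n) \<ominus>\<^bsub>K'\<^esub> K_C_to_K q f (equi `` {s})))"
  using cauchy_limit[OF s] K_C_to_K_class[OF s] unfolding K_converges_Fil by metis

end

section \<open>Points where the curve has a transversal parameter\<close>

text \<open>Finite dimension is assumed for every transversal \<open>d\<close>, because denominators
  of arbitrary functions will take that role; the existence of one such \<open>d\<close> is what the
  study of \<open>f\<close> itself rests on.\<close>

locale transversal_point = curve_point F m q f + tower q f
  for F :: "'k::field form" and m :: nat and q :: "'k form set" and f :: "'k ratfun" +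
  assumes finite_span: "d \<in> stalk_ideal q q \<Longrightarrow> d \<notin> fO \<Longrightarrow>
      \<exists>(M::nat) B. (\<forall>b. B b \<in> stalk q) \<and> (\<forall>x\<in>stalk q. \<exists>c. \<exists>u\<in>stalk q. \<exists>v\<in>stalk q.
        x = (\<Sum>b<M. ratfun_const (c b) * B b) + d * u + f * v)"
    and ex_transversal: "\<exists>d. d \<in> stalk_ideal q q \<and> d \<notin> fO"
begin

interpretation A: local_subring ratfun_const "stalk q" "stalk_ideal q q" by (rule local_subring_stalk)
interpretation KK: cring "K_ring q f" by (rule K_cring)
interpretation OKr: cring "OK_ring q f" by (rule OK_cring)
interpretation Ch: cring "completed_stalk q" by (rule hat_cring)

abbreviation "H \<equiv> completed_stalk q"
abbreviation "hf \<equiv> to_hat q f"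

lemma hf_carr: "hf \<in> carrier H" using f_stalk by blast

lemma transversalI:
  assumes "d \<in> stalk_ideal q q" "d \<notin> fO"
  shows "\<exists>M B. transversal ratfun_const (stalk q) (stalk_ideal q q) f d M B"
proof -
  from finite_span[OF assms] obtain M :: nat and B where B0: "\<forall>b. B b \<in> stalk q"
    "\<forall>x\<in>stalk q. \<exists>c. \<exists>u\<in>stalk q. \<exists>v\<in>stalk q. x = (\<Sum>b<M. ratfun_const (c b) * B b) + d * u + f * v"
    by (elim exE conjE)
  note B = spec[OF B0(1)] bspec[OF B0(2)]
  have "transversal ratfun_const (stalk q) (stalk_ideal q q) f d M B"
  proof (intro transversal.intro local_subring_stalk transversal_axioms.intro)
    show "f \<in> stalk_ideal q q" by (rule f_m)
    show "f \<noteq> 0" by (rule f_nz)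
    show "d \<in> stalk_ideal q q" by fact
    show "d \<noteq> f * w" if "w \<in> stalk q" for w using fO_I[OF that] assms(2) by auto
    show "B b \<in> stalk q" for b by (rule B)
    show "\<exists>c. \<exists>u\<in>stalk q. \<exists>v\<in>stalk q. x = (\<Sum>b<M. ratfun_const (c b) * B b) + d * u + f * v" if "x \<in> stalk q" for x
      by (rule B(2)[OF that])
    show "(\<exists>w\<in>stalk q. x = f * w) \<or> (\<exists>w\<in>stalk q. y = f * w)"
      if "x \<in> stalk q" "y \<in> stalk q" "z \<in> stalk q" "x * y = f * z" for x y z
      using fO_prime[OF that(1,2)] fO_I[OF that(3)] that(4) by (auto simp: fO_eq)
  qed
  then show ?thesis by blast
qed

lemma H_E:
  assumes "\<alpha> \<in> carrier H"
  obtains x where "A.coh x" "\<alpha> = A.cls x"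
  using assms unfolding completed_eq by (rule A.C_E)

lemma cls_H: "A.coh x \<Longrightarrow> A.cls x \<in> carrier H" unfolding completed_eq by simp

lemma hat_mult_cls:
  assumes "a \<in> stalk q" "A.coh x"
  shows "to_hat q a \<otimes>\<^bsub>H\<^esub> A.cls x = A.cls (\<lambda>n. a * x n)"
  using A.C_mult[OF A.coh_const'[OF assms(1)] assms(2)] by (simp add: completed_eq to_hat_eq A.toc_eq)

lemma cls_eqI: "A.coh x \<Longrightarrow> A.coh y \<Longrightarrow> (\<And>n. x n - y n \<in> A.Pw n) \<Longrightarrow> A.cls x = A.cls y"
  using A.cls_eq_iff[of x y] by (simp add: A.coh_O)
lemma cls_eqD: "A.cls x = A.cls y \<Longrightarrow> A.coh x \<Longrightarrow> A.coh y \<Longrightarrow> x n - y n \<in> A.Pw n"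
  using A.cls_eq_iff[of x y] A.coh_O[of x n] A.coh_O[of y n] A.Rg_minus[of "x n" "y n"] by metis

lemma PIdl_iff: "\<alpha> \<in> cgenideal H \<beta> \<longleftrightarrow> (\<exists>\<gamma>\<in>carrier H. \<alpha> = \<gamma> \<otimes>\<^bsub>H\<^esub> \<beta>)"
  by (auto simp: cgenideal_def)

lemma hf_cancel0:
  assumes z: "hf \<otimes>\<^bsub>H\<^esub> \<alpha> = \<zero>\<^bsub>H\<^esub>" and a: "\<alpha> \<in> carrier H"
  shows "\<alpha> = \<zero>\<^bsub>H\<^esub>"
proof -
  obtain d where d: "d \<in> stalk_ideal q q" "d \<notin> fO" using ex_transversal by blast
  obtain M B where "transversal ratfun_const (stalk q) (stalk_ideal q q) f d M B" using transversalI[OF d] by blast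
  then interpret T: transversal ratfun_const "stalk q" "stalk_ideal q q" f d M B .
  obtain x where x: "A.coh x" "\<alpha> = A.cls x" using a by (rule H_E)
  have z0: "\<zero>\<^bsub>H\<^esub> = A.cls (\<lambda>n. 0)" unfolding completed_eq using A.C_zero by simp
  have c0: "A.coh (\<lambda>n. 0)" by (rule A.coh_const'[OF A.O_zero])
  have cf: "A.coh (\<lambda>n. f * x n)" by (intro A.coh_mult' A.coh_const' f_stalk x)
  have "f * x n \<in> A.Pw n" for n
    using cls_eqD[OF _ cf c0, of n] z x hat_mult_cls[OF f_stalk x(1)] z0 by simp
  then have "x n \<in> A.Pw n" for n using T.coh_f_cancel[OF x(1)] by blast
  then show ?thesis unfolding z0 x(2) by (intro cls_eqI x c0) simp
qed

lemma hf_cancel: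
  assumes e: "hf \<otimes>\<^bsub>H\<^esub> \<alpha> = hf \<otimes>\<^bsub>H\<^esub> \<beta>" and "\<alpha> \<in> carrier H" "\<beta> \<in> carrier H"
  shows "\<alpha> = \<beta>"
proof -
  have "hf \<otimes>\<^bsub>H\<^esub> (\<alpha> \<ominus>\<^bsub>H\<^esub> \<beta>) = hf \<otimes>\<^bsub>H\<^esub> \<alpha> \<ominus>\<^bsub>H\<^esub> hf \<otimes>\<^bsub>H\<^esub> \<beta>"
    using assms(2,3) hf_carr by (simp add: Ch.minus_eq Ch.r_distr Ch.r_minus)
  also have "\<dots> = \<zero>\<^bsub>H\<^esub>" using assms hf_carr by (simp add: Ch.minus_eq Ch.r_neg)
  finally have "\<alpha> \<ominus>\<^bsub>H\<^esub> \<beta> = \<zero>\<^bsub>H\<^esub>" by (rule hf_cancel0) (use assms in auto)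
  then show ?thesis using Ch.r_right_minus_eq assms by blast
qed

section \<open>Nonzerodivisors modulo \<open>f\<close> in the completed local ring\<close>

definition nzd :: "'k ratfun compl \<Rightarrow> bool" where
  "nzd s \<longleftrightarrow> s \<in> carrier H \<and> (\<forall>x\<in>carrier H. s \<otimes>\<^bsub>H\<^esub> x \<in> cgenideal H hf \<longrightarrow> x \<in> cgenideal H hf)"

text \<open>Powers of \<open>f\<close> are stripped one at a time: \<open>s\<close> is a
  nonzerodivisor modulo \<open>f\<close>, and \<open>f\<close> itself is a nonzerodivisor.\<close>

lemma nzd_pow:
  assumes s: "nzd s" and x: "x \<in> carrier H" and y: "y \<in> carrier H" "s \<otimes>\<^bsub>H\<^esub> x = hf [^]\<^bsub>H\<^esub> (n::nat) \<otimes>\<^bsub>H\<^esub> y"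
  shows "\<exists>z\<in>carrier H. x = hf [^]\<^bsub>H\<^esub> n \<otimes>\<^bsub>H\<^esub> z \<and> y = s \<otimes>\<^bsub>H\<^esub> z"
  using x y
proof (induction n arbitrary: x y)
  case 0
  then show ?case by (intro bexI[of _ x]) auto
next
  case (Suc n)
  have sc: "s \<in> carrier H" using s by (simp add: nzd_def)
  have "s \<otimes>\<^bsub>H\<^esub> x = (hf [^]\<^bsub>H\<^esub> n \<otimes>\<^bsub>H\<^esub> y) \<otimes>\<^bsub>H\<^esub> hf"
    using Suc.prems hf_carr by (simp add: Ch.m_ac)
  then have "s \<otimes>\<^bsub>H\<^esub> x \<in> cgenideal H hf" using Suc.prems hf_carr unfolding PIdl_iff by auto
  then have "x \<in> cgenideal H hf" using s Suc.prems by (auto simp: nzd_def)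
  then obtain x' where x': "x' \<in> carrier H" "x = x' \<otimes>\<^bsub>H\<^esub> hf" unfolding PIdl_iff by blast
  have "hf \<otimes>\<^bsub>H\<^esub> (s \<otimes>\<^bsub>H\<^esub> x') = s \<otimes>\<^bsub>H\<^esub> x" using x' sc hf_carr by (simp add: Ch.m_ac)
  also have "\<dots> = hf \<otimes>\<^bsub>H\<^esub> (hf [^]\<^bsub>H\<^esub> n \<otimes>\<^bsub>H\<^esub> y)" unfolding Suc.prems(3) using Suc.prems(2) hf_carr by (simp add: Ch.m_ac)
  finally have "s \<otimes>\<^bsub>H\<^esub> x' = hf [^]\<^bsub>H\<^esub> n \<otimes>\<^bsub>H\<^esub> y" by (rule hf_cancel) (use x' sc hf_carr Suc.prems(2) in auto)
  from Suc.IH[OF x'(1) Suc.prems(2) this] obtain z where z: "z \<in> carrier H" "x' = hf [^]\<^bsub>H\<^esub> n \<otimes>\<^bsub>H\<^esub> z" "y = s \<otimes>\<^bsub>H\<^esub> z" by blast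
  then have "x = hf [^]\<^bsub>H\<^esub> Suc n \<otimes>\<^bsub>H\<^esub> z" unfolding x'(2) using hf_carr by (simp add: Ch.m_ac)
  then show ?case using z by blast
qed

lemma nzd_transversal:
  assumes d: "d \<in> stalk_ideal q q" "d \<notin> fO"
  shows "nzd (to_hat q d)"
  unfolding nzd_def
proof (intro conjI ballI impI)
  obtain M B where "transversal ratfun_const (stalk q) (stalk_ideal q q) f d M B" using transversalI[OF d] by blast
  then interpret T: transversal ratfun_const "stalk q" "stalk_ideal q q" f d M B .
  show "to_hat q d \<in> carrier H" using T.d_O by blast
  fix \<alpha> assume a: "\<alpha> \<in> carrier H" "to_hat q d \<otimes>\<^bsub>H\<^esub> \<alpha> \<in> cgenideal H hf"
  obtain x where x: "A.coh x" "\<alpha> = A.cls x" using a(1) by (rule H_E)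
  obtain \<beta> where b: "\<beta> \<in> carrier H" "to_hat q d \<otimes>\<^bsub>H\<^esub> \<alpha> = \<beta> \<otimes>\<^bsub>H\<^esub> hf" using a(2) PIdl_iff by blast
  obtain y where y: "A.coh y" "\<beta> = A.cls y" using b(1) by (rule H_E)
  have cd: "A.coh (\<lambda>n. d * x n)" by (intro A.coh_mult' A.coh_const' T.d_O x)
  have cf: "A.coh (\<lambda>n. f * y n)" by (intro A.coh_mult' A.coh_const' f_stalk y)
  have "A.cls (\<lambda>n. d * x n) = A.cls (\<lambda>n. f * y n)"
    using b(2) hat_mult_cls[OF T.d_O x(1)] hat_mult_cls[OF f_stalk y(1)] x(2) y(2) Ch.m_comm[OF b(1) hf_carr] by simp
  then have "d * x n - f * y n \<in> A.Pw n" for n by (rule cls_eqD[OF _ cd cf])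
  then obtain c where c: "A.coh c" "\<And>n. x n - f * c n \<in> A.Pw n"
    using T.coh_d_cancel[OF x(1) y(1)] by blast
  have "A.coh (\<lambda>n. f * c n)" by (intro A.coh_mult' A.coh_const' f_stalk c)
  then have "\<alpha> = A.cls (\<lambda>n. f * c n)" unfolding x(2) using c x by (intro cls_eqI) auto
  also have "\<dots> = A.cls c \<otimes>\<^bsub>H\<^esub> hf" using hat_mult_cls[OF f_stalk c(1)] Ch.m_comm[OF cls_H[OF c(1)] hf_carr] by simp
  finally show "\<alpha> \<in> cgenideal H hf" unfolding PIdl_iff using cls_H[OF c(1)] by blast
qed

lemma hat_pow: "a \<in> stalk q \<Longrightarrow> to_hat q a [^]\<^bsub>H\<^esub> (n::nat) = to_hat q (a ^ n)"
  by (induction n) (auto simp: hat_one hat_mult A.O_power Ch.m_comm)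

lemma cls_pow: "A.coh r \<Longrightarrow> A.cls r [^]\<^bsub>H\<^esub> (n::nat) = A.cls (\<lambda>k. r k ^ n)"
proof (induction n)
  case 0
  then show ?case using A.C_one by (simp add: completed_eq)
next
  case (Suc n)
  then have "A.cls r [^]\<^bsub>H\<^esub> Suc n = A.cls (\<lambda>k. r k ^ n) \<otimes>\<^bsub>H\<^esub> A.cls r" by simp
  also have "\<dots> = A.cls (\<lambda>k. r k ^ n * r k)"
    using A.C_mult[OF A.coh_power'[OF Suc.prems] Suc.prems] by (simp add: completed_eq)
  finally show ?case by (simp add: mult.commute)
qed

text \<open>Since \<open>coh_pi_regular\<close> supplies the regularity condition, the criterion
  \<open>non_zero_divisor_off_minimal_primes\<close> applies. It lets divisibility by
  \<open>f\<close> pass back through the localization that forms \<open>curve_loc\<close>.\<close>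

lemma off_curve_nzd:
  assumes s: "s \<in> off_curve q f"
  shows "nzd s"
  unfolding nzd_def
proof (intro conjI ballI impI)
  show sc: "s \<in> carrier H" using s by (simp add: off_curve_def)
  obtain d where d: "d \<in> stalk_ideal q q" "d \<notin> fO" using ex_transversal by blast
  obtain M B where "transversal ratfun_const (stalk q) (stalk_ideal q q) f d M B" using transversalI[OF d] by blast
  then interpret T: transversal ratfun_const "stalk q" "stalk_ideal q q" f d M B .
  have dc: "to_hat q d \<in> carrier H" using T.d_O by blast
  fix x assume x: "x \<in> carrier H" "s \<otimes>\<^bsub>H\<^esub> x \<in> cgenideal H hf"
  show "x \<in> cgenideal H hf"
  proof (rule Ch.non_zero_divisor_off_minimal_primes[OF hf_carr dc _ _ sc _ x])
    show "y \<in> cgenideal H hf" if "y \<in> carrier H" "to_hat q d \<otimes>\<^bsub>H\<^esub> y \<in> cgenideal H hf" for y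
      using nzd_transversal[OF d] that by (simp add: nzd_def)
    show "s \<notin> \<Union>{P. minimal_prime_over H (cgenideal H hf) P}" using s by (simp add: off_curve_def)
    fix \<rho> assume "\<rho> \<in> carrier H"
    then obtain r where r: "A.coh r" "\<rho> = A.cls r" by (rule H_E)
    obtain i k y z where yz: "A.coh y" "A.coh z" "\<And>n. A.cg n (r n ^ i * (d ^ k - r n * y n)) (f * z n)"
      using T.coh_pi_regular[OF r(1)] by blast
    have c1: "A.coh (\<lambda>n. r n * y n)" by (rule A.coh_mult'[OF r(1) yz(1)])
    have c2: "A.coh (\<lambda>n. d ^ k - r n * y n)" by (intro A.coh_diff' c1 A.coh_const' A.O_power T.d_O)
    have c3: "A.coh (\<lambda>n. r n ^ i)" by (rule A.coh_power'[OF r(1)])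
    have c4: "A.coh (\<lambda>n. r n ^ i * (d ^ k - r n * y n))" by (rule A.coh_mult'[OF c3 c2])
    have c5: "A.coh (\<lambda>n. f * z n)" by (intro A.coh_mult' A.coh_const' f_stalk yz)
    have dk: "to_hat q d [^]\<^bsub>H\<^esub> k = A.cls (\<lambda>n. d ^ k)" using hat_pow[OF T.d_O] by (simp add: to_hat_eq A.toc_eq)
    have "to_hat q d [^]\<^bsub>H\<^esub> k \<ominus>\<^bsub>H\<^esub> \<rho> \<otimes>\<^bsub>H\<^esub> A.cls y = A.cls (\<lambda>n. d ^ k - r n * y n)"
    proof -
      have "\<rho> \<otimes>\<^bsub>H\<^esub> A.cls y = A.cls (\<lambda>n. r n * y n)" unfolding r(2) completed_eq using A.C_mult[OF r(1) yz(1)] by simp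
      moreover have "A.cls (\<lambda>n. d ^ k) \<ominus>\<^bsub>H\<^esub> A.cls (\<lambda>n. r n * y n) = A.cls (\<lambda>n. d ^ k - r n * y n)"
        unfolding completed_eq using A.C_minus[OF A.coh_const'[OF A.O_power[OF T.d_O]] c1]
          A.Rg_minus[OF A.O_power[OF T.d_O] A.coh_O[OF c1]] by simp
      ultimately show ?thesis unfolding dk by simp
    qed
    then have "\<rho> [^]\<^bsub>H\<^esub> i \<otimes>\<^bsub>H\<^esub> (to_hat q d [^]\<^bsub>H\<^esub> k \<ominus>\<^bsub>H\<^esub> \<rho> \<otimes>\<^bsub>H\<^esub> A.cls y) = A.cls (\<lambda>n. r n ^ i * (d ^ k - r n * y n))"
      unfolding r(2) cls_pow[OF r(1)] using A.C_mult[OF c3 c2] by (simp add: completed_eq)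
    also have "\<dots> = A.cls (\<lambda>n. f * z n)" using yz(3) c4 c5 by (intro cls_eqI) (auto simp: A.cg_def)
    also have "\<dots> = A.cls z \<otimes>\<^bsub>H\<^esub> hf" using hat_mult_cls[OF f_stalk yz(2)] Ch.m_comm[OF cls_H[OF yz(2)] hf_carr] by simp
    finally have "\<rho> [^]\<^bsub>H\<^esub> i \<otimes>\<^bsub>H\<^esub> (to_hat q d [^]\<^bsub>H\<^esub> k \<ominus>\<^bsub>H\<^esub> \<rho> \<otimes>\<^bsub>H\<^esub> A.cls y) \<in> cgenideal H hf"
      unfolding PIdl_iff using cls_H[OF yz(2)] by blast
    then show "\<exists>(n::nat) (j::nat). \<exists>y\<in>carrier H. \<rho> [^]\<^bsub>H\<^esub> n \<otimes>\<^bsub>H\<^esub> (to_hat q d [^]\<^bsub>H\<^esub> j \<ominus>\<^bsub>H\<^esub> \<rho> \<otimes>\<^bsub>H\<^esub> y) \<in> cgenideal H hf"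
      using cls_H[OF yz(1)] by blast
  qed
qed

lemma nzd_pow_closed:
  assumes s: "nzd s" and w: "w \<in> carrier H" "w \<otimes>\<^bsub>H\<^esub> s [^]\<^bsub>H\<^esub> (n::nat) \<in> cgenideal H hf"
  shows "w \<in> cgenideal H hf"
  using w
proof (induction n arbitrary: w)
  case 0
  then show ?case by simp
next
  case (Suc n)
  have sc: "s \<in> carrier H" using s by (simp add: nzd_def)
  have "(s \<otimes>\<^bsub>H\<^esub> w) \<otimes>\<^bsub>H\<^esub> s [^]\<^bsub>H\<^esub> n \<in> cgenideal H hf" using Suc.prems sc by (simp add: Ch.m_ac)
  then have "s \<otimes>\<^bsub>H\<^esub> w \<in> cgenideal H hf" using Suc.IH sc Suc.prems(1) by blast
  then show ?case using s Suc.prems(1) by (simp add: nzd_def)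
qed

text \<open>If the image of \<open>d\<close> were in a minimal prime over \<open>f\<close>, some
  \<open>w\<close> off that prime times a power of \<open>d\<close> would be divisible by
  \<open>f\<close>; cancelling \<open>d\<close> puts \<open>w\<close> into the prime.\<close>

lemma transversal_off_curve:
  assumes d: "d \<in> stalk_ideal q q" "d \<notin> fO"
  shows "to_hat q d \<in> off_curve q f"
proof -
  note nz = nzd_transversal[OF d]
  have "to_hat q d \<notin> P" if P: "minimal_prime_over H (cgenideal H hf) P" for P
  proof
    assume "to_hat q d \<in> P"
    then obtain w and n :: nat where w: "w \<in> carrier H - P" "w \<otimes>\<^bsub>H\<^esub> to_hat q d [^]\<^bsub>H\<^esub> n \<in> cgenideal H hf"
      using Ch.minimal_prime_elem[OF P Ch.cgenideal_ideal[OF hf_carr]] by blast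
    then have "w \<in> cgenideal H hf" using nzd_pow_closed[OF nz] by blast
    then show False using w P by (auto simp: minimal_prime_over_def)
  qed
  then show ?thesis using nz by (auto simp: off_curve_def nzd_def)
qed

interpretation S: mult_system H "off_curve q f" by (rule off_curve_mult_system)
interpretation OK: principal_adic "curve_loc q f" fl by (rule principal_adic_loc)
interpretation K: mult_system "OK_ring q f" "OK_powers q f" by (rule OK_powers_mult_system)

text \<open>Elements of the maximal ideal outside the ideal of the curve are transversal and get
  inverted by the localization; all others are units in the local ring already.\<close>

lemma off_fO_unit':
  assumes b: "b \<in> stalk q" "b \<notin> fO"
  shows "\<exists>\<xi>\<in>carrier (OK_ring q f). \<iota> b \<otimes>\<^bsub>K_ring q f\<^esub> j \<xi> = \<one>\<^bsub>K_ring q f\<^esub>"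
proof (cases "b \<in> stalk_ideal q q")
  case True
  then have s: "to_hat q b \<in> off_curve q f" using transversal_off_curve b by blast
  define v where "v = frac H (off_curve q f) \<one>\<^bsub>H\<^esub> (to_hat q b)"
  have v: "v \<in> carrier (curve_loc q f)" unfolding v_def curve_loc_def using s by (intro S.frac_in_L) auto
  have "S.tol (to_hat q b) \<otimes>\<^bsub>curve_loc q f\<^esub> v = \<one>\<^bsub>curve_loc q f\<^esub>"
    unfolding v_def curve_loc_def by (rule S.tol_unit[OF s])
  then have "OK.toc (S.tol (to_hat q b)) \<otimes>\<^bsub>OK.C\<^esub> OK.toc v = \<one>\<^bsub>OK.C\<^esub>"
    using OK.toc_mult[OF tol_loc[OF hat_carr[OF b(1)]] v] OK.toc_one by simp
  then have "hat_to_OK q f (to_hat q b) \<otimes>\<^bsub>OK_ring q f\<^esub> OK.toc v = \<one>\<^bsub>OK_ring q f\<^esub>"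
    by (simp only: hat_to_OK_eq OK_eq)
  moreover have vc: "OK.toc v \<in> carrier (OK_ring q f)" unfolding OK_eq by (rule OK.toc_carr[OF v])
  ultimately have "\<iota> b \<otimes>\<^bsub>K_ring q f\<^esub> j (OK.toc v) = \<one>\<^bsub>K_ring q f\<^esub>"
    unfolding iota_eq using b(1) by (metis j_mult j_one hO_carr hat_carr)
  then show ?thesis using vc by blast
next
  case False
  then have i: "inverse b \<in> stalk q" using A.O_unit b(1) by blast
  have "b \<noteq> 0" using False A.m_zero by blast
  then have "\<iota> b \<otimes>\<^bsub>K_ring q f\<^esub> \<iota> (inverse b) = \<one>\<^bsub>K_ring q f\<^esub>"
    using iota_mult[OF b(1) i] by (simp add: iota_one)
  then show ?thesis using i by (intro bexI[of _ "hat_to_OK q f (to_hat q (inverse b))"]) (auto simp: iota_eq)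
qed

section \<open>Injectivity and separatedness along the tower\<close>

lemma fl_cancel0:
  assumes z: "fl \<otimes>\<^bsub>curve_loc q f\<^esub> a = \<zero>\<^bsub>curve_loc q f\<^esub>" and a: "a \<in> carrier (curve_loc q f)"
  shows "a = \<zero>\<^bsub>curve_loc q f\<^esub>"
proof -
  obtain \<alpha> s where as: "\<alpha> \<in> carrier H" "s \<in> off_curve q f" "a = S.fr \<alpha> s"
    using a unfolding curve_loc_def by (rule S.L_E)
  have "S.fr (hf \<otimes>\<^bsub>H\<^esub> \<alpha>) s = S.fr \<zero>\<^bsub>H\<^esub> \<one>\<^bsub>H\<^esub>"
    using z S.L_mult[OF hf_carr as(1) S.S_one as(2)] as hf_carr unfolding as(3) curve_loc_def to_loc_def S.L_zero by simp
  then obtain w where w: "w \<in> off_curve q f" "w \<otimes>\<^bsub>H\<^esub> (hf \<otimes>\<^bsub>H\<^esub> \<alpha> \<otimes>\<^bsub>H\<^esub> \<one>\<^bsub>H\<^esub>) = w \<otimes>\<^bsub>H\<^esub> (\<zero>\<^bsub>H\<^esub> \<otimes>\<^bsub>H\<^esub> s)"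
    using S.frac_eq_iff[of "hf \<otimes>\<^bsub>H\<^esub> \<alpha>" "\<zero>\<^bsub>H\<^esub>" s "\<one>\<^bsub>H\<^esub>"] as hf_carr S.S_one by auto
  have wc: "w \<in> carrier H" "s \<in> carrier H" using S.S_carr[OF w(1)] S.S_carr[OF as(2)] by simp_all
  have "hf \<otimes>\<^bsub>H\<^esub> (w \<otimes>\<^bsub>H\<^esub> \<alpha>) = \<zero>\<^bsub>H\<^esub>" using w(2) wc as(1) hf_carr by (simp add: Ch.m_lcomm)
  then have wa: "w \<otimes>\<^bsub>H\<^esub> \<alpha> = \<zero>\<^bsub>H\<^esub>" by (rule hf_cancel0) (use wc as(1) in auto)
  have "S.fr \<alpha> s = S.fr \<zero>\<^bsub>H\<^esub> \<one>\<^bsub>H\<^esub>"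
    using as wc wa S.S_one w(1) by (subst S.frac_eq_iff) (auto intro!: bexI[of _ w])
  then show ?thesis unfolding as(3) curve_loc_def S.L_zero .
qed

lemma fl_carr: "fl \<in> carrier (curve_loc q f)" by (rule tol_loc[OF hf_carr])

lemma fh_cancel0:
  assumes z: "fh \<otimes>\<^bsub>OK_ring q f\<^esub> \<xi> = \<zero>\<^bsub>OK_ring q f\<^esub>" and x: "\<xi> \<in> carrier (OK_ring q f)"
  shows "\<xi> = \<zero>\<^bsub>OK_ring q f\<^esub>"
proof -
  obtain x where x: "OK.coh x" "\<xi> = OK.cls x" using x unfolding OK_eq by (rule OK.C_E)
  have xc: "x n \<in> carrier (curve_loc q f)" for n by (rule OK.cohD(1)[OF x(1)])
  have cf: "OK.coh (\<lambda>n. fl \<otimes>\<^bsub>curve_loc q f\<^esub> x n)" by (rule OK.coh_mult[OF OK.coh_const[OF fl_carr] x(1)])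
  have "fh \<otimes>\<^bsub>OK_ring q f\<^esub> \<xi> = OK.cls (\<lambda>n. fl \<otimes>\<^bsub>curve_loc q f\<^esub> x n)"
    unfolding fh_eq x(2) OK_eq OK.toc_eq by (rule OK.C_mult[OF OK.coh_const[OF fl_carr] x(1)])
  then have fx: "fl \<otimes>\<^bsub>curve_loc q f\<^esub> x n \<in> OK.Pw n" for n
    using z OK.cls_zero_iff[OF cf] by (simp add: OK_eq)
  have "x n \<in> OK.Pw n" for n
  proof -
    \<comment> \<open>Dividing by \<open>f\<close> costs one power, so the entry at
      \<open>Suc n\<close> is used and coherence brings the result back to \<open>n\<close>.\<close>
    obtain y where y: "y \<in> carrier (curve_loc q f)" "fl \<otimes>\<^bsub>curve_loc q f\<^esub> x (Suc n) = fl [^]\<^bsub>curve_loc q f\<^esub> (Suc n) \<otimes>\<^bsub>curve_loc q f\<^esub> y"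
      using fx[of "Suc n"] OK.Pw_iff by blast
    let ?z = "fl [^]\<^bsub>curve_loc q f\<^esub> n \<otimes>\<^bsub>curve_loc q f\<^esub> y"
    have zc: "?z \<in> carrier (curve_loc q f)" using y fl_carr by simp
    have "fl \<otimes>\<^bsub>curve_loc q f\<^esub> x (Suc n) = fl \<otimes>\<^bsub>curve_loc q f\<^esub> ?z"
      unfolding y(2) using y(1) fl_carr by (simp add: OK.m_ac)
    then have "fl \<otimes>\<^bsub>curve_loc q f\<^esub> (x (Suc n) \<ominus>\<^bsub>curve_loc q f\<^esub> ?z) = \<zero>\<^bsub>curve_loc q f\<^esub>"
      using xc zc fl_carr by (simp add: OK.minus_eq OK.r_distr OK.r_minus OK.r_neg)
    then have "x (Suc n) \<ominus>\<^bsub>curve_loc q f\<^esub> ?z = \<zero>\<^bsub>curve_loc q f\<^esub>" by (rule fl_cancel0) (use xc zc in auto)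
    then have "x (Suc n) = ?z" using OK.r_right_minus_eq xc zc by blast
    then have "x (Suc n) \<in> OK.Pw n" using OK.Pw_I[OF y(1)] by simp
    then have "x (Suc n) \<ominus>\<^bsub>curve_loc q f\<^esub> (x (Suc n) \<ominus>\<^bsub>curve_loc q f\<^esub> x n) \<in> OK.Pw n"
      using OK.cohD(2)[OF x(1)] by (rule OK.Pw_minus)
    moreover have "x (Suc n) \<ominus>\<^bsub>curve_loc q f\<^esub> (x (Suc n) \<ominus>\<^bsub>curve_loc q f\<^esub> x n) = x n"
      using xc by (simp add: OK.minus_eq OK.minus_add OK.r_neg2)
    ultimately show ?thesis by simp
  qed
  then show ?thesis unfolding x(2) OK_eq using OK.cls_zero_iff[OF x(1)] by blast
qed

lemma fh_pow_cancel0: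
  assumes z: "fh [^]\<^bsub>OK_ring q f\<^esub> (n::nat) \<otimes>\<^bsub>OK_ring q f\<^esub> \<xi> = \<zero>\<^bsub>OK_ring q f\<^esub>" and x: "\<xi> \<in> carrier (OK_ring q f)"
  shows "\<xi> = \<zero>\<^bsub>OK_ring q f\<^esub>"
  using z
proof (induction n)
  case 0
  then show ?case using x by simp
next
  case (Suc n)
  have "fh \<otimes>\<^bsub>OK_ring q f\<^esub> (fh [^]\<^bsub>OK_ring q f\<^esub> n \<otimes>\<^bsub>OK_ring q f\<^esub> \<xi>) = \<zero>\<^bsub>OK_ring q f\<^esub>"
    using Suc.prems x by (simp add: OKr.m_assoc OKr.m_lcomm)
  then have "fh [^]\<^bsub>OK_ring q f\<^esub> n \<otimes>\<^bsub>OK_ring q f\<^esub> \<xi> = \<zero>\<^bsub>OK_ring q f\<^esub>"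
    by (rule fh_cancel0) (use x in auto)
  then show ?case by (rule Suc.IH)
qed

text \<open>Inverting \<open>f\<close> loses nothing because \<open>f\<close> is a nonzerodivisor in
  \<open>OK_ring q f\<close>. Identities can thus be checked in the local field.\<close>

lemma j_inj:
  assumes x: "\<xi> \<in> carrier (OK_ring q f)" "\<zeta> \<in> carrier (OK_ring q f)" and e: "j \<xi> = j \<zeta>"
  shows "\<xi> = \<zeta>"
proof -
  have "K.tol \<xi> = K.tol \<zeta>" using e by (simp add: OK_to_K_def)
  then obtain w where w: "w \<in> OK_powers q f" "w \<otimes>\<^bsub>OK_ring q f\<^esub> \<xi> = w \<otimes>\<^bsub>OK_ring q f\<^esub> \<zeta>"
    using K.tol_eq_iff[OF x] by blast
  obtain n :: nat where n: "w = fh [^]\<^bsub>OK_ring q f\<^esub> n" using w(1) by (auto simp: OK_powers_def powers_def)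
  have "fh [^]\<^bsub>OK_ring q f\<^esub> n \<otimes>\<^bsub>OK_ring q f\<^esub> (\<xi> \<ominus>\<^bsub>OK_ring q f\<^esub> \<zeta>) = \<zero>\<^bsub>OK_ring q f\<^esub>"
    using w(2) x unfolding n by (simp add: OKr.minus_eq OKr.r_distr OKr.r_minus OKr.r_neg)
  then have "\<xi> \<ominus>\<^bsub>OK_ring q f\<^esub> \<zeta> = \<zero>\<^bsub>OK_ring q f\<^esub>" by (rule fh_pow_cancel0) (use x in auto)
  then show ?thesis using OKr.r_right_minus_eq x by blast
qed

lemma fh_pow_multiple_comp:
  assumes x: "OK.coh x" and y: "\<zeta> \<in> carrier (OK_ring q f)" and e: "OK.cls x = fh [^]\<^bsub>OK_ring q f\<^esub> (n::nat) \<otimes>\<^bsub>OK_ring q f\<^esub> \<zeta>"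
  shows "x n \<in> OK.Pw n"
proof -
  obtain z where z: "OK.coh z" "\<zeta> = OK.cls z" using y unfolding OK_eq by (rule OK.C_E)
  have fn: "fl [^]\<^bsub>curve_loc q f\<^esub> n \<in> carrier (curve_loc q f)" using fl_carr by simp
  have cm: "OK.coh (\<lambda>k. fl [^]\<^bsub>curve_loc q f\<^esub> n \<otimes>\<^bsub>curve_loc q f\<^esub> z k)"
    by (rule OK.coh_mult[OF OK.coh_const[OF fn] z(1)])
  have "fh [^]\<^bsub>OK_ring q f\<^esub> n \<otimes>\<^bsub>OK_ring q f\<^esub> \<zeta> = OK.cls (\<lambda>k. fl [^]\<^bsub>curve_loc q f\<^esub> n \<otimes>\<^bsub>curve_loc q f\<^esub> z k)"
    unfolding fh_eq z(2) OK_eq OK.toc_pow[OF fl_carr] unfolding OK.toc_eq by (rule OK.C_mult[OF OK.coh_const[OF fn] z(1)])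
  then have "x n \<ominus>\<^bsub>curve_loc q f\<^esub> (fl [^]\<^bsub>curve_loc q f\<^esub> n \<otimes>\<^bsub>curve_loc q f\<^esub> z n) \<in> OK.Pw n"
    using e OK.cls_eq_iff[OF x cm] by simp
  moreover have "fl [^]\<^bsub>curve_loc q f\<^esub> n \<otimes>\<^bsub>curve_loc q f\<^esub> z n \<in> OK.Pw n" by (rule OK.Pw_I[OF OK.cohD(1)[OF z(1)]])
  ultimately have "(x n \<ominus>\<^bsub>curve_loc q f\<^esub> (fl [^]\<^bsub>curve_loc q f\<^esub> n \<otimes>\<^bsub>curve_loc q f\<^esub> z n)) \<oplus>\<^bsub>curve_loc q f\<^esub> (fl [^]\<^bsub>curve_loc q f\<^esub> n \<otimes>\<^bsub>curve_loc q f\<^esub> z n) \<in> OK.Pw n"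
    by (rule OK.Pw_add)
  then show ?thesis using OK.cohD(1)[OF x, of n] OK.cohD(1)[OF z(1), of n] fn by (simp add: OK.minus_eq OK.a_assoc OK.l_neg)
qed

lemma Fil_separated':
  assumes F: "\<And>N. Fil N \<kappa>"
  shows "\<kappa> = \<zero>\<^bsub>K_ring q f\<^esub>"
proof -
  obtain \<xi> where \<xi>: "\<xi> \<in> carrier (OK_ring q f)" "\<kappa> = j \<xi>" using F[of 0] unfolding Fil_def by auto
  obtain x where x: "OK.coh x" "\<xi> = OK.cls x" using \<xi>(1) unfolding OK_eq by (rule OK.C_E)
  have "x N \<in> OK.Pw N" for N
  proof -
    obtain \<zeta> where z: "\<zeta> \<in> carrier (OK_ring q f)" "\<kappa> = j (fh [^]\<^bsub>OK_ring q f\<^esub> N \<otimes>\<^bsub>OK_ring q f\<^esub> \<zeta>)"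
      using F[of N] unfolding Fil_def by blast
    have "\<xi> = fh [^]\<^bsub>OK_ring q f\<^esub> N \<otimes>\<^bsub>OK_ring q f\<^esub> \<zeta>" using z \<xi> by (intro j_inj) auto
    then show ?thesis using fh_pow_multiple_comp[OF x(1) z(1)] x(2) by simp
  qed
  then have "\<xi> = \<zero>\<^bsub>OK_ring q f\<^esub>" unfolding x(2) OK_eq using OK.cls_zero_iff[OF x(1)] by blast
  then show ?thesis unfolding \<xi>(2) by (simp add: j_zero)
qed

lemma good: "good_point F m q f"
  by (intro good_point.intro good_point_axioms.intro curve_point_axioms tower_axioms off_fO_unit' Fil_separated')

text \<open>Modulo the \<open>n\<close>-th power of \<open>f\<close>, an element of
  \<open>OK_ring q f\<close> is a fraction with denominator off the minimal primes. Such
  denominators are nonzerodivisors modulo \<open>f\<close>, so divisibility by powers of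
  \<open>f\<close> descends to the completed local ring.\<close>

lemma hO_multiple:
  assumes a: "\<alpha> \<in> carrier H" and y: "\<zeta> \<in> carrier (OK_ring q f)" and e: "hat_to_OK q f \<alpha> = fh [^]\<^bsub>OK_ring q f\<^esub> (n::nat) \<otimes>\<^bsub>OK_ring q f\<^esub> \<zeta>"
  shows "\<exists>\<beta>\<in>carrier H. \<alpha> = hf [^]\<^bsub>H\<^esub> n \<otimes>\<^bsub>H\<^esub> \<beta>"
proof -
  have "S.tol \<alpha> \<in> OK.Pw n"
    using fh_pow_multiple_comp[OF OK.coh_const[OF tol_loc[OF a]] y] e by (simp add: hat_to_OK_eq OK.toc_eq)
  then obtain l where l: "l \<in> carrier (curve_loc q f)" "S.tol \<alpha> = fl [^]\<^bsub>curve_loc q f\<^esub> n \<otimes>\<^bsub>curve_loc q f\<^esub> l"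
    using OK.Pw_iff by blast
  obtain \<beta> s where b: "\<beta> \<in> carrier H" "s \<in> off_curve q f" "l = S.fr \<beta> s"
    using l(1) unfolding curve_loc_def by (rule S.L_E)
  have fp: "fl [^]\<^bsub>curve_loc q f\<^esub> n = S.tol (hf [^]\<^bsub>H\<^esub> n)"
    using hf_carr by (induction n) (auto simp: curve_loc_def)
  have hn: "hf [^]\<^bsub>H\<^esub> n \<in> carrier H" using hf_carr by simp
  have sc: "s \<in> carrier H" using S.S_carr[OF b(2)] .
  have "S.fr \<alpha> \<one>\<^bsub>H\<^esub> = S.fr (hf [^]\<^bsub>H\<^esub> n \<otimes>\<^bsub>H\<^esub> \<beta>) (\<one>\<^bsub>H\<^esub> \<otimes>\<^bsub>H\<^esub> s)"
    using l(2)[unfolded fp b(3)] S.L_mult[OF hn b(1) S.S_one b(2)] unfolding curve_loc_def to_loc_def by simp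
  then have "S.fr \<alpha> \<one>\<^bsub>H\<^esub> = S.fr (hf [^]\<^bsub>H\<^esub> n \<otimes>\<^bsub>H\<^esub> \<beta>) s" using sc by simp
  then obtain w where w: "w \<in> off_curve q f" "w \<otimes>\<^bsub>H\<^esub> (\<alpha> \<otimes>\<^bsub>H\<^esub> s) = w \<otimes>\<^bsub>H\<^esub> (hf [^]\<^bsub>H\<^esub> n \<otimes>\<^bsub>H\<^esub> \<beta> \<otimes>\<^bsub>H\<^esub> \<one>\<^bsub>H\<^esub>)"
    using S.frac_eq_iff[of \<alpha> "hf [^]\<^bsub>H\<^esub> n \<otimes>\<^bsub>H\<^esub> \<beta>" "\<one>\<^bsub>H\<^esub>" s] a b hn S.S_one by auto
  have wc: "w \<in> carrier H" using S.S_carr[OF w(1)] .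
  have "(w \<otimes>\<^bsub>H\<^esub> s) \<otimes>\<^bsub>H\<^esub> \<alpha> = hf [^]\<^bsub>H\<^esub> n \<otimes>\<^bsub>H\<^esub> (w \<otimes>\<^bsub>H\<^esub> \<beta>)"
    using w(2) wc sc a b(1) hn by (simp add: Ch.m_ac)
  moreover have "nzd (w \<otimes>\<^bsub>H\<^esub> s)" using off_curve_nzd S.S_mult[OF w(1) b(2)] by blast
  ultimately show ?thesis using nzd_pow[of "w \<otimes>\<^bsub>H\<^esub> s" \<alpha> "w \<otimes>\<^bsub>H\<^esub> \<beta>" n] a b(1) wc by auto
qed

text \<open>A small substitute for faithful flatness: truncating at index \<open>M\<close> leaves an
  error in the \<open>M\<close>-th power of the maximal ideal, which lies in the ideal of
  \<open>d\<close> and \<open>f\<close> anyway.\<close>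

lemma hat_combination:
  assumes c: "c \<in> stalk q" and d: "d \<in> stalk q" "d \<notin> fO"
    and e: "\<gamma> \<in> carrier H" "\<beta> \<in> carrier H" "to_hat q c = to_hat q d \<otimes>\<^bsub>H\<^esub> \<gamma> \<oplus>\<^bsub>H\<^esub> hf \<otimes>\<^bsub>H\<^esub> \<beta>"
  shows "\<exists>u\<in>stalk q. \<exists>v\<in>stalk q. c = d * u + f * v"
proof (cases "d \<in> stalk_ideal q q")
  case True
  obtain M B where "transversal ratfun_const (stalk q) (stalk_ideal q q) f d M B" using transversalI[OF True d(2)] by blast
  then interpret T: transversal ratfun_const "stalk q" "stalk_ideal q q" f d M B .
  obtain x where x: "A.coh x" "\<gamma> = A.cls x" using e(1) by (rule H_E)
  obtain y where y: "A.coh y" "\<beta> = A.cls y" using e(2) by (rule H_E)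
  have c1: "A.coh (\<lambda>n. d * x n)" by (intro A.coh_mult' A.coh_const' d x)
  have c2: "A.coh (\<lambda>n. f * y n)" by (intro A.coh_mult' A.coh_const' f_stalk y)
  have "A.cls (\<lambda>n. c) = A.cls (\<lambda>n. d * x n + f * y n)"
    using e(3) hat_mult_cls[OF d(1) x(1)] hat_mult_cls[OF f_stalk y(1)] A.C_add[OF c1 c2] x(2) y(2)
    by (simp add: to_hat_eq A.toc_eq completed_eq)
  then have "c - (d * x M + f * y M) \<in> A.Pw M"
    by (rule cls_eqD[OF _ A.coh_const'[OF c] A.coh_add'[OF c1 c2]])
  then obtain u v where uv: "u \<in> stalk q" "v \<in> stalk q" "c - (d * x M + f * y M) = d * u + f * v"
    using T.Pw_M unfolding T.If_def by blast
  have "c = d * (x M + u) + f * (y M + v)" using uv(3) by (simp add: algebra_simps)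
  then show ?thesis using uv A.coh_O[OF x(1)] A.coh_O[OF y(1)] A.O_add by blast
next
  case False
  then have i: "inverse d \<in> stalk q" "d \<noteq> 0" using A.O_unit d A.m_zero by auto
  then have "c = d * (inverse d * c) + f * 0" by simp
  then show ?thesis using i c A.O_mult A.O_zero by blast
qed

text \<open>The local core of the argument. Clearing powers of \<open>f\<close> from
  \<open>r\<close> and \<open>\<kappa>\<close>, which agree beyond order \<open>N\<close>, makes
  \<open>f ^ E * c\<close> minus a multiple of \<open>d\<close> divisible by
  \<open>f ^ Suc E\<close>, first in \<open>OK_ring q f\<close>, then in the completed local ring.
  Hence \<open>d\<close> divides \<open>c\<close> modulo \<open>f\<close>, there and finally in the
  local ring: the leading coefficient \<open>c / d\<close> is regular on the curve at
  \<open>q\<close>.\<close>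

lemma regular_on_curve:
  fixes N :: int and l k :: nat
  assumes c: "c \<in> stalk q" and d: "d \<in> stalk q" "d \<notin> fO" and r: "r \<in> function_field" "r = f powi N * c / d"
    and \<kappa>: "\<kappa> \<in> B_to_K q f ` carrier (B_ring q f)" and k: "N < int k"
    and F: "Fil k (funfield_to_K q f r \<ominus>\<^bsub>K_ring q f\<^esub> \<kappa>)"
  shows "\<exists>u\<in>stalk q. \<exists>v\<in>stalk q. c = d * u + f * v"
proof -
  interpret G: good_point F m q f by (rule good)
  let ?K = "K_ring q f"
  obtain n :: nat and \<alpha> where n: "\<kappa> \<in> carrier ?K" "\<alpha> \<in> carrier H" "\<iota> f [^]\<^bsub>?K\<^esub> n \<otimes>\<^bsub>?K\<^esub> \<kappa> = j (hat_to_OK q f \<alpha>)"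
    using \<kappa> unfolding B_image_iff by blast
  \<comment> \<open>\<open>n\<close> clears the denominator of \<open>\<kappa>\<close>; the summand
    \<open>nat (- N)\<close> makes \<open>E = e + N\<close> a natural number.\<close>
  define e where "e = n + nat (- N)"
  define E where "E = nat (int e + N)"
  have E: "int E = int e + N" by (simp add: E_def e_def)
  \<comment> \<open>After clearing, the error has order at least \<open>e + k\<close>, strictly
    above \<open>E\<close>. This is where agreement beyond the leading term enters.\<close>
  have ek: "Suc E \<le> e + k" using E k by linarith
  obtain \<xi> where \<xi>: "\<xi> \<in> carrier (OK_ring q f)" "funfield_to_K q f r \<ominus>\<^bsub>?K\<^esub> \<kappa> = j (fh [^]\<^bsub>OK_ring q f\<^esub> k \<otimes>\<^bsub>OK_ring q f\<^esub> \<xi>)"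
    using F unfolding Fil_def by blast
  define \<phi>r where "\<phi>r = funfield_to_K q f r"
  have \<phi>c: "\<phi>r \<in> carrier ?K" unfolding \<phi>r_def using G.phi_carr r by blast
  have d0: "d \<noteq> 0" using d fO_I[OF A.O_zero] by auto
  have fO: "f ^ i \<in> stalk q" for i by (rule A.O_power[OF f_stalk])
  have "f ^ e * f powi N = f ^ E" using f_nz E by (simp flip: power_int_of_nat add: power_int_add)
  moreover have "d * (f ^ e * r) = f ^ e * f powi N * c" using r(2) d0 by simp
  ultimately have "d * (f ^ e * r) = f ^ E * c" by simp
  then have "funfield_to_K q f (d * (f ^ e * r)) = \<iota> (f ^ E * c)"
    using G.phi_stalk[OF A.O_mult[OF fO c]] by simp
  then have 1: "\<iota> d \<otimes>\<^bsub>?K\<^esub> (\<iota> f [^]\<^bsub>?K\<^esub> e \<otimes>\<^bsub>?K\<^esub> \<phi>r) = \<iota> (f ^ E * c)"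
  proof -
    have ff: "d \<in> function_field" "f ^ e \<in> function_field" "f ^ e * r \<in> function_field"
      using stalk_funfield[OF d(1)] stalk_funfield[OF fO] r(1) funfield_closed(3) by auto
    have "funfield_to_K q f (d * (f ^ e * r)) = \<iota> d \<otimes>\<^bsub>?K\<^esub> (\<iota> (f ^ e) \<otimes>\<^bsub>?K\<^esub> \<phi>r)"
      unfolding \<phi>r_def G.phi_mult[OF ff(1,3)] G.phi_mult[OF ff(2) r(1)] G.phi_stalk[OF d(1)] G.phi_stalk[OF fO] ..
    then show ?thesis
      using \<open>funfield_to_K q f (d * (f ^ e * r)) = \<iota> (f ^ E * c)\<close> by (simp only: iota_pow[OF f_stalk])
  qed
  define \<alpha>' where "\<alpha>' = hf [^]\<^bsub>H\<^esub> (nat (- N)) \<otimes>\<^bsub>H\<^esub> \<alpha>"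
  have \<alpha>'c: "\<alpha>' \<in> carrier H" using n(2) hf_carr by (simp add: \<alpha>'_def)
  have jh: "j (hat_to_OK q f (hf [^]\<^bsub>H\<^esub> i)) = \<iota> f [^]\<^bsub>?K\<^esub> i" for i :: nat
    unfolding hat_pow[OF f_stalk] iota_pow[OF f_stalk, symmetric] by (rule iota_eq[symmetric])
  have 2: "\<iota> f [^]\<^bsub>?K\<^esub> e \<otimes>\<^bsub>?K\<^esub> \<kappa> = j (hat_to_OK q f \<alpha>')"
  proof -
    have "\<iota> f [^]\<^bsub>?K\<^esub> e = \<iota> f [^]\<^bsub>?K\<^esub> nat (- N) \<otimes>\<^bsub>?K\<^esub> \<iota> f [^]\<^bsub>?K\<^esub> n"
      unfolding e_def using f_stalk by (simp add: KK.nat_pow_mult add.commute)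
    then have "\<iota> f [^]\<^bsub>?K\<^esub> e \<otimes>\<^bsub>?K\<^esub> \<kappa> = \<iota> f [^]\<^bsub>?K\<^esub> nat (- N) \<otimes>\<^bsub>?K\<^esub> j (hat_to_OK q f \<alpha>)"
      using n f_stalk by (simp add: KK.m_assoc)
    also have "\<dots> = j (hat_to_OK q f \<alpha>')"
      unfolding jh[symmetric] \<alpha>'_def using n(2) hf_carr by (simp add: hO_mult j_mult)
    finally show ?thesis .
  qed
  let ?g = "to_hat q (f ^ E * c) \<ominus>\<^bsub>H\<^esub> to_hat q d \<otimes>\<^bsub>H\<^esub> \<alpha>'"
  have gc: "to_hat q (f ^ E * c) \<in> carrier H" "to_hat q d \<otimes>\<^bsub>H\<^esub> \<alpha>' \<in> carrier H" "to_hat q d \<in> carrier H"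
    using A.O_mult[OF fO c] d(1) \<alpha>'c by auto
  have hO_minus: "hat_to_OK q f (x \<ominus>\<^bsub>H\<^esub> y) = hat_to_OK q f x \<ominus>\<^bsub>OK_ring q f\<^esub> hat_to_OK q f y"
    if "x \<in> carrier H" "y \<in> carrier H" for x y
  proof -
    have "hat_to_OK q f x = hat_to_OK q f (x \<ominus>\<^bsub>H\<^esub> y) \<oplus>\<^bsub>OK_ring q f\<^esub> hat_to_OK q f y"
    proof -
      have "(x \<ominus>\<^bsub>H\<^esub> y) \<oplus>\<^bsub>H\<^esub> y = x" using that by (simp add: Ch.minus_eq Ch.a_assoc Ch.l_neg)
      then show ?thesis using hO_add[of "x \<ominus>\<^bsub>H\<^esub> y" y] that by simp
    qed
    then show ?thesis using that by (simp add: OKr.minus_eq OKr.a_assoc OKr.r_neg hO_carr)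
  qed
  define \<zeta> where "\<zeta> = hat_to_OK q f (to_hat q d) \<otimes>\<^bsub>OK_ring q f\<^esub> (fh [^]\<^bsub>OK_ring q f\<^esub> (e + k - Suc E) \<otimes>\<^bsub>OK_ring q f\<^esub> \<xi>)"
  have \<zeta>c: "\<zeta> \<in> carrier (OK_ring q f)" using \<xi>(1) gc(3) by (simp add: \<zeta>_def hO_carr)
  have "j (hat_to_OK q f ?g) = \<iota> (f ^ E * c) \<ominus>\<^bsub>?K\<^esub> \<iota> d \<otimes>\<^bsub>?K\<^esub> j (hat_to_OK q f \<alpha>')"
    using gc \<alpha>'c by (simp add: hO_minus j_minus hO_mult j_mult iota_eq hO_carr)
  also have "\<dots> = \<iota> d \<otimes>\<^bsub>?K\<^esub> (\<iota> f [^]\<^bsub>?K\<^esub> e \<otimes>\<^bsub>?K\<^esub> \<phi>r) \<ominus>\<^bsub>?K\<^esub> \<iota> d \<otimes>\<^bsub>?K\<^esub> (\<iota> f [^]\<^bsub>?K\<^esub> e \<otimes>\<^bsub>?K\<^esub> \<kappa>)"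
    by (simp only: 1 2)
  also have "\<dots> = \<iota> d \<otimes>\<^bsub>?K\<^esub> (\<iota> f [^]\<^bsub>?K\<^esub> e \<otimes>\<^bsub>?K\<^esub> (\<phi>r \<ominus>\<^bsub>?K\<^esub> \<kappa>))"
    using d(1) f_stalk \<phi>c n(1) by (simp add: KK.minus_eq KK.r_distr KK.r_minus)
  also have "\<dots> = \<iota> d \<otimes>\<^bsub>?K\<^esub> (\<iota> f [^]\<^bsub>?K\<^esub> e \<otimes>\<^bsub>?K\<^esub> (\<iota> f [^]\<^bsub>?K\<^esub> k \<otimes>\<^bsub>?K\<^esub> j \<xi>))"
    unfolding \<phi>r_def \<xi>(2) using \<xi>(1) by (simp add: j_mult j_pow iota_f)
  also have "\<dots> = \<iota> d \<otimes>\<^bsub>?K\<^esub> (\<iota> f [^]\<^bsub>?K\<^esub> (e + k) \<otimes>\<^bsub>?K\<^esub> j \<xi>)"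
    using \<xi>(1) f_stalk by (simp add: KK.m_assoc[symmetric] KK.nat_pow_mult)
  also have "\<iota> f [^]\<^bsub>?K\<^esub> (e + k) = \<iota> f [^]\<^bsub>?K\<^esub> Suc E \<otimes>\<^bsub>?K\<^esub> \<iota> f [^]\<^bsub>?K\<^esub> (e + k - Suc E)"
    using KK.nat_pow_mult[OF iota_carr[OF f_stalk], of "Suc E" "e + k - Suc E", symmetric] le_add_diff_inverse[OF ek]
    by (simp only:)
  also have "\<iota> d \<otimes>\<^bsub>?K\<^esub> (\<iota> f [^]\<^bsub>?K\<^esub> Suc E \<otimes>\<^bsub>?K\<^esub> \<iota> f [^]\<^bsub>?K\<^esub> (e + k - Suc E) \<otimes>\<^bsub>?K\<^esub> j \<xi>) = j (fh [^]\<^bsub>OK_ring q f\<^esub> Suc E \<otimes>\<^bsub>OK_ring q f\<^esub> \<zeta>)"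
  proof -
    have "j (fh [^]\<^bsub>OK_ring q f\<^esub> Suc E \<otimes>\<^bsub>OK_ring q f\<^esub> \<zeta>) =
        \<iota> f [^]\<^bsub>?K\<^esub> Suc E \<otimes>\<^bsub>?K\<^esub> (\<iota> d \<otimes>\<^bsub>?K\<^esub> (\<iota> f [^]\<^bsub>?K\<^esub> (e + k - Suc E) \<otimes>\<^bsub>?K\<^esub> j \<xi>))"
      unfolding \<zeta>_def iota_f iota_eq[of d]
      using \<xi>(1) gc(3) by (simp add: j_mult j_pow hO_carr del: Group.nat_pow_Suc)
    then show ?thesis using \<xi>(1) d(1) f_stalk by (simp add: KK.m_ac del: Group.nat_pow_Suc)
  qed
  finally have "hat_to_OK q f ?g = fh [^]\<^bsub>OK_ring q f\<^esub> Suc E \<otimes>\<^bsub>OK_ring q f\<^esub> \<zeta>"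
    using gc \<zeta>c by (intro j_inj) (auto simp: hO_carr)
  then obtain \<beta> where b: "\<beta> \<in> carrier H" "?g = hf [^]\<^bsub>H\<^esub> Suc E \<otimes>\<^bsub>H\<^esub> \<beta>"
    using hO_multiple[of ?g \<zeta> "Suc E"] gc \<zeta>c by auto
  have cc: "to_hat q c \<in> carrier H" using c by blast
  have "to_hat q d \<otimes>\<^bsub>H\<^esub> \<alpha>' = to_hat q (f ^ E * c) \<ominus>\<^bsub>H\<^esub> ?g"
    using gc by (simp add: Ch.minus_eq Ch.minus_add Ch.r_neg2)
  also have "\<dots> = hf [^]\<^bsub>H\<^esub> E \<otimes>\<^bsub>H\<^esub> (to_hat q c \<ominus>\<^bsub>H\<^esub> hf \<otimes>\<^bsub>H\<^esub> \<beta>)"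
    unfolding b(2) using b(1) cc hf_carr
    by (simp add: hat_mult[OF fO c] hat_pow[OF f_stalk, symmetric] Ch.minus_eq Ch.r_distr Ch.r_minus Ch.m_assoc)
  finally have da: "to_hat q d \<otimes>\<^bsub>H\<^esub> \<alpha>' = hf [^]\<^bsub>H\<^esub> E \<otimes>\<^bsub>H\<^esub> (to_hat q c \<ominus>\<^bsub>H\<^esub> hf \<otimes>\<^bsub>H\<^esub> \<beta>)" .
  have xc: "to_hat q c \<ominus>\<^bsub>H\<^esub> hf \<otimes>\<^bsub>H\<^esub> \<beta> \<in> carrier H" using cc b(1) hf_carr by simp
  \<comment> \<open>\<open>f ^ E\<close> can be removed from the last equation, as \<open>d\<close>
    is either a unit or a nonzerodivisor modulo \<open>f\<close>.\<close>
  have "\<exists>\<gamma>\<in>carrier H. to_hat q c \<ominus>\<^bsub>H\<^esub> hf \<otimes>\<^bsub>H\<^esub> \<beta> = to_hat q d \<otimes>\<^bsub>H\<^esub> \<gamma>"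
  proof (cases "d \<in> stalk_ideal q q")
    case True
    show ?thesis using nzd_pow[OF nzd_transversal[OF True d(2)] \<alpha>'c xc da] by blast
  next
    case False
    then have i: "inverse d \<in> stalk q" using A.O_unit d by blast
    have "to_hat q d \<otimes>\<^bsub>H\<^esub> to_hat q (inverse d) = \<one>\<^bsub>H\<^esub>" using hat_mult[OF d(1) i] d0 by (simp add: hat_one)
    then show ?thesis using i xc gc(3)
      by (intro bexI[of _ "to_hat q (inverse d) \<otimes>\<^bsub>H\<^esub> (to_hat q c \<ominus>\<^bsub>H\<^esub> hf \<otimes>\<^bsub>H\<^esub> \<beta>)"])
        (auto simp: Ch.m_assoc[symmetric] hat_carr)
  qed
  then obtain \<gamma> where g: "\<gamma> \<in> carrier H" "to_hat q c \<ominus>\<^bsub>H\<^esub> hf \<otimes>\<^bsub>H\<^esub> \<beta> = to_hat q d \<otimes>\<^bsub>H\<^esub> \<gamma>" by blast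
  have "to_hat q c = (to_hat q c \<ominus>\<^bsub>H\<^esub> hf \<otimes>\<^bsub>H\<^esub> \<beta>) \<oplus>\<^bsub>H\<^esub> hf \<otimes>\<^bsub>H\<^esub> \<beta>"
    using cc b(1) hf_carr by (simp add: Ch.minus_eq Ch.a_assoc Ch.l_neg)
  then have "to_hat q c = to_hat q d \<otimes>\<^bsub>H\<^esub> \<gamma> \<oplus>\<^bsub>H\<^esub> hf \<otimes>\<^bsub>H\<^esub> \<beta>" using g(2) by simp
  then show ?thesis by (rule hat_combination[OF c d g(1) b(1)])
qed

end

section \<open>Dehomogenization\<close>

lemma coeff_dehomogenize:
  assumes "homogeneous d G"
  shows "coeff (coeff (dehomogenize G) j) i = (if i + j \<le> d then gc G i j (d - i - j) else 0)"
proof -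
  have "coeff (coeff (dehomogenize G) j) i = (\<Sum>l\<le>degree G. gc G i j l)"
    by (simp add: dehomogenize_def poly_altdef coeff_sum gc_def)
  also have "\<dots> = (\<Sum>l\<le>degree G. if l = d - i - j then (if i + j \<le> d then gc G i j (d - i - j) else 0) else 0)"
  proof (rule sum.cong)
    fix l
    show "gc G i j l = (if l = d - i - j then (if i + j \<le> d then gc G i j (d - i - j) else 0) else 0)"
    proof (cases "gc G i j l = 0")
      case False
      then have "i + j + l = d" using assms by (simp add: homogeneous_gc)
      then show ?thesis by auto
    qed auto
  qed simp
  also have "\<dots> = (if i + j \<le> d then gc G i j (d - i - j) else 0)"
    using coeff_eq_0[of G "d - i - j"] by (auto simp: sum.delta gc_def)
  finally show ?thesis .
qed

lemma degree_dehomogenize_le: "homogeneous d G \<Longrightarrow> degree (dehomogenize G) \<le> d"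
  by (rule degree_le) (auto intro!: poly_eqI simp: coeff_dehomogenize)

lemma dehomogenize_eq_0:
  assumes "homogeneous d G" "dehomogenize G = 0" shows "G = 0"
proof (rule form_eqI)
  fix i j l
  show "gc G i j l = gc 0 i j l"
  proof (cases "gc G i j l = 0")
    case False
    then have "i + j + l = d" using assms by (simp add: homogeneous_gc)
    then show ?thesis using coeff_dehomogenize[OF assms(1), of j i] assms(2) by (auto simp: gc_zero)
  qed (simp add: gc_zero)
qed

text \<open>Built up along the generators; summands of different degree are multiplied by powers of
  \<open>form_z\<close>, which become 1. The degree is not claimed to be minimal.\<close>

lemma homogenization: "\<exists>d G. homogeneous d G \<and> dehomogenize G = g"
proof -
  note D = rhomD[OF rhom_dehomogenize]
  have add: "\<exists>d G. homogeneous d G \<and> dehomogenize G = g + h"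
    if "\<exists>d G. homogeneous d G \<and> dehomogenize G = g" "\<exists>d G. homogeneous d G \<and> dehomogenize G = h" for g h :: "'a poly poly"
  proof -
    from that(1) obtain d G where "homogeneous d G" "dehomogenize G = g" by (elim exE conjE)
    moreover from that(2) obtain e H where "homogeneous e H" "dehomogenize H = h" by (elim exE conjE)
    ultimately have "homogeneous d G" "dehomogenize G = g" "homogeneous e H" "dehomogenize H = h" by simp_all
    then show ?thesis
      using homogeneous_add[OF homogeneous_mult[OF _ homogeneous_power1[OF homogeneous_vars(3)], of d G e]
          homogeneous_mult[OF homogeneous_power1[OF homogeneous_vars(3)], of e H d]]
      by (intro exI[of _ "d + e"] exI[of _ "G * form_z ^ e + form_z ^ d * H"]) (simp add: D dehomogenize_gens)
  qed
  have var: "\<exists>d G. homogeneous d G \<and> dehomogenize G = dehomogenize v * g"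
    if "\<exists>d G. homogeneous d G \<and> dehomogenize G = g" "homogeneous (Suc 0) v" for g :: "'a poly poly" and v
    using that homogeneous_mult D(2) by metis
  have "\<exists>d G. homogeneous d G \<and> dehomogenize G = [:p:]" for p :: "'a poly"
  proof (induction p)
    case 0
    show ?case by (intro exI[of _ 0] exI[of _ "0 :: 'a form"]) (simp add: D)
  next
    case (pCons a p)
    have "[:pCons a p:] = dehomogenize (form_const a) + dehomogenize form_x * [:p:]" by (simp add: dehomogenize_gens)
    then show ?case using add[OF _ var[OF pCons(2) homogeneous_vars(1)], of "dehomogenize (form_const a)"] homogeneous_const by metis
  qed
  note c = this
  show ?thesis
  proof (induction g)
    case 0
    show ?case by (intro exI[of _ 0] exI[of _ "0 :: 'a form"]) (simp add: D)
  next
    case (pCons a g)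
    have "pCons a g = [:a:] + dehomogenize form_y * g" by (simp add: dehomogenize_gens)
    then show ?case using add[OF c var[OF pCons(2) homogeneous_vars(2)], of a] by metis
  qed
qed

definition ev :: "'k::field poly poly \<Rightarrow> 'k ratfun" where
  "ev = ev2 ratfun_const (emb form_x / emb form_z) (emb form_y / emb form_z)"

lemma rhom_ev: "rhom ev" unfolding ev_def by (rule rhom_ev2[OF rhom_ratfun_const])
lemmas evD = rhomD[OF rhom_ev]
lemma ev_const: "ev [:[:c:]:] = ratfun_const c" unfolding ev_def by (rule ev2_gens(1)[OF rhom_ratfun_const])

lemma z_nz [simp]: "form_z \<noteq> 0" "form_x \<noteq> 0" "form_y \<noteq> 0" by (simp_all add: form_z_def form_x_def form_y_def)

lemma emb_ev:
  assumes "homogeneous d G"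
  shows "emb G = emb form_z ^ d * ev (dehomogenize G)"
proof -
  have "emb G = ev3 ratfun_const (emb form_z * (emb form_x / emb form_z)) (emb form_z * (emb form_y / emb form_z)) (emb form_z * 1) G"
    by (subst emb_ev3) simp
  also have "\<dots> = emb form_z ^ d * ev (dehomogenize G)"
    unfolding ev3_scale[OF rhom_ratfun_const assms] ev_def ev3_dehomogenize[OF rhom_ratfun_const] ..
  finally show ?thesis .
qed

lemma ev_eq_0: "ev g = 0 \<longleftrightarrow> g = 0"
proof
  assume e: "ev g = 0"
  obtain d G where G: "homogeneous d G" "dehomogenize G = g" using homogenization by blast
  then have "emb G = 0" using emb_ev[OF G(1)] e by simp
  then show "g = 0" using G(2) rhomD(4)[OF rhom_dehomogenize] by auto
qed (simp add: evD)
lemma ev_inj: "ev g = ev h \<longleftrightarrow> g = h" using ev_eq_0[of "g - h"] by (simp add: evD)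

lemma ev_quot: "homogeneous d G \<Longrightarrow> emb G / emb form_z ^ d = ev (dehomogenize G)"
  using emb_ev[of d G] by simp

lemma ev_quot2: "homogeneous d G \<Longrightarrow> homogeneous d H \<Longrightarrow> emb G / emb H = ev (dehomogenize G) / ev (dehomogenize H)"
  by (simp add: emb_ev)

lemma ev_funfield: "ev g \<in> function_field"
proof -
  obtain d G where G: "homogeneous d G" "dehomogenize G = g" using homogenization by blast
  show ?thesis using funfieldI[OF G(1) homogeneous_power1[OF homogeneous_vars(3)]] ev_quot[OF G(1)] G(2)
    by (simp add: rhomD[OF rhom_emb])
qed

section \<open>Homogeneous prime ideals\<close>

context plane_point
begin

lemma q_uminus: "x \<in> q \<Longrightarrow> - x \<in> q" using q_mult[of x "- 1"] by simp
lemma q_diff: "x \<in> q \<Longrightarrow> y \<in> q \<Longrightarrow> x - y \<in> q" using q_add[of x "- y"] q_uminus by simp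
lemma q_sum: "(\<And>i. i \<in> A \<Longrightarrow> g i \<in> q) \<Longrightarrow> (\<Sum>i\<in>A. g i) \<in> q"
  by (induction A rule: infinite_finite_induct) (auto simp: q_zero q_add)

lemma genideal_minimal_set:
  assumes "0 \<in> J" "\<And>x y. x \<in> J \<Longrightarrow> y \<in> J \<Longrightarrow> x + y \<in> J" "\<And>x y. x \<in> J \<Longrightarrow> y * x \<in> J" "A \<subseteq> J"
  shows "genideal (ring_of_type_algebra :: 'b::comm_ring_1 ring) A \<subseteq> J"
proof -
  interpret R: cring "ring_of_type_algebra :: 'b ring" by (rule cring_from_type_algebra)
  have "ideal J ring_of_type_algebra"
  proof (rule idealI[OF R.ring_axioms])
    show "subgroup J (add_monoid ring_of_type_algebra)"
    proof (rule R.add.subgroupI)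
      fix x assume x: "x \<in> J"
      have "\<ominus>\<^bsub>ring_of_type_algebra\<^esub> x = - 1 * x" using R.minus_equality[of "- 1 * x" x] by simp
      then show "\<ominus>\<^bsub>ring_of_type_algebra\<^esub> x \<in> J" using assms(3)[OF x, of "- 1"] by simp
    qed (use assms in auto)
  qed (use assms(3) in \<open>auto simp: mult.commute\<close>)
  then show ?thesis using R.genideal_minimal assms(4) by blast
qed

text \<open>A scheme point is generated by its homogeneous members, and the elements with all
  components in \<open>q\<close> form an ideal that contains these generators.\<close>

lemma hcomp_in:
  assumes "G \<in> q" shows "hcomp e G \<in> q"
proof -
  define J where "J = {G. \<forall>e. hcomp e G \<in> q}"
  have "genideal ring_of_type_algebra {G \<in> q. \<exists>d. homogeneous d G} \<subseteq> J"
  proof (rule genideal_minimal_set)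
    show "0 \<in> J" by (simp add: J_def hcomp_zero q_zero)
    show "x + y \<in> J" if "x \<in> J" "y \<in> J" for x y using that q_add by (simp add: J_def hcomp_add)
    show "y * x \<in> J" if x: "x \<in> J" for x y
    proof -
      obtain D where D: "\<forall>e>D. hcomp e y = 0" using hcomp_bound by blast
      have "hcomp e (y * x) \<in> q" for e
      proof -
        have "hcomp e (y * x) = hcomp e ((\<Sum>d\<le>D. hcomp d y) * x)" using sum_hcomp[OF D] by simp
        also have "\<dots> = (\<Sum>d\<le>D. if d \<le> e then hcomp d y * hcomp (e - d) x else 0)"
          by (simp add: sum_distrib_right hcomp_sum hcomp_mult_homogeneous[OF hcomp_homogeneous])
        also have "\<dots> \<in> q" using x by (intro q_sum) (auto simp: J_def q_mult' q_zero)
        finally show ?thesis .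
      qed
      then show ?thesis by (simp add: J_def)
    qed
    show "{G \<in> q. \<exists>d. homogeneous d G} \<subseteq> J" by (auto simp: J_def hcomp_of_homogeneous q_zero)
  qed
  then have "q \<subseteq> J" using proj unfolding proj_point_def by auto
  then show ?thesis using assms by (auto simp: J_def)
qed

end

lemma homogeneous_subset:
  assumes "plane_point q" "plane_point q'" and "\<And>d G. homogeneous d G \<Longrightarrow> G \<in> q \<Longrightarrow> G \<in> q'"
  shows "q \<subseteq> q'"
proof
  fix G assume G: "G \<in> q"
  obtain D where D: "\<forall>e>D. hcomp e G = 0" using hcomp_bound by blast
  have "hcomp e G \<in> q'" for e
    by (rule assms(3)[OF hcomp_homogeneous plane_point.hcomp_in[OF assms(1) G]])
  then have "(\<Sum>e\<le>D. hcomp e G) \<in> q'" by (rule plane_point.q_sum[OF assms(2)])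
  then show "G \<in> q'" using sum_hcomp[OF D] by simp
qed

lemma prime_type_algebra:
  fixes J :: "'a::comm_ring_1 set"
  assumes "0 \<in> J" "\<And>x y. x \<in> J \<Longrightarrow> y \<in> J \<Longrightarrow> x + y \<in> J" "\<And>x y. x \<in> J \<Longrightarrow> y * x \<in> J" "1 \<notin> J"
    "\<And>x y. x * y \<in> J \<Longrightarrow> x \<in> J \<or> y \<in> J"
  shows "primeideal J ring_of_type_algebra"
proof -
  interpret R: cring "ring_of_type_algebra :: 'a ring" by (rule cring_from_type_algebra)
  have "ideal J ring_of_type_algebra"
  proof (rule idealI[OF R.ring_axioms])
    show "subgroup J (add_monoid ring_of_type_algebra)"
    proof (rule R.add.subgroupI)
      fix x assume x: "x \<in> J"
      have "\<ominus>\<^bsub>ring_of_type_algebra\<^esub> x = - 1 * x" using R.minus_equality[of "- 1 * x" x] by simp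
      then show "\<ominus>\<^bsub>ring_of_type_algebra\<^esub> x \<in> J" using assms(3)[OF x, of "- 1"] by simp
    qed (use assms in auto)
  qed (use assms(3) in \<open>auto simp: mult.commute\<close>)
  then show ?thesis
    by (rule primeidealI) (use assms R.is_cring in auto)
qed

lemma genideal_homogeneous:
  fixes q :: "'k::field form set"
  assumes "0 \<in> q" "\<And>x y. x \<in> q \<Longrightarrow> y \<in> q \<Longrightarrow> x + y \<in> q" "\<And>x y. x \<in> q \<Longrightarrow> y * x \<in> q"
    "\<And>G e. G \<in> q \<Longrightarrow> hcomp e G \<in> q"
  shows "q = genideal ring_of_type_algebra {G \<in> q. \<exists>d. homogeneous d G}"
proof
  let ?A = "{G \<in> q. \<exists>d. homogeneous d G}"
  interpret R: cring "ring_of_type_algebra :: 'k form ring" by (rule cring_from_type_algebra)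
  show "genideal ring_of_type_algebra ?A \<subseteq> q"
    by (rule plane_point.genideal_minimal_set[OF plane_point_zero]) (use assms in auto)
  have A: "ideal (genideal ring_of_type_algebra ?A) ring_of_type_algebra" by (rule R.genideal_ideal) simp
  note S = ideal.axioms(1)[OF A]
  show "q \<subseteq> genideal ring_of_type_algebra ?A"
  proof
    fix G assume G: "G \<in> q"
    obtain D where D: "\<forall>e>D. hcomp e G = 0" using hcomp_bound by blast
    have "hcomp e G \<in> ?A" for e using assms(4)[OF G] hcomp_homogeneous[of e G] by blast
    then have "hcomp e G \<in> genideal ring_of_type_algebra ?A" for e
      using subsetD[OF R.genideal_self[of ?A]] by simp
    note hg = this
    have "(\<Sum>e\<le>n. hcomp e G) \<in> genideal ring_of_type_algebra ?A" for n
    proof (induction n)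
      case (Suc n)
      show ?case using additive_subgroup.a_closed[OF S Suc hg[of "Suc n"]] by simp
    qed (use hg in simp)
    from this[of D] show "G \<in> genideal ring_of_type_algebra ?A" using sum_hcomp[OF D] by simp
  qed
qed

text \<open>Restriction to \<open>y = z = 0\<close>. Its kernel is the homogeneous ideal of (1:0:0),
  so membership in \<open>point_100\<close> becomes a computation.\<close>

definition lead_x :: "'k::field form \<Rightarrow> 'k poly" where "lead_x G = coeff (coeff G 0) 0"

lemma rhom_lead_x: "rhom lead_x"
  by (simp add: rhom_def lead_x_def coeff_mult)
lemma lead_x_gens: "lead_x form_x = [:0, 1:]" "lead_x form_y = 0" "lead_x form_z = 0"
  by (simp_all add: lead_x_def form_x_def form_y_def form_z_def)

lemma lead_x_decomp: "\<exists>a b. G = [:[:lead_x G:]:] + form_y * a + form_z * b"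
proof -
  obtain g b where G: "G = pCons g b" by (cases G)
  obtain p a where g: "g = pCons p a" by (cases g)
  have e: "G = [:[:p:]:] + form_y * [:a:] + form_z * b" by (simp add: G g form_y_def form_z_def)
  have p: "lead_x G = p" by (simp add: lead_x_def G g)
  show ?thesis unfolding p by (intro exI) (rule e)
qed

lemma point_100_eq: "point_100 = {G. lead_x G = 0}"
proof
  note L = rhomD[OF rhom_lead_x]
  show "point_100 \<subseteq> {G :: 'a form. lead_x G = 0}"
    unfolding point_100_def
    by (rule plane_point.genideal_minimal_set[OF plane_point_zero]) (auto simp: L lead_x_gens)
  interpret R: cring "ring_of_type_algebra :: 'a form ring" by (rule cring_from_type_algebra)
  have A: "ideal (point_100 :: 'a form set) ring_of_type_algebra" unfolding point_100_def by (rule R.genideal_ideal) simp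
  have g: "form_y \<in> (point_100 :: 'a form set)" "form_z \<in> (point_100 :: 'a form set)"
    unfolding point_100_def using R.genideal_self[of "{form_y, form_z}"] by auto
  show "{G :: 'a form. lead_x G = 0} \<subseteq> point_100"
  proof
    fix G :: "'a form" assume "G \<in> {G. lead_x G = 0}"
    then obtain a b where "G = form_y * a + form_z * b" using lead_x_decomp[of G] by auto
    then show "G \<in> point_100"
      using additive_subgroup.a_closed[OF ideal.axioms(1)[OF A]] ideal.I_r_closed[OF A g(1), of a] ideal.I_r_closed[OF A g(2), of b] by simp
  qed
qed

lemma lead_x_homogeneous:
  assumes "homogeneous d G" shows "lead_x G = monom (gc G d 0 0) d"
proof (rule poly_eqI)
  fix i
  show "coeff (lead_x G) i = coeff (monom (gc G d 0 0) d) i"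
    using assms[unfolded homogeneous_gc, rule_format, of i 0 0] by (auto simp: lead_x_def gc_def)
qed

lemma proj_point_100: "proj_point (point_100 :: 'k::field form set)"
  unfolding proj_point_def
proof (intro conjI)
  note L = rhomD[OF rhom_lead_x]
  show "primeideal (point_100 :: 'k form set) ring_of_type_algebra"
    by (rule prime_type_algebra) (auto simp: point_100_eq L)
  show "point_100 = genideal ring_of_type_algebra {G \<in> (point_100 :: 'k form set). \<exists>d. homogeneous d G}"
  proof (rule genideal_homogeneous)
    fix G :: "'k form" and e assume "G \<in> point_100"
    then have "gc G i 0 0 = 0" for i by (simp add: point_100_eq lead_x_def gc_def)
    then show "hcomp e G \<in> point_100" by (simp add: point_100_eq lead_x_homogeneous[OF hcomp_homogeneous] gc_hcomp)
  qed (auto simp: point_100_eq L)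
  show "\<not> {form_x, form_y, form_z} \<subseteq> (point_100 :: 'k form set)" by (simp add: point_100_eq lead_x_gens)
qed

lemma plane_point_100: "plane_point point_100" by unfold_locales (rule proj_point_100)

text \<open>A larger point would contain \<open>form_y\<close>, \<open>form_z\<close> and a form
  with a pure power of \<open>x\<close>, hence \<open>form_x\<close> as well; but no point contains
  all three variables.\<close>

lemma point_100_maximal:
  assumes q: "proj_point q" and s: "point_100 \<subseteq> q"
  shows "q = point_100"
proof (rule ccontr)
  interpret Q: plane_point q by unfold_locales (rule q)
  assume "q \<noteq> point_100"
  then have "\<not> q \<subseteq> point_100" using s by blast
  then obtain d G where G: "homogeneous d G" "G \<in> q" "G \<notin> point_100"
    using homogeneous_subset[OF Q.plane_point_axioms plane_point_100] by blast
  have yz: "form_y \<in> q" "form_z \<in> q" using s by (auto simp: point_100_eq lead_x_gens)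
  obtain a b where ab: "G = [:[:lead_x G:]:] + form_y * a + form_z * b" using lead_x_decomp by blast
  define e where "e = gc G d 0 0"
  have e0: "e \<noteq> 0" using G(3) lead_x_homogeneous[OF G(1)] by (auto simp: e_def point_100_eq)
  have lx: "[:[:lead_x G:]:] = form_const e * form_x ^ d"
    unfolding lead_x_homogeneous[OF G(1)] e_def[symmetric]
    by (simp add: monom_altdef poly_const_pow form_const_def form_x_def)
  have "form_const e * form_x ^ d = G - (form_y * a + form_z * b)" using ab lx by (simp add: algebra_simps)
  then have "form_const e * form_x ^ d \<in> q" using G(2) yz Q.q_mult Q.q_diff Q.q_add by simp
  then have m: "form_const (inverse e) * (form_const e * form_x ^ d) \<in> q" by (rule Q.q_mult')
  have "form_const (inverse e) * (form_const e * form_x ^ d) = form_const (inverse e * e) * form_x ^ d"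
    by (simp only: rhomD(2)[OF rhom_form_const] mult.assoc)
  also have "\<dots> = form_x ^ d" using e0 by (simp add: rhomD(3)[OF rhom_form_const])
  finally have "form_x ^ d \<in> q" using m by (simp only:)
  then have "form_x \<in> q" by (rule Q.q_power)
  then show False using q yz by (auto simp: proj_point_def)
qed

lemma closed_point_100: "closed_point point_100"
  using proj_point_100 point_100_maximal by (auto simp: closed_point_def)

section \<open>The affine curve\<close>

locale hyperflex = plane_curve F m for F :: "'k::field form" and m +
  fixes c :: 'k and L :: "'k form"
  assumes m2: "2 \<le> m" and c_nz: "c \<noteq> 0" and F_eq: "F = form_const c * form_y ^ m + form_z * L"
    and L_hom: "homogeneous (m - 1) L" and L_off: "L \<notin> point_100"
begin

definition f0 :: "'k poly poly" where "f0 = dehomogenize F"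

lemma f0_eq: "f0 = monom [:c:] m + dehomogenize L"
  unfolding f0_def
  by (subst F_eq) (simp add: rhomD[OF rhom_dehomogenize] dehomogenize_gens monom_altdef)

lemma degree_f0: "degree f0 = m" and lead_f0: "coeff f0 m = [:c:]"
proof -
  have d: "degree (dehomogenize L) < m" using degree_dehomogenize_le[OF L_hom] m2 by linarith
  have "degree (monom [:c:] m) = m" using c_nz by (simp add: degree_monom_eq)
  then show "degree f0 = m" unfolding f0_eq using d by (simp add: degree_add_eq_left)
  show "coeff f0 m = [:c:]" unfolding f0_eq using d by (simp add: coeff_eq_0)
qed

lemma f0_nz: "f0 \<noteq> 0" using degree_f0 m2 by auto

lemma F_not_dvd_z: "\<not> F dvd form_z"
proof
  assume "F dvd form_z"
  then obtain u where u: "form_z = F * u" by (elim dvdE)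
  then have "homogeneous (Suc 0) (F * u)" using homogeneous_vars(3) by metis
  moreover have "u \<noteq> 0" using u by auto
  ultimately have "m \<le> Suc 0" using homogeneous_cancel(1)[OF homF F_nz] by blast
  then show False using m2 by simp
qed

lemma F_not_dvd_z_power: "\<not> F dvd form_z ^ n"
  using F_not_dvd_z prime_elem_dvd_power[OF primeF] by blast

text \<open>Setting \<open>z = 1\<close> changes divisibility only by powers of
  \<open>form_z\<close>, and the prime \<open>F\<close>, of degree at least 2, divides none of
  them.\<close>

lemma dvd_dehomogenize:
  assumes G: "homogeneous d G"
  shows "f0 dvd dehomogenize G \<longleftrightarrow> F dvd G"
proof
  assume "f0 dvd dehomogenize G"
  then obtain h where h: "dehomogenize G = f0 * h" by (elim dvdE)
  obtain e H where H: "homogeneous e H" "dehomogenize H = h" using homogenization by blast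
  have "emb G * emb form_z ^ (m + e) = emb form_z ^ d * (emb F * emb H)"
    unfolding emb_ev[OF G] emb_ev[OF homF] emb_ev[OF H(1)] H(2) h f0_def[symmetric]
    by (simp add: evD power_add mult_ac)
  then have "emb (G * form_z ^ (m + e)) = emb (F * (H * form_z ^ d))"
    by (simp add: rhomD[OF rhom_emb] mult_ac)
  then have "G * form_z ^ (m + e) = F * (H * form_z ^ d)" by (simp only: emb_eq_iff)
  then have "F dvd G * form_z ^ (m + e)" by simp
  then show "F dvd G" using F_dvd_mult F_not_dvd_z_power by blast
next
  assume "F dvd G"
  then show "f0 dvd dehomogenize G" unfolding f0_def by (auto simp: rhomD[OF rhom_dehomogenize])
qed

lemma f0_prime: "f0 dvd g * h \<Longrightarrow> f0 dvd g \<or> f0 dvd h"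
proof -
  assume a: "f0 dvd g * h"
  obtain d G where G: "homogeneous d G" "dehomogenize G = g" using homogenization by blast
  obtain e H where H: "homogeneous e H" "dehomogenize H = h" using homogenization by blast
  have "F dvd G * H" using dvd_dehomogenize[OF homogeneous_mult[OF G(1) H(1)]] a G(2) H(2)
    by (simp add: rhomD[OF rhom_dehomogenize])
  then show ?thesis using F_dvd_mult dvd_dehomogenize[OF G(1)] dvd_dehomogenize[OF H(1)] G(2) H(2) by auto
qed

lemma f0_not_dvd_1: "\<not> f0 dvd 1"
proof
  assume "f0 dvd 1"
  then have "degree f0 = 0" by (metis degree_1 divides_degree le_zero_eq one_neq_zero)
  then show False using degree_f0 m2 by simp
qed

lemma f0_prime_power: "f0 dvd g ^ n \<Longrightarrow> f0 dvd g"
  by (induction n) (use f0_not_dvd_1 f0_prime in auto)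

text \<open>The leading coefficient in \<open>Y\<close> is the nonzero constant \<open>c\<close>, so
  pseudo-division becomes genuine division: the affine coordinate ring is free of rank
  \<open>m\<close> over k[X].\<close>

lemma f0_division: "\<exists>q r. g = f0 * q + r \<and> (r = 0 \<or> degree r < m)"
proof -
  obtain q r where qr: "pseudo_divmod g f0 = (q, r)" by (cases "pseudo_divmod g f0")
  define k where "k = Suc (degree g) - degree f0"
  have e: "smult ([:c:] ^ k) g = f0 * q + r" "r = 0 \<or> degree r < m"
    using pseudo_divmod[OF f0_nz qr] by (simp_all add: degree_f0 lead_f0 k_def)
  define i where "i = [:inverse (c ^ k):]"
  have i: "i * [:c:] ^ k = 1" using c_nz by (simp add: i_def poly_const_pow one_pCons)
  have "g = smult (i * [:c:] ^ k) g" by (simp add: i)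
  also have "\<dots> = smult i (f0 * q + r)" by (simp flip: e(1))
  also have "\<dots> = f0 * smult i q + smult i r" by (simp add: smult_add_right)
  finally have "g = f0 * smult i q + smult i r" .
  moreover have "smult i r = 0 \<or> degree (smult i r) < m" using e(2) by auto
  ultimately show ?thesis by blast
qed

text \<open>A stand-in for the resultant. Modulo \<open>f0\<close> the powers of \<open>g\<close> up
  to the \<open>m\<close>-th are dependent over k[X]; as \<open>f0\<close> is prime and does not
  divide \<open>g\<close>, the lowest power of \<open>g\<close> can be cancelled, and its
  coefficient is the desired \<open>P\<close>.\<close>

lemma elimination:
  assumes g: "\<not> f0 dvd g"
  shows "\<exists>P a b. P \<noteq> 0 \<and> [:P:] = f0 * a + g * b"
proof -
  have "\<forall>i. \<exists>q r. g ^ i = f0 * q + r \<and> (r = 0 \<or> degree r < m)" using f0_division by blast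
  then obtain q r where qr: "\<And>i. g ^ i = f0 * q i + r i" "\<And>i. r i = 0 \<or> degree (r i) < m" by metis
  obtain x where x: "\<exists>i\<le>m. x i \<noteq> 0" "\<And>j. j < m \<Longrightarrow> (\<Sum>i\<le>m. coeff (r i) j * x i) = 0"
    using homogeneous_system_nontrivial[of m "\<lambda>j i. coeff (r i) j"] by blast
  have z: "(\<Sum>i\<le>m. [:x i:] * r i) = 0"
  proof (rule poly_eqI)
    fix j
    have "coeff (\<Sum>i\<le>m. [:x i:] * r i) j = (\<Sum>i\<le>m. coeff (r i) j * x i)"
      by (simp add: coeff_sum mult.commute)
    also have "\<dots> = 0"
    proof (cases "j < m")
      case False
      then have "coeff (r i) j = 0" for i using qr(2)[of i] by (auto intro: coeff_eq_0)
      then show ?thesis by simp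
    qed (rule x(2))
    finally show "coeff (\<Sum>i\<le>m. [:x i:] * r i) j = coeff 0 j" by simp
  qed
  have s: "(\<Sum>i\<le>m. [:x i:] * g ^ i) = f0 * (\<Sum>i\<le>m. [:x i:] * q i)"
  proof -
    have "[:x i:] * g ^ i = f0 * ([:x i:] * q i) + [:x i:] * r i" for i
      unfolding qr(1)[of i] distrib_left by (simp only: mult.left_commute)
    then have "(\<Sum>i\<le>m. [:x i:] * g ^ i) = (\<Sum>i\<le>m. f0 * ([:x i:] * q i)) + (\<Sum>i\<le>m. [:x i:] * r i)"
      by (simp only: sum.distrib)
    then show ?thesis using z by (simp add: sum_distrib_left)
  qed
  define i where "i = (LEAST i. x i \<noteq> 0)"
  obtain i0 where i0: "i0 \<le> m" "x i0 \<noteq> 0" using x(1) by blast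
  have i: "x i \<noteq> 0" "i \<le> m" unfolding i_def
    using LeastI[of "\<lambda>j. x j \<noteq> 0", OF i0(2)] Least_le[of "\<lambda>j. x j \<noteq> 0", OF i0(2)] i0(1) by auto
  have lt: "x j = 0" if "j < i" for j using that not_less_Least unfolding i_def by blast
  define w where "w = (\<Sum>k\<in>{Suc i..m}. [:x k:] * g ^ (k - Suc i))"
  have "(\<Sum>k\<le>m. [:x k:] * g ^ k) = (\<Sum>k\<in>{i..m}. [:x k:] * g ^ k)"
    by (rule sum.mono_neutral_right) (auto simp: lt)
  also have "\<dots> = [:x i:] * g ^ i + (\<Sum>k\<in>{Suc i..m}. [:x k:] * g ^ k)"
    using i by (simp add: sum.atLeast_Suc_atMost)
  also have "(\<Sum>k\<in>{Suc i..m}. [:x k:] * g ^ k) = (\<Sum>k\<in>{Suc i..m}. g ^ i * (g * ([:x k:] * g ^ (k - Suc i))))"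
  proof (rule sum.cong)
    fix k assume "k \<in> {Suc i..m}"
    then have "g ^ k = g ^ i * (g * g ^ (k - Suc i))"
      using power_add[of g "Suc i" "k - Suc i"] by (simp add: mult_ac)
    then show "[:x k:] * g ^ k = g ^ i * (g * ([:x k:] * g ^ (k - Suc i)))" by (simp only: mult_ac)
  qed simp
  also have "\<dots> = g ^ i * (g * w)" by (simp only: w_def sum_distrib_left)
  also have "[:x i:] * g ^ i + g ^ i * (g * w) = g ^ i * ([:x i:] + g * w)"
    by (simp only: distrib_left mult.commute[of "[:x i:]"])
  finally have "g ^ i * ([:x i:] + g * w) = f0 * (\<Sum>i\<le>m. [:x i:] * q i)"
    unfolding s by (rule sym)
  then have "f0 dvd g ^ i * ([:x i:] + g * w)" by (rule dvdI)
  then have "f0 dvd [:x i:] + g * w" using f0_prime f0_prime_power g by blast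
  then obtain a where "[:x i:] + g * w = f0 * a" by (elim dvdE)
  then have "[:x i:] = f0 * a + g * (- w)" by (simp add: algebra_simps)
  then show ?thesis using i by blast
qed

text \<open>Reduction modulo \<open>f0\<close> bounds the degree in \<open>Y\<close>; reduction
  modulo the polynomial \<open>P\<close> from \<open>elimination\<close> bounds the degree in
  \<open>X\<close>.\<close>

lemma finite_quotient:
  assumes g: "\<not> f0 dvd g"
  shows "\<exists>(M::nat) B. \<forall>h. \<exists>e u v. h = (\<Sum>b<M. [:[:e b:]:] * B b) + f0 * u + g * v"
proof -
  obtain P a b where P: "P \<noteq> 0" "[:P:] = f0 * a + g * b" using elimination[OF g] by blast
  define n where "n = degree P"
  \<comment> \<open>The monomials \<open>X ^ i * Y ^ j\<close> with \<open>i < n\<close> and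
    \<open>j < m\<close>, numbered by \<open>j * n + i\<close>.\<close>
  define B :: "nat \<Rightarrow> 'k poly poly" where "B i = monom (monom 1 (i mod n)) (i div n)" for i
  have "\<exists>e u v. h = (\<Sum>b<m * n. [:[:e b:]:] * B b) + f0 * u + g * v" for h
  proof -
    obtain q r where qr: "h = f0 * q + r" "r = 0 \<or> degree r < m" using f0_division by blast
    define s where "s = (\<Sum>j<m. monom (coeff r j div P) j)"
    define t where "t j = coeff r j mod P" for j
    define e where "e i = coeff (t (i div n)) (i mod n)" for i
    have rj: "r = (\<Sum>j<m. monom (coeff r j) j)"
      by (rule poly_eqI) (use qr(2) in \<open>auto simp: coeff_sum coeff_eq_0\<close>)
    have tj: "t j = (\<Sum>i<n. monom (coeff (t j) i) i)" for j
    proof (cases "n = 0")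
      case True
      then have "t j = 0" unfolding t_def n_def using P(1) by (metis is_unit_iff_degree mod_0_imp_dvd mod_poly_less degree_mod_less' not_less0 unit_imp_mod_eq_0)
      then show ?thesis by simp
    next
      case False
      then have "t j = 0 \<or> degree (t j) < n" unfolding t_def n_def using degree_mod_less P(1) by blast
      then show ?thesis by (intro poly_eqI) (auto simp: coeff_sum coeff_eq_0)
    qed
    have "(\<Sum>i<m * n. [:[:e i:]:] * B i) = (\<Sum>j<m. \<Sum>i\<in>{j * n..<j * n + n}. [:[:e i:]:] * B i)"
      by (rule sum.nat_group[symmetric])
    also have "\<dots> = (\<Sum>j<m. \<Sum>i<n. monom (monom (coeff (t j) i) i) j)"
    proof (rule sum.cong)
      fix j
      have "(\<Sum>i\<in>{j * n..<j * n + n}. [:[:e i:]:] * B i) = (\<Sum>i\<in>{0..<n}. [:[:e (i + j * n):]:] * B (i + j * n))"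
        using sum.shift_bounds_nat_ivl[of "\<lambda>i. [:[:e i:]:] * B i" 0 "j * n" n] by (simp add: add.commute)
      also have "\<dots> = (\<Sum>i<n. monom (monom (coeff (t j) i) i) j)"
        unfolding atLeast0LessThan by (rule sum.cong) (auto simp: e_def B_def smult_monom)
      finally show "(\<Sum>i\<in>{j * n..<j * n + n}. [:[:e i:]:] * B i) = (\<Sum>i<n. monom (monom (coeff (t j) i) i) j)" .
    qed simp
    also have "\<dots> = (\<Sum>j<m. monom (t j) j)"
    proof (rule sum.cong)
      fix j
      have "(\<Sum>i<n. monom (monom (coeff (t j) i) i) j) = monom (\<Sum>i<n. monom (coeff (t j) i) i) j"
        by (rule poly_eqI) (simp add: coeff_sum)
      then show "(\<Sum>i<n. monom (monom (coeff (t j) i) i) j) = monom (t j) j" using tj[of j] by simp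
    qed simp
    finally have sumB: "(\<Sum>i<m * n. [:[:e i:]:] * B i) = (\<Sum>j<m. monom (t j) j)" .
    have "r = (\<Sum>j<m. [:P:] * monom (coeff r j div P) j + monom (t j) j)"
      by (subst rj, rule sum.cong) (auto simp: t_def smult_monom add_monom)
    also have "\<dots> = [:P:] * s + (\<Sum>i<m * n. [:[:e i:]:] * B i)"
      by (simp only: sum.distrib s_def sum_distrib_left sumB)
    finally have "h = (\<Sum>i<m * n. [:[:e i:]:] * B i) + f0 * (q + a * s) + g * (b * s)"
      unfolding qr(1) P(2) by (simp add: algebra_simps)
    then show ?thesis by blast
  qed
  then show ?thesis by blast
qed

text \<open>In the finite-dimensional ring modulo \<open>f0\<close> and \<open>g\<close> the ideals
  generated by powers of \<open>b\<close> become stationary. Hence \<open>b\<close> is invertible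
  modulo any prime over \<open>f0\<close> and \<open>g\<close> that does not contain it. The chain
  is moved into the function field by \<open>ev\<close>, where the dimension count applies.\<close>

lemma power_stationary:
  assumes g: "\<not> f0 dvd g"
  shows "\<exists>i x u v. b ^ i = b ^ Suc i * x + f0 * u + g * v"
proof -
  from finite_quotient[OF g] obtain M :: nat and B
    where B: "\<forall>h. \<exists>e u v. h = (\<Sum>b<M. [:[:e b:]:] * B b) + f0 * u + g * v" by (elim exE)
  define V where "V i = {ev (b ^ i * x + f0 * u + g * v) | x u v. True}" for i
  define I where "I = {ev (f0 * u + g * v) | u v. True}"
  have VI: "ev (b ^ i * x + f0 * u + g * v) \<in> V i" for i x u v by (auto simp: V_def)
  have II: "ev (f0 * u + g * v) \<in> I" for u v by (auto simp: I_def)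
  have "\<exists>i\<le>M. V i = V (Suc i)"
  proof (rule rc.finite_span_chain_stationary)
    fix i
    show "rc.ksub (V i)" unfolding rc.ksub_def
    proof (intro conjI ballI allI)
      show "0 \<in> V i" using VI[of i 0 0 0] by (simp add: evD)
      fix y assume "y \<in> V i"
      then obtain x u v where y: "y = ev (b ^ i * x + f0 * u + g * v)" by (auto simp: V_def)
      show "ratfun_const e * y \<in> V i" for e
        using VI[of i "[:[:e:]:] * x" "[:[:e:]:] * u" "[:[:e:]:] * v"]
        unfolding y ev_const[symmetric] evD(2)[symmetric] by (simp only: distrib_left mult_ac)
      fix y' assume "y' \<in> V i"
      then obtain x' u' v' where y': "y' = ev (b ^ i * x' + f0 * u' + g * v')" by (auto simp: V_def)
      show "y + y' \<in> V i"
        using VI[of i "x + x'" "u + u'" "v + v'"]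
        unfolding y y' evD(1)[symmetric] by (simp only: algebra_simps)
    qed
    show "V (Suc i) \<subseteq> V i"
    proof
      fix y assume "y \<in> V (Suc i)"
      then obtain x u v where y: "y = ev (b ^ Suc i * x + f0 * u + g * v)" by (auto simp: V_def)
      show "y \<in> V i" using VI[of i "b * x" u v] unfolding y by (simp add: mult_ac)
    qed
    show "I \<subseteq> V i" using VI[of i 0] by (auto simp: I_def)
  next
    show "rc.ksub I" unfolding rc.ksub_def
    proof (intro conjI ballI allI)
      show "0 \<in> I" using II[of 0 0] by (simp add: evD)
      fix y assume "y \<in> I"
      then obtain u v where y: "y = ev (f0 * u + g * v)" by (auto simp: I_def)
      show "ratfun_const e * y \<in> I" for e
        using II[of "[:[:e:]:] * u" "[:[:e:]:] * v"]
        unfolding y ev_const[symmetric] evD(2)[symmetric] by (simp only: distrib_left mult_ac)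
      fix y' assume "y' \<in> I"
      then obtain u' v' where y': "y' = ev (f0 * u' + g * v')" by (auto simp: I_def)
      show "y + y' \<in> I"
        using II[of "u + u'" "v + v'"]
        unfolding y y' evD(1)[symmetric] by (simp only: algebra_simps)
    qed
    fix y assume "y \<in> V 0"
    then obtain h where h: "y = ev h" by (auto simp: V_def)
    from spec[OF B, of h] obtain e u v where he: "h = (\<Sum>b<M. [:[:e b:]:] * B b) + f0 * u + g * v" by (elim exE)
    have "y - (\<Sum>b<M. ratfun_const (e b) * ev (B b)) = ev (f0 * u + g * v)"
      unfolding h he evD ev_const by simp
    then show "\<exists>e. y - (\<Sum>b<M. ratfun_const (e b) * ev (B b)) \<in> I" using II by metis
  qed
  then obtain i where "V i = V (Suc i)" by blast
  then have "ev (b ^ i) \<in> V (Suc i)" using VI[of i 1 0 0] by simp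
  then obtain x u v where "ev (b ^ i) = ev (b ^ Suc i * x + f0 * u + g * v)" by (auto simp: V_def)
  then show ?thesis unfolding ev_inj by blast
qed

end

section \<open>Local equations and points off the flex\<close>

lemma local_equation_quot:
  assumes "plane_curve F m" "plane_point q" and F: "F \<in> q" and l: "homogeneous (Suc 0) l" "l \<notin> q"
  shows "local_equation F q (emb F / emb (l ^ m))"
proof -
  interpret C: plane_curve F m by fact
  interpret Q: plane_point q by fact
  interpret A: local_subring ratfun_const "stalk q" "stalk_ideal q q" by (rule Q.local_subring_stalk)
  have lm: "l ^ n \<notin> q" for n using l Q.q_power by blast
  have l0: "emb l \<noteq> 0" using Q.q_nonzero[OF l(2)] by simp
  note lh = homogeneous_power1[OF l(1)]
  have f: "emb F / emb (l ^ m) \<in> stalk q" by (rule Q.stalkI[OF lm C.homF lh])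
  have "{x * (emb F / emb (l ^ m)) | x. x \<in> stalk q} = stalk_ideal q (curve_ideal F)"
  proof safe
    fix x assume "x \<in> stalk q"
    moreover have "emb F / emb (l ^ m) \<in> stalk_ideal q (curve_ideal F)"
      by (rule Q.stI[OF _ lm C.homF lh]) (simp add: curve_ideal_def)
    ultimately have "emb F / emb (l ^ m) * x \<in> stalk_ideal q (curve_ideal F)"
      by (intro Q.stalk_ideal_mult) (auto simp: curve_ideal_def)
    then show "x * (emb F / emb (l ^ m)) \<in> stalk_ideal q (curve_ideal F)" by (simp only: mult.commute)
  next
    fix y assume "y \<in> stalk_ideal q (curve_ideal F)"
    then obtain d G H where G: "y = emb G / emb H" "G \<in> curve_ideal F" "H \<notin> q" "H \<noteq> 0" "homogeneous d G" "homogeneous d H"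
      by (rule Q.stE)
    obtain G' where G': "G = F * G'" using G(2) by (auto simp: curve_ideal_def)
    show "\<exists>x. y = x * (emb F / emb (l ^ m)) \<and> x \<in> stalk q"
    proof (cases "G' = 0")
      case True
      then show ?thesis using G G' A.O_zero by (intro exI[of _ 0]) (simp add: rhomD[OF rhom_emb])
    next
      case False
      then have h: "m \<le> d" "homogeneous (d - m) G'"
        using homogeneous_cancel[OF C.homF C.F_nz, of d G'] G(5) G' by auto
      have "homogeneous d (l ^ m * G')" using homogeneous_mult[OF lh[of m] h(2)] h(1) by simp
      then have "emb (l ^ m * G') / emb H \<in> stalk q" using G by (intro Q.stalkI) auto
      moreover have "y = emb (l ^ m * G') / emb H * (emb F / emb (l ^ m))"
        using l0 by (simp add: G(1) G' rhomD[OF rhom_emb])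
      ultimately show ?thesis by blast
    qed
  qed
  then show ?thesis using f unfolding local_equation_def cgenideal_def stalk_ring_def by simp
qed

context hyperflex
begin

lemma F_100: "F \<in> point_100"
proof -
  note L = rhomD[OF rhom_lead_x]
  have "lead_x F = 0" using m2 by (subst F_eq) (simp add: L lead_x_gens)
  then show ?thesis by (simp add: point_100_eq)
qed

lemma y_mem:
  assumes "plane_point q" "F \<in> q" "form_z \<in> q"
  shows "form_y \<in> q"
proof -
  interpret Q: plane_point q by fact
  have "form_const c * form_y ^ m = F - form_z * L" by (subst F_eq) simp
  then have "form_const c * form_y ^ m \<in> q" using assms Q.q_diff Q.q_mult by simp
  then have m: "form_const (inverse c) * (form_const c * form_y ^ m) \<in> q" by (rule Q.q_mult')
  have "form_const (inverse c) * (form_const c * form_y ^ m) = form_const (inverse c * c) * form_y ^ m"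
    by (simp only: rhomD(2)[OF rhom_form_const] mult.assoc)
  also have "\<dots> = form_y ^ m" using c_nz by (simp add: rhomD(3)[OF rhom_form_const])
  finally have "form_y ^ m \<in> q" using m by (simp only:)
  then show ?thesis by (rule Q.q_power)
qed

text \<open>On \<open>z = 0\<close> the equation of the curve becomes \<open>c * y ^ m = 0\<close>,
  so a point of the curve on that line contains \<open>form_y\<close> too and must be the
  flex.\<close>

lemma z_off:
  assumes q: "closed_point q" "F \<in> q" "q \<noteq> point_100"
  shows "form_z \<notin> q"
proof
  assume z: "form_z \<in> q"
  have pq: "proj_point q" using q by (simp add: closed_point_def)
  interpret Q: plane_point q by unfold_locales (rule pq)
  have y: "form_y \<in> q" by (rule y_mem[OF Q.plane_point_axioms q(2) z])
  have "point_100 \<subseteq> q"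
  proof
    fix G assume "G \<in> (point_100 :: 'k form set)"
    then obtain a b where "G = form_y * a + form_z * b" using lead_x_decomp[of G] by (auto simp: point_100_eq)
    then show "G \<in> q" using y z Q.q_add Q.q_mult by simp
  qed
  then show False using point_100_maximal[OF pq] q(3) by simp
qed

end

locale affine_point = hyperflex F m c L + curve_point F m q f
  for F :: "'k::field form" and m c L q f +
  assumes z_notin: "form_z \<notin> q"
begin

interpretation A: local_subring ratfun_const "stalk q" "stalk_ideal q q" by (rule local_subring_stalk)

lemma z_pow: "form_z ^ n \<notin> q" using z_notin q_power by blast

lemma ev_stalk: "ev g \<in> stalk q"
proof -
  obtain d G where G: "homogeneous d G" "dehomogenize G = g" using homogenization by blast
  show ?thesis using stalkI[OF z_pow G(1) homogeneous_power1[OF homogeneous_vars(3)]] ev_quot[OF G(1)] G(2)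
    by (simp add: rhomD[OF rhom_emb])
qed

lemma ev_unit:
  assumes H: "homogeneous d H" "H \<notin> q"
  shows "inverse (ev (dehomogenize H)) \<in> stalk q" "ev (dehomogenize H) \<noteq> 0"
proof -
  have "emb (form_z ^ d) / emb H \<in> stalk q"
    by (rule stalkI[OF H(2) homogeneous_power1[OF homogeneous_vars(3)] H(1)])
  moreover have "emb (form_z ^ d) / emb H = inverse (ev (dehomogenize H))"
    unfolding ev_quot[OF H(1), symmetric] by (simp add: rhomD[OF rhom_emb])
  ultimately show "inverse (ev (dehomogenize H)) \<in> stalk q" by simp
  show "ev (dehomogenize H) \<noteq> 0" using dehomogenize_eq_0[OF H(1)] q_nonzero[OF H(2)] ev_eq_0 by blast
qed

lemma ev_f0: "ev f0 = emb F / emb (form_z ^ m)"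
  using ev_quot[OF homF] by (simp add: f0_def rhomD[OF rhom_emb])

lemma ev_f0_unit: obtains w where "w \<in> stalk q" "inverse w \<in> stalk q" "w \<noteq> 0" "ev f0 = f * w"
  using curve_equation_unit[OF homogeneous_vars(3) z_notin] unfolding ev_f0 by blast

text \<open>Polynomials that span modulo \<open>f0\<close> and \<open>g\<close> still span the local
  ring modulo \<open>f\<close> and \<open>d\<close>: a denominator that is a unit at
  \<open>q\<close> has a polynomial inverse modulo \<open>f0\<close> and \<open>g\<close>, by
  \<open>power_stationary\<close>.\<close>

lemma affine_finite_span:
  assumes d: "d \<in> stalk q" "d \<notin> fO"
  shows "\<exists>(M::nat) B. (\<forall>b. B b \<in> stalk q) \<and> (\<forall>x\<in>stalk q. \<exists>c. \<exists>u\<in>stalk q. \<exists>v\<in>stalk q.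
        x = (\<Sum>b<M. ratfun_const (c b) * B b) + d * u + f * v)"
proof -
  obtain e G H where G: "d = emb G / emb H" "H \<notin> q" "H \<noteq> 0" "homogeneous e G" "homogeneous e H"
    using d(1) by (rule stalkE)
  define g where "g = dehomogenize G"
  have "\<not> F dvd G" using quot_in_fO[OF G(2,4,5)] d(2) G(1) by simp
  then have g: "\<not> f0 dvd g" using dvd_dehomogenize[OF G(4)] by (simp add: g_def)
  obtain w where w: "w \<in> stalk q" "ev f0 = f * w" using ev_f0_unit by blast
  have eg: "ev g = d * ev (dehomogenize H)"
    unfolding G(1) ev_quot2[OF G(4,5)] g_def using ev_unit(2)[OF G(5,2)] by simp
  from finite_quotient[OF g] obtain M :: nat and B
    where B: "\<forall>h. \<exists>e u v. h = (\<Sum>b<M. [:[:e b:]:] * B b) + f0 * u + g * v" by (elim exE)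
  show ?thesis
  proof (intro exI[of _ M] exI[of _ "\<lambda>b. ev (B b)"] conjI allI ballI ev_stalk)
    fix x assume "x \<in> stalk q"
    then obtain k N D where x: "x = emb N / emb D" "D \<notin> q" "D \<noteq> 0" "homogeneous k N" "homogeneous k D" by (rule stalkE)
    define n b where "n = dehomogenize N" and "b = dehomogenize D"
    have b: "inverse (ev b) \<in> stalk q" "ev b \<noteq> 0" unfolding b_def by (rule ev_unit[OF x(5,2)])+
    \<comment> \<open>Dividing this relation by the unit \<open>ev b ^ Suc i\<close> shows that
      \<open>1 / ev b\<close> is congruent to \<open>ev y\<close>.\<close>
    obtain i y u v where st: "b ^ i = b ^ Suc i * y + f0 * u + g * v" using power_stationary[OF g] by blast
    have "ev b ^ i = ev b ^ Suc i * ev y + ev f0 * ev u + ev g * ev v"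
      using arg_cong[OF st, of ev] unfolding evD .
    then have "ev b ^ i * inverse (ev b) ^ Suc i = (ev b ^ Suc i * ev y + (ev f0 * ev u + ev g * ev v)) * inverse (ev b) ^ Suc i"
      by (simp only: add.assoc)
    also have "\<dots> = (ev b ^ Suc i * inverse (ev b) ^ Suc i) * ev y + (ev f0 * ev u + ev g * ev v) * inverse (ev b) ^ Suc i"
      by (simp only: distrib_right mult.assoc mult.commute[of "ev y"])
    finally have "ev b ^ i * inverse (ev b) ^ i * inverse (ev b) = (ev b ^ Suc i * inverse (ev b) ^ Suc i) * ev y + (ev f0 * ev u + ev g * ev v) * inverse (ev b) ^ Suc i"
      by (simp only: power_Suc2 mult.assoc)
    moreover have "ev b ^ n * inverse (ev b) ^ n = 1" for n using b(2) by (simp flip: power_mult_distrib)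
    ultimately have y: "1 / ev b = ev y + (ev f0 * ev u + ev g * ev v) * inverse (ev b) ^ Suc i"
      by (simp only: mult_1_left inverse_eq_divide)
    have xe: "x = ev n * (1 / ev b)" unfolding x(1) ev_quot2[OF x(4,5)] n_def b_def by simp
    from spec[OF B, of "n * y"] obtain e u' v' where he: "n * y = (\<Sum>b<M. [:[:e b:]:] * B b) + f0 * u' + g * v'" by (elim exE)
    have s: "ev n * ev y = (\<Sum>b<M. ratfun_const (e b) * ev (B b)) + ev f0 * ev u' + ev g * ev v'"
      using arg_cong[OF he, of ev] unfolding evD ev_const .
    define t where "t = ev n * inverse (ev b) ^ Suc i"
    have t: "t \<in> stalk q" unfolding t_def by (intro A.O_mult ev_stalk A.O_power b(1))
    have "x = (\<Sum>b<M. ratfun_const (e b) * ev (B b)) + d * (ev (dehomogenize H) * (ev v' + ev v * t)) + f * (w * (ev u' + ev u * t))"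
      unfolding xe y distrib_left s eg w(2) t_def by (simp add: algebra_simps)
    moreover have "ev (dehomogenize H) * (ev v' + ev v * t) \<in> stalk q" "w * (ev u' + ev u * t) \<in> stalk q"
      by (intro A.O_mult A.O_add ev_stalk t w(1))+
    ultimately show "\<exists>c. \<exists>u\<in>stalk q. \<exists>v\<in>stalk q. x = (\<Sum>b<M. ratfun_const (c b) * ev (B b)) + d * u + f * v" by blast
  qed
qed

end

context hyperflex
begin

text \<open>If every form in \<open>q\<close> were a multiple of \<open>F\<close>, then
  \<open>q\<close> would lie in \<open>point_100\<close>, and a closed point lies in no other
  point.\<close>

lemma ex_form_off_curve:
  assumes q: "closed_point q" "F \<in> q" "q \<noteq> point_100"
  shows "\<exists>d G. homogeneous d G \<and> G \<in> q \<and> \<not> F dvd G"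
proof (rule ccontr)
  assume no: "\<not> ?thesis"
  have pq: "plane_point q" using q by (simp add: closed_point_def plane_point_def)
  have "q \<subseteq> point_100"
  proof (rule homogeneous_subset[OF pq plane_point_100])
    fix d G assume "homogeneous d G" "G \<in> q"
    then have "F dvd G" using no by blast
    then obtain u where "G = F * u" by (elim dvdE)
    then show "G \<in> point_100" using F_100 plane_point.q_mult[OF plane_point_100] by simp
  qed
  then show False using q proj_point_100 by (auto simp: closed_point_def)
qed

lemma transversal_point_off:
  assumes q: "closed_point q" "F \<in> q" "q \<noteq> point_100" and f: "local_equation F q f"
  shows "transversal_point F m q f" "affine_point F m c L q f"
proof -
  have pq: "plane_point q" using q by (simp add: closed_point_def plane_point_def)
  have cp: "curve_point F m q f"
    by (intro curve_point.intro curve_point_axioms.intro plane_curve_axioms pq q(2) f)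
  show ap: "affine_point F m c L q f"
    by (intro affine_point.intro affine_point_axioms.intro hyperflex_axioms cp z_off q)
  interpret Q: affine_point F m c L q f by (rule ap)
  have tw: "tower q f" by (intro tower.intro tower_axioms.intro pq Q.f_O)
  show "transversal_point F m q f"
  proof (intro transversal_point.intro transversal_point_axioms.intro cp tw)
    fix d assume "d \<in> stalk_ideal q q" "d \<notin> Q.fO"
    then show "\<exists>(M::nat) B. (\<forall>b. B b \<in> stalk q) \<and> (\<forall>x\<in>stalk q. \<exists>c. \<exists>u\<in>stalk q. \<exists>v\<in>stalk q.
        x = (\<Sum>b<M. ratfun_const (c b) * B b) + d * u + f * v)"
      using Q.stalk_sub by (intro Q.affine_finite_span) auto
  next
    obtain d G where G: "homogeneous d G" "G \<in> q" "\<not> F dvd G" using ex_form_off_curve[OF q] by blast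
    have "emb G / emb (form_z ^ d) \<in> stalk_ideal q q"
      by (rule Q.stI[OF G(2) Q.z_pow G(1) homogeneous_power1[OF homogeneous_vars(3)]])
    moreover have "emb G / emb (form_z ^ d) \<notin> Q.fO"
      using Q.quot_in_fO[OF Q.z_pow G(1) homogeneous_power1[OF homogeneous_vars(3)]] G(3) by simp
    ultimately show "\<exists>d. d \<in> stalk_ideal q q \<and> d \<notin> Q.fO" by blast
  qed
qed

text \<open>The point consists of the forms whose restriction to \<open>z = 1\<close> lies in
  \<open>J\<close>. The element \<open>h\<close> makes the quotient by \<open>J\<close>
  finite-dimensional over the constants, and this forces maximality.\<close>

lemma point_of_prime:
  assumes J: "primeideal J (ring_of_type_algebra :: 'k poly poly ring)" and fJ: "f0 \<in> J" and hJ: "h \<in> J" "\<not> f0 dvd h"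
  shows "\<exists>q. closed_point q \<and> F \<in> q \<and> q \<noteq> point_100 \<and> (\<forall>d G. homogeneous d G \<longrightarrow> (G \<in> q \<longleftrightarrow> dehomogenize G \<in> J))"
proof -
  interpret P: primeideal J "ring_of_type_algebra :: 'k poly poly ring" by (rule J)
  note S = ideal.axioms(1)[OF P.is_ideal]
  have J0: "0 \<in> J" using additive_subgroup.zero_closed[OF S] by simp
  have Jadd: "x + y \<in> J" if "x \<in> J" "y \<in> J" for x y using additive_subgroup.a_closed[OF S that] by simp
  have Jmult: "y * x \<in> J" if "x \<in> J" for x y using P.I_l_closed[OF that, of y] by simp
  have Jprime: "x \<in> J \<or> y \<in> J" if "x * y \<in> J" for x y using P.I_prime[of x y] that by simp
  have J1: "1 \<notin> J" using P.one_imp_carrier P.I_notcarr by auto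
  have Jdiff: "x - y \<in> J" if "x \<in> J" "y \<in> J" for x y using Jadd[OF that(1) Jmult[OF that(2), of "- 1"]] by simp
  have Jsum: "(\<Sum>i\<in>A. g i) \<in> J" if "\<And>i. i \<in> A \<Longrightarrow> g i \<in> J" for A :: "nat set" and g
    using that by (induction A rule: infinite_finite_induct) (auto simp: J0 Jadd)
  note D = rhomD[OF rhom_dehomogenize]
  \<comment> \<open>Taken componentwise, since a homogeneous ideal contains all components of its
    elements.\<close>
  define q where "q = {G. \<forall>e. dehomogenize (hcomp e G) \<in> J}"
  have qh: "G \<in> q \<longleftrightarrow> dehomogenize G \<in> J" if "homogeneous d G" for d G
    using that J0 by (auto simp: q_def hcomp_of_homogeneous D)
  have hm: "dehomogenize (hcomp n (x * y)) = (\<Sum>a\<le>n. dehomogenize (hcomp a x) * dehomogenize (hcomp (n - a) y))" for n x y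
  proof -
    obtain B where B: "\<forall>e>B. hcomp e x = 0" using hcomp_bound by blast
    have B': "\<forall>e>B + n. hcomp e x = 0" using B by simp
    have "hcomp n (x * y) = hcomp n ((\<Sum>a\<le>B + n. hcomp a x) * y)" using sum_hcomp[OF B'] by simp
    also have "\<dots> = (\<Sum>a\<le>B + n. if a \<le> n then hcomp a x * hcomp (n - a) y else 0)"
      by (simp add: sum_distrib_right hcomp_sum hcomp_mult_homogeneous[OF hcomp_homogeneous])
    also have "\<dots> = (\<Sum>a\<le>n. hcomp a x * hcomp (n - a) y)"
      by (rule sum.mono_neutral_cong_right) auto
    finally show ?thesis by (simp add: D)
  qed
  have q0: "0 \<in> q" by (simp add: q_def hcomp_zero D J0)
  have qadd: "x + y \<in> q" if "x \<in> q" "y \<in> q" for x y using that Jadd by (simp add: q_def hcomp_add D)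
  have qmult: "y * x \<in> q" if "x \<in> q" for x y
    using that unfolding q_def hm mem_Collect_eq by (intro allI Jsum Jmult) auto
  have q1: "1 \<notin> q" using qh[OF homogeneous_one] J1 by (simp add: D)
  have qprime: "x \<in> q \<or> y \<in> q" if xy: "x * y \<in> q" for x y
  proof (rule ccontr)
    assume "\<not> (x \<in> q \<or> y \<in> q)"
    then obtain a0 b0 where ab0: "dehomogenize (hcomp a0 x) \<notin> J" "dehomogenize (hcomp b0 y) \<notin> J" by (auto simp: q_def)
    \<comment> \<open>The usual argument for graded primes: among the summands of the component of
      degree \<open>a + b\<close>, only the product of the two lowest components outside
      \<open>J\<close> is not known to lie in \<open>J\<close>.\<close>
    define a where "a = (LEAST a. dehomogenize (hcomp a x) \<notin> J)"
    define b where "b = (LEAST b. dehomogenize (hcomp b y) \<notin> J)"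
    have a: "dehomogenize (hcomp a x) \<notin> J" "\<And>i. i < a \<Longrightarrow> dehomogenize (hcomp i x) \<in> J"
      unfolding a_def using LeastI[of "\<lambda>a. dehomogenize (hcomp a x) \<notin> J", OF ab0(1)] not_less_Least by blast+
    have b: "dehomogenize (hcomp b y) \<notin> J" "\<And>i. i < b \<Longrightarrow> dehomogenize (hcomp i y) \<in> J"
      unfolding b_def using LeastI[of "\<lambda>a. dehomogenize (hcomp a y) \<notin> J", OF ab0(2)] not_less_Least by blast+
    have S: "(\<Sum>i\<le>a + b. dehomogenize (hcomp i x) * dehomogenize (hcomp (a + b - i) y)) \<in> J"
      using xy unfolding q_def by (simp add: hm)
    have T: "(\<Sum>i\<le>a + b. dehomogenize (hcomp i x) * dehomogenize (hcomp (a + b - i) y)) =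
      dehomogenize (hcomp a x) * dehomogenize (hcomp b y) + (\<Sum>i\<in>{..a + b} - {a}. dehomogenize (hcomp i x) * dehomogenize (hcomp (a + b - i) y))"
      by (subst sum.remove[of _ a]) auto
    have U: "(\<Sum>i\<in>{..a + b} - {a}. dehomogenize (hcomp i x) * dehomogenize (hcomp (a + b - i) y)) \<in> J"
    proof (rule Jsum)
      fix i assume i: "i \<in> {..a + b} - {a}"
      show "dehomogenize (hcomp i x) * dehomogenize (hcomp (a + b - i) y) \<in> J"
      proof (cases "i < a")
        case True
        show ?thesis using Jmult[OF a(2)[OF True], of "dehomogenize (hcomp (a + b - i) y)"] by (subst mult.commute)
      next
        case False
        then have "a + b - i < b" using i by auto
        then show ?thesis using Jmult[OF b(2)] by simp
      qed
    qed
    have "dehomogenize (hcomp a x) * dehomogenize (hcomp b y) \<in> J"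
      using Jdiff[OF S U] unfolding T by (simp only: add_diff_cancel_right')
    then show False using Jprime a(1) b(1) by blast
  qed
  have zq: "form_z ^ n \<notin> q" for n
    using qh[OF homogeneous_power1[OF homogeneous_vars(3)], of n] J1 by (simp add: D dehomogenize_gens)
  have z1: "form_z \<notin> q" using zq[of 1] by simp
  have qp: "proj_point q" unfolding proj_point_def
  proof (intro conjI)
    show "primeideal q ring_of_type_algebra" by (rule prime_type_algebra) (use q0 qadd qmult q1 qprime in auto)
    show "q = genideal ring_of_type_algebra {G \<in> q. \<exists>d. homogeneous d G}"
      by (rule genideal_homogeneous) (use q0 qadd qmult in \<open>auto simp: q_def hcomp_of_homogeneous[OF hcomp_homogeneous] D J0\<close>)
    show "\<not> {form_x, form_y, form_z} \<subseteq> q" using z1 by simp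
  qed
  then interpret Q: plane_point q by unfold_locales
  have Fq: "F \<in> q" using qh[OF homF] fJ by (simp add: f0_def)
  obtain P a b where P: "P \<noteq> 0" "[:P:] = f0 * a + h * b" using elimination[OF hJ(2)] by blast
  have PJ: "[:P:] \<in> J" unfolding P(2) using Jadd[OF Jmult[OF fJ, of a] Jmult[OF hJ(1), of b]] by (simp only: mult.commute)
  have max: "q' = q" if q': "proj_point q'" "q \<subseteq> q'" for q'
  proof -
    interpret Q': plane_point q' by unfold_locales (rule q')
    have "form_z \<notin> q'"
    proof
      assume z: "form_z \<in> q'"
      have y: "form_y \<in> q'" using y_mem[OF Q'.plane_point_axioms _ z] Fq q'(2) by blast
      define n where "n = degree P"
      \<comment> \<open>The homogenization of \<open>P\<close> lies in \<open>q\<close>. If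
        \<open>form_z\<close> were in \<open>q'\<close>, only its top term would be left, a nonzero
        multiple of a power of \<open>form_x\<close>.\<close>
      define Ph where "Ph = (\<Sum>i\<le>n. form_const (coeff P i) * form_x ^ i * form_z ^ (n - i))"
      have Phom: "homogeneous n Ph" unfolding Ph_def
      proof (rule homogeneous_sum)
        fix i assume "i \<in> {..n}"
        then show "homogeneous n (form_const (coeff P i) * form_x ^ i * form_z ^ (n - i))"
          using homogeneous_mult[OF homogeneous_mult[OF homogeneous_const homogeneous_power1[OF homogeneous_vars(1)]]
            homogeneous_power1[OF homogeneous_vars(3)], of i "n - i" "coeff P i"] by simp
      qed
      have "dehomogenize Ph = (\<Sum>i\<le>n. [:[:coeff P i:] * [:0, 1:] ^ i:])"
        by (simp add: Ph_def D dehomogenize_gens poly_const_pow)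
      also have "\<dots> = [:\<Sum>i\<le>n. [:coeff P i:] * [:0, 1:] ^ i:]"
        using rhomD(8)[OF rhom_const_poly, of "\<lambda>i. [:coeff P i:] * [:0, 1:] ^ i" "{..n}"] by simp
      also have "(\<Sum>i\<le>n. [:coeff P i:] * [:0, 1:] ^ i) = P"
        unfolding n_def using poly_as_sum_of_monoms[of P] by (simp add: monom_altdef)
      finally have PhJ: "dehomogenize Ph \<in> J" using PJ by simp
      have "Ph \<in> q" by (rule iffD2[OF qh[OF Phom] PhJ])
      then have S: "Ph \<in> q'" using q'(2) by blast
      have T: "Ph = form_const (coeff P n) * form_x ^ n + (\<Sum>i<n. form_const (coeff P i) * form_x ^ i * form_z ^ (n - i))"
        unfolding Ph_def by (simp add: lessThan_Suc_atMost[symmetric])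
      have U: "(\<Sum>i<n. form_const (coeff P i) * form_x ^ i * form_z ^ (n - i)) \<in> q'"
      proof (rule Q'.q_sum)
        fix i assume "i \<in> {..<n}"
        then obtain k where "n - i = Suc k" by (metis Suc_diff_Suc lessThan_iff)
        then have "form_z ^ (n - i) \<in> q'" using Q'.q_mult[OF z, of "form_z ^ k"] by simp
        then show "form_const (coeff P i) * form_x ^ i * form_z ^ (n - i) \<in> q'" by (rule Q'.q_mult')
      qed
      have lx: "form_const (coeff P n) * form_x ^ n \<in> q'"
        using Q'.q_diff[OF S U] by (subst (asm) T) (simp only: add_diff_cancel_right')
      have cn: "coeff P n \<noteq> 0" unfolding n_def using P(1) by simp
      have m: "form_const (inverse (coeff P n)) * (form_const (coeff P n) * form_x ^ n) \<in> q'" by (rule Q'.q_mult'[OF lx])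
      have "form_const (inverse (coeff P n)) * (form_const (coeff P n) * form_x ^ n) = form_const (inverse (coeff P n) * coeff P n) * form_x ^ n"
        by (simp only: rhomD(2)[OF rhom_form_const] mult.assoc)
      also have "\<dots> = form_x ^ n" using cn by (simp add: rhomD(3)[OF rhom_form_const])
      finally have "form_x ^ n \<in> q'" using m by (simp only:)
      then have "form_x \<in> q'" by (rule Q'.q_power)
      then show False using q'(1) y z by (auto simp: proj_point_def)
    qed
    then have zq': "form_z ^ n \<notin> q'" for n using Q'.q_power by blast
    have "q' \<subseteq> q"
    proof (rule homogeneous_subset[OF Q'.plane_point_axioms Q.plane_point_axioms], rule ccontr)
      fix d G assume G: "homogeneous d G" "G \<in> q'" "G \<notin> q"
      define g where "g = dehomogenize G"
      have gJ: "g \<notin> J" using qh[OF G(1)] G(3) by (simp add: g_def)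
      \<comment> \<open>\<open>g\<close> is invertible modulo \<open>J\<close> with inverse
        \<open>x\<close>, so a homogenization of \<open>1 - g * x\<close> lies in \<open>q\<close>.
        Together with \<open>G\<close> it would put a power of \<open>form_z\<close> into
        \<open>q'\<close>.\<close>
      obtain i x u v where st: "g ^ i = g ^ Suc i * x + f0 * u + h * v" using power_stationary[OF hJ(2)] by blast
      have "g ^ i * (1 - g * x) = u * f0 + v * h" using st by (simp add: algebra_simps)
      then have "g ^ i * (1 - g * x) \<in> J" using Jadd[OF Jmult[OF fJ, of u] Jmult[OF hJ(1), of v]] by simp
      moreover have "g ^ i \<notin> J" using gJ by (induction i) (use J1 Jprime in auto)
      ultimately have gx: "1 - g * x \<in> J" using Jprime by blast
      obtain e V where V: "homogeneous e V" "dehomogenize V = x" using homogenization by blast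
      have hom: "homogeneous (d + e) (form_z ^ (d + e) - G * V)"
        using homogeneous_add[OF homogeneous_power1[OF homogeneous_vars(3)] homogeneous_uminus[OF homogeneous_mult[OF G(1) V(1)]]] by simp
      have "form_z ^ (d + e) - G * V \<in> q" using qh[OF hom] gx V(2) by (simp add: D dehomogenize_gens g_def)
      then have "(form_z ^ (d + e) - G * V) + G * V \<in> q'" using q'(2) Q'.q_mult[OF G(2)] Q'.q_add by blast
      then show False using zq' by simp
    qed
    then show ?thesis using q'(2) by blast
  qed
  have "closed_point q" unfolding closed_point_def using qp max by blast
  moreover have "q \<noteq> point_100" using z1 by (auto simp: point_100_eq lead_x_gens)
  ultimately show ?thesis using Fq qh by blast
qed

text \<open>The multipliers \<open>t\<close> with \<open>t * g\<close> in the ideal of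
  \<open>h\<close> and \<open>f0\<close> form an ideal containing \<open>h\<close> and
  \<open>f0\<close>. If it were proper, a prime above it would come from a closed point by
  \<open>point_of_prime\<close>, and the local solution at that point provides a multiplier outside
  the prime.\<close>

lemma globalize:
  assumes G: "homogeneous d G" "homogeneous d H" "\<not> F dvd H"
    and loc: "\<And>q. closed_point q \<Longrightarrow> F \<in> q \<Longrightarrow> q \<noteq> point_100 \<Longrightarrow>
      \<exists>e G1 H1. homogeneous e G1 \<and> homogeneous e H1 \<and> H1 \<notin> q \<and> F dvd G * H1 - G1 * H"
  shows "\<exists>y a. dehomogenize G = dehomogenize H * y + f0 * a"
proof -
  note D = rhomD[OF rhom_dehomogenize]
  define g h where "g = dehomogenize G" and "h = dehomogenize H"
  have h: "\<not> f0 dvd h" using dvd_dehomogenize[OF G(2)] G(3) by (simp add: h_def)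
  define I where "I = {t. \<exists>y a. t * g = h * y + f0 * a}"
  have II: "t \<in> I" if "t * g = h * y + f0 * a" for t y a using that by (auto simp: I_def)
  interpret R: cring "ring_of_type_algebra :: 'k poly poly ring" by (rule cring_from_type_algebra)
  have "1 \<in> I"
  proof (rule ccontr)
    assume n1: "1 \<notin> I"
    have mult: "s * t \<in> I" if t: "t \<in> I" for s t
    proof -
      obtain y a where "t * g = h * y + f0 * a" using t by (auto simp: I_def)
      then have "s * (t * g) = s * (h * y + f0 * a)" by (simp only:)
      then have "s * t * g = h * (s * y) + f0 * (s * a)"
        by (simp only: distrib_left mult.assoc mult.left_commute[of s h] mult.left_commute[of s f0])
      then show ?thesis by (rule II)
    qed
    have idI: "ideal I ring_of_type_algebra"
    proof (rule idealI[OF R.ring_axioms])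
      show "subgroup I (add_monoid ring_of_type_algebra)"
      proof (rule R.add.subgroupI)
        show "I \<subseteq> carrier ring_of_type_algebra" by simp
        show "I \<noteq> {}" using II[of 0 0 0] by auto
        fix s t assume s: "s \<in> I"
        have "\<ominus>\<^bsub>ring_of_type_algebra\<^esub> s = - 1 * s" using R.minus_equality[of "- 1 * s" s] by simp
        then show "\<ominus>\<^bsub>ring_of_type_algebra\<^esub> s \<in> I" using mult[OF s, of "- 1"] by simp
        assume t: "t \<in> I"
        obtain y a y' a' where "s * g = h * y + f0 * a" "t * g = h * y' + f0 * a'" using s t by (auto simp: I_def)
        then have "(s + t) * g = h * (y + y') + f0 * (a + a')" by (simp add: algebra_simps)
        then show "s \<oplus>\<^bsub>ring_of_type_algebra\<^esub> t \<in> I" using II by simp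
      qed
      fix t s assume "t \<in> I"
      then show "s \<otimes>\<^bsub>ring_of_type_algebra\<^esub> t \<in> I" "t \<otimes>\<^bsub>ring_of_type_algebra\<^esub> s \<in> I"
        using mult[of t s] by (simp_all add: mult.commute)
    qed
    have "\<exists>J. primeideal J ring_of_type_algebra \<and> I \<subseteq> J \<and> J \<inter> {1} = {}"
      by (rule R.prime_avoiding[OF idI]) (use n1 in auto)
    then obtain J where J: "primeideal J ring_of_type_algebra" "I \<subseteq> J" by blast
    have "f0 \<in> I" using II[of f0 0 g] by simp
    moreover have "h \<in> I" using II[of h g 0] by simp
    ultimately obtain q where q: "closed_point q" "F \<in> q" "q \<noteq> point_100"
      and qJ: "\<And>d G. homogeneous d G \<Longrightarrow> G \<in> q \<longleftrightarrow> dehomogenize G \<in> J"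
      using point_of_prime[OF J(1) _ _ h] J(2) by blast
    obtain e G1 H1 where 1: "homogeneous e G1" "homogeneous e H1" "H1 \<notin> q" "F dvd G * H1 - G1 * H"
      using loc[OF q] by blast
    obtain a where a: "G * H1 - G1 * H = F * a" using 1(4) by (elim dvdE)
    have "g * dehomogenize H1 - dehomogenize G1 * h = f0 * dehomogenize a"
      using arg_cong[OF a, of dehomogenize] by (simp add: D g_def h_def f0_def)
    then have "dehomogenize H1 * g = h * dehomogenize G1 + f0 * dehomogenize a" by (simp add: algebra_simps)
    then have "dehomogenize H1 \<in> I" by (rule II)
    then show False using qJ[OF 1(2)] 1(3) J(2) by blast
  qed
  then show ?thesis by (auto simp: I_def g_def h_def)
qed

end

section \<open>Functions on the curve\<close>

lemma homogeneous_cross: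
  assumes "homogeneous d G" "homogeneous d H" "homogeneous e G1" "homogeneous e H1"
  shows "homogeneous (d + e) (G * H1 - G1 * H)"
  using homogeneous_add[OF homogeneous_mult[OF assms(1,4)], of "- (G1 * H)"]
    homogeneous_uminus[OF homogeneous_mult[OF assms(3,2)]] by (simp add: add.commute)

context hyperflex
begin

lemma proj_curve: "proj_point (curve_ideal F)"
  unfolding proj_point_def
proof (intro conjI)
  show "primeideal (curve_ideal F) ring_of_type_algebra"
  proof (rule prime_type_algebra)
    show "1 \<notin> curve_ideal F" using primeF by (auto simp: curve_ideal_def prime_elem_def)
    show "x * y \<in> curve_ideal F \<Longrightarrow> x \<in> curve_ideal F \<or> y \<in> curve_ideal F" for x y
      using F_dvd_mult by (auto simp: curve_ideal_def)
  qed (auto simp: curve_ideal_def)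
  show "curve_ideal F = genideal ring_of_type_algebra {G \<in> curve_ideal F. \<exists>d. homogeneous d G}"
  proof (rule genideal_homogeneous)
    fix G e assume "G \<in> curve_ideal F"
    then obtain G' where "G = F * G'" by (auto simp: curve_ideal_def)
    then show "hcomp e G \<in> curve_ideal F" by (auto simp: hcomp_mult_homogeneous[OF homF] curve_ideal_def)
  qed (auto simp: curve_ideal_def)
  show "\<not> {form_x, form_y, form_z} \<subseteq> curve_ideal F" using F_not_dvd_z by (simp add: curve_ideal_def)
qed

lemma plane_point_curve: "plane_point (curve_ideal F)" by unfold_locales (rule proj_curve)

interpretation P: plane_point "curve_ideal F" by (rule plane_point_curve)
interpretation PA: local_subring ratfun_const "stalk (curve_ideal F)" "stalk_ideal (curve_ideal F) (curve_ideal F)"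
  by (rule P.local_subring_stalk)

abbreviation "P \<equiv> curve_ideal F"
abbreviation "I \<equiv> stalk_ideal P P"
abbreviation "res \<equiv> restrict_to_curve F"

lemma stalk_P:
  assumes "plane_point q" "F \<in> q"
  shows "stalk q \<subseteq> stalk P"
proof
  interpret Q: plane_point q by fact
  fix a assume "a \<in> stalk q"
  then obtain d G H where a: "a = emb G / emb H" "H \<notin> q" "H \<noteq> 0" "homogeneous d G" "homogeneous d H" by (rule Q.stalkE)
  have "H \<notin> P" using a(2) assms(2) Q.q_mult by (auto simp: curve_ideal_def)
  then show "a \<in> stalk P" unfolding a(1) using a by (intro P.stalkI)
qed

lemma curve_field_eq: "curve_field F = PA.Rg Quot I" by (simp add: curve_field_def stalk_ring_def)

lemma res_eq: "res a = I +>\<^bsub>PA.Rg\<^esub> a" by (simp add: restrict_to_curve_def stalk_ring_def)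

lemma I_diff: "x \<in> I \<Longrightarrow> y \<in> I \<Longrightarrow> x - y \<in> I"
  using PA.m_add[OF _ PA.m_mult[of y "- 1"]] PA.O_uminus[OF PA.O_one] by simp

lemma res_eq_iff:
  assumes "a \<in> stalk P" "b \<in> stalk P"
  shows "res a = res b \<longleftrightarrow> a - b \<in> I"
proof -
  have r: "res x = {i + x | i. i \<in> I}" for x by (auto simp: res_eq a_r_coset_def')
  show ?thesis
  proof
    assume e: "res a = res b"
    have "0 + a \<in> res a" unfolding r using PA.m_zero by blast
    then have "0 + a \<in> res b" by (simp only: e)
    then obtain i where "0 + a = i + b" "i \<in> I" unfolding r by blast
    then show "a - b \<in> I" by (simp add: algebra_simps)
  next
    assume ab: "a - b \<in> I"
    have "i + a = (i + (a - b)) + b" "i + b = (i - (a - b)) + a" for i by simp_all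
    then show "res a = res b" unfolding r using PA.m_add[OF _ ab] I_diff[OF _ ab] by blast
  qed
qed

lemma res_mult: "a \<in> stalk P \<Longrightarrow> b \<in> stalk P \<Longrightarrow> res a \<otimes>\<^bsub>curve_field F\<^esub> res b = res (a * b)"
  using ideal.rcoset_mult_add[OF PA.m_ideal, of a b] by (simp add: curve_field_eq res_eq FactRing_def)

lemma res_pow: "a \<in> stalk P \<Longrightarrow> res a [^]\<^bsub>curve_field F\<^esub> (n::nat) = res (a ^ n)"
proof (induction n)
  case 0
  then show ?case by (simp add: curve_field_eq res_eq FactRing_def nat_pow_def)
next
  case (Suc n)
  then show ?case using res_mult[OF PA.O_power] by (simp add: nat_pow_def mult.commute)
qed

lemma curve_field_E:
  assumes "\<alpha> \<in> carrier (curve_field F)"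
  obtains a where "a \<in> stalk P" "\<alpha> = res a"
  using assms by (auto simp: curve_field_eq res_eq FactRing_def A_RCOSETS_def')

lemma res_carr: "a \<in> stalk P \<Longrightarrow> res a \<in> carrier (curve_field F)"
  by (auto simp: curve_field_eq res_eq FactRing_def A_RCOSETS_def')

lemma res_quot_iff:
  assumes G: "\<not> F dvd H" "homogeneous d G" "homogeneous d H" and G1: "\<not> F dvd H1" "homogeneous e G1" "homogeneous e H1"
  shows "res (emb G / emb H) = res (emb G1 / emb H1) \<longleftrightarrow> F dvd G * H1 - G1 * H"
proof -
  have n: "H \<notin> P" "H1 \<notin> P" using G G1 by (auto simp: curve_ideal_def)
  have z: "emb H \<noteq> 0" "emb H1 \<noteq> 0" using G(1) G1(1) by auto
  have h: "homogeneous (d + e) (G * H1 - G1 * H)"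
    by (rule homogeneous_cross[OF G(2,3) G1(2,3)])
  have "emb G / emb H - emb G1 / emb H1 = emb (G * H1 - G1 * H) / emb (H * H1)"
    using z by (simp add: rhomD[OF rhom_emb] field_simps)
  then show ?thesis
    using P.max_iff[OF _ h homogeneous_mult[OF G(3) G1(3)]] P.q_prime n res_eq_iff[OF P.stalkI[OF n(1) G(2,3)] P.stalkI[OF n(2) G1(2,3)]]
    by (auto simp: curve_ideal_def)
qed

lemma ev_quot_z:
  obtains e Y where "homogeneous e Y" "dehomogenize Y = y" "ev y = emb Y / emb (form_z ^ e)"
  using homogenization[of y] ev_quot by (metis rhomD(7)[OF rhom_emb])

lemma ev_stalk_P: "ev y \<in> stalk P"
proof -
  obtain e Y where "homogeneous e Y" "ev y = emb Y / emb (form_z ^ e)" by (rule ev_quot_z[of y])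
  moreover have "form_z ^ e \<notin> P" using F_not_dvd_z_power by (simp add: curve_ideal_def)
  ultimately show ?thesis using P.stalkI[OF _ _ homogeneous_power1[OF homogeneous_vars(3)]] by metis
qed

lemma functions_off_ev: "res (ev y) \<in> functions_off F point_100"
  unfolding functions_off_def mem_Collect_eq
proof (intro conjI allI impI res_carr ev_stalk_P)
  fix q assume q: "closed_point q \<and> F \<in> q \<and> q \<noteq> point_100"
  interpret Q: plane_point q using q by (simp add: closed_point_def plane_point_def)
  obtain e Y where Y: "homogeneous e Y" "ev y = emb Y / emb (form_z ^ e)" by (rule ev_quot_z[of y])
  have "form_z ^ e \<notin> q" using z_off[of q] q Q.q_power by blast
  then have "ev y \<in> stalk q" unfolding Y(2) by (rule Q.stalkI[OF _ Y(1) homogeneous_power1[OF homogeneous_vars(3)]])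
  then show "res (ev y) \<in> curve_stalk F q" by (simp add: curve_stalk_def)
qed

text \<open>At each closed point off the flex the function is a fraction with invertible
  denominator; \<open>globalize\<close> replaces these fractions by one polynomial. So k[X,Y] maps
  onto the functions regular off the flex.\<close>

lemma functions_off_E:
  assumes "\<alpha> \<in> functions_off F point_100"
  obtains y where "\<alpha> = res (ev y)"
proof -
  note D = rhomD[OF rhom_dehomogenize]
  have "\<alpha> \<in> carrier (curve_field F)" using assms by (simp add: functions_off_def)
  then obtain a where a: "a \<in> stalk P" "\<alpha> = res a" by (rule curve_field_E)
  obtain d G H where G: "a = emb G / emb H" "H \<notin> P" "H \<noteq> 0" "homogeneous d G" "homogeneous d H" using a(1) by (rule P.stalkE)
  have H: "\<not> F dvd H" using G(2) by (simp add: curve_ideal_def)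
  have "\<exists>y b. dehomogenize G = dehomogenize H * y + f0 * b"
  proof (rule globalize[OF G(4,5) H])
    fix q :: "'k form set" assume q: "closed_point q" "F \<in> q" "q \<noteq> point_100"
    interpret Q: plane_point q using q by (simp add: closed_point_def plane_point_def)
    obtain b where b: "b \<in> stalk q" "\<alpha> = res b" using assms q by (auto simp: functions_off_def curve_stalk_def)
    obtain e G1 H1 where 1: "b = emb G1 / emb H1" "H1 \<notin> q" "H1 \<noteq> 0" "homogeneous e G1" "homogeneous e H1" using b(1) by (rule Q.stalkE)
    have "\<not> F dvd H1" using 1(2) q(2) Q.q_mult by (auto elim!: dvdE)
    then have "F dvd G * H1 - G1 * H" using res_quot_iff[OF H G(4,5) _ 1(4,5)] a(2) b(2) G(1) 1(1) by simp
    then show "\<exists>e G1 H1. homogeneous e G1 \<and> homogeneous e H1 \<and> H1 \<notin> q \<and> F dvd G * H1 - G1 * H" using 1 by blast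
  qed
  then obtain y b where y: "dehomogenize G = dehomogenize H * y + f0 * b" by blast
  obtain e Y where Y: "homogeneous e Y" "dehomogenize Y = y" "ev y = emb Y / emb (form_z ^ e)" by (rule ev_quot_z[of y])
  note zh = homogeneous_power1[OF homogeneous_vars(3), of e]
  have h: "homogeneous (d + e) (G * form_z ^ e - Y * H)"
    by (rule homogeneous_cross[OF G(4,5) Y(1) zh])
  have "dehomogenize (G * form_z ^ e - Y * H) = f0 * b"
    by (simp add: D dehomogenize_gens y Y(2) mult.commute)
  then have "F dvd G * form_z ^ e - Y * H" using dvd_dehomogenize[OF h] by simp
  then have "res a = res (ev y)"
    using res_quot_iff[OF H G(4,5) F_not_dvd_z_power Y(1) zh] G(1) Y(3) by simp
  then show ?thesis using a(2) that by blast
qed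

section \<open>Elements of the Krichever subspace\<close>

text \<open>The element of \<open>K_C\<close> need not be rational, so a term of the Cauchy sequence
  is used that agrees with it beyond its own order. \<open>regular_on_curve\<close> treats its
  leading coefficient at each point off the flex, and \<open>globalize\<close> turns the local
  answers into the polynomial \<open>y\<close>.\<close>

lemma regular_function:
  assumes g: "g \<in> krichever_K_C F point_100" "s \<in> curve_cauchy F"
    and ge: "g = good_point.equi F `` {s}"
    and r: "s i \<noteq> 0" "curve_ord F (s i) < int k" "\<And>n. n \<ge> i \<Longrightarrow> curve_ord_ge F (int k) (s i - s n)"
  shows "\<exists>y a h. \<not> f0 dvd y \<and> \<not> f0 dvd h \<and> s i = ev f0 powi curve_ord F (s i) * (ev y + ev f0 * ev a / ev h)"
proof -
  note D = rhomD[OF rhom_dehomogenize]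
  define r where "r = s i"
  have rf: "r \<in> function_field" using g(2) by (auto simp: r_def curve_cauchy_def)
  obtain d V Y where V: "r = emb V / emb Y" "Y \<noteq> 0" "homogeneous d V" "homogeneous d Y" using rf by (rule funfieldE)
  have "V \<noteq> 0" using V(1) r(1) by (auto simp: r_def)
  then obtain a G' where G': "V = F ^ a * G'" "\<not> F dvd G'" "m * a \<le> d" "homogeneous (d - m * a) G'"
    using split_power[OF V(3)] by blast
  obtain b H' where H': "Y = F ^ b * H'" "\<not> F dvd H'" "m * b \<le> d" "homogeneous (d - m * b) H'"
    using split_power[OF V(4) V(2)] by blast
  define N where "N = int a - int b"
  have N: "curve_ord F r = N" unfolding N_def by (rule curve_ord_eq[OF G'(2) H'(2), of d]) (use V G' H' in auto)
  \<comment> \<open>The powers of \<open>form_z\<close> restore the common degree \<open>d\<close>;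
    they are what is left over when powers of \<open>F\<close> are replaced by powers of
    \<open>ev f0\<close>.\<close>
  define G H where "G = form_z ^ (m * a) * G'" and "H = form_z ^ (m * b) * H'"
  note zh = homogeneous_power1[OF homogeneous_vars(3)]
  have h: "homogeneous d G" "homogeneous d H"
    unfolding G_def H_def using homogeneous_mult[OF zh G'(4), of "m * a"] homogeneous_mult[OF zh H'(4), of "m * b"] G'(3) H'(3) by simp_all
  have nd: "\<not> F dvd G" "\<not> F dvd H" unfolding G_def H_def F_dvd_mult using F_not_dvd_z_power G'(2) H'(2) by auto
  have F0: "ev f0 = emb F / emb (form_z ^ m)" using ev_quot[OF homF] by (simp add: f0_def rhomD[OF rhom_emb])
  have nz: "emb F \<noteq> 0" "emb form_z \<noteq> 0" "emb H' \<noteq> 0" "emb H \<noteq> 0" using F_nz H'(2) nd(2) by auto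
  have f0z: "ev f0 \<noteq> 0" using ev_eq_0[of f0] f0_nz by simp
  have "ev f0 powi N = ev f0 ^ a / ev f0 ^ b" unfolding N_def using f0z by (simp add: power_int_diff)
  then have rG: "r = ev f0 powi N * (emb G / emb H)"
    unfolding V(1) G'(1) H'(1) G_def H_def F0 using nz by (simp add: rhomD[OF rhom_emb] power_divide field_simps flip: power_mult)
  have "\<exists>y a. dehomogenize G = dehomogenize H * y + f0 * a"
  proof (rule globalize[OF h nd(2)])
    fix q :: "'k form set" assume q: "closed_point q" "F \<in> q" "q \<noteq> point_100"
    interpret Q: plane_point q using q by (simp add: closed_point_def plane_point_def)
    interpret A: local_subring ratfun_const "stalk q" "stalk_ideal q q" by (rule Q.local_subring_stalk)
    have zq: "form_z ^ n \<notin> q" for n using z_off[OF q] Q.q_power by blast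
    have loc: "local_equation F q (ev f0)"
      unfolding F0 by (rule local_equation_quot[OF plane_curve_axioms Q.plane_point_axioms q(2) homogeneous_vars(3)]) (use zq[of 1] in simp)
    interpret T: transversal_point F m q "ev f0" by (rule transversal_point_off(1)[OF q loc])
    interpret GP: good_point F m q "ev f0" by (rule T.good)
    interpret KK: cring "K_ring q (ev f0)" by (rule T.K_cring)
    define \<kappa> where "\<kappa> = K_C_to_K q (ev f0) g"
    have \<kappa>B: "\<kappa> \<in> B_to_K q (ev f0) ` carrier (B_ring q (ev f0))"
      using g(1) q loc unfolding krichever_K_C_def \<kappa>_def by blast
    have ap: "\<kappa> \<in> carrier (K_ring q (ev f0))"
      "\<exists>n0. \<forall>n\<ge>n0. T.Fil k (GP.\<phi> (s n) \<ominus>\<^bsub>K_ring q (ev f0)\<^esub> \<kappa>)"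
      using GP.K_C_to_K_approx[OF g(2)] unfolding \<kappa>_def ge by blast+
    then obtain n0 where n0: "\<And>n. n \<ge> n0 \<Longrightarrow> T.Fil k (GP.\<phi> (s n) \<ominus>\<^bsub>K_ring q (ev f0)\<^esub> \<kappa>)" by blast
    \<comment> \<open>Beyond \<open>i\<close> for the Cauchy estimate and beyond \<open>n0\<close>
      for the comparison with the limit; the sum of the two differences compares \<open>s i\<close>
      with the limit.\<close>
    define n where "n = max n0 i"
    have sf: "s l \<in> function_field" for l by (rule GP.cauchy_funfield[OF g(2)])
    have "T.Fil k (GP.\<phi> (s i - s n))" by (rule GP.phi_Fil[OF funfield_closed(2)[OF sf sf] r(3)]) (simp add: n_def)
    then have "T.Fil k ((GP.\<phi> (s i) \<ominus>\<^bsub>K_ring q (ev f0)\<^esub> GP.\<phi> (s n)) \<oplus>\<^bsub>K_ring q (ev f0)\<^esub> (GP.\<phi> (s n) \<ominus>\<^bsub>K_ring q (ev f0)\<^esub> \<kappa>))"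
      using T.Fil_add[OF _ n0[of n]] by (simp add: GP.phi_diff[OF sf sf] n_def)
    moreover have "(GP.\<phi> (s i) \<ominus>\<^bsub>K_ring q (ev f0)\<^esub> GP.\<phi> (s n)) \<oplus>\<^bsub>K_ring q (ev f0)\<^esub> (GP.\<phi> (s n) \<ominus>\<^bsub>K_ring q (ev f0)\<^esub> \<kappa>) = GP.\<phi> r \<ominus>\<^bsub>K_ring q (ev f0)\<^esub> \<kappa>"
    proof -
      have "GP.\<phi> (s i) \<in> carrier (K_ring q (ev f0))" "GP.\<phi> (s n) \<in> carrier (K_ring q (ev f0))" using sf by auto
      then show ?thesis unfolding r_def using ap(1) by algebra
    qed
    ultimately have Fil: "T.Fil k (GP.\<phi> r \<ominus>\<^bsub>K_ring q (ev f0)\<^esub> \<kappa>)" by simp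
    define c' d' where "c' = emb G / emb (form_z ^ d)" and "d' = emb H / emb (form_z ^ d)"
    have cd: "c' \<in> stalk q" "d' \<in> stalk q" unfolding c'_def d'_def by (rule Q.stalkI[OF zq h(1) zh], rule Q.stalkI[OF zq h(2) zh])
    have d': "d' \<notin> T.fO" unfolding d'_def T.quot_in_fO[OF zq h(2) zh] by (rule nd(2))
    have rr: "r = ev f0 powi N * c' / d'" unfolding rG c'_def d'_def using nz by (simp add: rhomD[OF rhom_emb])
    have Nk: "N < int k" using r(2) N by (simp add: r_def)
    obtain u v where uv: "u \<in> stalk q" "v \<in> stalk q" "c' = d' * u + ev f0 * v"
      using T.regular_on_curve[OF cd d' rf rr \<kappa>B Nk Fil] by blast
    obtain e G1 H1 where 1: "u = emb G1 / emb H1" "H1 \<notin> q" "H1 \<noteq> 0" "homogeneous e G1" "homogeneous e H1" using uv(1) by (rule Q.stalkE)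
    have h2: "homogeneous (d + e) (G * H1 - G1 * H)"
      by (rule homogeneous_cross[OF h 1(4,5)])
    have "emb (G * H1 - G1 * H) / emb (form_z ^ d * H1) = c' - d' * u"
      unfolding c'_def d'_def 1(1) using nz 1(3) by (simp add: rhomD[OF rhom_emb] field_simps)
    also have "\<dots> = ev f0 * v" using uv(3) by simp
    finally have "emb (G * H1 - G1 * H) / emb (form_z ^ d * H1) \<in> T.fO" using T.fO_I[OF uv(2)] by simp
    moreover have "form_z ^ d * H1 \<notin> q" using Q.q_prime zq 1(2) by blast
    ultimately have "F dvd G * H1 - G1 * H" using T.quot_in_fO[OF _ h2 homogeneous_mult[OF zh 1(5)]] by simp
    then show "\<exists>e G1 H1. homogeneous e G1 \<and> homogeneous e H1 \<and> H1 \<notin> q \<and> F dvd G * H1 - G1 * H" using 1 by blast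
  qed
  then obtain y a where y: "dehomogenize G = dehomogenize H * y + f0 * a" by blast
  have nf: "\<not> f0 dvd dehomogenize G" "\<not> f0 dvd dehomogenize H" using dvd_dehomogenize h nd by blast+
  then have "\<not> f0 dvd y" using y by auto
  moreover have "ev (dehomogenize H) \<noteq> 0" using nf(2) ev_eq_0[of "dehomogenize H"] by auto
  then have "emb G / emb H = ev y + ev f0 * ev a / ev (dehomogenize H)"
    unfolding ev_quot2[OF h] y by (simp add: evD field_simps)
  ultimately show ?thesis using nf(2) rG N unfolding r_def by auto
qed

text \<open>Off the flex \<open>ev f0\<close> is the local equation up to a unit and
  \<open>ev y\<close> is regular, so a power of \<open>f\<close> brings the product into the local
  ring. This feeds the construction of elements of the Krichever subspace.\<close>

lemma curve_multiples_regular: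
  assumes q: "closed_point q" "F \<in> q" "q \<noteq> point_100" "local_equation F q f"
  shows "good_point F m q f" "funfield_to_K q f (ev f0 powi l * ev y) \<in> B_to_K q f ` carrier (B_ring q f)"
proof -
  interpret T: transversal_point F m q f by (rule transversal_point_off(1)[OF q])
  interpret Af: affine_point F m c L q f by (rule transversal_point_off(2)[OF q])
  show gp: "good_point F m q f" by (rule T.good)
  interpret GP: good_point F m q f by (rule gp)
  interpret A: local_subring ratfun_const "stalk q" "stalk_ideal q q" by (rule T.local_subring_stalk)
  interpret KK: cring "K_ring q f" by (rule T.K_cring)
  obtain w where w: "w \<in> stalk q" "inverse w \<in> stalk q" "w \<noteq> 0" "ev f0 = f * w" by (rule Af.ev_f0_unit)
  define n where "n = nat (- l)"
  have wl: "w powi l \<in> stalk q" using w A.O_power by (cases "l \<ge> 0") (auto simp: power_int_def)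
  define r where "r = ev f0 powi l * ev y"
  have lf: "f ^ n * f powi l = f ^ nat l"
    using T.f_nz by (cases "l \<ge> 0") (auto simp: n_def power_int_def power_inverse)
  have "f ^ n * r = f ^ nat l * w powi l * ev y"
    unfolding r_def w(4) lf[symmetric] by (simp add: power_int_mult_distrib mult.assoc)
  then have fr: "f ^ n * r \<in> stalk q" using A.O_mult[OF A.O_mult[OF A.O_power[OF T.f_O] wl] Af.ev_stalk] by simp
  have rf: "r \<in> function_field"
  proof -
    have "ev f0 powi l \<in> function_field"
      using ev_funfield funfield_closed(5) funfield_inverse by (cases "l \<ge> 0") (auto simp: power_int_def)
    then show ?thesis unfolding r_def using ev_funfield funfield_closed(3) by blast
  qed
  have ff: "f ^ n \<in> function_field" using T.stalk_funfield A.O_power T.f_O by blast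
  have "T.\<iota> f [^]\<^bsub>K_ring q f\<^esub> n \<otimes>\<^bsub>K_ring q f\<^esub> GP.\<phi> r = T.\<iota> (f ^ n * r)"
    using GP.phi_mult[OF ff rf] GP.phi_stalk[OF A.O_power[OF T.f_O]] GP.phi_stalk[OF fr]
    by (simp add: T.iota_pow[OF T.f_O])
  then have "GP.\<phi> r \<in> B_to_K q f ` carrier (B_ring q f)"
    unfolding T.B_image_iff T.iota_eq[of "f ^ n * r"] using GP.phi_carr[OF rf] T.hat_carr[OF fr] by blast
  then show "funfield_to_K q f (ev f0 powi l * ev y) \<in> B_to_K q f ` carrier (B_ring q f)" by (simp add: r_def)
qed

end

section \<open>The point \<open>(1:0:0)\<close>\<close>

context
begin

interpretation p100: plane_point point_100 by (rule plane_point_100)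
interpretation p100: local_subring ratfun_const "stalk point_100" "stalk_ideal point_100 point_100"
  by (rule p100.local_subring_stalk)

abbreviation "param_s \<equiv> emb form_z / emb form_x"

lemma param_t_eq: "param_t = emb form_y / emb form_x" by (simp add: param_t_def Fract_emb)

lemma x_off: "(form_x :: 'k::field form) ^ n \<notin> point_100"
  using rhomD(7)[OF rhom_lead_x, of "form_x :: 'k form" n] by (simp add: point_100_eq lead_x_gens)

lemma y_on: "form_y \<in> point_100" and z_on: "form_z \<in> point_100" by (simp_all add: point_100_eq lead_x_gens)

lemma x_pow_stalk: "homogeneous d G \<Longrightarrow> emb G / emb (form_x ^ d) \<in> stalk point_100"
  by (rule p100.stalkI[OF x_off _ homogeneous_power1[OF homogeneous_vars(1)]])

lemma t_max: "param_t \<in> stalk_ideal point_100 point_100"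
  unfolding param_t_eq by (rule iffD2[OF p100.max_iff[OF x_off[of 1, unfolded power_one_right] homogeneous_vars(2,1)] y_on])

lemma s_max: "param_s \<in> stalk_ideal point_100 point_100"
  by (rule iffD2[OF p100.max_iff[OF x_off[of 1, unfolded power_one_right] homogeneous_vars(3,1)] z_on])

lemma t_stalk: "param_t \<in> stalk point_100"
  by (rule subsetD[OF p100.m_sub t_max])

lemma s_stalk: "param_s \<in> stalk point_100"
  by (rule subsetD[OF p100.m_sub s_max])

lemma form_at_100:
  assumes "homogeneous d G" "G \<in> point_100"
  shows "\<exists>A B. homogeneous (d - 1) A \<and> homogeneous (d - 1) B \<and> G = form_y * A + form_z * B \<and> (d = 0 \<longrightarrow> A = 0 \<and> B = 0)"
proof -
  obtain a b where G: "G = form_y * a + form_z * b" using lead_x_decomp[of G] assms(2) by (auto simp: point_100_eq)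
  define r where "r x = (if 1 \<le> d then hcomp (d - 1) x else 0)" for x :: "'a form"
  have "G = hcomp d (form_y * a + form_z * b)" using hcomp_of_homogeneous[OF assms(1), of d] G by simp
  also have "\<dots> = form_y * r a + form_z * r b"
    unfolding hcomp_add hcomp_mult_homogeneous[OF homogeneous_vars(2)] hcomp_mult_homogeneous[OF homogeneous_vars(3)] r_def by simp
  finally show ?thesis by (intro exI[of _ "r a"] exI[of _ "r b"]) (auto simp: r_def)
qed

text \<open>Expansion in \<open>form_y\<close> modulo \<open>form_z\<close>: as long as the cofactor
  vanishes at (1:0:0) another \<open>form_y\<close> can be split off, and the degree bounds the
  number of rounds.\<close>

lemma form_mod_z:
  assumes "homogeneous d G"
  shows "\<exists>k E V. homogeneous (d - k) E \<and> homogeneous (d - 1) V \<and> k \<le> d \<and> G = form_y ^ k * E + form_z * V \<and>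
    (E = 0 \<or> E \<notin> point_100) \<and> (d = 0 \<longrightarrow> V = 0)"
  using assms
proof (induction d arbitrary: G)
  case 0
  then show ?case using form_at_100[OF 0] by (intro exI[of _ 0] exI[of _ G] exI) auto
next
  case (Suc d)
  show ?case
  proof (cases "G \<in> point_100")
    case False
    then show ?thesis using Suc.prems by (intro exI[of _ 0] exI[of _ G] exI) auto
  next
    case True
    then obtain A B where AB: "homogeneous d A" "homogeneous d B" "G = form_y * A + form_z * B"
      using form_at_100[OF Suc.prems] by auto
    obtain k E V where k: "homogeneous (d - k) E" "homogeneous (d - 1) V" "k \<le> d" "A = form_y ^ k * E + form_z * V"
      "E = 0 \<or> E \<notin> point_100" "d = 0 \<longrightarrow> V = 0" using Suc.IH[OF AB(1)] by blast
    have "homogeneous d (form_y * V)"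
      using homogeneous_mult[OF homogeneous_vars(2) k(2)] k(6) by (cases d) auto
    then have "homogeneous d (form_y * V + B)" by (rule homogeneous_add[OF _ AB(2)])
    moreover have "G = form_y ^ Suc k * E + form_z * (form_y * V + B)" unfolding AB(3) k(4) by (simp add: algebra_simps)
    ultimately show ?thesis using k by (intro exI[of _ "Suc k"] exI[of _ E] exI[of _ "form_y * V + B"]) simp
  qed
qed

lemma emb_nz: "emb form_x \<noteq> 0" "emb form_x ^ n \<noteq> 0" by simp_all

lemma quot_mod_z:
  assumes "G = form_y ^ k * E + form_z * V" "k \<le> d" "d = 0 \<longrightarrow> V = 0" "H \<noteq> 0"
  shows "emb G / emb H = param_t ^ k * (emb (form_x ^ k * E) / emb H) + param_s * (emb (form_x * V) / emb H)"
  using emb_nz assms(4) unfolding assms(1) param_t_eq by (simp add: rhomD[OF rhom_emb] field_simps)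

text \<open>Modulo \<open>param_s\<close> the local ring is that of the line \<open>z = 0\<close> at
  the point, a discrete valuation ring with uniformizer \<open>param_t\<close>.\<close>

lemma stalk_mod_s:
  assumes "w \<in> stalk point_100"
  shows "\<exists>k e v. e \<in> stalk point_100 \<and> v \<in> stalk point_100 \<and> w = param_t ^ k * e + param_s * v \<and>
    (e = 0 \<or> (inverse e \<in> stalk point_100 \<and> e \<noteq> 0))"
proof -
  obtain d G H where w: "w = emb G / emb H" "H \<notin> point_100" "H \<noteq> 0" "homogeneous d G" "homogeneous d H" using assms by (rule p100.stalkE)
  obtain k E V where k: "homogeneous (d - k) E" "homogeneous (d - 1) V" "k \<le> d" "G = form_y ^ k * E + form_z * V"
      "E = 0 \<or> E \<notin> point_100" "d = 0 \<longrightarrow> V = 0" using form_mod_z[OF w(4)] by blast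
  have hE: "homogeneous d (form_x ^ k * E)"
    using homogeneous_mult[OF homogeneous_power1[OF homogeneous_vars(1)] k(1), of k] k(3) by simp
  have hV: "homogeneous d (form_x * V)"
    using homogeneous_mult[OF homogeneous_vars(1) k(2)] k(6) by (cases d) auto
  have E: "emb (form_x ^ k * E) / emb H \<in> stalk point_100" by (rule p100.stalkI[OF w(2) hE w(5)])
  moreover have "emb (form_x * V) / emb H \<in> stalk point_100" by (rule p100.stalkI[OF w(2) hV w(5)])
  moreover have "emb (form_x ^ k * E) / emb H = 0 \<or>
      inverse (emb (form_x ^ k * E) / emb H) \<in> stalk point_100 \<and> emb (form_x ^ k * E) / emb H \<noteq> 0"
  proof (cases "E = 0")
    case True
    then show ?thesis by (simp add: rhomD(4)[OF rhom_emb])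
  next
    case False
    then have "form_x ^ k * E \<notin> point_100" using p100.q_prime x_off k(5) by blast
    then show ?thesis using p100.stalk_unitI[OF w(2) _ hE w(5)] w(3) False by simp
  qed
  ultimately show ?thesis unfolding w(1) using quot_mod_z[OF k(4,3,6) w(3)] by blast
qed

text \<open>An ideal containing \<open>param_s\<close> is governed by the least power of
  \<open>param_t\<close> in it. Along a strictly increasing chain this exponent drops strictly,
  starting from at most \<open>k\<close>.\<close>

lemma colength_le:
  assumes J: "ideal J (stalk_ring point_100)" and s: "param_s \<in> J" and t: "param_t ^ k \<in> J"
  shows "colength (stalk_ring point_100) J \<le> enat k"
  unfolding colength_def
proof (rule Sup_least)
  fix x assume "x \<in> {enat n |n. \<exists>K. K 0 = J \<and> K n = carrier (stalk_ring point_100) \<and>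
     (\<forall>i\<le>n. ideal (K i) (stalk_ring point_100)) \<and> (\<forall>i<n. K i \<subset> K (Suc i))}"
  then obtain n K where n: "x = enat n" and K: "K 0 = J" "\<And>i. i \<le> n \<Longrightarrow> ideal (K i) (stalk_ring point_100)"
    "\<And>i. i < n \<Longrightarrow> K i \<subset> K (Suc i)" by blast
  have JK: "J \<subseteq> K i" if "i \<le> n" for i using that
  proof (induction i)
    case (Suc i)
    then show ?case using K(3)[of i] by auto
  qed (simp add: K(1))
  have mult: "a * b \<in> K i" if "i \<le> n" "a \<in> K i" "b \<in> stalk point_100" for i a b
    using ideal.I_r_closed[OF K(2)[OF that(1)] that(2), of b] that(3) by (simp add: stalk_ring_def)
  have add: "a + b \<in> K i" if "i \<le> n" "a \<in> K i" "b \<in> K i" for i a b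
    using additive_subgroup.a_closed[OF ideal.axioms(1)[OF K(2)[OF that(1)]] that(2,3)] by (simp add: stalk_ring_def)
  have sub: "K i \<subseteq> stalk point_100" if "i \<le> n" for i
    using additive_subgroup.a_subset[OF ideal.axioms(1)[OF K(2)[OF that]]] by (simp add: stalk_ring_def)
  define \<nu> where "\<nu> i = (LEAST l. param_t ^ l \<in> K i)" for i
  have ex: "\<exists>l. param_t ^ l \<in> K i" if "i \<le> n" for i using t JK[OF that] by blast
  have \<nu>: "param_t ^ \<nu> i \<in> K i" "\<And>l. param_t ^ l \<in> K i \<Longrightarrow> \<nu> i \<le> l" if "i \<le> n" for i
    unfolding \<nu>_def using LeastI_ex[OF ex[OF that]] Least_le by auto
  \<comment> \<open>Modulo \<open>param_s\<close>, an element of \<open>K (Suc i)\<close> outside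
    \<open>K i\<close> is \<open>param_t ^ l\<close> times zero or a unit. Without a drop of the
    exponent it would already lie in \<open>K i\<close>.\<close>
  have step: "\<nu> (Suc i) < \<nu> i" if i: "i < n" for i
  proof (rule ccontr)
    assume "\<not> \<nu> (Suc i) < \<nu> i"
    then have le: "\<nu> i \<le> \<nu> (Suc i)" by simp
    obtain w where w: "w \<in> K (Suc i)" "w \<notin> K i" using K(3)[OF i] by blast
    have "w \<in> stalk point_100" using w(1) sub[of "Suc i"] i by auto
    then obtain l e v where v: "e \<in> stalk point_100" "v \<in> stalk point_100" "w = param_t ^ l * e + param_s * v"
      "e = 0 \<or> (inverse e \<in> stalk point_100 \<and> e \<noteq> 0)" using stalk_mod_s by blast
    have sK: "param_s * v \<in> K j" if "j \<le> n" for j using mult[OF that _ v(2)] s JK[OF that] by blast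
    have tK: "param_t ^ l * e \<in> K i"
    proof (cases "e = 0")
      case True
      then show ?thesis using mult[OF _ _ p100.O_zero, of i "param_s"] s JK[of i] i by auto
    next
      case False
      have "w + param_s * v * (- 1) \<in> K (Suc i)"
        using add[OF _ w(1) mult[OF _ sK p100.O_uminus[OF p100.O_one]]] i by simp
      then have "(w + param_s * v * (- 1)) * inverse e \<in> K (Suc i)" using mult v(4) False i by simp
      then have "param_t ^ l \<in> K (Suc i)" using False by (simp add: v(3) mult.assoc)
      then have "\<nu> i \<le> l" using \<nu>(2)[of "Suc i" l] le i by linarith
      then have tl: "param_t ^ l = param_t ^ \<nu> i * param_t ^ (l - \<nu> i)" by (simp flip: power_add)
      have "param_t ^ l \<in> K i" by (subst tl) (rule mult[OF _ \<nu>(1) p100.O_power[OF t_stalk]], use i in simp_all)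
      then show ?thesis using mult v(1) i by simp
    qed
    then have "w \<in> K i" unfolding v(3) using add[OF _ tK sK] i by simp
    then show False using w(2) by simp
  qed
  have "i + \<nu> i \<le> \<nu> 0" if "i \<le> n" for i
    using that
  proof (induction i)
    case (Suc i)
    then show ?case using step[of i] by simp
  qed simp
  from this[of n] have "n \<le> \<nu> 0" by simp
  also have "\<dots> \<le> k" by (rule \<nu>(2)) (use t K(1) in auto)
  finally show "x \<le> enat k" by (simp add: n)
qed

lemma intersection_ideal:
  fixes F :: "'k::field form"
  assumes "F \<in> point_100" "homogeneous m F"
  defines "J \<equiv> stalk_ideal point_100 (curve_ideal form_z) <+>\<^bsub>stalk_ring point_100\<^esub> stalk_ideal point_100 (curve_ideal F)"
  shows "ideal J (stalk_ring point_100)" "param_s \<in> J" "emb F / emb (form_x ^ m) \<in> J"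
proof -
  interpret R: cring "stalk_ring point_100" using p100.Rg_cring by (simp add: stalk_ring_def)
  have id: "ideal (stalk_ideal point_100 (curve_ideal G)) (stalk_ring point_100)" for G :: "'k form"
  proof (rule idealI[OF R.ring_axioms])
    have z: "0 \<in> stalk_ideal point_100 (curve_ideal G)"
      using p100.stI[of 0 "curve_ideal G" 1 0] p100.q_one by (simp add: curve_ideal_def rhomD[OF rhom_emb])
    have add: "a + b \<in> stalk_ideal point_100 (curve_ideal G)" if "a \<in> stalk_ideal point_100 (curve_ideal G)" "b \<in> stalk_ideal point_100 (curve_ideal G)" for a b
      by (rule p100.stalk_ideal_add[OF _ _ that]) (auto simp: curve_ideal_def)
    have mult: "a * b \<in> stalk_ideal point_100 (curve_ideal G)" if "a \<in> stalk_ideal point_100 (curve_ideal G)" "b \<in> stalk point_100" for a b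
      by (rule p100.stalk_ideal_mult[OF _ that]) (auto simp: curve_ideal_def)
    show "subgroup (stalk_ideal point_100 (curve_ideal G)) (add_monoid (stalk_ring point_100))"
    proof (rule R.add.subgroupI)
      show "stalk_ideal point_100 (curve_ideal G) \<subseteq> carrier (stalk_ring point_100)" using p100.stalk_sub by (simp add: stalk_ring_def)
      show "stalk_ideal point_100 (curve_ideal G) \<noteq> {}" using z by blast
      fix a b assume a: "a \<in> stalk_ideal point_100 (curve_ideal G)"
      have "- a \<in> stalk_ideal point_100 (curve_ideal G)" using mult[OF a p100.O_uminus[OF p100.O_one]] by simp
      moreover have "a \<in> stalk point_100" using a p100.stalk_sub by blast
      ultimately show "\<ominus>\<^bsub>stalk_ring point_100\<^esub> a \<in> stalk_ideal point_100 (curve_ideal G)"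
        using p100.Rg_uminus[of a] by (simp add: stalk_ring_def)
      assume "b \<in> stalk_ideal point_100 (curve_ideal G)"
      then show "a \<oplus>\<^bsub>stalk_ring point_100\<^esub> b \<in> stalk_ideal point_100 (curve_ideal G)" using add[OF a] by (simp add: stalk_ring_def)
    qed
    fix a x :: "'k ratfun" assume "a \<in> stalk_ideal point_100 (curve_ideal G)" "x \<in> carrier (stalk_ring point_100)"
    then show "x \<otimes>\<^bsub>stalk_ring point_100\<^esub> a \<in> stalk_ideal point_100 (curve_ideal G)"
      "a \<otimes>\<^bsub>stalk_ring point_100\<^esub> x \<in> stalk_ideal point_100 (curve_ideal G)"
      using mult[of a x] by (simp_all add: stalk_ring_def mult.commute)
  qed
  show "ideal J (stalk_ring point_100)" unfolding J_def by (rule R.add_ideals[OF id id])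
  have z: "0 \<in> stalk_ideal point_100 (curve_ideal G)" for G :: "'k form"
    using p100.stI[of 0 "curve_ideal G" 1 0] p100.q_one by (simp add: curve_ideal_def rhomD[OF rhom_emb])
  have J: "a + b \<in> J" if "a \<in> stalk_ideal point_100 (curve_ideal form_z)" "b \<in> stalk_ideal point_100 (curve_ideal F)" for a b
    using that by (auto simp: J_def set_add_def' stalk_ring_def)
  have "param_s \<in> stalk_ideal point_100 (curve_ideal form_z)"
    using p100.stI[of form_z "curve_ideal form_z" form_x 1] x_off[of 1] by (simp add: curve_ideal_def)
  from J[OF this z] show "param_s \<in> J" by simp
  have "emb F / emb (form_x ^ m) \<in> stalk_ideal point_100 (curve_ideal F)"
    by (rule p100.stI[OF _ x_off assms(2) homogeneous_power1[OF homogeneous_vars(1)]]) (simp add: curve_ideal_def)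
  from J[OF z this] show "emb F / emb (form_x ^ m) \<in> J" by simp
qed

text \<open>With \<open>F = y ^ k * E + z * V\<close>, the intersection ideal contains
  \<open>param_t ^ k\<close>, so its colength is at most \<open>k\<close>; contact of order
  \<open>m\<close> gives \<open>k = m\<close> and leaves a constant \<open>E\<close>. The tangent
  line yields \<open>V\<close> nonzero at the point, because there the \<open>z\<close>-derivative
  of \<open>F\<close> equals \<open>V\<close>.\<close>

lemma hyperflexI:
  fixes F :: "'k::field form"
  assumes m: "2 \<le> m" and F: "homogeneous m F" "prime_elem F"
    and tangent: "\<exists>e. e \<noteq> 0 \<and> tangent_form F 1 0 0 = form_const e * form_z"
    and contact: "intersection_mult form_z F point_100 = enat m"
    and F_on: "form_eval F 1 0 0 = 0"
  shows "\<exists>c L. hyperflex F m c L"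
proof -
  have pc: "plane_curve F m" by unfold_locales (use m F in auto)
  interpret C: plane_curve F m by (rule pc)
  have eval: "form_eval G 1 0 0 = poly (lead_x G) 1" for G :: "'k form"
    by (simp add: form_eval_def lead_x_def poly_0_coeff_0)
  have Fp: "F \<in> point_100"
    using F_on lead_x_homogeneous[OF F(1)] by (simp add: eval point_100_eq poly_monom)
  obtain k E V where k: "homogeneous (m - k) E" "homogeneous (m - 1) V" "k \<le> m" "F = form_y ^ k * E + form_z * V"
      "E = 0 \<or> E \<notin> point_100" using form_mod_z[OF F(1)] by blast
  \<comment> \<open>Otherwise \<open>F\<close> is the product of \<open>form_z\<close> and
    \<open>V\<close>, and the prime \<open>F\<close> would divide a factor of degree smaller than
    \<open>m\<close>.\<close>
  have E: "E \<noteq> 0"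
  proof
    assume "E = 0"
    then have FV: "F = form_z * V" using k(4) by simp
    then have V: "V \<noteq> 0" using C.F_nz by auto
    have "F dvd form_z \<or> F dvd V" using C.F_dvd_mult[of form_z V] FV by simp
    then show False
    proof
      assume "F dvd form_z"
      then obtain G where G: "form_z = F * G" by (elim dvdE)
      have "homogeneous (Suc 0) (F * G)" unfolding G[symmetric] by (rule homogeneous_vars(3))
      then show False using homogeneous_cancel(1)[OF F(1) C.F_nz, of "Suc 0" G] G m by (cases "G = 0") auto
    next
      assume "F dvd V"
      then obtain G where G: "V = F * G" by (elim dvdE)
      then show False using homogeneous_cancel(1)[OF F(1) C.F_nz, of "m - 1" G] k(2) V m by (cases "G = 0") auto
    qed
  qed
  then have Ep: "E \<notin> point_100" using k(5) by blast
  define J where "J = stalk_ideal point_100 (curve_ideal form_z) <+>\<^bsub>stalk_ring point_100\<^esub> stalk_ideal point_100 (curve_ideal F)"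
  note Ji = intersection_ideal[OF Fp F(1), folded J_def]
  define e v where "e = emb (form_x ^ k * E) / emb (form_x ^ m)" and "v = emb (form_x * V) / emb (form_x ^ m)"
  have hE: "homogeneous m (form_x ^ k * E)"
    using homogeneous_mult[OF homogeneous_power1[OF homogeneous_vars(1)] k(1), of k] k(3) by simp
  have hV: "homogeneous m (form_x * V)" using homogeneous_mult[OF homogeneous_vars(1) k(2)] m by simp
  have "form_x ^ k * E \<notin> point_100" using p100.q_prime x_off Ep by blast
  then have e: "inverse e \<in> stalk point_100" "e \<noteq> 0" "v \<in> stalk point_100"
    unfolding e_def v_def using p100.stalk_unitI[OF x_off _ hE homogeneous_power1[OF homogeneous_vars(1)]] E x_pow_stalk[OF hV] by auto
  have Feq: "emb F / emb (form_x ^ m) = param_t ^ k * e + param_s * v"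
    unfolding e_def v_def by (rule quot_mod_z[OF k(4,3)]) (use m in auto)
  have tk: "param_t ^ k = (emb F / emb (form_x ^ m)) * inverse e + param_s * (- v * inverse e)"
    unfolding Feq using e(2) by (simp add: distrib_right mult.assoc)
  have mult: "a * b \<in> J" if "a \<in> J" "b \<in> stalk point_100" for a b
    using ideal.I_r_closed[OF Ji(1) that(1), of b] that(2) by (simp add: stalk_ring_def)
  have add: "a + b \<in> J" if "a \<in> J" "b \<in> J" for a b
    using additive_subgroup.a_closed[OF ideal.axioms(1)[OF Ji(1)] that] by (simp add: stalk_ring_def)
  have "param_t ^ k \<in> J"
    unfolding tk by (intro add mult Ji p100.O_mult p100.O_uminus e)
  then have "colength (stalk_ring point_100) J \<le> enat k" by (rule colength_le[OF Ji(1,2)])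
  then have "k = m" using contact k(3) by (simp add: intersection_mult_def J_def)
  then have "homogeneous 0 E" using k(1) by simp
  then have "\<exists>c. E = form_const c"
    by (intro exI[of _ "gc E 0 0 0"] form_eqI) (auto simp: homogeneous_gc gc_def form_const_def coeff_pCons split: nat.split)
  then obtain c where c: "E = form_const c" by blast
  have c0: "c \<noteq> 0" using E c rhomD(4)[OF rhom_form_const] by auto
  have Fc: "F = form_const c * form_y ^ m + form_z * V" using k(4) \<open>k = m\<close> c by (simp add: mult.commute)
  have "form_const c * form_y ^ m = [:[:[:c:]:] * [:0, 1:] ^ m:]"
    by (simp add: form_const_def form_y_def poly_const_pow)
  then have "pderiv F = form_z * pderiv V + V"
    unfolding Fc by (simp add: pderiv_add pderiv_mult pderiv_pCons form_z_def)
  then have "lead_x (pderiv F) = lead_x V" by (simp add: rhomD[OF rhom_lead_x] lead_x_gens)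
  moreover have "form_eval (pderiv F) 1 0 0 \<noteq> 0"
  proof -
    obtain e where e: "e \<noteq> 0" "tangent_form F 1 0 0 = form_const e * form_z" using tangent by blast
    have "gc (tangent_form F 1 0 0) 0 0 1 = form_eval (pderiv F) 1 0 0"
      by (simp add: tangent_form_def gc_def form_const_def form_x_def form_y_def form_z_def)
    moreover have "gc (form_const e * form_z) 0 0 1 = e" by (simp add: gc_def form_const_def form_z_def)
    ultimately show ?thesis using e by simp
  qed
  ultimately have "lead_x V \<noteq> 0" by (auto simp: eval)
  then have "V \<notin> point_100" by (simp add: point_100_eq)
  then show ?thesis using hyperflex.intro[OF pc] hyperflex_axioms.intro[OF m c0 Fc k(2)] by blast
qed

end

section \<open>Lowest monomials\<close>

lemma fls_sum_distinct_subdegrees: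
  assumes "finite I" "I \<noteq> {}" "\<And>i. i \<in> I \<Longrightarrow> g i \<noteq> 0" "inj_on (\<lambda>i. fls_subdegree (g i)) I"
  shows "sum g I \<noteq> (0 :: 'a::ab_group_add fls) \<and> fls_subdegree (sum g I) \<in> (\<lambda>i. fls_subdegree (g i)) ` I"
  using assms
proof (induction I rule: finite_ne_induct)
  case (insert x I)
  have IH: "sum g I \<noteq> 0" "fls_subdegree (sum g I) \<in> (\<lambda>i. fls_subdegree (g i)) ` I"
    using insert.IH insert.prems by (auto simp: inj_on_def)
  have x: "g x \<noteq> 0" using insert.prems by simp
  have ne: "fls_subdegree (g x) \<noteq> fls_subdegree (sum g I)" using IH(2) insert.prems(2) insert.hyps(3) by (auto simp: inj_on_def)
  have s: "sum g (insert x I) = g x + sum g I" using insert.hyps by simp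
  have nz: "g x + sum g I \<noteq> 0"
  proof
    assume "g x + sum g I = 0"
    then have "g x = - sum g I" by (simp add: eq_neg_iff_add_eq_0)
    then show False using ne by simp
  qed
  have "fls_subdegree (g x + sum g I) = fls_subdegree (g x) \<or> fls_subdegree (g x + sum g I) = fls_subdegree (sum g I)"
    using ne fls_subdegree_add_eq1[OF x, of "sum g I"] fls_subdegree_add_eq2[OF IH(1), of "g x"] by linarith
  then show ?case using IH(2) nz unfolding s by auto
qed simp

lemma fls_times_nth_0:
  fixes f g :: "'a::{comm_monoid_add,mult_zero} fls"
  assumes "0 \<le> fls_subdegree f" "0 \<le> fls_subdegree g"
  shows "(f * g) $$ 0 = f $$ 0 * g $$ 0"
  using arg_cong[OF fls_times_conv_regpart[OF assms], of "\<lambda>h. fps_nth h 0"] by (simp add: fps_mult_nth)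

text \<open>The rank two valuation as a relation, with \<open>N\<close> the exponent of
  \<open>u\<close> and \<open>i\<close> that of \<open>t\<close>. It includes that \<open>h\<close>
  is nonzero and is additive under products.\<close>

definition leading :: "'k::field fls fls \<Rightarrow> int \<Rightarrow> int \<Rightarrow> bool" where
  "leading h N i \<longleftrightarrow> h \<noteq> 0 \<and> fls_subdegree h = N \<and> fls_subdegree (h $$ N) = i"

lemma leading_unique: "leading h N i \<Longrightarrow> leading h N' i' \<Longrightarrow> N = N' \<and> i = i'" by (auto simp: leading_def)

lemma ex_leading: "h \<noteq> 0 \<Longrightarrow> \<exists>N i. leading h N i" by (simp add: leading_def)

lemma leading_mult:
  assumes "leading h N i" "leading h' N' i'"
  shows "leading (h * h') (N + N') (i + i')"
proof -
  have "h $$ N \<noteq> 0" "h' $$ N' \<noteq> 0" using assms by (auto simp: leading_def)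
  then show ?thesis using assms fls_times_base[of h h'] by (auto simp: leading_def)
qed

lemma leading_1: "leading 1 0 0" by (simp add: leading_def)

lemma leading_power: "leading h N i \<Longrightarrow> leading (h ^ n) (int n * N) (int n * i)"
proof (induction n)
  case (Suc n)
  then show ?case using leading_mult[of h N i "h ^ n" "int n * N" "int n * i"] by (simp add: algebra_simps)
qed (simp add: leading_1)

lemma leading_inverse:
  assumes h: "leading h N i"
  shows "leading (inverse h) (- N) (- i)"
proof -
  have h0: "h \<noteq> 0" using h by (simp add: leading_def)
  obtain N' i' where h': "leading (inverse h) N' i'" using ex_leading[of "inverse h"] h0 by auto
  have "leading (h * inverse h) (N + N') (i + i')" by (rule leading_mult[OF h h'])
  then have "N + N' = 0 \<and> i + i' = 0" using leading_unique[OF _ leading_1] h0 by simp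
  then have "N' = - N" "i' = - i" by simp_all
  then show ?thesis using h' by simp
qed

lemma leading_powi: "leading h N i \<Longrightarrow> leading (h powi l) (l * N) (l * i)"
  using leading_power[of h N i "nat l"] leading_inverse[OF leading_power[of h N i "nat (- l)"]]
  by (cases "l \<ge> 0") (simp_all add: power_int_def power_inverse)

text \<open>Coefficients above \<open>u ^ N\<close> have no influence; this is why approximating a
  limit is enough.\<close>

lemma leading_perturb:
  assumes h: "leading h N i" and e: "\<And>j. j \<le> N \<Longrightarrow> h' $$ j = h $$ j"
  shows "leading h' N i"
proof -
  have hN: "h $$ N \<noteq> 0" using h by (auto simp: leading_def)
  have "fls_subdegree h' = N" by (rule fls_subdegree_eqI) (use h hN e in \<open>auto simp: leading_def\<close>)
  then show ?thesis using h hN e by (auto simp: leading_def)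
qed

lemma leading_0_iff: "leading h 0 i \<longleftrightarrow> 0 \<le> fls_subdegree h \<and> h $$ 0 \<noteq> 0 \<and> fls_subdegree (h $$ 0) = i"
  using fls_subdegree_eqI[of h 0] nth_fls_subdegree_nonzero[of h] by (auto simp: leading_def simp del: nth_fls_subdegree_nonzero)

lemma leading_inverse_nth_0:
  assumes h: "leading h 0 i"
  shows "inverse h $$ 0 = inverse (h $$ 0)"
proof -
  have h': "leading (inverse h) 0 (- i)" using leading_inverse[OF h] by simp
  have "h $$ 0 * inverse h $$ 0 = (h * inverse h) $$ 0"
    by (rule fls_times_nth_0[symmetric]) (use h h' in \<open>auto simp: leading_0_iff\<close>)
  also have "\<dots> = 1" using h by (simp add: leading_def)
  finally show ?thesis by (simp add: inverse_unique)
qed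

lemma leading_monomial: "leading (monomial i j) j i"
proof -
  have "leading (fls_const (fls_X_intpow i)) 0 i" "leading (fls_X_intpow j) j 0"
    by (auto simp: leading_def)
  from leading_mult[OF this] show ?thesis by (simp add: monomial_def)
qed

lemma lowest_monomial_leading: "leading h N i \<Longrightarrow> lowest_monomial h = monomial i N"
  by (auto simp: leading_def lowest_monomial_def)

lemma monomial_eq_iff: "monomial i j = monomial i' j' \<longleftrightarrow> i = i' \<and> j = j'"
  using leading_unique[OF leading_monomial] leading_monomial by metis

section \<open>Expansions at the point \<open>(1:0:0)\<close>\<close>

locale flex_point = hyperflex F m c L for F :: "'k::field form" and m c L +
  fixes \<theta> :: "'k localfield \<Rightarrow> 'k fls fls"
  assumes ident: "identifies_by_parameters point_100 param_t (param_u m F) \<theta>"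
begin

interpretation p100: plane_point "point_100 :: 'k form set" by (rule plane_point_100)
interpretation p100: local_subring ratfun_const "stalk point_100 :: 'k ratfun set" "stalk_ideal point_100 point_100"
  by (rule p100.local_subring_stalk)

abbreviation "u \<equiv> param_u m F"
abbreviation "K \<equiv> K_ring point_100 u"

lemma u_eq: "u = emb F / emb (form_x ^ m)"
proof -
  have "u = (emb form_z / emb form_x) ^ m * ev f0"
    by (simp add: param_u_def affine_eval_def ev_def ev2_def f0_def Fract_emb)
  also have "\<dots> = emb F / emb (form_x ^ m)"
    unfolding f0_def ev_quot[OF homF, symmetric] by (simp add: rhomD[OF rhom_emb] power_divide)
  finally show ?thesis .
qed

lemma curve_point_100: "curve_point F m point_100 u"
  by (intro curve_point.intro curve_point_axioms.intro plane_curve_axioms plane_point_100 F_100)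
     (unfold u_eq, rule local_equation_quot[OF plane_curve_axioms plane_point_100 F_100 homogeneous_vars(1)],
      rule x_off[of 1, unfolded power_one_right])

interpretation cp: curve_point F m point_100 u by (rule curve_point_100)

lemma tower_100: "tower point_100 u" by (intro tower.intro tower_axioms.intro plane_point_100 cp.f_O)

interpretation tw: tower point_100 u by (rule tower_100)
interpretation KK: cring K by (rule tw.K_cring)
interpretation OKr: cring "OK_ring point_100 u" by (rule tw.OK_cring)

lemma theta_hom:
  "x \<in> carrier K \<Longrightarrow> y \<in> carrier K \<Longrightarrow> \<theta> (x \<otimes>\<^bsub>K\<^esub> y) = \<theta> x * \<theta> y"
  "x \<in> carrier K \<Longrightarrow> y \<in> carrier K \<Longrightarrow> \<theta> (x \<oplus>\<^bsub>K\<^esub> y) = \<theta> x + \<theta> y"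
  "\<theta> \<one>\<^bsub>K\<^esub> = 1"
proof -
  have h: "\<theta> \<in> ring_hom K ring_of_type_algebra" using ident by (simp add: identifies_by_parameters_def ring_iso_def)
  show "x \<in> carrier K \<Longrightarrow> y \<in> carrier K \<Longrightarrow> \<theta> (x \<otimes>\<^bsub>K\<^esub> y) = \<theta> x * \<theta> y"
    "x \<in> carrier K \<Longrightarrow> y \<in> carrier K \<Longrightarrow> \<theta> (x \<oplus>\<^bsub>K\<^esub> y) = \<theta> x + \<theta> y" "\<theta> \<one>\<^bsub>K\<^esub> = 1"
    using ring_hom_mult[OF h] ring_hom_add[OF h] ring_hom_one[OF h] by simp_all
qed

lemma theta_zero: "\<theta> \<zero>\<^bsub>K\<^esub> = 0"
  using theta_hom(2)[OF KK.zero_closed KK.zero_closed]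
  by (simp only: KK.l_zero KK.zero_closed add_cancel_right_right)

lemma theta_minus: "x \<in> carrier K \<Longrightarrow> y \<in> carrier K \<Longrightarrow> \<theta> (x \<ominus>\<^bsub>K\<^esub> y) = \<theta> x - \<theta> y"
proof -
  assume c: "x \<in> carrier K" "y \<in> carrier K"
  have "(x \<ominus>\<^bsub>K\<^esub> y) \<oplus>\<^bsub>K\<^esub> y = x" using c by algebra
  then show ?thesis using theta_hom(2)[of "x \<ominus>\<^bsub>K\<^esub> y" y] c by (simp add: eq_diff_eq)
qed

lemma theta_power: "x \<in> carrier K \<Longrightarrow> \<theta> (x [^]\<^bsub>K\<^esub> (n::nat)) = \<theta> x ^ n"
  by (induction n) (simp_all add: theta_hom mult.commute)

lemma theta_inj: "x \<in> carrier K \<Longrightarrow> y \<in> carrier K \<Longrightarrow> \<theta> x = \<theta> y \<Longrightarrow> x = y"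
  using ident by (auto simp: identifies_by_parameters_def ring_iso_def bij_betw_def inj_on_def)

lemma theta_OK: "\<theta> ` tw.j ` carrier (OK_ring point_100 u) = {h. \<forall>j. h $$ j \<noteq> 0 \<longrightarrow> 0 \<le> j}"
  using ident by (simp add: identifies_by_parameters_def)

lemma theta_j: "\<xi> \<in> carrier (OK_ring point_100 u) \<Longrightarrow> 0 \<le> fls_subdegree (\<theta> (tw.j \<xi>))"
proof -
  assume "\<xi> \<in> carrier (OK_ring point_100 u)"
  then have "\<theta> (tw.j \<xi>) \<in> {h. \<forall>j. h $$ j \<noteq> 0 \<longrightarrow> 0 \<le> j}" unfolding theta_OK[symmetric] by blast
  then show ?thesis by (intro fls_subdegree_ge0I) force
qed

definition chi :: "'k ratfun \<Rightarrow> 'k fls fls" where "chi a = \<theta> (tw.\<iota> a)"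

lemma chi_add: "a \<in> stalk point_100 \<Longrightarrow> b \<in> stalk point_100 \<Longrightarrow> chi (a + b) = chi a + chi b"
  by (simp add: chi_def tw.iota_add theta_hom)

lemma chi_mult: "a \<in> stalk point_100 \<Longrightarrow> b \<in> stalk point_100 \<Longrightarrow> chi (a * b) = chi a * chi b"
  by (simp add: chi_def tw.iota_mult theta_hom)

lemma chi_const: "chi (ratfun_const e) = fls_const (fls_const e)" and chi_t: "chi param_t = fls_const fls_X"
  and chi_u: "chi u = fls_X"
  using ident by (simp_all add: chi_def identifies_by_parameters_def)

lemma chi_1: "chi 1 = 1" by (simp add: chi_def tw.iota_one theta_hom)

text \<open>\<open>\<theta>\<close> carries the image of the completed local ring onto the series
  with nonnegative exponents of \<open>t\<close> and \<open>u\<close>.\<close>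

lemma chi_nonneg:
  assumes "a \<in> stalk point_100"
  shows "0 \<le> fls_subdegree (chi a)" "0 \<le> fls_subdegree (chi a $$ 0)"
proof -
  have "chi a \<in> \<theta> ` hat_to_K point_100 u ` carrier (completed_stalk point_100)"
    unfolding chi_def stalk_to_K_def using tw.hat_carr[OF assms] by blast
  then have *: "0 \<le> i \<and> 0 \<le> j" if "chi a $$ j $$ i \<noteq> 0" for i j
    using ident that by (simp add: identifies_by_parameters_def)
  have "chi a $$ j = 0" if "j < 0" for j
    by (rule fls_eqI) (use *[of j] that in force)
  then show "0 \<le> fls_subdegree (chi a)" by (rule fls_subdegree_ge0I)
  show "0 \<le> fls_subdegree (chi a $$ 0)" by (rule fls_subdegree_ge0I) (use *[of 0] in force)
qed

text \<open>Setting \<open>u = 0\<close>, that is, restriction to the curve followed by expansion in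
  \<open>t\<close>.\<close>

definition delta :: "'k ratfun \<Rightarrow> 'k fls" where "delta a = chi a $$ 0"

lemma delta_add: "a \<in> stalk point_100 \<Longrightarrow> b \<in> stalk point_100 \<Longrightarrow> delta (a + b) = delta a + delta b"
  by (simp add: delta_def chi_add)

lemma delta_mult: "a \<in> stalk point_100 \<Longrightarrow> b \<in> stalk point_100 \<Longrightarrow> delta (a * b) = delta a * delta b"
  by (simp add: delta_def chi_mult fls_times_nth_0 chi_nonneg)

lemma delta_gens: "delta (ratfun_const e) = fls_const e" "delta param_t = fls_X" "delta u = 0" "delta 1 = 1" "delta 0 = 0"
proof -
  show "delta 0 = 0" using delta_add[OF p100.O_zero p100.O_zero] by (simp only: add_0_left add_cancel_right_right)
qed (simp_all add: delta_def chi_const chi_t chi_u chi_1)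

lemma delta_power: "a \<in> stalk point_100 \<Longrightarrow> delta (a ^ n) = delta a ^ n"
  by (induction n) (simp_all add: delta_gens delta_mult p100.O_power)

lemma delta_sum: "(\<And>i. i \<in> A \<Longrightarrow> g i \<in> stalk point_100) \<Longrightarrow> delta (\<Sum>i\<in>A. g i) = (\<Sum>i\<in>A. delta (g i))"
  by (induction A rule: infinite_finite_induct) (simp_all add: delta_gens delta_add p100.O_sum)

lemma delta_nonneg: "a \<in> stalk point_100 \<Longrightarrow> 0 \<le> fls_subdegree (delta a)"
  by (simp add: delta_def chi_nonneg)

lemma delta_unit:
  assumes a: "a \<in> stalk point_100" "inverse a \<in> stalk point_100" "a \<noteq> 0"
  shows "delta a \<noteq> 0" "fls_subdegree (delta a) = 0" "delta a $$ 0 \<noteq> 0"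
proof -
  have e: "delta a * delta (inverse a) = 1" using delta_mult[OF a(1,2)] a(3) by (simp add: delta_gens)
  then have n: "delta a \<noteq> 0" "delta (inverse a) \<noteq> 0" by auto
  have "fls_subdegree (delta a) + fls_subdegree (delta (inverse a)) = 0"
    using fls_subdegree_mult[OF n] e by simp
  then show s: "fls_subdegree (delta a) = 0" using delta_nonneg[OF a(1)] delta_nonneg[OF a(2)] by linarith
  show "delta a \<noteq> 0" by (rule n)
  show "delta a $$ 0 \<noteq> 0" using nth_fls_subdegree_nonzero[OF n(1)] s by simp
qed

text \<open>The constant term is the value at the rational point. If it were nonzero on the maximal
  ideal, subtracting it would give a unit of the local ring whose expansion has no constant
  term.\<close>

lemma max_delta:
  assumes a: "a \<in> stalk point_100"
  shows "a \<in> stalk_ideal point_100 point_100 \<longleftrightarrow> delta a $$ 0 = 0"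
proof
  assume am: "a \<in> stalk_ideal point_100 point_100"
  define e where "e = delta a $$ 0"
  show "delta a $$ 0 = 0"
  proof (rule ccontr)
    assume "delta a $$ 0 \<noteq> 0"
    then have e: "e \<noteq> 0" by (simp add: e_def)
    define b where "b = a + ratfun_const (- e)"
    have b: "b \<in> stalk point_100" unfolding b_def by (intro p100.O_add a p100.O_h)
    have db: "delta b $$ 0 = 0" unfolding b_def using delta_add[OF a p100.O_h] by (simp add: delta_gens e_def)
    have "b \<notin> stalk_ideal point_100 point_100"
    proof
      assume bm: "b \<in> stalk_ideal point_100 point_100"
      have "b * (- 1) + a \<in> stalk_ideal point_100 point_100"
        by (intro p100.m_add p100.m_mult bm am p100.O_uminus p100.O_one)
      then have "ratfun_const e \<in> stalk_ideal point_100 point_100"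
        by (simp add: b_def rhomD[OF rhom_ratfun_const])
      then have "ratfun_const e * ratfun_const (inverse e) \<in> stalk_ideal point_100 point_100"
        by (rule p100.m_mult[OF _ p100.O_h])
      moreover have "ratfun_const e * ratfun_const (inverse e) = 1"
        using e by (simp flip: rhomD(2,3)[OF rhom_ratfun_const])
      ultimately show False using p100.m_one by simp
    qed
    then have "inverse b \<in> stalk point_100" "b \<noteq> 0" using p100.O_unit[OF b] p100.m_zero by auto
    then show False using delta_unit(3)[OF b] db by simp
  qed
next
  assume z: "delta a $$ 0 = 0"
  show "a \<in> stalk_ideal point_100 point_100"
  proof (rule ccontr)
    assume n: "a \<notin> stalk_ideal point_100 point_100"
    then have "a \<noteq> 0" using p100.m_zero by blast
    then show False using delta_unit(3)[OF a p100.O_unit[OF a n]] z by simp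
  qed
qed

section \<open>The function \<open>z/x\<close> along the curve\<close>

definition S0 :: "'k fls" where "S0 = delta param_s"
definition w :: "'k ratfun" where "w = emb L / emb (form_x ^ (m - 1))"

lemma w_unit: "w \<in> stalk point_100" "inverse w \<in> stalk point_100" "w \<noteq> 0"
proof -
  show "w \<in> stalk point_100" unfolding w_def by (rule x_pow_stalk[OF L_hom])
  show "inverse w \<in> stalk point_100" unfolding w_def
    by (rule p100.stalk_unitI[OF x_off L_off L_hom homogeneous_power1[OF homogeneous_vars(1)]])
  show "w \<noteq> 0" unfolding w_def using p100.q_nonzero[OF L_off] by simp
qed

lemma u_expand: "u = ratfun_const c * param_t ^ m + param_s * w"
proof -
  have "(form_x :: 'k form) ^ m = form_x * form_x ^ (m - 1)" using m2 by (simp add: power_eq_if)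
  then have x: "emb (form_x ^ m :: 'k form) = emb form_x * emb (form_x ^ (m - 1))" by (simp only: rhomD(2)[OF rhom_emb])
  have t: "param_t ^ m = emb form_y ^ m / emb (form_x ^ m)" by (simp add: param_t_eq power_divide rhomD[OF rhom_emb])
  have "emb F = ratfun_const c * emb form_y ^ m + emb form_z * emb L"
    by (subst F_eq) (simp add: rhomD[OF rhom_emb] ratfun_const_emb)
  then show ?thesis unfolding u_eq t w_def by (simp add: add_divide_distrib x)
qed

text \<open>\<open>u\<close> vanishes on the curve, so \<open>u_expand\<close> turns into an
  equation for the restriction of \<open>z/x\<close>. As \<open>w\<close> is a unit, it fixes the
  order of \<open>S0\<close>.\<close>

lemma S0_eq: "S0 * delta w = - fls_const c * fls_X ^ m"
proof -
  note st = p100.O_mult[OF p100.O_h p100.O_power[OF t_stalk]] p100.O_mult[OF s_stalk w_unit(1)]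
  have "0 = delta u" by (simp add: delta_gens)
  also have "\<dots> = fls_const c * fls_X ^ m + S0 * delta w"
    unfolding u_expand delta_add[OF st] delta_mult[OF p100.O_h p100.O_power[OF t_stalk]] delta_mult[OF s_stalk w_unit(1)]
    by (simp add: delta_power[OF t_stalk] delta_gens S0_def)
  finally show ?thesis by (simp add: eq_neg_iff_add_eq_0 add.commute)
qed

lemma S0_nz: "S0 \<noteq> 0" and S0_subdegree: "fls_subdegree S0 = int m"
proof -
  have r: "fls_const c * fls_X ^ m \<noteq> 0" using c_nz by simp
  then show z: "S0 \<noteq> 0" using S0_eq by auto
  have "fls_subdegree (S0 * delta w) = fls_subdegree (fls_const c * fls_X ^ m)" unfolding S0_eq by simp
  also have "\<dots> = int m" using r by (subst fls_subdegree_mult) (auto simp: fls_subdegree_pow)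
  finally show "fls_subdegree S0 = int m" using fls_subdegree_mult[OF z delta_unit(1)[OF w_unit]] delta_unit(2)[OF w_unit] by simp
qed

text \<open>The functions on the affine curve, expanded in \<open>t\<close> along the curve.\<close>

definition rho :: "'k poly poly \<Rightarrow> 'k fls" where "rho = ev2 fls_const (inverse S0) (fls_X * inverse S0)"

lemma rhom_fls_const: "rhom (fls_const :: 'k \<Rightarrow> 'k fls)"
  by (simp add: rhom_def fls_plus_const)

lemma rhom_rho: "rhom rho" unfolding rho_def by (rule rhom_ev2[OF rhom_fls_const])

text \<open>On the curve \<open>x/z\<close> and \<open>y/z\<close> expand to \<open>1 / S0\<close>
  and \<open>t / S0\<close>; homogeneity converts division by \<open>x ^ d\<close> into the factor
  \<open>S0 ^ d\<close>.\<close>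

lemma delta_form:
  assumes G: "homogeneous d G"
  shows "delta (emb G / emb (form_x ^ d)) = S0 ^ d * rho (dehomogenize G)"
proof -
  have "emb G / emb (form_x ^ d) = ev3 ratfun_const 1 param_t param_s G"
    using ev3_scale[OF rhom_ratfun_const G, of "inverse (emb form_x)" "emb form_x" "emb form_y" "emb form_z"] emb_ev3[of G] emb_nz
    by (simp add: param_t_eq rhomD[OF rhom_emb] divide_inverse mult.commute power_inverse)
  also have "\<dots> = (\<Sum>(i, j, l)\<in>degs d. ratfun_const (gc G i j l) * 1 ^ i * param_t ^ j * param_s ^ l)"
    by (rule ev3_homogeneous[OF rhom_ratfun_const G])
  finally have "delta (emb G / emb (form_x ^ d)) = delta (\<Sum>(i, j, l)\<in>degs d. ratfun_const (gc G i j l) * 1 ^ i * param_t ^ j * param_s ^ l)"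
    by (rule arg_cong)
  also have "\<dots> = (\<Sum>p\<in>degs d. delta (case p of (i, j, l) \<Rightarrow> ratfun_const (gc G i j l) * 1 ^ i * param_t ^ j * param_s ^ l))"
    by (rule delta_sum) (auto intro!: p100.O_mult p100.O_h p100.O_power t_stalk s_stalk)
  also have "\<dots> = (\<Sum>(i, j, l)\<in>degs d. fls_const (gc G i j l) * 1 ^ i * fls_X ^ j * S0 ^ l)"
  proof (rule sum.cong, simp, clarify)
    fix i j l
    note a = p100.O_mult[OF p100.O_h p100.O_power[OF t_stalk]]
    show "delta (ratfun_const (gc G i j l) * 1 ^ i * param_t ^ j * param_s ^ l) = fls_const (gc G i j l) * 1 ^ i * fls_X ^ j * S0 ^ l"
      using delta_mult[OF a p100.O_power[OF s_stalk]] delta_mult[OF p100.O_h p100.O_power[OF t_stalk]]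
      by (simp add: delta_power[OF t_stalk] delta_power[OF s_stalk] delta_gens S0_def)
  qed
  also have "\<dots> = ev3 fls_const 1 fls_X S0 G" by (rule ev3_homogeneous[OF rhom_fls_const G, symmetric])
  also have "\<dots> = S0 ^ d * rho (dehomogenize G)"
    using ev3_scale[OF rhom_fls_const G, of S0 "inverse S0" "fls_X * inverse S0" 1] S0_nz
    by (simp add: rho_def ev3_dehomogenize[OF rhom_fls_const] mult.left_commute)
  finally show ?thesis .
qed

lemma rho_f0: "rho f0 = 0"
  using delta_form[OF homF] S0_nz delta_gens(3) by (simp add: u_eq f0_def)

text \<open>The pole order of a monomial \<open>X ^ i * Y ^ j\<close> is congruent to
  \<open>- j\<close> modulo \<open>m\<close>, so \<open>j < m\<close> can be recovered from it, and
  then \<open>i\<close>. Hence the lowest terms of different monomials cannot cancel.\<close>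

lemma rho_reduced:
  assumes r: "r \<noteq> 0" "degree r < m"
  shows "rho r \<noteq> 0 \<and> (\<exists>n. fls_subdegree (rho r) = - int n)"
proof -
  obtain d G where G: "homogeneous d G" "dehomogenize G = r" using homogenization by blast
  define I where "I = {(i, j, l)\<in>degs d. gc G i j l \<noteq> 0}"
  define g where "g = (\<lambda>(i, j, l). fls_const (gc G i j l) * inverse S0 ^ i * (fls_X * inverse S0) ^ j)"
  have "rho r = ev3 fls_const (inverse S0) (fls_X * inverse S0) 1 G"
    by (simp add: rho_def ev3_dehomogenize[OF rhom_fls_const] G(2))
  also have "\<dots> = sum g (degs d)"
    unfolding ev3_homogeneous[OF rhom_fls_const G(1)] by (rule sum.cong) (auto simp: g_def)
  also have "\<dots> = sum g I" by (rule sum.mono_neutral_right) (auto simp: I_def g_def finite_degs)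
  finally have e: "rho r = sum g I" .
  have jm: "j < m" if "(i, j, l) \<in> I" for i j l
  proof -
    have "i + j + l = d" "gc G i j l \<noteq> 0" using that by (auto simp: I_def degs_def)
    then have "coeff (coeff r j) i \<noteq> 0" using coeff_dehomogenize[OF G(1), of j i] G(2) by auto
    then have "coeff r j \<noteq> 0" by auto
    then show ?thesis using le_degree r(2) by fastforce
  qed
  have sub: "fls_subdegree (g p) = (case p of (i, j, l) \<Rightarrow> - int (m * i + (m - 1) * j))" "g p \<noteq> 0" if pI: "p \<in> I" for p
  proof -
    obtain i j l where p: "p = (i, j, l)" by (cases p)
    have gn: "gc G i j l \<noteq> 0" using pI by (auto simp: I_def p)
    have nz: "fls_const (gc G i j l) \<noteq> 0" "inverse S0 ^ i \<noteq> 0" "(fls_X * inverse S0) ^ j \<noteq> 0" using gn S0_nz by auto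
    show "g p \<noteq> 0" using nz by (simp add: g_def p)
    have x: "fls_subdegree (fls_X * inverse S0) = 1 - int m"
      using S0_nz by (subst fls_subdegree_mult) (auto simp: S0_subdegree)
    have "fls_subdegree (g p) = int i * (- int m) + int j * (1 - int m)"
      using nz by (simp add: g_def p fls_subdegree_pow S0_subdegree x)
    also have "\<dots> = - int (m * i + (m - 1) * j)" using m2 by (cases m) (simp_all add: algebra_simps)
    finally show "fls_subdegree (g p) = (case p of (i, j, l) \<Rightarrow> - int (m * i + (m - 1) * j))" by (simp add: p)
  qed
  obtain k where k: "m = Suc k" using m2 by (cases m) auto
  have fin: "finite I" by (rule finite_subset[OF _ finite_degs[of d]]) (auto simp: I_def)
  have ne: "I \<noteq> {}"
  proof
    assume empty: "I = {}"
    have "gc G i j l = 0" for i j l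
    proof (rule ccontr)
      assume "gc G i j l \<noteq> 0"
      then have "(i, j, l) \<in> I" using G(1) by (simp add: I_def degs_def homogeneous_gc)
      then show False using empty by simp
    qed
    then have "G = 0" by (intro form_eqI) (simp add: gc_zero)
    then show False using r(1) G(2) by (simp add: rhomD[OF rhom_dehomogenize])
  qed
  have inj: "inj_on (\<lambda>p. fls_subdegree (g p)) I"
  proof (rule inj_onI)
    fix p p' assume p: "p \<in> I" "p' \<in> I" "fls_subdegree (g p) = fls_subdegree (g p')"
    obtain i j l i' j' l' where pp: "p = (i, j, l)" "p' = (i', j', l')" by (cases p, cases p')
    have deg: "i + j + l = d" "i' + j' + l' = d" using p by (auto simp: I_def degs_def pp)
    have "int (m * i + (m - 1) * j) = int (m * i' + (m - 1) * j')"
      using p(3) sub(1)[OF p(1)] sub(1)[OF p(2)] by (simp only: pp prod.case neg_equal_iff_equal)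
    then have eq: "int j - int j' = int m * (int i + int j - int i' - int j')" by (simp add: k algebra_simps)
    have b: "j < m" "j' < m" using jm p by (auto simp: pp)
    have "int m dvd int j - int j'" using eq by (metis dvd_triv_left)
    moreover have "\<bar>int j - int j'\<bar> < int m" using b by linarith
    ultimately have "int j - int j' = 0" using zdvd_not_zless[of "\<bar>int j - int j'\<bar>" "int m"] by (metis dvd_abs_iff abs_ge_zero abs_eq_0 less_le)
    then have "j = j'" "i = i'" using eq m2 by auto
    then show "p = p'" using deg by (simp add: pp)
  qed
  have s: "sum g I \<noteq> 0 \<and> fls_subdegree (sum g I) \<in> (\<lambda>p. fls_subdegree (g p)) ` I"
    by (rule fls_sum_distinct_subdegrees[OF fin ne sub(2) inj])
  then obtain p where p: "p \<in> I" "fls_subdegree (sum g I) = fls_subdegree (g p)" by blast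
  obtain i j l where "p = (i, j, l)" by (cases p)
  then have "fls_subdegree (sum g I) = - int (m * i + (m - 1) * j)" using p(2) sub(1)[OF p(1)] by simp
  then show ?thesis using s unfolding e by blast
qed

text \<open>Division by \<open>f0\<close> reduces both claims to remainders of degree below
  \<open>m\<close>, where \<open>rho_reduced\<close> excludes cancellation. So the expansion is
  faithful on the affine curve.\<close>

lemma rho_0_iff: "rho g = 0 \<longleftrightarrow> f0 dvd g" and rho_subdegree: "\<exists>n. fls_subdegree (rho g) = - int n"
proof -
  note R = rhomD[OF rhom_rho]
  obtain q r where g: "g = f0 * q + r" "r = 0 \<or> degree r < m" using f0_division[of g] by blast
  have e: "rho g = rho r" by (simp add: g(1) R rho_f0)
  show "rho g = 0 \<longleftrightarrow> f0 dvd g"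
  proof
    assume "f0 dvd g"
    then show "rho g = 0" by (elim dvdE) (simp add: R rho_f0)
  next
    assume "rho g = 0"
    then have "r = 0" using rho_reduced[of r] e g(2) by auto
    then show "f0 dvd g" using g(1) by simp
  qed
  show "\<exists>n. fls_subdegree (rho g) = - int n"
  proof (cases "r = 0")
    case True
    then show ?thesis unfolding e by (intro exI[of _ 0]) (simp add: R)
  next
    case False
    then show ?thesis using rho_reduced[of r] g(2) unfolding e by blast
  qed
qed

lemma delta_form_nz: "homogeneous d G \<Longrightarrow> delta (emb G / emb (form_x ^ d)) \<noteq> 0 \<longleftrightarrow> \<not> F dvd G"
  using S0_nz by (simp add: delta_form rho_0_iff dvd_dehomogenize)

lemma delta_0_iff:
  assumes "b \<in> stalk point_100"
  shows "delta b = 0 \<longleftrightarrow> b \<in> cp.fO"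
proof -
  obtain d G H where b: "b = emb G / emb H" "H \<notin> point_100" "H \<noteq> 0" "homogeneous d G" "homogeneous d H" using assms by (rule p100.stalkE)
  define h where "h = emb H / emb (form_x ^ d)"
  have h: "h \<in> stalk point_100" "inverse h \<in> stalk point_100" "h \<noteq> 0"
    unfolding h_def using x_pow_stalk[OF b(5)] p100.stalk_unitI[OF x_off b(2) b(5) homogeneous_power1[OF homogeneous_vars(1)]] b(3) by simp_all
  have "b * h = emb G / emb (form_x ^ d)" unfolding b(1) h_def using b(3) by simp
  then have "delta b * delta h = delta (emb G / emb (form_x ^ d))" using delta_mult[OF assms h(1)] by simp
  then have "delta b = 0 \<longleftrightarrow> delta (emb G / emb (form_x ^ d)) = 0" using delta_unit(1)[OF h] by auto
  then show ?thesis using delta_form_nz[OF b(4)] cp.quot_in_fO[OF b(2,4,5)] b(1) by blast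
qed

lemma theta_Fil: "tw.Fil N \<kappa> \<Longrightarrow> j < int N \<Longrightarrow> \<theta> \<kappa> $$ j = 0"
proof -
  assume F: "tw.Fil N \<kappa>" and j: "j < int N"
  obtain \<xi> where x: "\<xi> \<in> carrier (OK_ring point_100 u)" "\<kappa> = tw.j ((tw.fh [^]\<^bsub>OK_ring point_100 u\<^esub> N) \<otimes>\<^bsub>OK_ring point_100 u\<^esub> \<xi>)"
    using F by (auto simp: tw.Fil_def)
  have fh: "\<theta> (tw.j tw.fh) = fls_X" using chi_u by (simp add: chi_def tw.iota_f)
  have t: "\<theta> \<kappa> = fls_X ^ N * \<theta> (tw.j \<xi>)"
    unfolding x(2) using x(1) by (simp add: tw.j_mult tw.j_pow theta_hom theta_power fh)
  show "\<theta> \<kappa> $$ j = 0"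
  proof (cases "\<theta> (tw.j \<xi>) = 0")
    case False
    then have "fls_subdegree (\<theta> \<kappa>) = int N + fls_subdegree (\<theta> (tw.j \<xi>))"
      unfolding t by (subst fls_subdegree_mult) (auto simp: fls_subdegree_pow)
    then show ?thesis using theta_j[OF x(1)] j by (intro fls_eq0_below_subdegree) linarith
  qed (simp add: t)
qed

text \<open>An element outside the ideal of the curve has \<open>u\<close>-order zero, so its
  inverse among Laurent series lies in the image of \<open>OK_ring\<close>. Separatedness holds
  because a Laurent series divisible by all powers of \<open>u\<close> is zero.\<close>

lemma good_point_100: "good_point F m point_100 u"
proof (intro good_point.intro good_point_axioms.intro curve_point_100 tower_100)
  fix b assume b: "b \<in> stalk point_100" "b \<notin> cp.fO"
  have lb: "leading (chi b) 0 (fls_subdegree (delta b))"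
    using delta_0_iff[OF b(1)] b(2) chi_nonneg(1)[OF b(1)] by (simp add: leading_0_iff delta_def)
  have l: "leading (inverse (chi b)) 0 (- fls_subdegree (delta b))" using leading_inverse[OF lb] by simp
  have n: "chi b \<noteq> 0" using lb by (simp add: leading_def)
  have "0 \<le> fls_subdegree (inverse (chi b))" using l by (simp only: leading_0_iff)
  then have "inverse (chi b) $$ j = 0" if "j < 0" for j using that by (intro fls_eq0_below_subdegree) linarith
  then have "inverse (chi b) \<in> {h. \<forall>j. h $$ j \<noteq> 0 \<longrightarrow> 0 \<le> j}" unfolding mem_Collect_eq using linorder_not_le by blast
  then obtain \<xi> where x: "\<xi> \<in> carrier (OK_ring point_100 u)" "inverse (chi b) = \<theta> (tw.j \<xi>)"
    unfolding theta_OK[symmetric] by blast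
  have "\<theta> (tw.\<iota> b \<otimes>\<^bsub>K\<^esub> tw.j \<xi>) = \<theta> \<one>\<^bsub>K\<^esub>"
    using n b(1) x by (simp add: theta_hom chi_def flip: x(2))
  then have "tw.\<iota> b \<otimes>\<^bsub>K\<^esub> tw.j \<xi> = \<one>\<^bsub>K\<^esub>" using b(1) x(1) by (intro theta_inj) auto
  then show "\<exists>\<xi>\<in>carrier (OK_ring point_100 u). tw.\<iota> b \<otimes>\<^bsub>K\<^esub> tw.j \<xi> = \<one>\<^bsub>K\<^esub>" using x(1) by blast
next
  fix \<kappa> assume F: "\<And>N. tw.Fil N \<kappa>"
  have "\<theta> \<kappa> = 0"
  proof (rule fls_eqI)
    fix j show "\<theta> \<kappa> $$ j = 0 $$ j" using theta_Fil[OF F[of "Suc (nat j)"], of j] by simp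
  qed
  then show "\<kappa> = \<zero>\<^bsub>K\<^esub>" using theta_inj[OF tw.Fil_carr[OF F[of 0]] KK.zero_closed] theta_zero by simp
qed

end

context flex_point
begin

interpretation p100: plane_point "point_100 :: 'k form set" by (rule plane_point_100)
interpretation p100: local_subring ratfun_const "stalk point_100 :: 'k ratfun set" "stalk_ideal point_100 point_100"
  by (rule p100.local_subring_stalk)
interpretation gp: good_point F m point_100 u by (rule good_point_100)
interpretation KK: cring K by (rule gp.K_cring)
interpretation P: plane_point P by (rule plane_point_curve)
interpretation PA: local_subring ratfun_const "stalk P" I by (rule P.local_subring_stalk)

section \<open>Expansions of rational functions at the flex\<close>

definition psi :: "'k ratfun \<Rightarrow> 'k fls fls" where "psi r = \<theta> (gp.\<phi> r)"

lemma psi_mult: "r \<in> function_field \<Longrightarrow> s \<in> function_field \<Longrightarrow> psi (r * s) = psi r * psi s"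
  by (simp add: psi_def gp.phi_mult theta_hom)

lemma psi_add: "r \<in> function_field \<Longrightarrow> s \<in> function_field \<Longrightarrow> psi (r + s) = psi r + psi s"
  by (simp add: psi_def gp.phi_add theta_hom)

lemma psi_diff: "r \<in> function_field \<Longrightarrow> s \<in> function_field \<Longrightarrow> psi (r - s) = psi r - psi s"
  by (simp add: psi_def gp.phi_diff theta_minus)

lemma psi_stalk: "a \<in> stalk point_100 \<Longrightarrow> psi a = chi a" by (simp add: psi_def chi_def gp.phi_stalk)

lemma chi_0: "chi 0 = 0"
  using chi_add[OF p100.O_zero p100.O_zero] by (simp only: add_0_left add_cancel_right_right)

lemma psi_0_1: "psi 0 = 0" "psi 1 = 1"
  using psi_stalk[OF p100.O_zero] psi_stalk[OF p100.O_one] by (simp_all add: chi_0 chi_1)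

lemma psi_inverse:
  assumes "r \<in> function_field"
  shows "psi (inverse r) = inverse (psi r)"
proof (cases "r = 0")
  case False
  then have "psi r * psi (inverse r) = 1"
    using psi_mult[OF assms funfield_inverse[OF assms]] by (simp add: psi_0_1)
  then show ?thesis by (simp add: inverse_unique)
qed (simp add: psi_0_1)

lemma psi_divide: "r \<in> function_field \<Longrightarrow> s \<in> function_field \<Longrightarrow> psi (r / s) = psi r / psi s"
  using psi_mult[OF _ funfield_inverse] by (simp add: divide_inverse psi_inverse)

lemma psi_power: "r \<in> function_field \<Longrightarrow> psi (r ^ n) = psi r ^ n"
  by (induction n) (simp_all add: psi_0_1 psi_mult funfield_closed(5))

lemma psi_powi: "r \<in> function_field \<Longrightarrow> psi (r powi l) = psi r powi l"
  by (simp add: power_int_def psi_power psi_inverse funfield_inverse)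

lemma funfield_powi: "r \<in> function_field \<Longrightarrow> r powi l \<in> function_field"
  by (simp add: power_int_def funfield_closed(5) funfield_inverse)

lemma funfield_divide: "r \<in> function_field \<Longrightarrow> s \<in> function_field \<Longrightarrow> r / s \<in> function_field"
  by (simp add: divide_inverse funfield_closed(3) funfield_inverse)

lemma s_funfield: "(param_s :: 'k ratfun) \<in> function_field" by (rule gp.stalk_funfield[OF s_stalk])

lemma leading_s: "leading (psi param_s) 0 (int m)"
  using S0_nz S0_subdegree chi_nonneg(1)[OF s_stalk] by (simp add: leading_0_iff psi_stalk[OF s_stalk] S0_def delta_def)

text \<open>A power of \<open>z/x\<close> moves a polynomial function into the local ring of the
  flex. This power has \<open>u\<close>-order zero, so at \<open>u ^ 0\<close> it can be divided out
  again.\<close>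

lemma psi_ev: "0 \<le> fls_subdegree (psi (ev y))" "psi (ev y) $$ 0 = rho y"
proof -
  obtain e Y where Y: "homogeneous e Y" "dehomogenize Y = y" "ev y = emb Y / emb (form_z ^ e)" by (rule ev_quot_z[of y])
  define a where "a = emb Y / emb (form_x ^ e)"
  have a: "a \<in> stalk point_100" unfolding a_def by (rule x_pow_stalk[OF Y(1)])
  have ey: "ev y = a / param_s ^ e" unfolding Y(3) a_def by (simp add: rhomD[OF rhom_emb] power_divide)
  have p: "psi (ev y) = chi a * inverse (psi param_s ^ e)"
    by (simp only: ey psi_divide[OF gp.stalk_funfield[OF a] funfield_closed(5)[OF s_funfield]]
      psi_power[OF s_funfield] psi_stalk[OF a] divide_inverse[of "chi a"])
  have l: "leading (psi param_s ^ e) 0 (int e * int m)" using leading_power[OF leading_s, of e] by simp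
  have il: "0 \<le> fls_subdegree (inverse (psi param_s ^ e))" using leading_inverse[OF l] by (simp add: leading_0_iff)
  show "0 \<le> fls_subdegree (psi (ev y))" unfolding p by (rule fls_mult_subdegree_ge_0[OF chi_nonneg(1)[OF a] il])
  have se: "psi param_s ^ e $$ 0 = S0 ^ e"
    using delta_power[OF s_stalk, of e] psi_power[OF s_funfield, of e] psi_stalk[OF p100.O_power[OF s_stalk], of e]
    by (simp add: delta_def S0_def)
  have "psi (ev y) $$ 0 = delta a * inverse (S0 ^ e)"
    unfolding p fls_times_nth_0[OF chi_nonneg(1)[OF a] il] leading_inverse_nth_0[OF l] se by (simp add: delta_def)
  then show "psi (ev y) $$ 0 = rho y" unfolding a_def delta_form[OF Y(1)] using S0_nz by (simp add: Y(2) mult.commute)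
qed

lemma leading_ev: "\<not> f0 dvd y \<Longrightarrow> leading (psi (ev y)) 0 (fls_subdegree (rho y))"
  using psi_ev[of y] rho_0_iff[of y] by (simp add: leading_0_iff)

lemma leading_f0: "leading (psi (ev f0)) 1 (- (int m)\<^sup>2)"
proof -
  have "ev f0 = u / param_s ^ m"
    using ev_quot[OF homF] by (simp add: u_eq f0_def rhomD[OF rhom_emb] power_divide)
  then have "psi (ev f0) = psi u / psi param_s ^ m"
    using psi_divide[OF gp.stalk_funfield[OF gp.f_O] funfield_closed(5)[OF s_funfield], of m] by (simp add: psi_power[OF s_funfield])
  also have "\<dots> = fls_X * inverse (psi param_s ^ m)" by (simp add: psi_stalk[OF gp.f_O] chi_u divide_inverse)
  finally have e: "psi (ev f0) = fls_X * inverse (psi param_s ^ m)" .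
  have "leading fls_X 1 0" by (simp add: leading_def)
  from leading_mult[OF this leading_inverse[OF leading_power[OF leading_s, of m]]]
  show ?thesis unfolding e by (simp add: power2_eq_square)
qed

text \<open>The correction term has a factor \<open>ev f0\<close> of \<open>u\<close>-order one and
  a cofactor without pole along the curve, so it does not touch the coefficient at
  \<open>u ^ 0\<close>.\<close>

lemma leading_multiple:
  assumes y: "\<not> f0 dvd y" "\<not> f0 dvd h"
  shows "leading (psi (ev f0 powi l * (ev y + ev f0 * ev a / ev h))) l (fls_subdegree (rho y) - (int m)\<^sup>2 * l)"
proof -
  define b where "b = ev a / ev h"
  have bf: "b \<in> function_field" unfolding b_def by (rule funfield_divide[OF ev_funfield ev_funfield])
  have lh: "leading (psi (ev h)) 0 (fls_subdegree (rho h))" by (rule leading_ev[OF y(2)])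
  have "psi b = psi (ev a) * inverse (psi (ev h))" unfolding b_def psi_divide[OF ev_funfield ev_funfield] by (rule divide_inverse)
  moreover have "0 \<le> fls_subdegree (inverse (psi (ev h)))" using leading_inverse[OF lh] by (simp add: leading_0_iff)
  ultimately have b0: "0 \<le> fls_subdegree (psi b)" using fls_mult_subdegree_ge_0[OF psi_ev(1)] by simp
  have z0: "0 \<le> fls_subdegree (psi (ev f0))" "psi (ev f0) $$ 0 = 0" using leading_f0 by (auto simp: leading_def)
  have fb: "ev f0 * b \<in> function_field" by (rule funfield_closed(3)[OF ev_funfield bf])
  have c: "psi (ev y + ev f0 * b) = psi (ev y) + psi (ev f0) * psi b"
    by (simp add: psi_add[OF ev_funfield fb] psi_mult[OF ev_funfield bf])
  have "leading (psi (ev y + ev f0 * b)) 0 (fls_subdegree (rho y))"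
  proof (rule leading_perturb[OF leading_ev[OF y(1)]])
    fix j :: int assume "j \<le> 0"
    then have "(psi (ev f0) * psi b) $$ j = 0"
      using fls_times_nth_0[OF z0(1) b0] fls_mult_subdegree_ge_0[OF z0(1) b0] z0(2)
      by (cases "j = 0") (auto intro: fls_eq0_below_subdegree)
    then show "psi (ev y + ev f0 * b) $$ j = psi (ev y) $$ j" by (simp add: c)
  qed
  from leading_mult[OF leading_powi[OF leading_f0, of l] this]
  have "leading (psi (ev f0 powi l) * psi (ev y + ev f0 * b)) l (fls_subdegree (rho y) - (int m)\<^sup>2 * l)"
    by (simp add: psi_powi[OF ev_funfield] mult.commute[of l])
  then show ?thesis
    using psi_mult[OF funfield_powi[OF ev_funfield] funfield_closed(1)[OF ev_funfield fb], of f0 l y] by (simp add: b_def)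
qed

section \<open>Pole orders\<close>

text \<open>On the local ring at the generic point of the curve this is multiplicative with kernel
  the maximal ideal: it is the embedding of the function field of the curve into k((t)).\<close>

definition D :: "'k ratfun \<Rightarrow> 'k fls" where "D a = psi a $$ 0"

lemma P_funfield: "a \<in> stalk P \<Longrightarrow> a \<in> function_field"
  by (elim P.stalkE) (simp add: funfieldI)

lemma P_expansion:
  assumes "a \<in> stalk P"
  shows "0 \<le> fls_subdegree (psi a)" "D a = 0 \<longleftrightarrow> a \<in> I"
proof -
  obtain d G H where a: "a = emb G / emb H" "H \<notin> P" "H \<noteq> 0" "homogeneous d G" "homogeneous d H" using assms by (rule P.stalkE)
  define g h where "g = emb G / emb (form_x ^ d)" and "h = emb H / emb (form_x ^ d)"
  have gh: "g \<in> stalk point_100" "h \<in> stalk point_100" unfolding g_def h_def using x_pow_stalk a by blast+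
  have "a = g / h" unfolding a(1) g_def h_def by simp
  then have p: "psi a = chi g * inverse (chi h)"
    using psi_divide[OF gp.stalk_funfield[OF gh(1)] gp.stalk_funfield[OF gh(2)]] by (simp add: psi_stalk gh divide_inverse)
  have dh: "delta h \<noteq> 0" using delta_form_nz[OF a(5)] a(2) by (simp add: h_def curve_ideal_def)
  then have l: "leading (chi h) 0 (fls_subdegree (delta h))"
    using chi_nonneg(1)[OF gh(2)] by (simp add: leading_0_iff delta_def)
  have il: "0 \<le> fls_subdegree (inverse (chi h))" using leading_inverse[OF l] by (simp add: leading_0_iff)
  show "0 \<le> fls_subdegree (psi a)" unfolding p by (rule fls_mult_subdegree_ge_0[OF chi_nonneg(1)[OF gh(1)] il])
  have "D a = delta g * inverse (delta h)"
    unfolding D_def p fls_times_nth_0[OF chi_nonneg(1)[OF gh(1)] il] leading_inverse_nth_0[OF l] by (simp add: delta_def)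
  then have "D a = 0 \<longleftrightarrow> F dvd G" using dh delta_form_nz[OF a(4)] by (auto simp: g_def)
  then show "D a = 0 \<longleftrightarrow> a \<in> I" using P.max_iff[OF a(2,4,5)] a(1) by (simp add: curve_ideal_def)
qed

lemma D_mult: "a \<in> stalk P \<Longrightarrow> b \<in> stalk P \<Longrightarrow> D (a * b) = D a * D b"
  by (simp add: D_def psi_mult P_funfield fls_times_nth_0 P_expansion(1))

lemma D_power: "a \<in> stalk P \<Longrightarrow> D (a ^ n) = D a ^ n"
  by (induction n) (simp_all add: D_mult PA.O_power, simp add: D_def psi_0_1)

lemma p_sub_P: "a \<in> stalk point_100 \<Longrightarrow> a \<in> stalk P"
  using stalk_P[OF plane_point_100 F_100] by blast

lemma D_stalk: "a \<in> stalk point_100 \<Longrightarrow> D a = delta a" by (simp add: D_def psi_stalk delta_def)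

lemma D_ev: "D (ev y) = rho y" by (simp add: D_def psi_ev)

lemma res_eq_D:
  assumes "a \<in> stalk P" "b \<in> stalk P"
  shows "res a = res b \<longleftrightarrow> D a = D b"
proof -
  have "D (a - b) = D a - D b" using assms by (simp add: D_def psi_diff P_funfield)
  then show ?thesis using P_expansion(2)[OF PA.O_diff[OF assms]] res_eq_iff[OF assms] by simp
qed

text \<open>The local ring of the curve at the flex is a discrete valuation ring with uniformizer \<open>t\<close>:
  modulo \<open>u\<close>, the other generator \<open>z/x\<close> of the maximal ideal is a unit times \<open>t\<^sup>m\<close>.\<close>

lemma max_D:
  assumes a: "a \<in> stalk_ideal point_100 point_100"
  shows "\<exists>b\<in>stalk point_100. D a = fls_X * D b"
proof -
  obtain d G H where G: "a = emb G / emb H" "G \<in> point_100" "H \<notin> point_100" "H \<noteq> 0" "homogeneous d G" "homogeneous d H"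
    using a by (rule p100.stE)
  obtain A B where AB: "homogeneous (d - 1) A" "homogeneous (d - 1) B" "G = form_y * A + form_z * B" "d = 0 \<longrightarrow> A = 0 \<and> B = 0"
    using form_at_100[OF G(5,2)] by blast
  define v1 v2 where "v1 = emb (form_x * A) / emb H" and "v2 = emb (form_x * B) / emb H"
  have h: "homogeneous d (form_x * A)" "homogeneous d (form_x * B)"
    using homogeneous_mult[OF homogeneous_vars(1) AB(1)] homogeneous_mult[OF homogeneous_vars(1) AB(2)] AB(4) by (cases d; simp)+
  have v: "v1 \<in> stalk point_100" "v2 \<in> stalk point_100"
    unfolding v1_def v2_def by (rule p100.stalkI[OF G(3) h(1) G(6)], rule p100.stalkI[OF G(3) h(2) G(6)])
  have av: "a = param_t * v1 + param_s * v2"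
    unfolding G(1) AB(3) v1_def v2_def param_t_eq using G(4) by (simp add: rhomD[OF rhom_emb] field_simps)
  have S: "S0 = fls_X * delta (ratfun_const (- c) * param_t ^ (m - 1) * inverse w)"
  proof -
    have m1: "fls_X ^ m = fls_X * (fls_X :: 'k fls) ^ (m - 1)" using m2 by (simp add: power_eq_if)
    have "delta w * delta (inverse w) = 1" using delta_mult[OF w_unit(1,2)] w_unit(3) by (simp add: delta_gens)
    then have "S0 = (S0 * delta w) * delta (inverse w)" by (simp add: mult.assoc)
    also have "\<dots> = fls_X * (fls_const (- c) * fls_X ^ (m - 1) * delta (inverse w))"
      unfolding S0_eq m1 by (simp add: mult_ac)
    also have "fls_const (- c) * fls_X ^ (m - 1) * delta (inverse w) = delta (ratfun_const (- c) * param_t ^ (m - 1) * inverse w)"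
      using delta_mult[OF p100.O_mult[OF p100.O_h p100.O_power[OF t_stalk]] w_unit(2)] delta_mult[OF p100.O_h p100.O_power[OF t_stalk]]
      by (simp add: delta_gens delta_power[OF t_stalk])
    finally show ?thesis .
  qed
  define w' where "w' = ratfun_const (- c) * param_t ^ (m - 1) * inverse w"
  have w': "w' \<in> stalk point_100" unfolding w'_def by (intro p100.O_mult p100.O_h p100.O_power t_stalk w_unit)
  have "D a = delta (param_t * v1 + param_s * v2)" unfolding av by (rule D_stalk) (intro p100.O_add p100.O_mult t_stalk s_stalk v)
  also have "\<dots> = fls_X * delta v1 + S0 * delta v2"
    using delta_add[OF p100.O_mult[OF t_stalk v(1)] p100.O_mult[OF s_stalk v(2)]] delta_mult[OF t_stalk v(1)] delta_mult[OF s_stalk v(2)]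
    by (simp add: delta_gens S0_def)
  also have "\<dots> = fls_X * (delta v1 + delta w' * delta v2)" unfolding S w'_def by (simp add: distrib_left mult.assoc)
  also have "delta v1 + delta w' * delta v2 = D (v1 + w' * v2)"
    using delta_add[OF v(1) p100.O_mult[OF w' v(2)]] delta_mult[OF w' v(2)] D_stalk[OF p100.O_add[OF v(1) p100.O_mult[OF w' v(2)]]] by simp
  finally show ?thesis using p100.O_add[OF v(1) p100.O_mult[OF w' v(2)]] by blast
qed

text \<open>As long as the constant term vanishes, \<open>max_D\<close> strips off one factor
  \<open>t\<close>; when it no longer vanishes, the element is a unit.\<close>

lemma D_uniformize:
  assumes "a \<in> stalk point_100" "D a \<noteq> 0" "fls_subdegree (D a) = int i"
  shows "\<exists>v\<in>stalk point_100. v \<notin> stalk_ideal point_100 point_100 \<and> D a = fls_X ^ i * D v"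
  using assms
proof (induction i arbitrary: a)
  case 0
  then have "delta a $$ 0 \<noteq> 0" using nth_fls_subdegree_nonzero[of "D a"] by (simp add: D_stalk)
  then show ?case using 0 max_delta[OF 0(1)] by (intro bexI[of _ a]) auto
next
  case (Suc i)
  have "delta a $$ 0 = 0" using Suc.prems by (simp add: D_stalk)
  then obtain b where b: "b \<in> stalk point_100" "D a = fls_X * D b" using max_D max_delta[OF Suc.prems(1)] by blast
  then have nz: "D b \<noteq> 0" using Suc.prems(2) by auto
  then have "fls_subdegree (D b) = int i" using Suc.prems(3) unfolding b(2) by (subst (asm) fls_subdegree_mult) auto
  then obtain v where "v \<in> stalk point_100" "v \<notin> stalk_ideal point_100 point_100" "D b = fls_X ^ i * D v" using Suc.IH[OF b(1) nz] by blast
  then show ?case using b(2) by (intro bexI[of _ v]) (simp_all add: mult.assoc)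
qed

lemma D_unit:
  assumes "v \<in> stalk point_100" "v \<notin> stalk_ideal point_100 point_100"
  shows "inverse v \<in> stalk point_100" "v \<noteq> 0" "D v \<noteq> 0" "fls_subdegree (D v) = 0"
proof -
  show i: "inverse v \<in> stalk point_100" by (rule p100.O_unit[OF assms])
  show n: "v \<noteq> 0" using assms(2) p100.m_zero by blast
  show "D v \<noteq> 0" "fls_subdegree (D v) = 0" using delta_unit[OF assms(1) i n] by (simp_all add: D_stalk[OF assms(1)])
qed

lemma max_generated: "curve_stalk_max F point_100 = (\<lambda>b. res param_t \<otimes>\<^bsub>curve_field F\<^esub> b) ` curve_stalk F point_100"
proof safe
  fix x assume "x \<in> curve_stalk_max F point_100"
  then obtain a where a: "a \<in> stalk_ideal point_100 point_100" "x = res a" by (auto simp: curve_stalk_max_def)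
  obtain b where b: "b \<in> stalk point_100" "D a = fls_X * D b" using max_D[OF a(1)] by blast
  have aO: "a \<in> stalk point_100" using a(1) p100.m_sub by blast
  have "D (param_t * b) = D a" using b(2) D_mult[OF p_sub_P[OF t_stalk] p_sub_P[OF b(1)]] by (simp add: D_stalk[OF t_stalk] delta_gens)
  then have "x = res (param_t * b)"
    unfolding a(2) using res_eq_D[OF p_sub_P[OF aO] p_sub_P[OF p100.O_mult[OF t_stalk b(1)]]] by simp
  then show "x \<in> (\<lambda>b. res param_t \<otimes>\<^bsub>curve_field F\<^esub> b) ` curve_stalk F point_100"
    using b(1) res_mult[OF p_sub_P[OF t_stalk] p_sub_P[OF b(1)]] by (auto simp: curve_stalk_def)
next
  fix x assume "x \<in> curve_stalk F point_100"
  then obtain b where b: "b \<in> stalk point_100" "x = res b" by (auto simp: curve_stalk_def)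
  then show "res param_t \<otimes>\<^bsub>curve_field F\<^esub> x \<in> curve_stalk_max F point_100"
    using res_mult[OF p_sub_P[OF t_stalk] p_sub_P[OF b(1)]] p100.m_mult[OF t_max b(1)] by (auto simp: curve_stalk_max_def)
qed

text \<open>The definition admits any uniformizer. In one direction every admissible
  \<open>\<tau>\<close> is shown to expand to order one; in the other \<open>t\<close> is chosen,
  and a unit of the local ring with the prescribed expansion has to be produced.\<close>

lemma has_pole_order_iff:
  "has_pole_order F point_100 (res (ev y)) n \<longleftrightarrow> rho y \<noteq> 0 \<and> fls_subdegree (rho y) = - int n"
proof
  assume "has_pole_order F point_100 (res (ev y)) n"
  then obtain \<tau> where t: "\<tau> \<in> curve_stalk F point_100"
    "curve_stalk_max F point_100 = (\<lambda>b. \<tau> \<otimes>\<^bsub>curve_field F\<^esub> b) ` curve_stalk F point_100"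
    "res (ev y) \<otimes>\<^bsub>curve_field F\<^esub> (\<tau> [^]\<^bsub>curve_field F\<^esub> n) \<in> curve_stalk F point_100 - curve_stalk_max F point_100"
    unfolding has_pole_order_def by blast
  obtain b where b: "b \<in> stalk point_100" "\<tau> = res b" using t(1) by (auto simp: curve_stalk_def)
  note bP = p_sub_P[OF b(1)]
  have "res param_t \<in> curve_stalk_max F point_100" using t_max by (auto simp: curve_stalk_max_def)
  then obtain e where e: "e \<in> stalk point_100" "res param_t = res b \<otimes>\<^bsub>curve_field F\<^esub> res e"
    unfolding t(2) b(2) curve_stalk_def by blast
  have "res param_t = res (b * e)" using e(2) res_mult[OF bP p_sub_P[OF e(1)]] by simp
  then have X: "fls_X = D b * D e"
    using res_eq_D[OF p_sub_P[OF t_stalk] p_sub_P[OF p100.O_mult[OF b(1) e(1)]]] D_mult[OF bP p_sub_P[OF e(1)]]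
    by (simp add: D_stalk[OF t_stalk] delta_gens)
  then have nz: "D b \<noteq> 0" "D e \<noteq> 0" by auto
  have "fls_subdegree (D b) + fls_subdegree (D e) = 1" using fls_subdegree_mult[OF nz] by (simp flip: X)
  moreover have "0 \<le> fls_subdegree (D b)" "0 \<le> fls_subdegree (D e)" using delta_nonneg b(1) e(1) by (simp_all add: D_stalk)
  \<comment> \<open>\<open>\<tau>\<close> divides \<open>t\<close>, which leaves order 0 or 1; since
    \<open>\<tau>\<close> lies in the maximal ideal, 0 is impossible.\<close>
  moreover have "fls_subdegree (D b) \<noteq> 0"
  proof -
    have "res 1 \<in> curve_stalk F point_100" using p100.O_one by (auto simp: curve_stalk_def)
    then have "res b \<otimes>\<^bsub>curve_field F\<^esub> res 1 \<in> curve_stalk_max F point_100" unfolding t(2) b(2) by blast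
    then obtain b' where b': "b' \<in> stalk_ideal point_100 point_100" "res b = res b'"
      using res_mult[OF bP PA.O_one] by (auto simp: curve_stalk_max_def)
    have bO: "b' \<in> stalk point_100" using b'(1) p100.m_sub by blast
    have "D b $$ 0 = 0" using res_eq_D[OF bP p_sub_P[OF bO]] b' max_delta[OF bO] by (simp add: D_stalk[OF bO])
    then show ?thesis using nz(1) nth_fls_subdegree_nonzero[OF nz(1)] by metis
  qed
  ultimately have sb: "fls_subdegree (D b) = 1" by linarith
  obtain a where a: "a \<in> stalk point_100" "res (ev y) \<otimes>\<^bsub>curve_field F\<^esub> (res b [^]\<^bsub>curve_field F\<^esub> n) = res a"
    "res a \<notin> curve_stalk_max F point_100" using t(3) unfolding b(2) curve_stalk_def by auto
  have "a \<notin> stalk_ideal point_100 point_100" using a(3) by (auto simp: curve_stalk_max_def)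
  note da = D_unit[OF a(1) this]
  have "res (ev y * b ^ n) = res a" using a(2) res_mult[OF ev_stalk_P PA.O_power[OF bP]] by (simp add: res_pow[OF bP])
  then have e: "rho y * D b ^ n = D a"
    using res_eq_D[OF PA.O_mult[OF ev_stalk_P PA.O_power[OF bP]] p_sub_P[OF a(1)]] D_mult[OF ev_stalk_P PA.O_power[OF bP]]
    by (simp add: D_power[OF bP] D_ev)
  then have r: "rho y \<noteq> 0" using da(3) by auto
  have "fls_subdegree (rho y) + int n = 0"
    using fls_subdegree_mult[of "rho y" "D b ^ n"] r nz(1) da(4) sb by (simp add: e fls_subdegree_pow)
  then show "rho y \<noteq> 0 \<and> fls_subdegree (rho y) = - int n" using r by simp
next
  assume r: "rho y \<noteq> 0 \<and> fls_subdegree (rho y) = - int n"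
  obtain e Y where Y: "homogeneous e Y" "ev y = emb Y / emb (form_z ^ e)" by (rule ev_quot_z[of y])
  define a where "a = emb Y / emb (form_x ^ e)"
  have a: "a \<in> stalk point_100" unfolding a_def by (rule x_pow_stalk[OF Y(1)])
  have ya: "ev y * param_s ^ e = a" unfolding Y(2) a_def by (simp add: rhomD[OF rhom_emb] power_divide)
  define b where "b = a * param_t ^ n"
  have b: "b \<in> stalk point_100" unfolding b_def by (intro p100.O_mult a p100.O_power t_stalk)
  have se: "(param_s :: 'k ratfun) ^ e \<in> stalk point_100" by (rule p100.O_power[OF s_stalk])
  have Ds: "D (param_s ^ e) = S0 ^ e" using D_stalk[OF se] delta_power[OF s_stalk] by (simp add: S0_def)
  have Da: "D a = rho y * S0 ^ e" using D_mult[OF ev_stalk_P p_sub_P[OF se], of y] by (simp add: ya Ds D_ev)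
  have Db: "D b = rho y * S0 ^ e * fls_X ^ n"
    using D_mult[OF p_sub_P[OF a] p_sub_P[OF p100.O_power[OF t_stalk]], of n] D_stalk[OF p100.O_power[OF t_stalk], of n]
    by (simp add: b_def Da delta_power[OF t_stalk] delta_gens)
  have se_sub: "S0 ^ e \<noteq> 0" "fls_subdegree (S0 ^ e) = int (m * e)" using S0_nz by (simp_all add: fls_subdegree_pow S0_subdegree)
  have b0: "D b \<noteq> 0" "fls_subdegree (D b) = int (m * e)" using r se_sub by (simp_all add: Db fls_subdegree_pow)
  \<comment> \<open>Both \<open>a * t ^ n\<close> and the power of \<open>z/x\<close> expand to
    \<open>t ^ (m * e)\<close> times the expansion of a unit. The quotient \<open>q\<close> of the
    two units then expands like \<open>ev y * t ^ n\<close>.\<close>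
  obtain v where v: "v \<in> stalk point_100" "v \<notin> stalk_ideal point_100 point_100" "D b = fls_X ^ (m * e) * D v"
    using D_uniformize[OF b b0] by blast
  obtain v' where v': "v' \<in> stalk point_100" "v' \<notin> stalk_ideal point_100 point_100" "S0 ^ e = fls_X ^ (m * e) * D v'"
    using D_uniformize[OF se, of "m * e"] se_sub Ds by auto
  define q where "q = v * inverse v'"
  have q: "q \<in> stalk point_100" "q \<notin> stalk_ideal point_100 point_100"
  proof -
    show qO: "q \<in> stalk point_100" unfolding q_def by (rule p100.O_mult[OF v(1) D_unit(1)[OF v'(1,2)]])
    show "q \<notin> stalk_ideal point_100 point_100"
    proof
      assume "q \<in> stalk_ideal point_100 point_100"
      then have "q * v' \<in> stalk_ideal point_100 point_100" by (rule p100.m_mult[OF _ v'(1)])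
      then show False using v(2) D_unit(2)[OF v'(1,2)] by (simp add: q_def mult.assoc)
    qed
  qed
  have "q * v' = v" using D_unit(2)[OF v'(1,2)] by (simp add: q_def mult.assoc)
  then have Dv: "D q * D v' = D v" using D_mult[OF p_sub_P[OF q(1)] p_sub_P[OF v'(1)]] by simp
  have "D q * S0 ^ e = fls_X ^ (m * e) * (D q * D v')" unfolding v'(3) by (rule mult.left_commute)
  also have "\<dots> = D b" unfolding Dv by (rule v(3)[symmetric])
  also have "\<dots> = rho y * S0 ^ e * fls_X ^ n" by (rule Db)
  finally have Dq: "D q = rho y * fls_X ^ n" using S0_nz by (simp add: mult.commute mult.left_commute)
  note tP = p_sub_P[OF t_stalk]
  have "D (ev y * param_t ^ n) = D q"
    using D_mult[OF ev_stalk_P PA.O_power[OF tP], of y n] D_stalk[OF t_stalk] by (simp add: Dq D_power[OF tP] D_ev delta_gens)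
  then have "res (ev y * param_t ^ n) = res q"
    using res_eq_D[OF PA.O_mult[OF ev_stalk_P PA.O_power[OF tP]] p_sub_P[OF q(1)]] by blast
  then have pole: "res (ev y) \<otimes>\<^bsub>curve_field F\<^esub> (res param_t [^]\<^bsub>curve_field F\<^esub> n) = res q"
    using res_mult[OF ev_stalk_P PA.O_power[OF tP]] by (simp add: res_pow[OF tP])
  have "res q \<notin> curve_stalk_max F point_100"
  proof
    assume "res q \<in> curve_stalk_max F point_100"
    then obtain b' where b': "b' \<in> stalk_ideal point_100 point_100" "res q = res b'" by (auto simp: curve_stalk_max_def)
    have bO: "b' \<in> stalk point_100" using b'(1) p100.m_sub by blast
    have "delta q = delta b'" using res_eq_D[OF p_sub_P[OF q(1)] p_sub_P[OF bO]] b'(2) by (simp add: D_stalk q(1) bO)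
    then show False using max_delta[OF bO] max_delta[OF q(1)] b'(1) q(2) by simp
  qed
  then have "res q \<in> curve_stalk F point_100 - curve_stalk_max F point_100" using q(1) by (simp add: curve_stalk_def)
  moreover have "res param_t \<in> curve_stalk F point_100" unfolding curve_stalk_def by (rule imageI[OF t_stalk])
  ultimately show "has_pole_order F point_100 (res (ev y)) n"
    unfolding has_pole_order_def using max_generated pole by (intro bexI[of _ "res param_t"] conjI) simp_all
qed

lemma nongap_iff: "n \<notin> weierstrass_gaps F point_100 \<longleftrightarrow> (\<exists>y. \<not> f0 dvd y \<and> fls_subdegree (rho y) = - int n)"
proof
  assume "n \<notin> weierstrass_gaps F point_100"
  then obtain \<alpha> where "\<alpha> \<in> functions_off F point_100" "has_pole_order F point_100 \<alpha> n" by (auto simp: weierstrass_gaps_def)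
  then show "\<exists>y. \<not> f0 dvd y \<and> fls_subdegree (rho y) = - int n"
    by (metis functions_off_E has_pole_order_iff rho_0_iff)
next
  assume "\<exists>y. \<not> f0 dvd y \<and> fls_subdegree (rho y) = - int n"
  then obtain y where "\<not> f0 dvd y" "fls_subdegree (rho y) = - int n" by blast
  then have "has_pole_order F point_100 (res (ev y)) n" by (simp add: has_pole_order_iff rho_0_iff)
  then show "n \<notin> weierstrass_gaps F point_100" using functions_off_ev[of y] by (auto simp: weierstrass_gaps_def)
qed

text \<open>The pole orders of \<open>X\<^sup>iY\<^sup>j\<close> already exhaust the numerical semigroup generated by \<open>m - 1\<close> and \<open>m\<close>.\<close>

lemma finite_gaps: "finite (weierstrass_gaps F point_100)"
proof (rule finite_subset)
  show "weierstrass_gaps F point_100 \<subseteq> {..<m * m}"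
  proof (rule ccontr)
    assume "\<not> ?thesis"
    then obtain n where n: "n \<in> weierstrass_gaps F point_100" "m * m \<le> n" by force
    \<comment> \<open>Chosen so that \<open>m * i + (m - 1) * j = n\<close>: the residue of
      \<open>n\<close> modulo \<open>m\<close> dictates \<open>j\<close>, and
      \<open>n \<ge> m * m\<close> makes the truncated difference in \<open>i\<close> exact.\<close>
    define j where "j = m - n mod m"
    define i where "i = n div m + 1 + n mod m - m"
    have "m \<le> n div m" using div_le_mono[OF n(2), of m] m2 by simp
    then have ii: "int i = int (n div m) + 1 + int (n mod m) - int m" unfolding i_def by simp
    have jj: "int j = int m - int (n mod m)" unfolding j_def using m2 by (simp add: of_nat_diff less_imp_le)
    have nn: "int n = int m * int (n div m) + int (n mod m)" by (simp flip: of_nat_mult of_nat_add)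
    have e: "int i * (- int m) + int j * (1 - int m) = - int n" unfolding ii jj nn by (simp add: algebra_simps)
    define y :: "'k poly poly" where "y = [:[:0, 1:]:] ^ i * [:0, 1:] ^ j"
    have ry: "rho y = inverse S0 ^ i * (fls_X * inverse S0) ^ j"
      unfolding y_def rhomD(2,7)[OF rhom_rho] by (simp only: rho_def ev2_gens(2,3)[OF rhom_fls_const])
    have nz: "rho y \<noteq> 0" unfolding ry using S0_nz by simp
    have x: "fls_subdegree (fls_X * inverse S0) = 1 - int m"
      using S0_nz by (subst fls_subdegree_mult) (auto simp: S0_subdegree)
    have "fls_subdegree (rho y) = int i * (- int m) + int j * (1 - int m)"
      unfolding ry using S0_nz by (subst fls_subdegree_mult) (auto simp: fls_subdegree_pow S0_subdegree x)
    then have "fls_subdegree (rho y) = - int n" using e by simp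
    then show False using nongap_iff[of n] n(1) nz rho_0_iff by blast
  qed
qed simp

text \<open>A nonzero element of the subspace shares its lowest monomial with an approximating
  rational function, whose leading coefficient \<open>regular_function\<close> identifies.
  Conversely, the functions \<open>ev f0 powi l * ev y\<close> realise every listed
  monomial.\<close>

lemma lowest_monomials:
  "lowest_monomial ` (krichever_subspace F point_100 u \<theta> - {0}) =
    {monomial (- int n - (int m)\<^sup>2 * l) l | n l. n \<notin> weierstrass_gaps F point_100}"
proof (intro subset_antisym subsetI)
  fix x :: "'k fls fls" assume "x \<in> lowest_monomial ` (krichever_subspace F point_100 u \<theta> - {0})"
  then obtain g where g: "g \<in> krichever_K_C F point_100" "\<theta> (K_C_to_K point_100 u g) \<noteq> 0" "x = lowest_monomial (\<theta> (K_C_to_K point_100 u g))"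
    by (auto simp: krichever_subspace_def)
  define \<kappa> where "\<kappa> = K_C_to_K point_100 u g"
  obtain s where s: "s \<in> curve_cauchy F" "g = gp.equi `` {s}"
    using g(1) unfolding krichever_K_C_def gp.K_C_eq by (auto elim: quotientE)
  obtain N i where l: "leading (\<theta> \<kappa>) N i" using ex_leading g(2) unfolding \<kappa>_def by blast
  \<comment> \<open>Accuracy beyond the exponent \<open>N\<close> fixes the lowest monomial; for
    negative \<open>N\<close> this gives 0, which still exceeds \<open>N\<close>.\<close>
  define k where "k = nat (N + 1)"
  have kN: "N < int k" unfolding k_def by simp
  have \<kappa>c: "\<kappa> \<in> carrier K" and ap: "\<exists>n0. \<forall>n\<ge>n0. gp.Fil k (gp.\<phi> (s n) \<ominus>\<^bsub>K\<^esub> \<kappa>)"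
    using gp.K_C_to_K_approx[OF s(1)] unfolding \<kappa>_def s(2) by blast+
  obtain n0 where n0: "\<And>n. n \<ge> n0 \<Longrightarrow> gp.Fil k (gp.\<phi> (s n) \<ominus>\<^bsub>K\<^esub> \<kappa>)" using ap by blast
  obtain n1 where n1: "\<And>i j. i \<ge> n1 \<Longrightarrow> j \<ge> n1 \<Longrightarrow> curve_ord_ge F (int k) (s i - s j)"
  proof -
    have *: "\<forall>N. \<exists>n0. \<forall>i\<ge>n0. \<forall>j\<ge>n0. curve_ord_ge F N (s i - s j)" using s(1) by (simp add: curve_cauchy_def)
    obtain n1 where "\<forall>i\<ge>n1. \<forall>j\<ge>n1. curve_ord_ge F (int k) (s i - s j)" using spec[OF *, of "int k"] by (elim exE)
    then show ?thesis by (intro that[of n1]) simp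
  qed
  define n where "n = max n0 n1"
  have sf: "s n \<in> function_field" by (rule gp.cauchy_funfield[OF s(1)])
  have "\<theta> (gp.\<phi> (s n)) $$ j = \<theta> \<kappa> $$ j" if "j \<le> N" for j
    using theta_Fil[OF n0[of n], of j] that kN theta_minus[OF gp.phi_carr[OF sf] \<kappa>c] by (simp add: n_def)
  then have lr: "leading (psi (s n)) N i" unfolding psi_def by (rule leading_perturb[OF l])
  have r0: "s n \<noteq> 0" using lr psi_0_1(1) by (auto simp: leading_def)
  obtain M a b where ab: "a \<in> stalk point_100" "b \<in> stalk point_100" "a \<notin> gp.fO" "b \<notin> gp.fO" "s n = u powi M * a / b" "curve_ord F (s n) = M"
    by (rule gp.ord_decomposition[OF sf r0])
  \<comment> \<open>Elements outside the ideal of the curve have \<open>u\<close>-order zero, so the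
    exponent of \<open>u\<close> in the expansion is the order along the curve.\<close>
  have M: "M = N"
  proof -
    have st: "leading (psi a') 0 (fls_subdegree (delta a'))" if "a' \<in> stalk point_100" "a' \<notin> gp.fO" for a'
      using delta_0_iff[OF that(1)] that chi_nonneg(1)[OF that(1)] by (simp add: leading_0_iff delta_def psi_stalk)
    have uf: "u \<in> function_field" by (rule gp.stalk_funfield[OF gp.f_O])
    have af: "a \<in> function_field" "b \<in> function_field" using gp.stalk_funfield ab by blast+
    have "leading (psi u) 1 0" by (simp add: psi_stalk[OF gp.f_O] chi_u leading_def)
    note leading_mult[OF leading_mult[OF leading_powi[OF this, of M] st[OF ab(1,3)]] leading_inverse[OF st[OF ab(2,4)]]]
    moreover have "psi (s n) = psi u powi M * psi a * inverse (psi b)"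
      unfolding ab(5) using psi_divide[OF funfield_closed(3)[OF funfield_powi[OF uf] af(1)] af(2)] psi_mult[OF funfield_powi[OF uf] af(1)]
      by (simp add: psi_powi[OF uf] divide_inverse)
    ultimately show ?thesis using leading_unique[OF lr] by simp
  qed
  obtain y a' h where y: "\<not> f0 dvd y" "\<not> f0 dvd h" "s n = ev f0 powi curve_ord F (s n) * (ev y + ev f0 * ev a' / ev h)"
    using regular_function[OF g(1) s r0, of k] kN n1 ab(6) M by (auto simp: n_def)
  obtain e where e: "fls_subdegree (rho y) = - int e" using rho_subdegree by blast
  have "leading (psi (s n)) N (- int e - (int m)\<^sup>2 * N)"
    using leading_multiple[OF y(1,2), of N a'] y(3) ab(6) M e by simp
  then have "i = - int e - (int m)\<^sup>2 * N" using leading_unique[OF lr] by blast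
  moreover have "e \<notin> weierstrass_gaps F point_100" using nongap_iff y(1) e by blast
  ultimately show "x \<in> {monomial (- int n - (int m)\<^sup>2 * l) l | n l. n \<notin> weierstrass_gaps F point_100}"
    using g(3) lowest_monomial_leading[OF l] unfolding \<kappa>_def by blast
next
  fix x :: "'k fls fls" assume "x \<in> {monomial (- int n - (int m)\<^sup>2 * l) l | n l. n \<notin> weierstrass_gaps F point_100}"
  then obtain n l where n: "x = monomial (- int n - (int m)\<^sup>2 * l) l" "n \<notin> weierstrass_gaps F point_100" by blast
  obtain y where y: "\<not> f0 dvd y" "fls_subdegree (rho y) = - int n" using nongap_iff n(2) by blast
  define r where "r = ev f0 powi l * ev y"
  have rf: "r \<in> function_field" unfolding r_def by (intro funfield_closed(3) funfield_powi ev_funfield)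
  have lr: "leading (psi r) l (- int n - (int m)\<^sup>2 * l)"
    using leading_multiple[OF y(1) f0_not_dvd_1, of l 0] y(2) by (simp add: r_def evD)
  \<comment> \<open>The class of a constant Cauchy sequence, that is, the rational function
    \<open>r\<close> itself as an element of \<open>K_C\<close>.\<close>
  define g where "g = gp.equi `` {\<lambda>n. r}"
  have "g \<in> krichever_K_C F point_100"
    unfolding krichever_K_C_def mem_Collect_eq
  proof (intro conjI allI impI)
    show "g \<in> K_C F" unfolding gp.K_C_eq g_def by (rule quotientI[OF gp.const_cauchy[OF rf]])
    fix q f assume q: "closed_point q \<and> F \<in> q \<and> q \<noteq> point_100 \<and> local_equation F q f"
    interpret GQ: good_point F m q f using curve_multiples_regular(1) q by blast
    show "K_C_to_K q f g \<in> B_to_K q f ` carrier (B_ring q f)"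
      using GQ.K_C_to_K_const[OF rf] curve_multiples_regular(2)[of q f l y] q unfolding g_def r_def by simp
  qed
  moreover have "\<theta> (K_C_to_K point_100 u g) = psi r" unfolding g_def psi_def gp.K_C_to_K_const[OF rf] ..
  moreover have "psi r \<noteq> 0" "lowest_monomial (psi r) = x" using lr lowest_monomial_leading[OF lr] n(1) by (auto simp: leading_def)
  ultimately show "x \<in> lowest_monomial ` (krichever_subspace F point_100 u \<theta> - {0})"
    unfolding krichever_subspace_def by (metis (no_types, lifting) DiffI image_eqI singletonD)
qed

end

theorem proposition2:
  fixes F :: "'k::field poly poly poly"
    and m :: nat
    and \<theta> :: "'k localfield \<Rightarrow> 'k fls fls"
  assumes "m \<ge> 2"
    and curve: "homogeneous m F" "prime_elem F"
    and on_curve: "form_eval F 1 0 0 = 0"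
    and smooth: "tangent_form F 1 0 0 \<noteq> 0"
    and tangent: "\<exists>e. e \<noteq> 0 \<and> tangent_form F 1 0 0 = form_const e * form_z"
    and contact: "\<And>q. closed_point q \<Longrightarrow>
      intersection_mult form_z F q = (if q = point_100 then enat m else 0)"
    and identification: "identifies_by_parameters point_100 param_t (param_u m F) \<theta>"
  shows "finite (weierstrass_gaps F point_100) \<and>
    support (krichever_subspace F point_100 (param_u m F) \<theta>) =
      closed_span ({monomial i j | i j. i \<le> - (int m)\<^sup>2 * j} -
        {monomial (- int \<alpha> - (int m)\<^sup>2 * l) l | \<alpha> l. \<alpha> \<in> weierstrass_gaps F point_100})"
proof -
  have "intersection_mult form_z F point_100 = enat m" using contact[OF closed_point_100] by simp
  then obtain c L where "hyperflex F m c L"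
    using hyperflexI[OF \<open>m \<ge> 2\<close> curve tangent _ on_curve] by blast
  then interpret flex_point F m c L \<theta>
    by (intro flex_point.intro flex_point_axioms.intro identification)
  let ?gaps = "weierstrass_gaps F point_100"
  \<comment> \<open>A monomial determines its exponents, and the distance of \<open>i\<close> from
    the bound is a natural number that is either a gap or not.\<close>
  have eq: "{monomial (- int n - (int m)\<^sup>2 * l) l | n l. n \<notin> ?gaps} =
      {monomial i j | i j. i \<le> - (int m)\<^sup>2 * j} - {monomial (- int \<alpha> - (int m)\<^sup>2 * l) l | \<alpha> l. \<alpha> \<in> ?gaps}" (is "?A = ?B")
  proof (intro subset_antisym subsetI)
    fix x assume "x \<in> ?A"
    then obtain n l where n: "x = monomial (- int n - (int m)\<^sup>2 * l) l" "n \<notin> ?gaps" by blast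
    have "- int n - (int m)\<^sup>2 * l \<le> - (int m)\<^sup>2 * l" by simp
    then show "x \<in> ?B" using n by (auto simp: monomial_eq_iff)
  next
    fix x assume x: "x \<in> ?B"
    then obtain i j where i: "x = monomial i j" "i \<le> - (int m)\<^sup>2 * j" by blast
    define n where "n = nat (- i - (int m)\<^sup>2 * j)"
    have "i = - int n - (int m)\<^sup>2 * j" unfolding n_def using i(2) by simp
    then show "x \<in> ?A" using x i(1) by blast
  qed
  show ?thesis unfolding support_def lowest_monomials eq using finite_gaps by blast
qed

end
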